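(* Let $f\in L^2(\Omega)$, let $u\in H_0^1(\Omega)$ be the solution of $(\nabla u,\nabla v)=(f,v)$ for all $v\in H_0^1(\Omega)$, and let $u_h^{\mathrm{CR}}\in V_{h,0}^{\mathrm{CR}}$ be the solution of $(\nabla_hu_h^{\mathrm{CR}},\nabla_hv_h)=(f,v_h)$ for all $v_h\in V_{h,0}^{\mathrm{CR}}$. Set $$\widehat M_h:=\sqrt{(h/\pi)^2+\kappa_{M,h}^2},\qquad \widehat{\mathfrak E}_h(f):=\frac h\pi\|f-\Pi_h^0f\|_{L^2(\Omega)}+\kappa_{M,h}\|\Pi_h^0f\|_{L^2(\Omega)} .$$ Then $$|u-u_h^{\mathrm{CR}}|_{H^1(\mathbb T_h)}\le2\widehat{\mathfrak E}_h(f)\le2\widehat M_h\|f\|_{L^2(\Omega)}$$ and $$\|u-u_h^{\mathrm{CR}}\|_{L^2(\Omega)}\le\min\left\{\widehat M_h^2\|f\|_{L^2(\Omega)},\ 2\widehat M_h\widehat{\mathfrak E}_h(f)\right\}.$$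
   Context: Let $d\in\{2,3\}$, let $\Omega\subset\mathbb R^d$ be a bounded polyhedral Lipschitz domain, and let $\mathbb T_h$ be a finite conforming triangulation of $\overline\Omega$ into non-degenerate closed $d$-simplices (the intersection of two distinct elements is empty or a common subsimplex); no shape regularity is assumed. $h:=\max_{T\in\mathbb T_h}\operatorname{diam}(T)$. $(\cdot,\cdot)$ is the $L^2(\Omega)$ inner product (scalar or vector valued). For elementwise $H^1$ functions $v$, $\nabla_hv$ is the elementwise (broken) gradient and $|v|_{H^1(\mathbb T_h)}:=\|\nabla_hv\|_{L^2(\Omega)^d}$. $X_h$ is the space of functions constant on each $T\in\mathbb T_h$, and $\Pi_h^0:L^2(\Omega)\to X_h$ is the $L^2$-orthogonal projection (elementwise mean). $V_h^c:=\{v\in H_0^1(\Omega): v|_T \text{ affine } \forall T\in\mathbb T_h\}$. The Crouzeix--Raviart space $V_{h,0}^{\mathrm{CR}}$ consists of the elementwise affine functions $v$ such that $\int_F[\![v]\!]\,ds=0$ for all faces $F$, where $[\![v]\!]$ is the jump across an interior face and the trace of $v$ on a boundary face. For $g_h\in X_h$: $z_h^c(g_h)\in V_h^c$ is the unique solution of $(\nabla z_h^c(g_h),\nabla v_h)=(g_h,v_h)$ for all $v_h\in V_h^c$; $z_h^{\mathrm{CR}}(g_h)\in V_{h,0}^{\mathrm{CR}}$ is the unique solution of $(\nabla_h z_h^{\mathrm{CR}}(g_h),\nabla_h v_h)=(g_h,v_h)$ for all $v_h\in V_{h,0}^{\mathrm{CR}}$; the Marini flux is $\bm\sigma_h^M(g_h)|_T:=\nabla_h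 z_h^{\mathrm{CR}}(g_h)|_T-\frac{g_h|_T}{d}(\bm x-\bm x_T)$, with $\bm x_T$ the barycentre of $T$; and $$\kappa_{M,h}:=\sup_{0\ne g_h\in X_h}\frac{\|\bm\sigma_h^M(g_h)-\nabla z_h^c(g_h)\|_{L^2(\Omega)^d}}{\|g_h\|_{L^2(\Omega)}}.$$ *)

theory Defs
  imports "HOL-Analysis.Analysis"
begin

section \<open>Lebesgue and Sobolev spaces\<close>

text \<open>
  Elements of \<open>L\<^sup>2\<close> and \<open>H\<^sup>1\<close> are represented by total functions; two functions that agree almost
  everywhere on \<open>\<Omega>\<close> represent the same element.  Scalar functions are the case of values
  in \<^typ>\<open>real\<close>, where the inner product is multiplication.
\<close>

definition L2_space :: "'a::euclidean_space set \<Rightarrow> ('a \<Rightarrow> 'b::euclidean_space) set" where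
  "L2_space \<Omega> = {f. f \<in> borel_measurable (lebesgue_on \<Omega>) \<and>
                    integrable (lebesgue_on \<Omega>) (\<lambda>x. (norm (f x))\<^sup>2)}"

definition L2_inner ::
    "'a::euclidean_space set \<Rightarrow> ('a \<Rightarrow> 'b::euclidean_space) \<Rightarrow> ('a \<Rightarrow> 'b) \<Rightarrow> real" where
  "L2_inner \<Omega> f g = (\<integral>x. f x \<bullet> g x \<partial>lebesgue_on \<Omega>)"

definition L2_norm :: "'a::euclidean_space set \<Rightarrow> ('a \<Rightarrow> 'b::euclidean_space) \<Rightarrow> real" where
  "L2_norm \<Omega> f = sqrt (L2_inner \<Omega> f f)"

primrec C_k :: "nat \<Rightarrow> ('a::euclidean_space \<Rightarrow> real) \<Rightarrow> bool" where
  "C_k 0 \<phi> \<longleftrightarrow> continuous_on UNIV \<phi>"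
| "C_k (Suc k) \<phi> \<longleftrightarrow> \<phi> differentiable_on UNIV \<and>
     (\<forall>i\<in>Basis. C_k k (\<lambda>x. frechet_derivative \<phi> (at x) i))"

definition test_functions :: "'a::euclidean_space set \<Rightarrow> ('a \<Rightarrow> real) set" where
  "test_functions \<Omega> = {\<phi>. (\<forall>k. C_k k \<phi>) \<and> compact (closure {x. \<phi> x \<noteq> 0}) \<and>
                          closure {x. \<phi> x \<noteq> 0} \<subseteq> \<Omega>}"

definition classical_grad :: "('a::euclidean_space \<Rightarrow> real) \<Rightarrow> 'a \<Rightarrow> 'a" where
  "classical_grad \<phi> x = (\<Sum>i\<in>Basis. frechet_derivative \<phi> (at x) i *\<^sub>R i)"

definition is_weak_grad ::
    "'a::euclidean_space set \<Rightarrow> ('a \<Rightarrow> real) \<Rightarrow> ('a \<Rightarrow> 'a) \<Rightarrow> bool" where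
  "is_weak_grad \<Omega> v G \<longleftrightarrow> v \<in> L2_space \<Omega> \<and> G \<in> L2_space \<Omega> \<and>
     (\<forall>\<phi>\<in>test_functions \<Omega>. \<forall>i\<in>Basis.
        (\<integral>x. v x * frechet_derivative \<phi> (at x) i \<partial>lebesgue_on \<Omega>) =
        - (\<integral>x. (G x \<bullet> i) * \<phi> x \<partial>lebesgue_on \<Omega>))"

definition H1_space :: "'a::euclidean_space set \<Rightarrow> ('a \<Rightarrow> real) set" where
  "H1_space \<Omega> = {v. \<exists>G. is_weak_grad \<Omega> v G}"

text \<open>The weak gradient is unique almost everywhere; a representative is selected.\<close>

definition weak_grad :: "'a::euclidean_space set \<Rightarrow> ('a \<Rightarrow> real) \<Rightarrow> 'a \<Rightarrow> 'a" where
  "weak_grad \<Omega> v = (SOME G. is_weak_grad \<Omega> v G)"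

text \<open>The closure of the test functions in the \<open>H\<^sup>1\<close> norm.\<close>

definition H01_space :: "'a::euclidean_space set \<Rightarrow> ('a \<Rightarrow> real) set" where
  "H01_space \<Omega> = {v \<in> H1_space \<Omega>. \<forall>\<epsilon>>0. \<exists>\<phi>\<in>test_functions \<Omega>.
      L2_norm \<Omega> (\<lambda>x. v x - \<phi> x) < \<epsilon> \<and>
      L2_norm \<Omega> (\<lambda>x. weak_grad \<Omega> v x - classical_grad \<phi> x) < \<epsilon>}"

section \<open>Domains and triangulations\<close>

text \<open>
  Near each boundary point, in suitable orthonormal coordinates, \<open>\<Omega>\<close> is the region on one side
  of the graph of a Lipschitz function; \<open>e\<close> is the direction of the last coordinate, and
  \<open>y - (y \<bullet> e) *\<^sub>R e\<close> collects the others.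
\<close>

definition lipschitz_boundary :: "'a::euclidean_space set \<Rightarrow> bool" where
  "lipschitz_boundary \<Omega> \<longleftrightarrow> (\<forall>x\<in>frontier \<Omega>. \<exists>e r L. \<exists>\<gamma>::'a \<Rightarrow> real.
      norm e = 1 \<and> r > 0 \<and> L-lipschitz_on {y. y \<bullet> e = 0} \<gamma> \<and>
      (\<forall>y\<in>ball x r. y \<in> \<Omega> \<longleftrightarrow> \<gamma> (y - (y \<bullet> e) *\<^sub>R e) < y \<bullet> e))"

definition polyhedral_lipschitz_domain :: "'a::euclidean_space set \<Rightarrow> bool" where
  "polyhedral_lipschitz_domain \<Omega> \<longleftrightarrow>
     open \<Omega> \<and> connected \<Omega> \<and> \<Omega> \<noteq> {} \<and> bounded \<Omega> \<and> lipschitz_boundary \<Omega> \<and>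
     (\<exists>\<P>. finite \<P> \<and> (\<forall>P\<in>\<P>. polytope P) \<and> closure \<Omega> = \<Union>\<P>)"

text \<open>
  The library predicate \<^const>\<open>triangulation\<close> provides finiteness and conformity (the
  intersection of two elements is a possibly empty common face).
\<close>

definition conforming_triangulation ::
    "'a::euclidean_space set \<Rightarrow> 'a set set \<Rightarrow> bool" where
  "conforming_triangulation \<Omega> \<T> \<longleftrightarrow> triangulation \<T> \<and>
     (\<forall>T\<in>\<T>. int DIM('a) simplex T) \<and> \<Union>\<T> = closure \<Omega>"

definition mesh_size :: "'a::euclidean_space set set \<Rightarrow> real" where
  "mesh_size \<T> = Max (diameter ` \<T>)"

definition barycentre :: "'a::euclidean_space set \<Rightarrow> 'a" where
  "barycentre T = (\<Sum>x\<in>{x. x extreme_point_of T}. x) /\<^sub>R real (card {x. x extreme_point_of T})"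

section \<open>Elementwise functions\<close>

definition is_broken_grad ::
    "'a::euclidean_space set set \<Rightarrow> ('a \<Rightarrow> real) \<Rightarrow> ('a \<Rightarrow> 'a) \<Rightarrow> bool" where
  "is_broken_grad \<T> v G \<longleftrightarrow> (\<forall>T\<in>\<T>. is_weak_grad (interior T) v G)"

definition broken_grad :: "'a::euclidean_space set set \<Rightarrow> ('a \<Rightarrow> real) \<Rightarrow> 'a \<Rightarrow> 'a" where
  "broken_grad \<T> v = (SOME G. is_broken_grad \<T> v G)"

definition broken_H1_seminorm ::
    "'a::euclidean_space set \<Rightarrow> 'a set set \<Rightarrow> ('a \<Rightarrow> real) \<Rightarrow> real" where
  "broken_H1_seminorm \<Omega> \<T> v = L2_norm \<Omega> (broken_grad \<T> v)"

text \<open>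
  Discrete functions are prescribed in the interiors of the elements only: their values on the
  skeleton, a null set, are irrelevant, and a function may not be single-valued there.
\<close>

definition pw_constant :: "'a::euclidean_space set set \<Rightarrow> ('a \<Rightarrow> real) set" where
  "pw_constant \<T> = {g. \<forall>T\<in>\<T>. \<exists>c. \<forall>x\<in>interior T. g x = c}"

definition pw_affine :: "'a::euclidean_space set set \<Rightarrow> ('a \<Rightarrow> real) set" where
  "pw_affine \<T> = {v. \<forall>T\<in>\<T>. \<exists>a b. \<forall>x\<in>interior T. v x = a \<bullet> x + b}"

definition proj0 ::
    "'a::euclidean_space set \<Rightarrow> 'a set set \<Rightarrow> ('a \<Rightarrow> real) \<Rightarrow> 'a \<Rightarrow> real" where
  "proj0 \<Omega> \<T> f = (SOME g. g \<in> pw_constant \<T> \<and>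
      (\<forall>w\<in>pw_constant \<T>. L2_inner \<Omega> (\<lambda>x. f x - g x) w = 0))"

section \<open>Face integrals\<close>

text \<open>
  The surface measure on the affine hull of a flat set \<open>F\<close>: Lebesgue measure in Cartesian
  coordinates with respect to an origin \<open>p\<close> and an orthonormal basis \<open>B\<close> of the direction
  space.  It does not depend on the choice of \<open>p\<close> and \<open>B\<close>.
\<close>

definition cartesian_frame :: "'a::euclidean_space set \<Rightarrow> 'a \<Rightarrow> 'a set \<Rightarrow> bool" where
  "cartesian_frame F p B \<longleftrightarrow> pairwise orthogonal B \<and> (\<forall>b\<in>B. norm b = 1) \<and>
     affine hull F = (+) p ` span B"

definition surface_measure :: "'a::euclidean_space set \<Rightarrow> 'a measure" where
  "surface_measure F = (case (SOME (p, B). cartesian_frame F p B) of (p, B) \<Rightarrow>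
     distr (\<Pi>\<^sub>M b\<in>B. lborel) borel (\<lambda>t. p + (\<Sum>b\<in>B. t b *\<^sub>R b)))"

definition face_integral :: "'a::euclidean_space set \<Rightarrow> ('a \<Rightarrow> real) \<Rightarrow> real" where
  "face_integral F q = (LINT x:F|surface_measure F. q x)"

text \<open>The trace of \<open>v|\<^sub>T\<close> on the boundary of \<open>T\<close>, for \<open>v\<close> affine in the interior of \<open>T\<close>.\<close>

definition elem_trace :: "'a::euclidean_space set \<Rightarrow> ('a \<Rightarrow> real) \<Rightarrow> 'a \<Rightarrow> real" where
  "elem_trace T v x = Lim (at x within interior T) v"

section \<open>Finite element spaces and discrete solutions\<close>

definition conforming_P1 :: "'a::euclidean_space set \<Rightarrow> 'a set set \<Rightarrow> ('a \<Rightarrow> real) set" where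
  "conforming_P1 \<Omega> \<T> = H01_space \<Omega> \<inter> pw_affine \<T>"

text \<open>
  The first condition concerns the interior faces, which are common to two elements (the jump is
  defined up to sign), and the second one the boundary faces.
\<close>

definition crouzeix_raviart ::
    "'a::euclidean_space set \<Rightarrow> 'a set set \<Rightarrow> ('a \<Rightarrow> real) set" where
  "crouzeix_raviart \<Omega> \<T> = {v \<in> pw_affine \<T>.
     (\<forall>T\<in>\<T>. \<forall>T'\<in>\<T>. \<forall>F. T \<noteq> T' \<and> F facet_of T \<and> F facet_of T' \<longrightarrow>
        face_integral F (\<lambda>x. elem_trace T v x - elem_trace T' v x) = 0) \<and>
     (\<forall>T\<in>\<T>. \<forall>F. F facet_of T \<and> F \<subseteq> frontier \<Omega> \<longrightarrow>
        face_integral F (elem_trace T v) = 0)}"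

definition is_weak_solution :: "'a::euclidean_space set \<Rightarrow> ('a \<Rightarrow> real) \<Rightarrow> ('a \<Rightarrow> real) \<Rightarrow> bool" where
  "is_weak_solution \<Omega> f u \<longleftrightarrow> u \<in> H01_space \<Omega> \<and>
     (\<forall>v\<in>H01_space \<Omega>. L2_inner \<Omega> (weak_grad \<Omega> u) (weak_grad \<Omega> v) = L2_inner \<Omega> f v)"

definition is_P1_solution ::
    "'a::euclidean_space set \<Rightarrow> 'a set set \<Rightarrow> ('a \<Rightarrow> real) \<Rightarrow> ('a \<Rightarrow> real) \<Rightarrow> bool" where
  "is_P1_solution \<Omega> \<T> f z \<longleftrightarrow> z \<in> conforming_P1 \<Omega> \<T> \<and>
     (\<forall>v\<in>conforming_P1 \<Omega> \<T>. L2_inner \<Omega> (weak_grad \<Omega> z) (weak_grad \<Omega> v) = L2_inner \<Omega> f v)"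

definition is_CR_solution ::
    "'a::euclidean_space set \<Rightarrow> 'a set set \<Rightarrow> ('a \<Rightarrow> real) \<Rightarrow> ('a \<Rightarrow> real) \<Rightarrow> bool" where
  "is_CR_solution \<Omega> \<T> f z \<longleftrightarrow> z \<in> crouzeix_raviart \<Omega> \<T> \<and>
     (\<forall>v\<in>crouzeix_raviart \<Omega> \<T>.
        L2_inner \<Omega> (broken_grad \<T> z) (broken_grad \<T> v) = L2_inner \<Omega> f v)"

text \<open>
  Discrete solutions are unique up to their values on a null set, so a representative is selected.
\<close>

definition P1_solution ::
    "'a::euclidean_space set \<Rightarrow> 'a set set \<Rightarrow> ('a \<Rightarrow> real) \<Rightarrow> 'a \<Rightarrow> real" where
  "P1_solution \<Omega> \<T> g = (SOME z. is_P1_solution \<Omega> \<T> g z)"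

definition CR_solution ::
    "'a::euclidean_space set \<Rightarrow> 'a set set \<Rightarrow> ('a \<Rightarrow> real) \<Rightarrow> 'a \<Rightarrow> real" where
  "CR_solution \<Omega> \<T> g = (SOME z. is_CR_solution \<Omega> \<T> g z)"

text \<open>The interiors of the elements are disjoint, so at most one summand is nonzero.\<close>

definition marini_flux ::
    "'a::euclidean_space set \<Rightarrow> 'a set set \<Rightarrow> ('a \<Rightarrow> real) \<Rightarrow> 'a \<Rightarrow> 'a" where
  "marini_flux \<Omega> \<T> g x = (\<Sum>T\<in>\<T>. indicator (interior T) x *\<^sub>R
     (broken_grad \<T> (CR_solution \<Omega> \<T> g) x - (g x / real DIM('a)) *\<^sub>R (x - barycentre T)))"

definition kappa_M :: "'a::euclidean_space set \<Rightarrow> 'a set set \<Rightarrow> real" where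
  "kappa_M \<Omega> \<T> = (SUP g\<in>{g \<in> pw_constant \<T>. L2_norm \<Omega> g \<noteq> 0}.
     L2_norm \<Omega> (\<lambda>x. marini_flux \<Omega> \<T> g x - weak_grad \<Omega> (P1_solution \<Omega> \<T> g) x) / L2_norm \<Omega> g)"

definition M_hat :: "'a::euclidean_space set \<Rightarrow> 'a set set \<Rightarrow> real" where
  "M_hat \<Omega> \<T> = sqrt ((mesh_size \<T> / pi)\<^sup>2 + (kappa_M \<Omega> \<T>)\<^sup>2)"

definition E_hat :: "'a::euclidean_space set \<Rightarrow> 'a set set \<Rightarrow> ('a \<Rightarrow> real) \<Rightarrow> real" where
  "E_hat \<Omega> \<T> f = mesh_size \<T> / pi * L2_norm \<Omega> (\<lambda>x. f x - proj0 \<Omega> \<T> f x) +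
     kappa_M \<Omega> \<T> * L2_norm \<Omega> (proj0 \<Omega> \<T> f)"

end

theory Submission
  imports Defs
begin

text \<open>
  Decompose \<open>f = f\<^sub>0 + f\<^sub>1\<close> into its elementwise means and the oscillation.  By the Poincare
  inequality on simplices with constant \<open>h/\<pi>\<close>, the oscillation contributes at most
  \<open>h/\<pi> \<parallel>f\<^sub>1\<parallel>\<close> to the energy of every conforming or Crouzeix--Raviart solution.  For the piecewise
  constant part the Marini flux \<open>\<sigma>\<close> satisfies \<open>(\<sigma>, \<nabla>v) = (f\<^sub>0, v)\<close> for all \<open>v\<close> in \<open>H\<^sup>1\<^sub>0\<close>, because
  the Crouzeix--Raviart interpolant of a test function preserves face integrals, and \<open>\<sigma>\<close> minus the
  discrete gradient is orthogonal to piecewise constant fields.  A hypercircle identity then bounds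
  the energy distance between the conforming and the nonconforming solution with right-hand side
  \<open>f\<^sub>0\<close> by \<open>\<kappa> \<parallel>f\<^sub>0\<parallel>\<close>.  No completeness of \<open>H\<^sup>1\<^sub>0\<close> is used: its role is taken by the span of the
  conforming discrete space and \<open>u\<close>.  For the \<open>L\<^sup>2\<close> estimate, the form
  \<open>(f, g) \<mapsto> (u - u\<^sub>C\<^sub>R, g)\<close> is bounded on the four blocks of the two decompositions.

  The Poincare inequality comes from writing the simplex as an iterated cone, the product
  decomposition of the variance, weighted one-dimensional inequalities, and an average over
  orderings of the vertices; the dimensions 2 and 3 leave room below the constant \<open>1/\<pi>\<close>.
\<close>

section \<open>Square integrable functions\<close>

text \<open>A single cone ordering weights its first edge with 1/2; as the variance of the edge
  values is at most a quarter of the squared range, this alone gives 1/8, which exceeds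
  \<open>1 / pi\<^sup>2\<close>. Averaging lowers it to 7/72 in the plane and 3/32 in space, both
  small enough. The L^2 bound must not lose a factor 2: the oscillation block is a difference of two
  nonnegative forms with the same upper bound, and polarization bounds it by that bound once, so
  that the four block bounds add up to \<open>E_hat\<close> of \<open>f\<close> times
  \<open>E_hat\<close> of \<open>g\<close>; the estimate follows with the error itself as
  \<open>g\<close>. Solvability of the Crouzeix-Raviart problem rests on the kernel of the broken
  gradient, where a nonzero elementwise constant is excluded by following a generic segment out of
  the domain through facets only. Surface measure enters through its proportionality to Lebesgue
  measure in a parametrization: the positive constants are never computed, because only vanishing
  and equality of integrals over one and the same face matter.\<close>

lemma discriminant_nonneg_le:
  fixes A B C :: real
  assumes "\<And>t. 0 \<le> A + 2 * t * B + t\<^sup>2 * C" and "0 \<le> C"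
  shows "B\<^sup>2 \<le> A * C"
proof (cases "C = 0")
  case True
  have "B = 0"
  proof (rule ccontr)
    assume "B \<noteq> 0"
    \<comment> \<open>This \<open>t\<close> makes the remaining affine function equal to -1.\<close>
    have "0 \<le> A + 2 * (- (A + 1) / (2 * B)) * B" using assms(1)[of "- (A + 1) / (2 * B)"] True by simp
    then show False using \<open>B \<noteq> 0\<close> by (simp add: field_simps)
  qed
  then show ?thesis using True by simp
next
  case False
  then have "0 < C" using assms(2) by simp
  have "0 \<le> A + 2 * (- B / C) * B + (- B / C)\<^sup>2 * C" by (rule assms(1))
  also have "\<dots> = A - B\<^sup>2 / C" using \<open>0 < C\<close> by (simp add: field_simps power2_eq_square)
  finally show ?thesis using \<open>0 < C\<close> by (simp add: field_simps)
qed

lemma norm_add_sq_le: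
  fixes a b :: "'b::real_normed_vector"
  shows "(norm (a + b))\<^sup>2 \<le> 2 * (norm a)\<^sup>2 + 2 * (norm b)\<^sup>2"
proof -
  have "(norm (a + b))\<^sup>2 \<le> (norm a + norm b)\<^sup>2"
    by (intro power_mono norm_triangle_ineq) auto
  also have "\<dots> \<le> 2 * (norm a)\<^sup>2 + 2 * (norm b)\<^sup>2"
    using zero_le_power2[of "norm a - norm b"] by (simp add: power2_eq_square algebra_simps)
  finally show ?thesis .
qed

lemma L2_space_measurable: "f \<in> L2_space \<Omega> \<Longrightarrow> f \<in> borel_measurable (lebesgue_on \<Omega>)"
  by (simp add: L2_space_def)

lemma L2_space_zero [simp]: "(\<lambda>x. 0) \<in> L2_space \<Omega>"
  by (simp add: L2_space_def)

lemma L2_space_add [simp]: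
  assumes "f \<in> L2_space \<Omega>" "g \<in> L2_space \<Omega>"
  shows "(\<lambda>x. f x + g x) \<in> L2_space \<Omega>"
proof -
  have [measurable]: "f \<in> borel_measurable (lebesgue_on \<Omega>)" "g \<in> borel_measurable (lebesgue_on \<Omega>)"
    using assms by (auto simp: L2_space_def)
  have "integrable (lebesgue_on \<Omega>) (\<lambda>x. (norm (f x + g x))\<^sup>2)"
    by (rule Bochner_Integration.integrable_bound[where f="\<lambda>x. 2 * (norm (f x))\<^sup>2 + 2 * (norm (g x))\<^sup>2"])
       (use assms in \<open>auto simp: L2_space_def norm_add_sq_le intro!: AE_I2\<close>)
  then show ?thesis by (simp add: L2_space_def)
qed

lemma L2_space_scaleR [simp]:
  "f \<in> L2_space \<Omega> \<Longrightarrow> (\<lambda>x. c *\<^sub>R f x) \<in> L2_space \<Omega>"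
  by (auto simp: L2_space_def power_mult_distrib)

lemma L2_space_mult_left [simp]:
  fixes f :: "'a::euclidean_space \<Rightarrow> real"
  shows "f \<in> L2_space \<Omega> \<Longrightarrow> (\<lambda>x. c * f x) \<in> L2_space \<Omega>"
  using L2_space_scaleR[of f \<Omega> c] by simp

lemma L2_space_uminus [simp]: "f \<in> L2_space \<Omega> \<Longrightarrow> (\<lambda>x. - f x) \<in> L2_space \<Omega>"
  using L2_space_scaleR[of f \<Omega> "-1"] by simp

lemma L2_space_diff [simp]:
  "f \<in> L2_space \<Omega> \<Longrightarrow> g \<in> L2_space \<Omega> \<Longrightarrow> (\<lambda>x. f x - g x) \<in> L2_space \<Omega>"
  using L2_space_add[of f \<Omega> "\<lambda>x. - g x"] by simp

lemma L2_space_sum [simp]: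
  "(\<And>i. i \<in> I \<Longrightarrow> f i \<in> L2_space \<Omega>) \<Longrightarrow> (\<lambda>x. \<Sum>i\<in>I. f i x) \<in> L2_space \<Omega>"
  by (induction I rule: infinite_finite_induct) auto

lemma L2_space_inner_const [simp]:
  assumes "f \<in> L2_space \<Omega>"
  shows "(\<lambda>x. f x \<bullet> a) \<in> L2_space \<Omega>"
proof -
  have [measurable]: "f \<in> borel_measurable (lebesgue_on \<Omega>)"
    using assms by (auto simp: L2_space_def)
  have le: "(f x \<bullet> a)\<^sup>2 \<le> (norm a)\<^sup>2 * (norm (f x))\<^sup>2" for x
    using power_mono[OF Cauchy_Schwarz_ineq2[of "f x" a], of 2] by (simp add: power_mult_distrib mult.commute)
  have "integrable (lebesgue_on \<Omega>) (\<lambda>x. (norm (f x \<bullet> a))\<^sup>2)"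
    by (rule Bochner_Integration.integrable_bound[where f="\<lambda>x. (norm a)\<^sup>2 * (norm (f x))\<^sup>2"])
       (use assms le in \<open>auto simp: L2_space_def intro!: AE_I2\<close>)
  then show ?thesis by (simp add: L2_space_def)
qed

lemma L2_inner_integrable:
  assumes "f \<in> L2_space \<Omega>" "g \<in> L2_space \<Omega>"
  shows "integrable (lebesgue_on \<Omega>) (\<lambda>x. f x \<bullet> g x)"
proof (rule Bochner_Integration.integrable_bound[where f="\<lambda>x. (norm (f x))\<^sup>2 + (norm (g x))\<^sup>2"])
  show "integrable (lebesgue_on \<Omega>) (\<lambda>x. (norm (f x))\<^sup>2 + (norm (g x))\<^sup>2)"
    using assms by (auto simp: L2_space_def)
  show "(\<lambda>x. f x \<bullet> g x) \<in> borel_measurable (lebesgue_on \<Omega>)"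
    using assms by (auto simp: L2_space_def)
  have "norm (f x \<bullet> g x) \<le> norm ((norm (f x))\<^sup>2 + (norm (g x))\<^sup>2)" for x
  proof -
    have "\<bar>f x \<bullet> g x\<bar> \<le> norm (f x) * norm (g x)" by (rule Cauchy_Schwarz_ineq2)
    also have "\<dots> \<le> (norm (f x))\<^sup>2 + (norm (g x))\<^sup>2"
    proof -
      have "2 * (norm (f x) * norm (g x)) \<le> (norm (f x))\<^sup>2 + (norm (g x))\<^sup>2"
        using sum_squares_bound[of "norm (f x)" "norm (g x)"] by simp
      moreover have "0 \<le> norm (f x) * norm (g x)" by simp
      ultimately show ?thesis by linarith
    qed
    finally show ?thesis by simp
  qed
  then show "AE x in lebesgue_on \<Omega>. norm (f x \<bullet> g x) \<le> norm ((norm (f x))\<^sup>2 + (norm (g x))\<^sup>2)"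
    by simp
qed

lemma L2_inner_commute: "L2_inner \<Omega> f g = L2_inner \<Omega> g f"
  by (simp add: L2_inner_def inner_commute)

lemma L2_inner_add_left:
  "f \<in> L2_space \<Omega> \<Longrightarrow> g \<in> L2_space \<Omega> \<Longrightarrow> w \<in> L2_space \<Omega> \<Longrightarrow>
    L2_inner \<Omega> (\<lambda>x. f x + g x) w = L2_inner \<Omega> f w + L2_inner \<Omega> g w"
  by (simp add: L2_inner_def inner_add_left L2_inner_integrable)

lemma L2_inner_add_right:
  "f \<in> L2_space \<Omega> \<Longrightarrow> g \<in> L2_space \<Omega> \<Longrightarrow> w \<in> L2_space \<Omega> \<Longrightarrow>
    L2_inner \<Omega> w (\<lambda>x. f x + g x) = L2_inner \<Omega> w f + L2_inner \<Omega> w g"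
  by (simp add: L2_inner_def inner_add_right L2_inner_integrable)

lemma L2_inner_diff_left:
  "f \<in> L2_space \<Omega> \<Longrightarrow> g \<in> L2_space \<Omega> \<Longrightarrow> w \<in> L2_space \<Omega> \<Longrightarrow>
    L2_inner \<Omega> (\<lambda>x. f x - g x) w = L2_inner \<Omega> f w - L2_inner \<Omega> g w"
  by (simp add: L2_inner_def inner_diff_left L2_inner_integrable)

lemma L2_inner_diff_right:
  "f \<in> L2_space \<Omega> \<Longrightarrow> g \<in> L2_space \<Omega> \<Longrightarrow> w \<in> L2_space \<Omega> \<Longrightarrow>
    L2_inner \<Omega> w (\<lambda>x. f x - g x) = L2_inner \<Omega> w f - L2_inner \<Omega> w g"
  by (simp add: L2_inner_def inner_diff_right L2_inner_integrable)

lemma L2_inner_scaleR_left: "L2_inner \<Omega> (\<lambda>x. c *\<^sub>R f x) w = c * L2_inner \<Omega> f w"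
  by (simp add: L2_inner_def)

lemma L2_inner_scaleR_right: "L2_inner \<Omega> w (\<lambda>x. c *\<^sub>R f x) = c * L2_inner \<Omega> w f"
  by (simp add: L2_inner_def)

lemma L2_inner_mult_left:
  "L2_inner \<Omega> (\<lambda>x. c * f x) w = c * L2_inner \<Omega> f (w :: _ \<Rightarrow> real)"
  by (simp add: L2_inner_def mult.assoc)

lemma L2_inner_mult_right:
  "L2_inner \<Omega> w (\<lambda>x. c * f x) = c * L2_inner \<Omega> w (f :: _ \<Rightarrow> real)"
  by (simp add: L2_inner_def mult.left_commute)

lemma L2_inner_sum_left:
  "(\<And>i. i \<in> I \<Longrightarrow> f i \<in> L2_space \<Omega>) \<Longrightarrow> w \<in> L2_space \<Omega> \<Longrightarrow>
    L2_inner \<Omega> (\<lambda>x. \<Sum>i\<in>I. f i x) w = (\<Sum>i\<in>I. L2_inner \<Omega> (f i) w)"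
  by (simp add: L2_inner_def inner_sum_left L2_inner_integrable)

lemmas L2_inner_simps = L2_inner_add_left L2_inner_add_right L2_inner_diff_left L2_inner_diff_right
  L2_inner_scaleR_left L2_inner_scaleR_right L2_inner_mult_left L2_inner_mult_right

lemma L2_inner_zero [simp]: "L2_inner \<Omega> (\<lambda>x. 0) g = 0" "L2_inner \<Omega> g (\<lambda>x. 0) = 0"
  by (simp_all add: L2_inner_def)

lemma L2_inner_cong_AE:
  assumes "AE x in lebesgue_on \<Omega>. f x = f' x" "AE x in lebesgue_on \<Omega>. g x = g' x"
    and "f \<in> borel_measurable (lebesgue_on \<Omega>)" "f' \<in> borel_measurable (lebesgue_on \<Omega>)"
      "g \<in> borel_measurable (lebesgue_on \<Omega>)" "g' \<in> borel_measurable (lebesgue_on \<Omega>)"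
  shows "L2_inner \<Omega> f g = L2_inner \<Omega> f' g'"
  unfolding L2_inner_def
proof (rule integral_cong_AE)
  show "AE x in lebesgue_on \<Omega>. f x \<bullet> g x = f' x \<bullet> g' x"
    using assms(1,2) by eventually_elim simp
qed (use assms in auto)

lemma L2_inner_cong_AE_left:
  assumes "AE x in lebesgue_on \<Omega>. f x = f' x" "f \<in> L2_space \<Omega>" "f' \<in> L2_space \<Omega>" "g \<in> L2_space \<Omega>"
  shows "L2_inner \<Omega> f g = L2_inner \<Omega> f' g"
  by (rule L2_inner_cong_AE) (use assms in \<open>auto simp: L2_space_def\<close>)

lemma L2_inner_self_nonneg [simp]: "0 \<le> L2_inner \<Omega> f f"
  by (simp add: L2_inner_def)

lemma L2_norm_nonneg [simp]: "0 \<le> L2_norm \<Omega> f"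
  by (simp add: L2_norm_def)

lemma L2_norm_sq: "(L2_norm \<Omega> f)\<^sup>2 = L2_inner \<Omega> f f"
  by (simp add: L2_norm_def)

lemma L2_norm_cong_AE:
  assumes "AE x in lebesgue_on \<Omega>. f x = f' x" "f \<in> L2_space \<Omega>" "f' \<in> L2_space \<Omega>"
  shows "L2_norm \<Omega> f = L2_norm \<Omega> f'"
  unfolding L2_norm_def
  by (subst L2_inner_cong_AE[where f'=f' and g'=f']) (use assms in \<open>auto simp: L2_space_def\<close>)

lemma L2_Cauchy_Schwarz:
  assumes "f \<in> L2_space \<Omega>" "g \<in> L2_space \<Omega>"
  shows "\<bar>L2_inner \<Omega> f g\<bar> \<le> L2_norm \<Omega> f * L2_norm \<Omega> g"
proof -
  have "(L2_inner \<Omega> f g)\<^sup>2 \<le> L2_inner \<Omega> f f * L2_inner \<Omega> g g"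
  proof (rule discriminant_nonneg_le)
    fix t :: real
    have "0 \<le> L2_inner \<Omega> (\<lambda>x. f x + t *\<^sub>R g x) (\<lambda>x. f x + t *\<^sub>R g x)" by simp
    also have "\<dots> = L2_inner \<Omega> f f + 2 * t * L2_inner \<Omega> f g + t\<^sup>2 * L2_inner \<Omega> g g"
      using assms by (simp add: L2_inner_simps L2_inner_commute[of _ g f] power2_eq_square algebra_simps)
    finally show "0 \<le> L2_inner \<Omega> f f + 2 * t * L2_inner \<Omega> f g + t\<^sup>2 * L2_inner \<Omega> g g" .
  qed simp
  also have "\<dots> = (L2_norm \<Omega> f * L2_norm \<Omega> g)\<^sup>2"
    by (simp add: power_mult_distrib L2_norm_sq)
  finally show ?thesis
    by (metis L2_norm_nonneg abs_le_square_iff abs_of_nonneg mult_nonneg_nonneg)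
qed

lemma L2_inner_le: "f \<in> L2_space \<Omega> \<Longrightarrow> g \<in> L2_space \<Omega> \<Longrightarrow> L2_inner \<Omega> f g \<le> L2_norm \<Omega> f * L2_norm \<Omega> g"
  using L2_Cauchy_Schwarz[of f \<Omega> g] by linarith

lemma L2_norm_triangle:
  assumes "f \<in> L2_space \<Omega>" "g \<in> L2_space \<Omega>"
  shows "L2_norm \<Omega> (\<lambda>x. f x + g x) \<le> L2_norm \<Omega> f + L2_norm \<Omega> g"
proof (rule power2_le_imp_le)
  have "(L2_norm \<Omega> (\<lambda>x. f x + g x))\<^sup>2 = L2_inner \<Omega> f f + 2 * L2_inner \<Omega> f g + L2_inner \<Omega> g g"
    using assms by (simp add: L2_norm_sq L2_inner_simps L2_inner_commute[of _ g f])
  also have "\<dots> \<le> (L2_norm \<Omega> f)\<^sup>2 + 2 * (L2_norm \<Omega> f * L2_norm \<Omega> g) + (L2_norm \<Omega> g)\<^sup>2"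
    using L2_inner_le[OF assms] by (simp add: L2_norm_sq)
  also have "\<dots> = (L2_norm \<Omega> f + L2_norm \<Omega> g)\<^sup>2"
    by (simp add: power2_eq_square algebra_simps)
  finally show "(L2_norm \<Omega> (\<lambda>x. f x + g x))\<^sup>2 \<le> (L2_norm \<Omega> f + L2_norm \<Omega> g)\<^sup>2" .
qed simp

lemma L2_norm_uminus [simp]: "L2_norm \<Omega> (\<lambda>x. - f x) = L2_norm \<Omega> f"
  by (simp add: L2_norm_def L2_inner_def)

lemma L2_norm_scaleR: "L2_norm \<Omega> (\<lambda>x. c *\<^sub>R f x) = \<bar>c\<bar> * L2_norm \<Omega> f"
  by (simp add: L2_norm_def L2_inner_simps real_sqrt_mult flip: mult.assoc power2_eq_square)

lemma L2_norm_diff_triangle: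
  assumes "f \<in> L2_space \<Omega>" "g \<in> L2_space \<Omega>"
  shows "L2_norm \<Omega> (\<lambda>x. f x - g x) \<le> L2_norm \<Omega> f + L2_norm \<Omega> g"
  using L2_norm_triangle[of f \<Omega> "\<lambda>x. - g x"] assms by simp

lemma L2_norm_zero_AE:
  assumes "f \<in> L2_space \<Omega>" "L2_inner \<Omega> f f = 0"
  shows "AE x in lebesgue_on \<Omega>. f x = 0"
proof -
  have "AE x in lebesgue_on \<Omega>. (norm (f x))\<^sup>2 = 0"
    using assms integral_nonneg_eq_0_iff_AE[of "lebesgue_on \<Omega>" "\<lambda>x. (norm (f x))\<^sup>2"]
    by (simp add: L2_space_def L2_inner_def power2_norm_eq_inner)
  then show ?thesis by simp
qed

text \<open>Both sides are continuous in \<open>g\<close> and \<open>G\<close>, so an identity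
  survives the limit when the two are approximated simultaneously. This is how identities for test
  functions pass to \<open>H01_space\<close>, whose elements come with such joint approximations of
  value and gradient.\<close>

lemma L2_approx_eqI:
  fixes f :: "'a::euclidean_space \<Rightarrow> 'b::euclidean_space" and v :: "'a \<Rightarrow> 'c::euclidean_space"
  assumes "f \<in> L2_space \<Omega>" "F \<in> L2_space \<Omega>" "g \<in> L2_space \<Omega>" "G \<in> L2_space \<Omega>"
    and "\<And>\<epsilon>. \<epsilon> > 0 \<Longrightarrow> \<exists>g' G'. g' \<in> L2_space \<Omega> \<and> G' \<in> L2_space \<Omega> \<and>
      L2_norm \<Omega> (\<lambda>x. g x - g' x) < \<epsilon> \<and> L2_norm \<Omega> (\<lambda>x. G x - G' x) < \<epsilon> \<and>
      L2_inner \<Omega> f g' = L2_inner \<Omega> F (G' :: 'a \<Rightarrow> 'c)"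
  shows "L2_inner \<Omega> f g = L2_inner \<Omega> F G"
proof (rule ccontr)
  define c where "c = \<bar>L2_inner \<Omega> f g - L2_inner \<Omega> F G\<bar>"
  \<comment> \<open>The summand 1 makes \<open>K\<close> positive and strictly larger than the two
    norms together, so the error ends up strictly below \<open>c\<close>.\<close>
  define K where "K = L2_norm \<Omega> f + L2_norm \<Omega> F + 1"
  assume "L2_inner \<Omega> f g \<noteq> L2_inner \<Omega> F G"
  then have "c > 0" by (simp add: c_def)
  have "K > 0" by (simp add: K_def add_nonneg_pos)
  obtain g' G' where g': "g' \<in> L2_space \<Omega>" "G' \<in> L2_space \<Omega>"
      "L2_norm \<Omega> (\<lambda>x. g x - g' x) < c / K" "L2_norm \<Omega> (\<lambda>x. G x - G' x) < c / K"
      "L2_inner \<Omega> f g' = L2_inner \<Omega> F G'"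
    using assms(5)[of "c / K"] \<open>c > 0\<close> \<open>K > 0\<close> by auto
  have "c = \<bar>L2_inner \<Omega> f (\<lambda>x. g x - g' x) - L2_inner \<Omega> F (\<lambda>x. G x - G' x)\<bar>"
    using assms(1-4) g'(1,2,5) by (simp add: c_def L2_inner_simps)
  also have "\<dots> \<le> L2_norm \<Omega> f * L2_norm \<Omega> (\<lambda>x. g x - g' x) + L2_norm \<Omega> F * L2_norm \<Omega> (\<lambda>x. G x - G' x)"
    using L2_Cauchy_Schwarz[of f \<Omega> "\<lambda>x. g x - g' x"] L2_Cauchy_Schwarz[of F \<Omega> "\<lambda>x. G x - G' x"]
      assms(1-4) g'(1,2) by auto
  also have "\<dots> \<le> L2_norm \<Omega> f * (c / K) + L2_norm \<Omega> F * (c / K)"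
    by (intro add_mono mult_left_mono) (use g' in auto)
  also have "\<dots> = (K - 1) * (c / K)" by (simp only: K_def distrib_right[symmetric]) simp
  also have "\<dots> < K * (c / K)" using \<open>c > 0\<close> \<open>K > 0\<close> by (intro mult_strict_right_mono) auto
  also have "\<dots> = c" using \<open>K > 0\<close> by simp
  finally show False by simp
qed

section \<open>Smooth functions\<close>

lemma C_k_Suc_D: "C_k (Suc k) f \<Longrightarrow> C_k k f"
proof (induction k arbitrary: f)
  case 0
  then show ?case by (simp add: differentiable_imp_continuous_on)
next
  case (Suc k)
  then show ?case by (metis C_k.simps(2))
qed

lemma C_k_differentiable: "C_k (Suc k) f \<Longrightarrow> f differentiable at x"
  by (simp add: differentiable_on_def)

lemma frechet_derivative_worksI:
  fixes f :: "'a::real_normed_vector \<Rightarrow> 'b::real_normed_vector"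
  assumes "f differentiable at x"
  shows "(f has_derivative frechet_derivative f (at x)) (at x)"
  using assms by (simp add: frechet_derivative_works)

lemma C_k_const: "C_k k (\<lambda>x. c)"
proof (induction k arbitrary: c)
  case (Suc k)
  have "frechet_derivative (\<lambda>x::'a. c) (at x) i = 0" for x i by simp
  then show ?case using Suc by simp
qed simp

lemma C_k_add: "C_k k f \<Longrightarrow> C_k k g \<Longrightarrow> C_k k (\<lambda>x. f x + g x)"
proof (induction k arbitrary: f g)
  case 0
  then show ?case by (auto intro: continuous_intros)
next
  case (Suc k)
  have d: "f differentiable at x" "g differentiable at x" for x
    using Suc.prems by (auto simp: differentiable_on_def)
  have "frechet_derivative (\<lambda>x. f x + g x) (at x) i =
      frechet_derivative f (at x) i + frechet_derivative g (at x) i" for x i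
    using fun_cong[OF frechet_derivative_at[OF has_derivative_add[OF
      frechet_derivative_worksI[OF d(1)] frechet_derivative_worksI[OF d(2)]]], of x i] by simp
  then show ?case using Suc by (auto simp: differentiable_on_def intro: differentiable_add)
qed

lemma C_k_mult: "C_k k f \<Longrightarrow> C_k k g \<Longrightarrow> C_k k (\<lambda>x. f x * g x)"
proof (induction k arbitrary: f g)
  case 0
  then show ?case by (auto intro: continuous_intros)
next
  case (Suc k)
  have d: "f differentiable at x" "g differentiable at x" for x
    using Suc.prems by (auto simp: differentiable_on_def)
  have "frechet_derivative (\<lambda>x. f x * g x) (at x) i =
      f x * frechet_derivative g (at x) i + frechet_derivative f (at x) i * g x" for x i
    using fun_cong[OF frechet_derivative_at[OF has_derivative_mult[OF
      frechet_derivative_worksI[OF d(1)] frechet_derivative_worksI[OF d(2)]]], of x i] by simp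
  moreover have "C_k k f" "C_k k g" using Suc.prems C_k_Suc_D by auto
  ultimately show ?case using Suc
    by (auto simp: differentiable_on_def intro!: C_k_add differentiable_mult)
qed

lemma C_k_diff: "C_k k f \<Longrightarrow> C_k k g \<Longrightarrow> C_k k (\<lambda>x. f x - g x)"
  using C_k_add[of k f "\<lambda>x. (-1) * g x"] C_k_mult[OF C_k_const[of k "-1"], of g] by simp

lemma C_k_prod: "(\<And>i. i \<in> I \<Longrightarrow> C_k k (f i)) \<Longrightarrow> C_k k (\<lambda>x. \<Prod>i\<in>I. f i x)"
  by (induction I rule: infinite_finite_induct) (auto intro: C_k_mult C_k_const)

lemma C_k_inner: "C_k k (\<lambda>x. x \<bullet> a)"
proof (cases k)
  case 0
  then show ?thesis by (simp add: continuous_intros)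
next
  case (Suc m)
  have "frechet_derivative (\<lambda>x. x \<bullet> a) (at x) i = i \<bullet> a" for x i :: 'a
    using fun_cong[OF frechet_derivative_at[OF has_derivative_inner_left[OF has_derivative_ident[of "at x"], of a]], of i] by simp
  then show ?thesis
    by (auto simp: Suc differentiable_on_def C_k_const intro!: bounded_linear_imp_differentiable bounded_linear_inner_left)
qed

text \<open>Closed under differentiation:
  \<open>E_m'(t) = - m E_{m+1}(t) + c E_{m+2}(t)\<close>.\<close>

definition flat_exp :: "real \<Rightarrow> nat \<Rightarrow> real \<Rightarrow> real" where
  "flat_exp c m t = (if t \<le> 0 then 0 else inverse t ^ m * exp (- (c * inverse t)))"

lemma flat_exp_tendsto_0:
  assumes "0 < c"
  shows "(flat_exp c m \<longlongrightarrow> 0) (at 0)"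
proof -
  have "((\<lambda>y. y ^ m / exp (c * y)) \<longlongrightarrow> 0) at_top"
  proof -
    have "((\<lambda>y::real. inverse c ^ m * ((c * y) ^ m / exp (c * y))) \<longlongrightarrow> inverse c ^ m * 0) at_top"
      by (intro tendsto_mult tendsto_const filterlim_compose[OF tendsto_power_div_exp_0]
          filterlim_tendsto_pos_mult_at_top[OF tendsto_const assms filterlim_ident])
    then show ?thesis using assms by (simp add: power_mult_distrib field_simps)
  qed
  then have "((\<lambda>t. inverse t ^ m / exp (c * inverse t)) \<longlongrightarrow> 0) (at_right 0)"
    by (rule filterlim_compose) (rule filterlim_inverse_at_top_right)
  then have "(flat_exp c m \<longlongrightarrow> 0) (at_right 0)"
    by (rule Lim_transform_eventually)
       (auto simp: flat_exp_def exp_minus divide_inverse eventually_at_right_field intro!: exI[of _ 1])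
  moreover have "(flat_exp c m \<longlongrightarrow> 0) (at_left 0)"
    by (rule Lim_transform_eventually[OF tendsto_const])
       (auto simp: flat_exp_def eventually_at_left_field intro!: exI[of _ "-1"])
  ultimately show ?thesis by (simp add: filterlim_split_at)
qed

lemma flat_exp_deriv:
  assumes "0 < c"
  shows "(flat_exp c m has_real_derivative
    (c * flat_exp c (m + 2) t - real m * flat_exp c (m + 1) t)) (at t)"
proof (cases t "0::real" rule: linorder_cases)
  case less
  have "((\<lambda>_. 0) has_real_derivative 0) (at t)" by simp
  then have "(flat_exp c m has_real_derivative 0) (at t)"
    by (rule has_field_derivative_transform_within_open[of _ _ _ "{..<0}"])
       (use less in \<open>auto simp: flat_exp_def\<close>)
  then show ?thesis using less by (simp add: flat_exp_def)
next
  case equal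
  \<comment> \<open>At 0 the difference quotient of \<open>flat_exp c m\<close> is
    \<open>flat_exp c (m + 1)\<close>, which tends to 0.\<close>
  have "((\<lambda>h. flat_exp c (m + 1) h) \<longlongrightarrow> 0) (at 0)" by (rule flat_exp_tendsto_0[OF assms])
  then have "((\<lambda>h. flat_exp c m h / h) \<longlongrightarrow> 0) (at 0)"
    by (rule Lim_transform_eventually) (auto simp: flat_exp_def eventually_at_filter field_simps)
  then show ?thesis using equal by (simp add: has_field_derivative_iff flat_exp_def)
next
  case greater
  have "((\<lambda>t. inverse t ^ m * exp (- (c * inverse t))) has_real_derivative
      (inverse t ^ m * (exp (- (c * inverse t)) * (c * inverse t ^ 2)) -
       real m * inverse t ^ (m + 1) * exp (- (c * inverse t)))) (at t)"
  proof (cases m)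
    case 0
    then show ?thesis using greater
      by (auto intro!: derivative_eq_intros simp: field_simps power2_eq_square)
  next
    case (Suc k)
    have y: "(inverse has_real_derivative - (inverse t ^ 2)) (at t)"
      using DERIV_inverse[of t UNIV] greater by (simp add: power2_eq_square)
    have 2: "((\<lambda>t. exp (- (c * inverse t))) has_real_derivative exp (- (c * inverse t)) * (c * inverse t ^ 2)) (at t)"
      by (rule DERIV_cong[OF DERIV_fun_exp[OF DERIV_minus[OF DERIV_cmult[OF y]]]]) simp
    have alg: "real (Suc k) * (y ^ k * - (y ^ 2)) * e + e * (c * y ^ 2) * y ^ Suc k =
        y ^ Suc k * (e * (c * y ^ 2)) - real (Suc k) * y ^ (Suc k + 1) * e" for y e :: real
      by (simp add: power2_eq_square algebra_simps)
    have 1: "((\<lambda>t. inverse t ^ Suc k) has_real_derivative real (Suc k) * (inverse t ^ k * - (inverse t ^ 2))) (at t)"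
      by (rule DERIV_cong[OF DERIV_power[OF y]]) simp
    show ?thesis unfolding Suc by (rule DERIV_cong[OF DERIV_mult[OF 1 2] alg])
  qed
  then have "((\<lambda>t. inverse t ^ m * exp (- (c * inverse t))) has_real_derivative
    (c * flat_exp c (m + 2) t - real m * flat_exp c (m + 1) t)) (at t)"
    using greater by (simp add: flat_exp_def algebra_simps power2_eq_square)
  then show ?thesis
    by (rule has_field_derivative_transform_within_open[of _ _ _ "{0<..}"])
       (use greater in \<open>auto simp: flat_exp_def\<close>)
qed

text \<open>Differentiation raises \<open>m\<close> by one and by two and multiplies by constants,
  so the induction on \<open>k\<close> has to keep \<open>m\<close> arbitrary.\<close>

lemma C_k_flat_exp_affine:
  assumes "0 < c"
  shows "C_k k (\<lambda>x. flat_exp c m (x \<bullet> a + b))"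
proof (induction k arbitrary: m)
  case 0
  have "continuous_on UNIV (flat_exp c m)"
    by (meson DERIV_isCont assms continuous_at_imp_continuous_on flat_exp_deriv)
  from continuous_on_compose2[OF this, of UNIV "\<lambda>x. x \<bullet> a + b"] show ?case by (simp add: continuous_intros)
next
  case (Suc k)
  have d: "((\<lambda>x. flat_exp c m (x \<bullet> a + b)) has_derivative
      (\<lambda>i. (i \<bullet> a) * (c * flat_exp c (m + 2) (x \<bullet> a + b) - real m * flat_exp c (m + 1) (x \<bullet> a + b)))) (at x)" for x
  proof -
    have l: "((\<lambda>x. x \<bullet> a + b) has_derivative (\<lambda>i. i \<bullet> a)) (at x)"
      by (auto intro!: derivative_eq_intros)
    show ?thesis
      using has_derivative_compose[OF l flat_exp_deriv[OF assms, of m "x \<bullet> a + b", unfolded has_field_derivative_def]]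
      by (simp add: mult.commute)
  qed
  have "frechet_derivative (\<lambda>x. flat_exp c m (x \<bullet> a + b)) (at x) i =
     (c * (i \<bullet> a)) * flat_exp c (m + 2) (x \<bullet> a + b) + (- real m * (i \<bullet> a)) * flat_exp c (m + 1) (x \<bullet> a + b)" for x i
    using fun_cong[OF frechet_derivative_at[OF d[of x]], of i] by (simp add: algebra_simps)
  then show ?case
    using d Suc by (auto simp: differentiable_on_def differentiable_def intro!: C_k_diff C_k_mult C_k_const)
qed

section \<open>Test functions and weak gradients\<close>

lemma test_functionsI:
  assumes "\<And>k. C_k k \<phi>" "compact K" "K \<subseteq> \<Omega>" "\<And>x. x \<notin> K \<Longrightarrow> \<phi> x = 0"
  shows "\<phi> \<in> test_functions \<Omega>"
proof -
  have "closure {x. \<phi> x \<noteq> 0} \<subseteq> K"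
    using assms by (intro closure_minimal) (auto simp: compact_imp_closed)
  moreover from this have "compact (closure {x. \<phi> x \<noteq> 0})"
    using assms(2) by (meson bounded_subset closed_closure compact_eq_bounded_closed)
  ultimately show ?thesis using assms(1,3) by (auto simp: test_functions_def)
qed

lemma test_functionsE:
  assumes "\<phi> \<in> test_functions \<Omega>"
  obtains K where "compact K" "K \<subseteq> \<Omega>" "\<And>x. x \<notin> K \<Longrightarrow> \<phi> x = 0"
    "\<And>x. x \<notin> K \<Longrightarrow> classical_grad \<phi> x = 0"
proof (rule that[of "closure {x. \<phi> x \<noteq> 0}"])
  show "compact (closure {x. \<phi> x \<noteq> 0})" "closure {x. \<phi> x \<noteq> 0} \<subseteq> \<Omega>"
    using assms by (auto simp: test_functions_def)
  show "\<phi> x = 0" if "x \<notin> closure {x. \<phi> x \<noteq> 0}" for x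
    using that closure_subset[of "{x. \<phi> x \<noteq> 0}"] by auto
  show "classical_grad \<phi> x = 0" if x: "x \<notin> closure {x. \<phi> x \<noteq> 0}" for x
  proof -
    have "(\<phi> has_derivative (\<lambda>h. 0)) (at x)"
    proof (rule has_derivative_transform_within_open[of "\<lambda>_. 0" _ _ _ "- closure {x. \<phi> x \<noteq> 0}"])
      show "0 = \<phi> y" if "y \<in> - closure {x. \<phi> x \<noteq> 0}" for y
        using that closure_subset[of "{x. \<phi> x \<noteq> 0}"] by auto
    qed (use x in auto)
    then have "frechet_derivative \<phi> (at x) = (\<lambda>h. 0)"
      by (rule frechet_derivative_at[symmetric])
    then show ?thesis by (simp add: classical_grad_def)
  qed
qed

lemma test_functions_C_k: "\<phi> \<in> test_functions \<Omega> \<Longrightarrow> C_k k \<phi>"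
  by (simp add: test_functions_def)

lemma C_k_continuous_on: "C_k k f \<Longrightarrow> continuous_on S f"
proof (induction k arbitrary: f)
  case 0
  then show ?case using continuous_on_subset by auto
next
  case (Suc k)
  then show ?case using C_k_Suc_D by blast
qed

lemma C_1_has_derivative:
  assumes "C_k (Suc k) \<phi>"
  shows "(\<phi> has_derivative (\<lambda>h. classical_grad \<phi> x \<bullet> h)) (at x)"
proof -
  have d: "(\<phi> has_derivative frechet_derivative \<phi> (at x)) (at x)"
    by (rule frechet_derivative_worksI[OF C_k_differentiable[OF assms]])
  interpret D: bounded_linear "frechet_derivative \<phi> (at x)"
    using d by (rule has_derivative_bounded_linear)
  have "frechet_derivative \<phi> (at x) h = classical_grad \<phi> x \<bullet> h" for h
  proof -
    have "frechet_derivative \<phi> (at x) h = frechet_derivative \<phi> (at x) (\<Sum>i\<in>Basis. (h \<bullet> i) *\<^sub>R i)"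
      by (simp add: euclidean_representation)
    also have "\<dots> = (\<Sum>i\<in>Basis. (h \<bullet> i) * frechet_derivative \<phi> (at x) i)"
      by (simp add: D.sum D.scaleR)
    also have "\<dots> = classical_grad \<phi> x \<bullet> h"
      by (simp add: classical_grad_def inner_sum_left mult.commute inner_commute[of h])
    finally show ?thesis .
  qed
  then have "frechet_derivative \<phi> (at x) = (\<lambda>h. classical_grad \<phi> x \<bullet> h)" by (rule ext)
  then show ?thesis using d by metis
qed

lemma classical_grad_unique:
  assumes "(\<phi> has_derivative (\<lambda>h. g \<bullet> h)) (at x)"
  shows "classical_grad \<phi> x = g"
proof -
  have "frechet_derivative \<phi> (at x) = (\<lambda>h. g \<bullet> h)"
    using frechet_derivative_at[OF assms] by simp
  then show ?thesis by (simp add: classical_grad_def euclidean_representation)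
qed

lemma classical_grad_inner_Basis:
  "i \<in> Basis \<Longrightarrow> classical_grad \<phi> x \<bullet> i = frechet_derivative \<phi> (at x) i"
  by (simp add: classical_grad_def)

lemma C_1_continuous_grad: "C_k (Suc k) \<phi> \<Longrightarrow> continuous_on S (classical_grad \<phi>)"
  unfolding classical_grad_def by (intro continuous_intros) (auto intro: C_k_continuous_on)

lemma classical_grad_add:
  assumes "C_k (Suc k) \<phi>" "C_k (Suc k) \<psi>"
  shows "classical_grad (\<lambda>x. \<phi> x + \<psi> x) x = classical_grad \<phi> x + classical_grad \<psi> x"
  using has_derivative_add[OF assms[THEN C_1_has_derivative, of x]]
  by (intro classical_grad_unique) (simp add: inner_add_left)

lemma classical_grad_mult:
  assumes "C_k (Suc k) \<phi>" "C_k (Suc k) \<psi>"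
  shows "classical_grad (\<lambda>x. \<phi> x * \<psi> x) x = \<phi> x *\<^sub>R classical_grad \<psi> x + \<psi> x *\<^sub>R classical_grad \<phi> x"
  using has_derivative_mult[OF assms[THEN C_1_has_derivative, of x]]
  by (intro classical_grad_unique) (simp add: inner_add_left mult.commute)

lemma classical_grad_cmult:
  assumes "C_k (Suc k) \<phi>"
  shows "classical_grad (\<lambda>x. c * \<phi> x) x = c *\<^sub>R classical_grad \<phi> x"
  using has_derivative_mult_right[OF C_1_has_derivative[OF assms, of x], of c]
  by (intro classical_grad_unique) simp

lemma classical_grad_inner: "classical_grad (\<lambda>x. x \<bullet> a) x = a"
  by (rule classical_grad_unique) (auto intro!: derivative_eq_intros simp: inner_commute)

lemma test_functions_add:
  assumes "\<phi> \<in> test_functions \<Omega>" "\<psi> \<in> test_functions \<Omega>"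
  shows "(\<lambda>x. \<phi> x + \<psi> x) \<in> test_functions \<Omega>"
proof -
  obtain K L where "compact K" "K \<subseteq> \<Omega>" "\<And>x. x \<notin> K \<Longrightarrow> \<phi> x = 0" "compact L" "L \<subseteq> \<Omega>" "\<And>x. x \<notin> L \<Longrightarrow> \<psi> x = 0"
    using assms by (elim test_functionsE) blast
  then show ?thesis
    by (intro test_functionsI[of _ "K \<union> L"]) (use assms in \<open>auto intro: C_k_add test_functions_C_k\<close>)
qed

lemma test_functions_mult:
  assumes "\<phi> \<in> test_functions \<Omega>" "\<And>k. C_k k \<psi>"
  shows "(\<lambda>x. \<psi> x * \<phi> x) \<in> test_functions \<Omega>"
proof -
  obtain K where "compact K" "K \<subseteq> \<Omega>" "\<And>x. x \<notin> K \<Longrightarrow> \<phi> x = 0"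
    using assms by (elim test_functionsE) blast
  then show ?thesis
    by (intro test_functionsI[of _ K]) (use assms in \<open>auto intro: C_k_mult test_functions_C_k\<close>)
qed

lemma test_functions_cmult: "\<phi> \<in> test_functions \<Omega> \<Longrightarrow> (\<lambda>x. c * \<phi> x) \<in> test_functions \<Omega>"
  by (rule test_functions_mult) (auto intro: C_k_const)

lemma test_functions_mono: "O' \<subseteq> \<Omega> \<Longrightarrow> test_functions O' \<subseteq> test_functions \<Omega>"
  by (auto simp: test_functions_def)

lemma continuous_compact_support_integrable:
  fixes f :: "'a::euclidean_space \<Rightarrow> 'b::{banach, second_countable_topology}"
  assumes "continuous_on UNIV f" "compact K" "\<And>x. x \<notin> K \<Longrightarrow> f x = 0"
  shows "integrable lborel f"
proof -
  have "integrable lborel (\<lambda>x. indicator K x *\<^sub>R f x)"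
    using assms by (intro borel_integrable_compact) (auto intro: continuous_on_subset)
  also have "(\<lambda>x. indicator K x *\<^sub>R f x) = f"
    using assms(3) by (auto simp: indicator_def)
  finally show ?thesis .
qed

lemma integrable_lebesgue_on:
  fixes f :: "'a::euclidean_space \<Rightarrow> 'b::{banach, second_countable_topology}"
  assumes "integrable lborel f" "S \<in> sets lebesgue"
  shows "integrable (lebesgue_on S) f"
proof -
  have "integrable lebesgue f"
    using assms(1) by (subst integrable_completion) (auto dest: borel_measurable_integrable)
  then have "integrable lebesgue (\<lambda>x. indicator S x *\<^sub>R f x)"
    using assms(2) by (intro integrable_mult_indicator) auto
  then show ?thesis using assms(2) by (subst integrable_restrict_space) auto
qed

lemma continuous_compact_support_L2:
  fixes f :: "'a::euclidean_space \<Rightarrow> 'b::euclidean_space"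
  assumes "continuous_on UNIV f" "compact K" "\<And>x. x \<notin> K \<Longrightarrow> f x = 0" "S \<in> sets lebesgue"
  shows "f \<in> L2_space S"
proof -
  have "integrable lborel (\<lambda>x. (norm (f x))\<^sup>2)"
    using assms by (intro continuous_compact_support_integrable[of _ K]) (auto intro!: continuous_intros)
  moreover have "f \<in> borel_measurable (lebesgue_on S)"
    using assms(1) borel_measurable_continuous_onI
    by (intro measurable_restrict_space1 measurable_completion) auto
  ultimately show ?thesis
    using assms(4) by (simp add: L2_space_def integrable_lebesgue_on)
qed

lemma test_functions_L2:
  assumes "\<phi> \<in> test_functions \<Omega>" "S \<in> sets lebesgue"
  shows "\<phi> \<in> L2_space S" "classical_grad \<phi> \<in> L2_space S"
proof -
  obtain K where "compact K" "\<And>x. x \<notin> K \<Longrightarrow> \<phi> x = 0" "\<And>x. x \<notin> K \<Longrightarrow> classical_grad \<phi> x = 0"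
    using assms(1) by (elim test_functionsE) blast
  then show "\<phi> \<in> L2_space S" "classical_grad \<phi> \<in> L2_space S"
    using assms C_1_continuous_grad[OF test_functions_C_k[OF assms(1)]]
      C_k_continuous_on[OF test_functions_C_k[OF assms(1)]]
    by (auto intro: continuous_compact_support_L2)
qed

text \<open>Translation invariance: the difference quotients have integral zero.\<close>

lemma integral_frechet_derivative_eq_0:
  fixes \<phi> :: "'a::euclidean_space \<Rightarrow> real"
  assumes "\<phi> \<in> test_functions \<Omega>" "i \<in> Basis"
  shows "(\<integral>x. frechet_derivative \<phi> (at x) i \<partial>lborel) = 0"
proof -
  obtain K where K: "compact K" "\<And>x. x \<notin> K \<Longrightarrow> \<phi> x = 0" "\<And>x. x \<notin> K \<Longrightarrow> classical_grad \<phi> x = 0"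
    using assms(1) by (elim test_functionsE) blast
  have c: "C_k (Suc 0) \<phi>" by (rule test_functions_C_k[OF assms(1)])
  obtain B where B: "\<And>x. norm (classical_grad \<phi> x) \<le> B"
  proof -
    have "compact (classical_grad \<phi> ` K)"
      using K C_1_continuous_grad[OF c] by (intro compact_continuous_image) auto
    then obtain B where "\<forall>y\<in>classical_grad \<phi> ` K. norm y \<le> B"
      using compact_imp_bounded bounded_iff by metis
    then have "norm (classical_grad \<phi> x) \<le> max B 0" for x
      using K(3)[of x] by (cases "x \<in> K") (auto simp: le_max_iff_disj)
    then show ?thesis using that by blast
  qed
  obtain R where R: "\<And>x. x \<in> K \<Longrightarrow> norm x \<le> R"
    using K(1) compact_imp_bounded bounded_iff by metis
  define s where "s n = inverse (real (Suc n))" for n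
  have s: "0 < s n" "s n \<le> 1" "(\<lambda>n. s n) \<longlonglongrightarrow> 0" for n
    using LIMSEQ_inverse_real_of_nat unfolding s_def by (auto simp: field_simps)
  define q where "q n x = (\<phi> (x + s n *\<^sub>R i) - \<phi> x) / s n" for n x
  have int: "integrable lborel \<phi>"
    using K C_k_continuous_on[OF c] by (intro continuous_compact_support_integrable) auto
  have int': "integrable lborel (\<lambda>x. \<phi> (x + s n *\<^sub>R i))" for n
  proof -
    have "integrable (distr lborel borel ((+) (s n *\<^sub>R i))) \<phi>"
      using int by (simp add: lborel_distr_plus)
    then have "integrable lborel (\<lambda>x. \<phi> (s n *\<^sub>R i + x))"
      by (rule integrable_distr[rotated]) simp
    then show ?thesis by (simp add: add.commute)
  qed
  have "(\<integral>x. q n x \<partial>lborel) = 0" for n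
  proof -
    have "(\<integral>x. \<phi> x \<partial>lborel) = (\<integral>x. \<phi> x \<partial>distr lborel borel ((+) (s n *\<^sub>R i)))"
      by (simp add: lborel_distr_plus)
    also have "\<dots> = (\<integral>x. \<phi> (x + s n *\<^sub>R i) \<partial>lborel)"
      using int by (subst integral_distr) (auto simp: add.commute dest: borel_measurable_integrable)
    finally show ?thesis using int int' by (simp add: q_def)
  qed
  moreover have "(\<lambda>n. \<integral>x. q n x \<partial>lborel) \<longlonglongrightarrow> (\<integral>x. frechet_derivative \<phi> (at x) i \<partial>lborel)"
  \<comment> \<open>The step \<open>s n\<close> is at most 1, so all quotients are supported in the
    ball of radius \<open>R + 1\<close>, where the mean value inequality bounds them by
    \<open>B\<close>.\<close>
  proof (rule integral_dominated_convergence[where w="\<lambda>x. B * indicator (cball 0 (R + 1)) x"])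
    show "(\<lambda>x. frechet_derivative \<phi> (at x) i) \<in> borel_measurable lborel"
      using c assms(2) by (auto intro!: borel_measurable_continuous_onI)
    show "q n \<in> borel_measurable lborel" for n
      unfolding q_def using int int' by (auto dest: borel_measurable_integrable)
    show "integrable lborel (\<lambda>x::'a. B * indicator (cball 0 (R + 1)) x)"
    proof -
      have "emeasure lborel (cball 0 (R + 1) :: 'a set) < \<infinity>" by (rule emeasure_bounded_finite) simp
      then show ?thesis by (intro integrable_mult_right integrable_real_indicator) auto
    qed
    have "(\<lambda>n. q n x) \<longlonglongrightarrow> frechet_derivative \<phi> (at x) i" for x
    proof -
      have "((\<lambda>t. x + t *\<^sub>R i) has_derivative (\<lambda>t. t *\<^sub>R i)) (at 0)"
        by (auto intro!: derivative_eq_intros)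
      moreover have "(\<phi> has_derivative (\<lambda>h. classical_grad \<phi> x \<bullet> h)) (at (x + 0 *\<^sub>R i))"
        using C_1_has_derivative[OF c, of x] by simp
      ultimately have "((\<lambda>t. \<phi> (x + t *\<^sub>R i)) has_derivative (\<lambda>t. classical_grad \<phi> x \<bullet> (t *\<^sub>R i))) (at 0)"
        by (rule has_derivative_compose)
      moreover have "(\<lambda>t. classical_grad \<phi> x \<bullet> (t *\<^sub>R i)) = (*) (classical_grad \<phi> x \<bullet> i)"
        by (simp add: fun_eq_iff)
      ultimately have "((\<lambda>t. \<phi> (x + t *\<^sub>R i)) has_real_derivative (classical_grad \<phi> x \<bullet> i)) (at 0)"
        by (simp add: has_field_derivative_def)
      then have "((\<lambda>h. (\<phi> (x + h *\<^sub>R i) - \<phi> x) / h) \<longlongrightarrow> classical_grad \<phi> x \<bullet> i) (at 0)"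
        by (simp add: has_field_derivative_iff)
      then have "(\<lambda>n. (\<phi> (x + s n *\<^sub>R i) - \<phi> x) / s n) \<longlonglongrightarrow> classical_grad \<phi> x \<bullet> i"
        by (rule filterlim_compose) (use s in \<open>auto simp: filterlim_at intro!: always_eventually less_imp_neq[symmetric]\<close>)
      then show ?thesis by (simp add: q_def classical_grad_inner_Basis[OF assms(2)])
    qed
    then show "AE x in lborel. (\<lambda>n. q n x) \<longlonglongrightarrow> frechet_derivative \<phi> (at x) i" by simp
    have "norm (q n x) \<le> B * indicator (cball 0 (R + 1)) x" for n x
    proof (cases "x \<in> cball 0 (R + 1)")
      case True
      have "norm (\<phi> (x + s n *\<^sub>R i) - \<phi> x) \<le> B * norm (x + s n *\<^sub>R i - x)"
      proof (rule differentiable_bound[of UNIV \<phi> "\<lambda>y h. classical_grad \<phi> y \<bullet> h"])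
        show "(\<phi> has_derivative (\<lambda>h. classical_grad \<phi> y \<bullet> h)) (at y within UNIV)" for y
          using C_1_has_derivative[OF c] by simp
        show "onorm (\<lambda>h. classical_grad \<phi> y \<bullet> h) \<le> B" for y
        proof (rule onorm_le)
          fix h
          have "norm (classical_grad \<phi> y \<bullet> h) \<le> norm (classical_grad \<phi> y) * norm h"
            by (simp add: Cauchy_Schwarz_ineq2)
          also have "\<dots> \<le> B * norm h" by (intro mult_right_mono B) auto
          finally show "norm (classical_grad \<phi> y \<bullet> h) \<le> B * norm h" .
        qed
      qed auto
      then show ?thesis using True s(1)[of n] assms(2) by (simp add: q_def field_simps)
    next
      case False
      then have "R + 1 < norm x" by simp
      moreover have "norm x \<le> norm (x + s n *\<^sub>R i) + norm (s n *\<^sub>R i)"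
        using norm_triangle_ineq4[of "x + s n *\<^sub>R i" "s n *\<^sub>R i"] by simp
      moreover have "norm (s n *\<^sub>R i) \<le> 1" using s(1,2)[of n] assms(2) by simp
      ultimately have "x + s n *\<^sub>R i \<notin> K" "x \<notin> K" using R by force+
      then show ?thesis using False K by (simp add: q_def)
    qed
    then show "AE x in lborel. norm (q n x) \<le> B * indicator (cball 0 (R + 1)) x" for n by simp
  qed
  ultimately show ?thesis by (simp add: LIMSEQ_const_iff)
qed

lemma integral_lebesgue_on_test:
  assumes "\<phi> \<in> borel_measurable borel" "\<And>x. x \<notin> \<Omega> \<Longrightarrow> \<phi> x = 0" "\<Omega> \<in> sets lebesgue"
  shows "(\<integral>x. \<phi> x \<partial>lebesgue_on \<Omega>) = (\<integral>x. \<phi> x \<partial>lborel :: real)"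
proof -
  have "(\<integral>x. \<phi> x \<partial>lebesgue_on \<Omega>) = (\<integral>x. indicator \<Omega> x *\<^sub>R \<phi> x \<partial>lebesgue)"
    using assms(3) by (subst integral_restrict_space) auto
  also have "(\<lambda>x. indicator \<Omega> x *\<^sub>R \<phi> x) = \<phi>"
  proof
    show "indicator \<Omega> x *\<^sub>R \<phi> x = \<phi> x" for x using assms(2)[of x] by (cases "x \<in> \<Omega>") auto
  qed
  also have "integral\<^sup>L lebesgue \<phi> = integral\<^sup>L lborel \<phi>"
    using assms(1) by (subst integral_completion) auto
  finally show ?thesis .
qed

text \<open>The product of an affine function and a test function is again a test function, so the
  integral of its derivative is zero; by the product rule this is the integration by parts.
  Agreement with the affine function is asked on the open set only, because the values of discrete
  functions on the skeleton are arbitrary.\<close>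

lemma affine_weak_grad:
  fixes O' :: "'a::euclidean_space set"
  assumes "open O'" "bounded O'" and v: "\<And>x. x \<in> O' \<Longrightarrow> v x = a \<bullet> x + b"
  shows "is_weak_grad O' v (\<lambda>x. a)"
proof -
  have O': "O' \<in> sets lebesgue" "O' \<in> sets borel" using assms(1) by (auto simp: borel_open)
  have fin: "finite_measure (lebesgue_on O')"
    using emeasure_bounded_finite[OF assms(2)] O' by (intro finite_measureI) (simp add: emeasure_restrict_space)
  then interpret finite_measure "lebesgue_on O'" .
  have m: "v \<in> borel_measurable (lebesgue_on O')"
  proof (subst measurable_cong)
    show "v x = a \<bullet> x + b" if "x \<in> space (lebesgue_on O')" for x using that v by simp
    show "(\<lambda>x. a \<bullet> x + b) \<in> borel_measurable (lebesgue_on O')"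
      by (intro measurable_restrict_space1 measurable_completion) auto
  qed
  obtain R where R: "\<And>x. x \<in> O' \<Longrightarrow> norm x \<le> R" using assms(2) bounded_iff by metis
  have "v \<in> L2_space O'"
  proof -
    have "integrable (lebesgue_on O') (\<lambda>x. (norm (v x))\<^sup>2)"
    proof (rule integrable_const_bound[where B="(norm a * R + \<bar>b\<bar>)\<^sup>2"])
      have "norm (v x) \<le> norm a * R + \<bar>b\<bar>" if "x \<in> O'" for x
      proof -
        have "\<bar>a \<bullet> x\<bar> \<le> norm a * norm x" by (rule Cauchy_Schwarz_ineq2)
        also have "\<dots> \<le> norm a * R" using R[OF that] by (simp add: mult_left_mono)
        finally show ?thesis using v[OF that] by simp
      qed
      then have "norm ((norm (v x))\<^sup>2) \<le> (norm a * R + \<bar>b\<bar>)\<^sup>2" if "x \<in> O'" for x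
        using power_mono[of "norm (v x)" "norm a * R + \<bar>b\<bar>" 2] that by simp
      then show "AE x in lebesgue_on O'. norm ((norm (v x))\<^sup>2) \<le> (norm a * R + \<bar>b\<bar>)\<^sup>2"
        by (intro AE_I2) simp
    qed (use m in measurable)
    then show ?thesis using m by (simp add: L2_space_def)
  qed
  moreover have "(\<lambda>x. a) \<in> L2_space O'" by (simp add: L2_space_def)
  moreover have "(\<integral>x. v x * frechet_derivative \<phi> (at x) i \<partial>lebesgue_on O') =
        - (\<integral>x. (a \<bullet> i) * \<phi> x \<partial>lebesgue_on O')" if phi: "\<phi> \<in> test_functions O'" and i: "i \<in> Basis" for \<phi> i
  proof -
    obtain K where K: "compact K" "K \<subseteq> O'" "\<And>x. x \<notin> K \<Longrightarrow> \<phi> x = 0" "\<And>x. x \<notin> K \<Longrightarrow> classical_grad \<phi> x = 0"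
      using phi by (elim test_functionsE) blast
    have c: "C_k (Suc 0) \<phi>" by (rule test_functions_C_k[OF phi])
    have aff: "C_k k (\<lambda>x. x \<bullet> a + b)" for k by (intro C_k_add C_k_inner C_k_const)
    define \<psi> where "\<psi> x = (x \<bullet> a + b) * \<phi> x" for x
    have psi: "\<psi> \<in> test_functions O'"
      unfolding \<psi>_def by (rule test_functions_mult[OF phi aff])
    have eq: "frechet_derivative \<psi> (at x) i = (x \<bullet> a + b) * frechet_derivative \<phi> (at x) i + (a \<bullet> i) * \<phi> x" for x
    proof -
      have "classical_grad \<psi> x = (x \<bullet> a + b) *\<^sub>R classical_grad \<phi> x + \<phi> x *\<^sub>R classical_grad (\<lambda>x. x \<bullet> a + b) x"
        unfolding \<psi>_def by (rule classical_grad_mult[OF aff c])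
      also have "classical_grad (\<lambda>x. x \<bullet> a + b) x = a"
        by (rule classical_grad_unique) (auto intro!: derivative_eq_intros simp: inner_commute)
      finally show ?thesis
        using i by (simp add: inner_add_left mult.commute flip: classical_grad_inner_Basis)
    qed
    have z: "frechet_derivative \<phi> (at x) i = 0" if "x \<notin> O'" for x
    proof -
      have "x \<notin> K" using K(2) that by blast
      then show ?thesis using K(4)[of x] classical_grad_inner_Basis[OF i, of \<phi> x] by simp
    qed
    have cont: "continuous_on UNIV (\<lambda>x. frechet_derivative \<phi> (at x) i)" "continuous_on UNIV \<phi>"
      using c i C_k_continuous_on[OF c] by auto
    have int: "integrable lborel (\<lambda>x. (x \<bullet> a + b) * frechet_derivative \<phi> (at x) i)"
      "integrable lborel (\<lambda>x. (a \<bullet> i) * \<phi> x)"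
      using cont K i by (auto intro!: continuous_compact_support_integrable[of _ K] continuous_intros
          simp flip: classical_grad_inner_Basis)
    have "0 = (\<integral>x. (x \<bullet> a + b) * frechet_derivative \<phi> (at x) i + (a \<bullet> i) * \<phi> x \<partial>lborel)"
      using integral_frechet_derivative_eq_0[OF psi i] by (simp add: eq)
    also have "\<dots> = (\<integral>x. (x \<bullet> a + b) * frechet_derivative \<phi> (at x) i \<partial>lborel) + (\<integral>x. (a \<bullet> i) * \<phi> x \<partial>lborel)"
      using int by (rule Bochner_Integration.integral_add)
    also have "(\<integral>x. (x \<bullet> a + b) * frechet_derivative \<phi> (at x) i \<partial>lborel) =
      (\<integral>x. (x \<bullet> a + b) * frechet_derivative \<phi> (at x) i \<partial>lebesgue_on O')"
      using z O' cont by (intro integral_lebesgue_on_test[symmetric] borel_measurable_continuous_onI continuous_intros) auto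
    also have "\<dots> = (\<integral>x. v x * frechet_derivative \<phi> (at x) i \<partial>lebesgue_on O')"
      by (rule Bochner_Integration.integral_cong) (auto simp: v inner_commute)
    also have "(\<integral>x. (a \<bullet> i) * \<phi> x \<partial>lborel) = (\<integral>x. (a \<bullet> i) * \<phi> x \<partial>lebesgue_on O')"
      using K O' cont by (intro integral_lebesgue_on_test[symmetric] borel_measurable_continuous_onI continuous_intros) auto
    finally show ?thesis by simp
  qed
  ultimately show ?thesis by (simp add: is_weak_grad_def)
qed

section \<open>Smooth box functions and the fundamental lemma of the calculus of variations\<close>

lemma flat_exp_0_bounds: "0 < c \<Longrightarrow> 0 \<le> flat_exp c 0 t \<and> flat_exp c 0 t \<le> 1"
  by (auto simp: flat_exp_def)

lemma flat_exp_0_limit: "(\<lambda>n. flat_exp (1 / real (Suc n)) 0 t) \<longlonglongrightarrow> (if 0 < t then 1 else 0)"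
proof (cases "0 < t")
  case True
  have "(\<lambda>n. exp (- (1 / real (Suc n) * inverse t))) \<longlonglongrightarrow> exp (- (0 * inverse t))"
    using LIMSEQ_inverse_real_of_nat by (intro tendsto_intros) (simp add: divide_inverse)
  then show ?thesis using True by (simp add: flat_exp_def)
qed (simp add: flat_exp_def)

text \<open>A product of flat exponentials, one for each bounding hyperplane. With decay parameter
  \<open>1 / (n + 1)\<close> the products tend pointwise to the indicator of the open box, while all
  of them are supported in the closed box; this takes the place of mollification.\<close>

definition box_bump :: "nat \<Rightarrow> 'a::euclidean_space \<Rightarrow> 'a \<Rightarrow> 'a \<Rightarrow> real" where
  "box_bump n a b x = (\<Prod>i\<in>Basis. flat_exp (1 / real (Suc n)) 0 (x \<bullet> i + - (a \<bullet> i)) *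
      flat_exp (1 / real (Suc n)) 0 (x \<bullet> (- i) + b \<bullet> i))"

lemma box_bump_C_k: "C_k k (box_bump n a b)"
  unfolding box_bump_def by (intro C_k_prod C_k_mult C_k_flat_exp_affine) auto

lemma box_bump_eq_0: "x \<notin> box a b \<Longrightarrow> box_bump n a b x = 0"
proof -
  assume "x \<notin> box a b"
  then obtain i where "i \<in> Basis" "x \<bullet> i \<le> a \<bullet> i \<or> b \<bullet> i \<le> x \<bullet> i"
    by (auto simp: box_def not_less)
  then show ?thesis
    unfolding box_bump_def by (intro prod_zero) (auto simp: flat_exp_def intro!: bexI[of _ i])
qed

lemma box_bump_bounds: "0 \<le> box_bump n a b x" "box_bump n a b x \<le> 1"
  using flat_exp_0_bounds[of "1 / real (Suc n)"]
  by (auto simp: box_bump_def intro!: prod_nonneg prod_le_1 mult_le_one)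

lemma box_bump_limit: "(\<lambda>n. box_bump n a b x) \<longlonglongrightarrow> indicator (box a b) x"
proof -
  have "(\<lambda>n. box_bump n a b x) \<longlonglongrightarrow>
      (\<Prod>i\<in>Basis. (if 0 < x \<bullet> i + - (a \<bullet> i) then 1 else 0) * (if 0 < x \<bullet> (- i) + b \<bullet> i then 1 else 0))"
    unfolding box_bump_def by (intro tendsto_intros flat_exp_0_limit)
  also have "(\<Prod>i\<in>Basis. (if 0 < x \<bullet> i + - (a \<bullet> i) then 1 else 0) * (if 0 < x \<bullet> (- i) + b \<bullet> i then 1 else 0)) =
      (indicator (box a b) x :: real)"
    by (auto simp: box_def indicator_def prod_zero_iff intro!: prod.neutral)
  finally show ?thesis .
qed

lemma box_bump_test:
  assumes "cbox a b \<subseteq> \<Omega>"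
  shows "box_bump n a b \<in> test_functions \<Omega>"
  by (rule test_functionsI[of _ "cbox a b"])
     (use assms box_subset_cbox[of a b] in \<open>auto intro: box_bump_C_k box_bump_eq_0\<close>)

lemma integral_box_eq_0:
  fixes g :: "'a::euclidean_space \<Rightarrow> real"
  assumes \<Omega>: "\<Omega> \<in> sets lebesgue" and g: "integrable (lebesgue_on \<Omega>) g"
    and 0: "\<And>\<phi>. \<phi> \<in> test_functions \<Omega> \<Longrightarrow> (\<integral>x. g x * \<phi> x \<partial>lebesgue_on \<Omega>) = 0"
    and ab: "cbox a b \<subseteq> \<Omega>"
  shows "(\<integral>x. g x * indicator (box a b) x \<partial>lebesgue_on \<Omega>) = 0"
proof -
  have "(\<lambda>n. \<integral>x. g x * box_bump n a b x \<partial>lebesgue_on \<Omega>) \<longlonglongrightarrow> (\<integral>x. g x * indicator (box a b) x \<partial>lebesgue_on \<Omega>)"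
  proof (rule integral_dominated_convergence[where w="\<lambda>x. \<bar>g x\<bar>"])
    have [measurable]: "g \<in> borel_measurable (lebesgue_on \<Omega>)" using g by auto
    have bm: "f \<in> borel_measurable (lebesgue_on \<Omega>)" if "f \<in> borel_measurable borel" for f :: "'a \<Rightarrow> real"
      using that by (intro measurable_restrict_space1 measurable_completion) auto
    have [measurable]: "indicat_real (box a b) \<in> borel_measurable (lebesgue_on \<Omega>)"
      by (intro bm) simp
    show "(\<lambda>x. g x * indicator (box a b) x) \<in> borel_measurable (lebesgue_on \<Omega>)" by measurable
    have [measurable]: "box_bump n a b \<in> borel_measurable (lebesgue_on \<Omega>)" for n
      using C_k_continuous_on[OF box_bump_C_k] by (intro bm borel_measurable_continuous_onI)
    show "(\<lambda>x. g x * box_bump n a b x) \<in> borel_measurable (lebesgue_on \<Omega>)" for n by measurable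
    show "integrable (lebesgue_on \<Omega>) (\<lambda>x. \<bar>g x\<bar>)" using g by simp
    show "AE x in lebesgue_on \<Omega>. (\<lambda>n. g x * box_bump n a b x) \<longlonglongrightarrow> g x * indicator (box a b) x"
      by (intro AE_I2 tendsto_intros box_bump_limit)
    show "AE x in lebesgue_on \<Omega>. norm (g x * box_bump n a b x) \<le> \<bar>g x\<bar>" for n
      using box_bump_bounds[of n a b] by (intro AE_I2) (auto simp: abs_mult intro!: mult_left_le)
  qed
  then show ?thesis
    using 0[OF box_bump_test[OF ab]] by (simp add: LIMSEQ_const_iff)
qed

text \<open>Dynkin's argument: open boxes form an intersection-stable generator of the Borel sets.
  The assumption \<open>total\<close> serves the step to complements, since the whole space is not a
  box.\<close>

lemma AE_zero_if_box_integrals_zero: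
  fixes h :: "'a::euclidean_space \<Rightarrow> real"
  assumes int: "integrable lborel h"
    and box: "\<And>a b. (\<integral>x. indicator (box a b) x * h x \<partial>lborel) = 0"
    and total: "(\<integral>x. h x \<partial>lborel) = 0"
  shows "AE x in lborel. h x = 0"
proof (rule sigma_finite_measure.density_unique_banach[OF lborel.sigma_finite_measure_axioms])
  show "integrable lborel h" "integrable lborel (\<lambda>x. 0 :: real)" using int by auto
  fix A :: "'a set" assume "A \<in> sets lborel"
  then have A: "A \<in> sigma_sets UNIV (range (\<lambda>(a, b). box a b))"
    by (simp add: borel_eq_box)
  have stable: "Int_stable (range (\<lambda>(a, b). box a b :: 'a set))"
    by (auto simp: Int_stable_def box_Int_box)
  have "range (\<lambda>(a, b). box a b :: 'a set) \<subseteq> Pow UNIV" by simp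
  from stable this A have "A \<in> sets borel \<and> (\<integral>x. indicator A x * h x \<partial>lborel) = 0"
  proof (induction rule: sigma_sets_induct_disjoint)
    case (compl A)
    have i: "integrable lborel (\<lambda>x. indicator A x * h x)"
      using compl integrable_mult_indicator[OF _ int, of A] by simp
    have "(\<integral>x. indicator (UNIV - A) x * h x \<partial>lborel) = (\<integral>x. h x - indicator A x * h x \<partial>lborel)"
      by (rule Bochner_Integration.integral_cong) (auto simp: indicator_def)
    also have "\<dots> = 0" using i int total compl by simp
    finally show ?case using compl by auto
  next
    case (union A)
    have m: "A i \<in> sets lborel" for i using union by auto
    have "set_integrable lborel (\<Union>i. A i) h"
      using integrable_mult_indicator[OF _ int, of "\<Union>i. A i"] m by (auto simp: set_integrable_def)
    from lebesgue_integral_countable_add[OF m _ this]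
    have "(\<integral>x. indicator (\<Union>i. A i) x * h x \<partial>lborel) = (\<Sum>i. \<integral>x. indicator (A i) x * h x \<partial>lborel)"
      using union(1) by (simp add: set_lebesgue_integral_def disjoint_family_on_def)
    then show ?case using union m by auto
  qed (use box in auto)
  then show "set_lebesgue_integral lborel A h = set_lebesgue_integral lborel A (\<lambda>x. 0)"
    by (simp add: set_lebesgue_integral_def)
qed

text \<open>Localization to closed boxes inside the open set: multiplied by the indicator of such a
  box, \<open>g\<close> becomes integrable on the whole space, and its integrals over smaller boxes
  are limits of tests with bump functions. Countably many closed boxes cover the open set.\<close>

lemma fundamental_lemma:
  fixes g :: "'a::euclidean_space \<Rightarrow> real"
  assumes \<Omega>: "open \<Omega>" and g: "integrable (lebesgue_on \<Omega>) g"
    and 0: "\<And>\<phi>. \<phi> \<in> test_functions \<Omega> \<Longrightarrow> (\<integral>x. g x * \<phi> x \<partial>lebesgue_on \<Omega>) = 0"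
  shows "AE x in lebesgue_on \<Omega>. g x = 0"
proof -
  have \<Omega>l: "\<Omega> \<in> sets lebesgue" using \<Omega> by auto
  have cb: "AE x in lebesgue. x \<in> cbox c d \<longrightarrow> g x = 0" if cd: "cbox c d \<subseteq> \<Omega>" for c d
  proof -
    define H where "H x = indicator (box c d) x * g x" for x
    have "box c d \<subseteq> \<Omega>" using cd box_subset_cbox by blast
    have Hint: "integrable lebesgue H"
    proof -
      have "integrable lebesgue (\<lambda>x. indicator \<Omega> x *\<^sub>R g x)"
        using g \<Omega>l by (simp add: integrable_restrict_space)
      then have "integrable lebesgue (\<lambda>x. indicator (box c d) x *\<^sub>R (indicator \<Omega> x *\<^sub>R g x))"
        by (rule integrable_mult_indicator[rotated]) auto
      also have "(\<lambda>x. indicator (box c d) x *\<^sub>R (indicator \<Omega> x *\<^sub>R g x)) = H"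
        using \<open>box c d \<subseteq> \<Omega>\<close> by (auto simp: H_def indicator_def fun_eq_iff)
      finally show ?thesis .
    qed
    \<comment> \<open>The generator argument concerns Borel sets, so \<open>H\<close> is replaced by
      a Borel function that agrees with it almost everywhere.\<close>
    obtain h where h: "h \<in> borel_measurable lborel" and Hh: "AE x in lborel. H x = h x"
      using completion_ex_borel_measurable_real[of H lborel] Hint by auto
    have Hh': "AE x in lebesgue. H x = h x" using Hh by (rule AE_completion)
    have hint: "integrable lebesgue h"
      using Hint Hh' h by (subst integrable_cong_AE[where g=H]) (auto intro: measurable_completion)
    have hint': "integrable lborel h" using hint h by (simp add: integrable_completion)
    have eq: "(\<integral>x. indicator S x * h x \<partial>lborel) = (\<integral>x. indicator S x * H x \<partial>lebesgue)" if "S \<in> sets borel" for S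
    proof -
      have "(\<integral>x. indicator S x * h x \<partial>lborel) = (\<integral>x. indicator S x * h x \<partial>lebesgue)"
        using h that by (subst integral_completion) auto
      also have "\<dots> = (\<integral>x. indicator S x * H x \<partial>lebesgue)"
        using Hint hint that Hh'
        by (intro integral_cong_AE borel_measurable_times borel_measurable_indicator) (auto dest: borel_measurable_integrable)
      finally show ?thesis .
    qed
    have box0: "(\<integral>x. indicator (box a b) x * H x \<partial>lebesgue) = 0" for a b
    proof -
      obtain a' b' where ab: "box a b \<inter> box c d = box a' b'" by (auto simp: box_Int_box)
      show ?thesis
      proof (cases "box a' b' = {}")
        case True
        then have "(\<lambda>x. indicator (box a b) x * H x) = (\<lambda>x. 0)"
          using ab by (auto simp: H_def indicator_def disjoint_iff fun_eq_iff)
        then show ?thesis by simp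
      next
        case False
        \<comment> \<open>Nonemptiness matters: only then is \<open>cbox a' b'\<close> the closure
          of the open box and hence inside \<open>cbox c d\<close>.\<close>
        then have "cbox a' b' \<subseteq> cbox c d"
          using ab by (metis Int_lower2 closure_box closure_mono inf_bot_right)
        then have "cbox a' b' \<subseteq> \<Omega>" using cd by blast
        from integral_box_eq_0[OF \<Omega>l g 0 this]
        have "0 = (\<integral>x. indicator \<Omega> x *\<^sub>R (g x * indicator (box a' b') x) \<partial>lebesgue)"
          using \<Omega>l by (simp add: integral_restrict_space)
        also have "(\<lambda>x. indicator \<Omega> x *\<^sub>R (g x * indicator (box a' b') x)) = (\<lambda>x. indicator (box a b) x * H x)"
          using ab \<open>box c d \<subseteq> \<Omega>\<close> by (auto simp: H_def indicator_def set_eq_iff fun_eq_iff)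
        finally show ?thesis by simp
      qed
    qed
    have "AE x in lborel. h x = 0"
    proof (rule AE_zero_if_box_integrals_zero[OF hint'])
      show "(\<integral>x. indicator (box a b) x * h x \<partial>lborel) = 0" for a b
        using box0 by (simp add: eq)
      have "(\<integral>x. h x \<partial>lborel) = (\<integral>x. indicator UNIV x * h x \<partial>lborel)" by simp
      also have "\<dots> = (\<integral>x. indicator UNIV x * H x \<partial>lebesgue)" by (rule eq) simp
      also have "(\<lambda>x. indicator UNIV x * H x) = (\<lambda>x. indicator (box c d) x * H x)"
        by (auto simp: H_def indicator_def)
      finally show "(\<integral>x. h x \<partial>lborel) = 0" using box0 by simp
    qed
    then have "AE x in lebesgue. h x = 0" by (rule AE_completion)
    moreover have "AE x in lebesgue. x \<notin> cbox c d - box c d"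
      by (rule AE_not_in) (use negligible_frontier_interval[of c d] in \<open>simp add: negligible_iff_null_sets\<close>)
    ultimately show ?thesis using Hh' by eventually_elim (auto simp: H_def indicator_def split: if_splits)
  qed
  obtain \<D> where D: "countable \<D>" "\<D> \<subseteq> Pow \<Omega>" "\<And>X. X \<in> \<D> \<Longrightarrow> \<exists>a b. X = cbox a b" "\<Union>\<D> = \<Omega>"
    using open_countable_Union_open_cbox[OF \<Omega>] by metis
  have "AE x in lebesgue. \<forall>X\<in>\<D>. x \<in> X \<longrightarrow> g x = 0"
    using D(1) cb D(2,3) by (subst AE_ball_countable) blast+
  then have "AE x in lebesgue. x \<in> \<Omega> \<longrightarrow> g x = 0"
    by eventually_elim (use D(4) in blast)
  then show ?thesis using \<Omega>l by (subst AE_restrict_space_iff) auto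
qed

lemma L2_integrable_bounded:
  fixes f :: "'a::euclidean_space \<Rightarrow> real"
  assumes "f \<in> L2_space \<Omega>" "bounded \<Omega>" "\<Omega> \<in> sets lebesgue"
  shows "integrable (lebesgue_on \<Omega>) f"
proof -
  have "emeasure lebesgue \<Omega> < \<infinity>"
    using fmeasurableD2[OF bounded_set_imp_lmeasurable[OF assms(2,3)]] by (simp add: less_top)
  then interpret finite_measure "lebesgue_on \<Omega>"
    using assms(3) by (intro finite_measureI) (auto simp: emeasure_restrict_space)
  have "(\<lambda>x. 1::real) \<in> L2_space \<Omega>" by (simp add: L2_space_def)
  from L2_inner_integrable[OF assms(1) this] show ?thesis by simp
qed

text \<open>Boundedness turns the square integrable difference into an integrable one, as
  \<open>fundamental_lemma\<close> requires; the components are treated one at a time.\<close>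

lemma weak_grad_unique:
  assumes "open \<Omega>" "bounded \<Omega>" "is_weak_grad \<Omega> v G" "is_weak_grad \<Omega> v G'"
  shows "AE x in lebesgue_on \<Omega>. G x = G' x"
proof -
  have \<Omega>l: "\<Omega> \<in> sets lebesgue" using assms(1) by auto
  have G: "G \<in> L2_space \<Omega>" "G' \<in> L2_space \<Omega>" using assms by (auto simp: is_weak_grad_def)
  have "AE x in lebesgue_on \<Omega>. (G x - G' x) \<bullet> i = 0" if i: "i \<in> Basis" for i
  proof (rule fundamental_lemma[OF assms(1)])
    have d: "(\<lambda>x. (G x - G' x) \<bullet> i) \<in> L2_space \<Omega>" using G by simp
    show "integrable (lebesgue_on \<Omega>) (\<lambda>x. (G x - G' x) \<bullet> i)"
      by (rule L2_integrable_bounded[OF d assms(2) \<Omega>l])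
    fix \<phi> assume phi: "\<phi> \<in> test_functions \<Omega>"
    have "\<phi> \<in> L2_space \<Omega>" by (rule test_functions_L2[OF phi \<Omega>l])
    then have "integrable (lebesgue_on \<Omega>) (\<lambda>x. (G x \<bullet> i) * \<phi> x)" "integrable (lebesgue_on \<Omega>) (\<lambda>x. (G' x \<bullet> i) * \<phi> x)"
      using L2_inner_integrable[OF L2_space_inner_const[OF G(1), of i]] L2_inner_integrable[OF L2_space_inner_const[OF G(2), of i]] by auto
    moreover have "(\<integral>x. (G x \<bullet> i) * \<phi> x \<partial>lebesgue_on \<Omega>) = (\<integral>x. (G' x \<bullet> i) * \<phi> x \<partial>lebesgue_on \<Omega>)"
    proof -
      have "(\<integral>x. v x * frechet_derivative \<phi> (at x) i \<partial>lebesgue_on \<Omega>) = - (\<integral>x. (G x \<bullet> i) * \<phi> x \<partial>lebesgue_on \<Omega>)"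
        using assms(3) phi i by (simp add: is_weak_grad_def)
      moreover have "(\<integral>x. v x * frechet_derivative \<phi> (at x) i \<partial>lebesgue_on \<Omega>) = - (\<integral>x. (G' x \<bullet> i) * \<phi> x \<partial>lebesgue_on \<Omega>)"
        using assms(4) phi i by (simp add: is_weak_grad_def)
      ultimately show ?thesis by simp
    qed
    ultimately show "(\<integral>x. (G x - G' x) \<bullet> i * \<phi> x \<partial>lebesgue_on \<Omega>) = 0"
      by (simp add: inner_diff_left left_diff_distrib)
  qed
  then have "AE x in lebesgue_on \<Omega>. \<forall>i\<in>Basis. (G x - G' x) \<bullet> i = 0"
    by (subst AE_ball_countable) (auto intro: countable_finite)
  then show ?thesis
    by eventually_elim (metis eq_iff_diff_eq_0 euclidean_all_zero_iff)
qed

section \<open>A weighted Poincare inequality on the unit interval\<close>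

text \<open>Completing the square in the manner of Jacobi. The function \<open>x - m\<close> solves
  the Euler equation \<open>(K y')' = - w y\<close>; with \<open>d = f / (x - m)\<close> the
  derivative of \<open>K f d\<close> is \<open>K F'^2 - w f^2 - K (F' - d)^2\<close>. Since
  \<open>K f d\<close> vanishes at both ends, dropping the last square leaves the claim. At one end
  \<open>f\<close> vanishes and at the other \<open>K\<close>, whence the two alternatives for
  \<open>m\<close>.\<close>

lemma weighted_poincare_half:
  fixes F F' K w :: "real \<Rightarrow> real"
  assumes ab: "a \<le> b"
    and F: "\<And>x. x \<in> {a..b} \<Longrightarrow> (F has_real_derivative F' x) (at x within {a..b})"
    and F': "continuous_on {a..b} F'"
    and K: "\<And>x. x \<in> {a..b} \<Longrightarrow> (K has_real_derivative - (x - m) * w x) (at x within {a..b})"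
    and w: "continuous_on {a..b} w"
    and K0: "\<And>x. x \<in> {a..b} \<Longrightarrow> 0 \<le> K x"
    and m: "m = a \<and> K b = 0 \<or> m = b \<and> K a = 0"
  shows "integral {a..b} (\<lambda>x. w x * (F x - F m)\<^sup>2) \<le> integral {a..b} (\<lambda>x. K x * (F' x)\<^sup>2)"
proof -
  define f where "f x = F x - F m" for x
  define d where "d x = f x / (x - m)" for x
  define H where "H x = K x * f x * d x" for x
  define H' where "H' x = - w x * (f x)\<^sup>2 + 2 * K x * F' x * d x - K x * (d x)\<^sup>2" for x
  have mab: "m \<in> {a..b}" using m ab by auto
  have contF: "continuous_on {a..b} F" by (rule DERIV_continuous_on[OF F])
  have contK: "continuous_on {a..b} K" by (rule DERIV_continuous_on[OF K])
  have contf: "continuous_on {a..b} f" unfolding f_def by (intro continuous_intros contF)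
  have "(H' has_integral H b - H a) {a..b}"
  proof (rule fundamental_theorem_of_calculus_interior[OF ab])
    show "continuous_on {a..b} H"
      unfolding continuous_on_eq_continuous_within
    proof
      fix x assume x: "x \<in> {a..b}"
      show "continuous (at x within {a..b}) H"
      proof (cases "x = m")
        case True
        \<comment> \<open>Division by zero gives \<open>d m = 0\<close> and not the derivative;
          \<open>H\<close> is still continuous at \<open>m\<close>, because the factor
          \<open>f\<close> vanishes there.\<close>
        have "((\<lambda>x. d x) \<longlongrightarrow> F' m) (at m within {a..b})"
          using F[OF mab] by (simp add: has_field_derivative_iff d_def f_def)
        moreover have "(f \<longlongrightarrow> f m) (at m within {a..b})" "(K \<longlongrightarrow> K m) (at m within {a..b})"
          using contf contK mab by (auto simp: continuous_on_def)
        ultimately have "((\<lambda>x. K x * f x * d x) \<longlongrightarrow> K m * f m * F' m) (at m within {a..b})"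
          by (intro tendsto_mult)
        then show ?thesis unfolding True continuous_within H_def[abs_def] by (simp add: f_def)
      next
        case False
        then show ?thesis using contf contK x unfolding H_def d_def
          by (intro continuous_intros) (auto simp: continuous_on_eq_continuous_within)
      qed
    qed
    fix x assume x: "x \<in> {a<..<b}"
    then have xm: "x - m \<noteq> 0" using m by auto
    have at: "at x within {a..b} = at x" using x by (simp add: at_within_Icc_at)
    have Fx: "(F has_real_derivative F' x) (at x)" using F[of x] x at by auto
    have Kx: "(K has_real_derivative - (x - m) * w x) (at x)" using K[of x] x at by auto
    have fx: "(f has_real_derivative F' x) (at x)"
      unfolding f_def by (rule DERIV_cong[OF DERIV_diff[OF Fx DERIV_const]]) simp
    have fd: "f x = d x * (x - m)" using xm by (simp add: d_def)
    have "(d has_real_derivative (F' x * (x - m) - f x * 1) / ((x - m) * (x - m))) (at x)"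
      unfolding d_def using DERIV_divide[OF fx DERIV_diff[OF DERIV_ident DERIV_const[of m]] xm] by simp
    moreover have "(F' x * (x - m) - f x * 1) / ((x - m) * (x - m)) = (F' x - d x) / (x - m)"
      using xm unfolding fd by (simp add: left_diff_distrib[symmetric])
    ultimately have dx: "(d has_real_derivative (F' x - d x) / (x - m)) (at x)" by simp
    have "(H has_real_derivative (- (x - m) * w x * f x + F' x * K x) * d x + (F' x - d x) / (x - m) * (K x * f x)) (at x)"
      unfolding H_def by (rule DERIV_mult[OF DERIV_mult[OF Kx fx] dx])
    moreover have "(- (x - m) * w x * f x + F' x * K x) * d x + (F' x - d x) / (x - m) * (K x * f x) = H' x"
    proof -
      have e1: "(F' x - d x) / (x - m) * (K x * f x) = (F' x - d x) * (K x * d x)"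
        using xm unfolding fd by simp
      have e2: "- (x - m) * w x * f x * d x = - w x * (f x)\<^sup>2"
        unfolding fd by (simp add: power2_eq_square algebra_simps)
      show ?thesis unfolding e1 distrib_right e2
        by (simp add: H'_def power2_eq_square algebra_simps)
    qed
    ultimately have "(H has_real_derivative H' x) (at x)" by simp
    then show "(H has_vector_derivative H' x) (at x)"
      by (simp add: has_real_derivative_iff_has_vector_derivative)
  qed
  moreover have "H b - H a = 0" using m by (auto simp: H_def f_def)
  ultimately have H': "(H' has_integral 0) {a..b}" by simp
  have i1: "(\<lambda>x. w x * (f x)\<^sup>2) integrable_on {a..b}" and i2: "(\<lambda>x. K x * (F' x)\<^sup>2) integrable_on {a..b}"
    by (intro integrable_continuous_interval continuous_intros w contf contK F')+
  have "integral {a..b} (\<lambda>x. K x * (F' x)\<^sup>2 - w x * (f x)\<^sup>2) \<ge> integral {a..b} H'"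
  proof (rule integral_le)
    show "H' integrable_on {a..b}" using H' by blast
    show "(\<lambda>x. K x * (F' x)\<^sup>2 - w x * (f x)\<^sup>2) integrable_on {a..b}" by (intro integrable_diff i1 i2)
    fix x assume "x \<in> {a..b}"
    then have "0 \<le> K x * (F' x - d x)\<^sup>2" using K0 by simp
    then show "H' x \<le> K x * (F' x)\<^sup>2 - w x * (f x)\<^sup>2"
      by (simp add: H'_def power2_eq_square algebra_simps)
  qed
  then have "0 \<le> integral {a..b} (\<lambda>x. K x * (F' x)\<^sup>2) - integral {a..b} (\<lambda>x. w x * (f x)\<^sup>2)"
    using H' i1 i2 by (simp add: Henstock_Kurzweil_Integration.integral_diff integral_unique)
  then show ?thesis by (simp add: f_def)
qed

text \<open>For the Jacobi weight \<open>x\<^sup>k\<close> the optimal kernel is \<open>x (1 - x)\<close> times the weight, up to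
  the factor \<open>k + 2\<close>; the comparison value is taken at the mean \<open>(k + 1) / (k + 2)\<close>.\<close>

lemma weighted_poincare_1d:
  fixes F F' :: "real \<Rightarrow> real" and k :: nat
  assumes F: "\<And>x. x \<in> {0..1} \<Longrightarrow> (F has_real_derivative F' x) (at x within {0..1})"
    and F': "continuous_on {0..1} F'"
  defines "m \<equiv> (real k + 1) / (real k + 2)"
  shows "integral {0..1} (\<lambda>x. x ^ k * (F x - F m)\<^sup>2) \<le>
    integral {0..1} (\<lambda>x. x ^ k * (x * (1 - x) * (F' x)\<^sup>2)) / (real k + 2)"
proof -
  \<comment> \<open>An antiderivative of \<open>- (x - m) x^k\<close>. As \<open>m\<close> is the
    mean of \<open>x\<close> under the weight \<open>x^k\<close>, it vanishes at both 0 and 1 and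
    serves both halves of the interval.\<close>
  define K where "K x = x ^ (k + 1) * (1 - x) / (real k + 2)" for x :: real
  have m: "0 \<le> m" "m \<le> 1" by (auto simp: m_def field_simps)
  have K: "(K has_real_derivative - (x - m) * x ^ k) (at x within S)" for x S
  proof -
    have "((\<lambda>x. x ^ (k + 1) * (1 - x) / (real k + 2)) has_real_derivative
       ((real k + 1) * x ^ k * (1 - x) - x ^ (k + 1)) / (real k + 2)) (at x within S)"
      by (rule derivative_eq_intros refl | simp)+
    moreover have "((real k + 1) * x ^ k * (1 - x) - x ^ (k + 1)) / (real k + 2) = - (x - m) * x ^ k"
      by (simp add: m_def field_simps)
    ultimately show ?thesis unfolding K_def[abs_def] by (simp only:)
  qed
  have sub: "(F has_real_derivative F' x) (at x within {a..b})" "continuous_on {a..b} F'"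
    if "x \<in> {a..b}" "{a..b} \<subseteq> {0..1}" for x a b
    using that DERIV_subset[OF F[of x] that(2)] continuous_on_subset[OF F' that(2)] by auto
  have cF: "continuous_on {0..1} F" by (rule DERIV_continuous_on[OF F])
  have "integral {0..m} (\<lambda>x. x ^ k * (F x - F m)\<^sup>2) \<le> integral {0..m} (\<lambda>x. K x * (F' x)\<^sup>2)"
    by (rule weighted_poincare_half[where K=K])
       (use m K sub[of _ 0 m] sub(2)[of 0 0 m] in \<open>auto simp: K_def intro!: continuous_intros\<close>)
  moreover have "integral {m..1} (\<lambda>x. x ^ k * (F x - F m)\<^sup>2) \<le> integral {m..1} (\<lambda>x. K x * (F' x)\<^sup>2)"
    by (rule weighted_poincare_half[where K=K])
       (use m K sub[of _ m 1] sub(2)[of m m 1] in \<open>auto simp: K_def intro!: continuous_intros\<close>)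
  moreover have "integral {0..1} G = integral {0..m} G + integral {m..1} G"
    if "continuous_on {0..1} G" for G :: "real \<Rightarrow> real"
    using m that by (simp add: Henstock_Kurzweil_Integration.integral_combine integrable_continuous_interval)
  moreover have "continuous_on {0..1} (\<lambda>x. x ^ k * (F x - F m)\<^sup>2)" "continuous_on {0..1} (\<lambda>x. K x * (F' x)\<^sup>2)"
    unfolding K_def by (intro continuous_intros cF F'; simp)+
  ultimately have "integral {0..1} (\<lambda>x. x ^ k * (F x - F m)\<^sup>2) \<le> integral {0..1} (\<lambda>x. K x * (F' x)\<^sup>2)"
    by simp
  also have "(\<lambda>x. K x * (F' x)\<^sup>2) = (\<lambda>x. x ^ k * (x * (1 - x) * (F' x)\<^sup>2) / (real k + 2))"
    by (simp add: K_def fun_eq_iff)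
  finally show ?thesis by simp
qed

section \<open>Poincare inequalities on cones and simplices\<close>

lemma set_integrable_compact:
  fixes f :: "'a::euclidean_space \<Rightarrow> real"
  shows "compact S \<Longrightarrow> continuous_on S f \<Longrightarrow> set_integrable lborel S f"
  unfolding set_integrable_def by (rule borel_integrable_compact)

lemma compact_Fubini:
  fixes F :: "'a::euclidean_space \<Rightarrow> 'b::euclidean_space \<Rightarrow> real"
  assumes A: "compact A" and B: "compact B" and F: "continuous_on (A \<times> B) (\<lambda>z. F (fst z) (snd z))"
  shows "set_integrable lborel A (\<lambda>x. LINT y:B|lborel. F x y)"
    and "set_integrable lborel B (\<lambda>y. LINT x:A|lborel. F x y)"
    and "(LINT x:A|lborel. LINT y:B|lborel. F x y) = (LINT z:A\<times>B|lborel. F (fst z) (snd z))"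
    and "(LINT x:A|lborel. LINT y:B|lborel. F x y) = (LINT y:B|lborel. LINT x:A|lborel. F x y)"
proof -
  have "integrable lborel (\<lambda>z. indicator (A \<times> B) z *\<^sub>R F (fst z) (snd z))"
    using A B F by (intro borel_integrable_compact compact_Times)
  moreover have eqf: "(\<lambda>(x, y). indicator A x *\<^sub>R (indicator B y *\<^sub>R F x y)) =
      (\<lambda>z. indicator (A \<times> B) z *\<^sub>R F (fst z) (snd z))"
    by (auto simp: fun_eq_iff indicator_times)
  ultimately have i: "integrable (lborel \<Otimes>\<^sub>M lborel) (\<lambda>(x, y). indicator A x *\<^sub>R (indicator B y *\<^sub>R F x y))"
    by (simp only: lborel_prod)
  have eq1: "(\<lambda>x. \<integral>y. indicator A x *\<^sub>R (indicator B y *\<^sub>R F x y) \<partial>lborel) =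
      (\<lambda>x. indicator A x *\<^sub>R (LINT y:B|lborel. F x y))"
    by (simp add: set_lebesgue_integral_def)
  have eq2: "(\<lambda>y. \<integral>x. indicator A x *\<^sub>R (indicator B y *\<^sub>R F x y) \<partial>lborel) =
      (\<lambda>y. indicator B y *\<^sub>R (LINT x:A|lborel. F x y))"
  proof
    fix y
    have "(\<lambda>x. indicator A x *\<^sub>R (indicator B y *\<^sub>R F x y)) = (\<lambda>x. indicator B y *\<^sub>R (indicator A x *\<^sub>R F x y))"
      by (simp add: fun_eq_iff)
    then show "(\<integral>x. indicator A x *\<^sub>R (indicator B y *\<^sub>R F x y) \<partial>lborel) =
        indicator B y *\<^sub>R (LINT x:A|lborel. F x y)"
      by (simp only: set_lebesgue_integral_def integral_scaleR_right)
  qed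
  show "set_integrable lborel A (\<lambda>x. LINT y:B|lborel. F x y)"
    using lborel_pair.integrable_fst'[OF i] by (simp only: set_integrable_def eq1 case_prod_conv)
  show "set_integrable lborel B (\<lambda>y. LINT x:A|lborel. F x y)"
    using lborel_pair.integrable_snd[OF i] by (simp only: set_integrable_def eq2)
  have f: "(LINT x:A|lborel. LINT y:B|lborel. F x y) =
      integral\<^sup>L (lborel \<Otimes>\<^sub>M lborel) (\<lambda>(x, y). indicator A x *\<^sub>R (indicator B y *\<^sub>R F x y))"
    using lborel_pair.integral_fst'[OF i]
    by (simp only: set_lebesgue_integral_def[of lborel A] eq1[symmetric] case_prod_conv)
  show "(LINT x:A|lborel. LINT y:B|lborel. F x y) = (LINT z:A\<times>B|lborel. F (fst z) (snd z))"
    unfolding f eqf by (simp add: lborel_prod set_lebesgue_integral_def)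
  show "(LINT x:A|lborel. LINT y:B|lborel. F x y) = (LINT y:B|lborel. LINT x:A|lborel. F x y)"
    using f lborel_pair.integral_snd[OF i]
    by (simp only: set_lebesgue_integral_def[of lborel B] eq2[symmetric])
qed

lemma lborel_integral_scale:
  fixes G :: "'a::euclidean_space \<Rightarrow> real"
  assumes "G \<in> borel_measurable borel" "0 < c"
  shows "(\<integral>x. G x \<partial>lborel) = c ^ DIM('a) * (\<integral>x. G (c *\<^sub>R x) \<partial>lborel)"
proof -
  have "(\<integral>x. G x \<partial>lborel) = (\<integral>x. G x \<partial>density (distr lborel borel (\<lambda>x. 0 + c *\<^sub>R x)) (\<lambda>_. ennreal (\<bar>c\<bar> ^ DIM('a))))"
    using lborel_affine[of c "0 :: 'a"] assms(2) by simp
  also have "\<dots> = (\<integral>x. c ^ DIM('a) *\<^sub>R G x \<partial>distr lborel borel (\<lambda>x. 0 + c *\<^sub>R x))"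
    using assms by (subst integral_density) auto
  also have "\<dots> = (\<integral>x. c ^ DIM('a) *\<^sub>R G (c *\<^sub>R x) \<partial>lborel)"
    using assms by (subst integral_distr) auto
  finally show ?thesis by simp
qed

text \<open>The slice at height \<open>t\<close> is \<open>S\<close> scaled by \<open>t\<close>, so
  integration over the cone carries the Jacobian \<open>t ^ DIM('a)\<close>. This is the weight of
  the one-dimensional inequality, and iterating the construction from the unit interval yields
  simplices.\<close>

definition cone_over :: "'a::euclidean_space set \<Rightarrow> (real \<times> 'a) set" where
  "cone_over S = (\<lambda>(t, y). (t, t *\<^sub>R y)) ` ({0..1} \<times> S)"

lemma compact_cone_over: "compact S \<Longrightarrow> compact (cone_over S)"
  unfolding cone_over_def case_prod_beta
  by (intro compact_continuous_image compact_Times continuous_intros) auto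

text \<open>Fubini in the height, and a scaling of each slice. Height 0 is left out as a null set,
  since the scaling needs a positive factor.\<close>

lemma cone_integral:
  fixes H :: "real \<times> 'a::euclidean_space \<Rightarrow> real"
  assumes S: "compact S" and H: "continuous_on (cone_over S) H"
  shows "(LINT z:cone_over S|lborel. H z) =
    (LINT t:{0..1}|lborel. LINT y:S|lborel. t ^ DIM('a) * H (t, t *\<^sub>R y))"
proof -
  have C: "compact (cone_over S)" by (rule compact_cone_over[OF S])
  define h where "h z = indicator (cone_over S) z *\<^sub>R H z" for z
  have i: "integrable lborel h" unfolding h_def by (rule borel_integrable_compact[OF C H])
  have eh: "(\<lambda>(t, e). h (t, e)) = h" by auto
  from i have i': "integrable (lborel \<Otimes>\<^sub>M lborel) (\<lambda>(t, e). h (t, e))" by (simp only: eh lborel_prod)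
  have hm: "h \<in> borel_measurable borel" using i by auto
  have "(LINT z:cone_over S|lborel. H z) = integral\<^sup>L (lborel \<Otimes>\<^sub>M lborel) (\<lambda>(t, e). h (t, e))"
    unfolding eh lborel_prod by (simp add: set_lebesgue_integral_def h_def[abs_def])
  also have "\<dots> = (\<integral>t. \<integral>e. h (t, e) \<partial>lborel \<partial>lborel)"
    using lborel_pair.integral_fst'[OF i'] by simp
  also have "\<dots> = (\<integral>t. indicator {0..1} t *\<^sub>R (LINT y:S|lborel. t ^ DIM('a) * H (t, t *\<^sub>R y)) \<partial>lborel)"
  proof (rule integral_cong_AE)
    show "(\<lambda>t. \<integral>e. h (t, e) \<partial>lborel) \<in> borel_measurable lborel"
      using lborel_pair.integrable_fst'[OF i'] by auto
    have "continuous_on ({0..1} \<times> S) (\<lambda>z. H (fst z, fst z *\<^sub>R snd z))"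
      by (rule continuous_on_compose2[OF H]) (auto intro!: continuous_intros simp: cone_over_def)
    then have "set_integrable lborel {0..1} (\<lambda>t. LINT y:S|lborel. t ^ DIM('a) * H (t, t *\<^sub>R y))"
      by (intro compact_Fubini S compact_Icc continuous_intros) (auto simp: )
    then show "(\<lambda>t. indicator {0..1} t *\<^sub>R (LINT y:S|lborel. t ^ DIM('a) * H (t, t *\<^sub>R y))) \<in> borel_measurable lborel"
      unfolding set_integrable_def by auto
    have "(\<integral>e. h (t, e) \<partial>lborel) = indicator {0..1} t *\<^sub>R (LINT y:S|lborel. t ^ DIM('a) * H (t, t *\<^sub>R y))"
      if "t \<noteq> 0" for t
    proof (cases "t \<in> {0..1}")
      case True
      then have t: "0 < t" using that by auto
      have "(\<integral>e. h (t, e) \<partial>lborel) = t ^ DIM('a) * (\<integral>y. h (t, t *\<^sub>R y) \<partial>lborel)"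
        using t by (intro lborel_integral_scale measurable_compose[OF _ hm] borel_measurable_continuous_onI continuous_intros)
      also have "(\<lambda>y. h (t, t *\<^sub>R y)) = (\<lambda>y. indicator S y *\<^sub>R H (t, t *\<^sub>R y))"
        using True t by (auto simp: h_def fun_eq_iff cone_over_def indicator_def)
      finally show ?thesis using True by (simp add: set_lebesgue_integral_def mult.left_commute)
    next
      case False
      then have "h (t, e) = 0" for e by (auto simp: h_def cone_over_def indicator_def)
      then show ?thesis using False by simp
    qed
    moreover have "AE t in lborel. t \<noteq> (0::real)" by (rule AE_lborel_singleton)
    ultimately show "AE t in lborel. (\<integral>e. h (t, e) \<partial>lborel) =
        indicator {0..1} t *\<^sub>R (LINT y:S|lborel. t ^ DIM('a) * H (t, t *\<^sub>R y))"
      by (auto elim!: eventually_mono)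
  qed
  finally show ?thesis by (simp add: set_lebesgue_integral_def)
qed

lemma set_integral_const_compact:
  "compact S \<Longrightarrow> (LINT y:S|lborel. c) = c * measure lborel S" for c :: real
  by (simp add: set_lebesgue_integral_def)

lemma set_integral_sq_diff:
  fixes h :: "'a::euclidean_space \<Rightarrow> real"
  assumes S: "compact S" and h: "continuous_on S h"
  shows "(LINT y:S|lborel. (h y - c)\<^sup>2) =
    (LINT y:S|lborel. (h y)\<^sup>2) - 2 * c * (LINT y:S|lborel. h y) + c\<^sup>2 * measure lborel S"
proof -
  have i: "set_integrable lborel S (\<lambda>y. (h y)\<^sup>2)" "set_integrable lborel S (\<lambda>y. (- 2 * c) * h y)"
    "set_integrable lborel S (\<lambda>y. c\<^sup>2)"
    by (intro set_integrable_compact S continuous_intros h)+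
  have "(LINT y:S|lborel. (h y - c)\<^sup>2) = (LINT y:S|lborel. (h y)\<^sup>2 + (- 2 * c) * h y + c\<^sup>2)"
    by (simp add: power2_eq_square algebra_simps)
  also have "\<dots> = (LINT y:S|lborel. (h y)\<^sup>2) + (LINT y:S|lborel. (- 2 * c) * h y) + (LINT y:S|lborel. c\<^sup>2)"
    by (subst set_integral_add(2)[OF set_integral_add(1)[OF i(1,2)] i(3)], subst set_integral_add(2)[OF i(1,2)]) simp
  also have "(LINT y:S|lborel. (- 2 * c) * h y) = (- 2 * c) * (LINT y:S|lborel. h y)"
    by (rule set_integral_mult_right)
  finally show ?thesis using S by (simp add: set_integral_const_compact)
qed

text \<open>Steiner's identity. Its use is that the mean minimizes the quadratic deviation, with an
  explicit excess for any other constant.\<close>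

lemma set_integral_variance:
  fixes h :: "'a::euclidean_space \<Rightarrow> real"
  assumes S: "compact S" and h: "continuous_on S h" and V: "0 < measure lborel S"
  defines "\<mu> \<equiv> (LINT y:S|lborel. h y) / measure lborel S"
  shows "(LINT y:S|lborel. (h y - c)\<^sup>2) = (LINT y:S|lborel. (h y - \<mu>)\<^sup>2) + measure lborel S * (\<mu> - c)\<^sup>2"
proof -
  have I: "(LINT y:S|lborel. h y) = \<mu> * measure lborel S" using V by (simp add: \<mu>_def)
  show ?thesis unfolding set_integral_sq_diff[OF S h] I
    by (simp add: power2_eq_square algebra_simps)
qed

text \<open>The variance of a product splits into the mean inner variance and the variance of the inner
  means; by Jensen the latter is at most the mean of the outer variances.\<close>

lemma cone_poincare:
  fixes G DG J :: "real \<Rightarrow> 'a::euclidean_space \<Rightarrow> real" and k :: nat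
  assumes S: "compact S" and V: "0 < measure lborel S"
    and G: "continuous_on ({0..1} \<times> S) (\<lambda>z. G (fst z) (snd z))"
    and DG: "continuous_on ({0..1} \<times> S) (\<lambda>z. DG (fst z) (snd z))"
    and J: "continuous_on ({0..1} \<times> S) (\<lambda>z. J (fst z) (snd z))"
    and deriv: "\<And>t y. t \<in> {0..1} \<Longrightarrow> y \<in> S \<Longrightarrow> ((\<lambda>t. G t y) has_real_derivative DG t y) (at t within {0..1})"
    and inner: "\<And>t. t \<in> {0..1} \<Longrightarrow> \<exists>c. (LINT y:S|lborel. (G t y - c)\<^sup>2) \<le> (LINT y:S|lborel. J t y)"
  shows "\<exists>c. (LINT t:{0..1}|lborel. LINT y:S|lborel. t ^ k * (G t y - c)\<^sup>2) \<le>
    (LINT t:{0..1}|lborel. LINT y:S|lborel. t ^ k * (J t y + t * (1 - t) * (DG t y)\<^sup>2 / (real k + 2)))"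
proof -
  define m where "m = (real k + 1) / (real k + 2)"
  have m: "m \<in> {0..1}" by (auto simp: m_def field_simps)
  define V where "V = measure lborel S"
  have V0: "0 < V" using V by (simp add: V_def)
  define \<mu> where "\<mu> t = (LINT y:S|lborel. G t y) / V" for t
  \<comment> \<open>The comparison constant is the mean over the slice at height \<open>m\<close>
    and not over the whole cone, because the one-dimensional inequality along the rays compares with
    the value at \<open>m\<close>.\<close>
  define c where "c = \<mu> m"
  have secy: "continuous_on S (F t)" if "continuous_on ({0..1} \<times> S) (\<lambda>z. F (fst z) (snd z))" "t \<in> {0..1}"
    for F :: "real \<Rightarrow> 'a \<Rightarrow> real" and t
  proof -
    have "continuous_on S (\<lambda>y. (t, y))" by (intro continuous_intros)
    moreover have "(\<lambda>y. (t, y)) ` S \<subseteq> {0..1} \<times> S" using that(2) by auto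
    ultimately show ?thesis using continuous_on_compose2[OF that(1)] by fastforce
  qed
  have sect: "continuous_on {0..1} (\<lambda>t. F t y)" if "continuous_on ({0..1} \<times> S) (\<lambda>z. F (fst z) (snd z))" "y \<in> S"
    for F :: "real \<Rightarrow> 'a \<Rightarrow> real" and y
  proof -
    have "continuous_on {0..1::real} (\<lambda>t. (t, y))" by (intro continuous_intros)
    moreover have "(\<lambda>t. (t, y)) ` {0..1} \<subseteq> {0..1} \<times> S" using that(2) by auto
    ultimately show ?thesis using continuous_on_compose2[OF that(1)] by fastforce
  qed
  have Gm: "continuous_on ({0..1} \<times> S) (\<lambda>z. G m (snd z))"
    by (rule continuous_on_compose2[OF secy[OF G m]]) (auto intro!: continuous_on_snd continuous_on_id)
  have ptw: "(LINT y:S|lborel. (G t y - c)\<^sup>2) \<le> (LINT y:S|lborel. J t y) + (LINT y:S|lborel. (G t y - G m y)\<^sup>2)"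
    if t: "t \<in> {0..1}" for t
  proof -
    note cGt = secy[OF G t] and cGm = secy[OF G m]
    obtain c' where c': "(LINT y:S|lborel. (G t y - c')\<^sup>2) \<le> (LINT y:S|lborel. J t y)"
      using inner[OF t] by blast
    have "(LINT y:S|lborel. (G t y - \<mu> t)\<^sup>2) \<le> (LINT y:S|lborel. (G t y - c')\<^sup>2)"
      using set_integral_variance[OF S cGt V, of c'] V0 by (simp add: \<mu>_def V_def)
    \<comment> \<open>Jensen: the square of a mean of differences is at most the mean of their
      squares.\<close>
    moreover have "V * (\<mu> t - c)\<^sup>2 \<le> (LINT y:S|lborel. (G t y - G m y)\<^sup>2)"
    proof -
      have "(LINT y:S|lborel. G t y - G m y) = (LINT y:S|lborel. G t y) - (LINT y:S|lborel. G m y)"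
        by (intro set_integral_diff set_integrable_compact S cGt cGm)
      then have \<mu>d: "(LINT y:S|lborel. G t y - G m y) / V = \<mu> t - c"
        by (simp add: \<mu>_def c_def diff_divide_distrib)
      have "continuous_on S (\<lambda>y. G t y - G m y)" by (intro continuous_intros cGt cGm)
      from set_integral_variance[OF S this V, of 0] \<mu>d
      have "(LINT y:S|lborel. (G t y - G m y)\<^sup>2) =
          (LINT y:S|lborel. (G t y - G m y - (\<mu> t - c))\<^sup>2) + V * (\<mu> t - c)\<^sup>2"
        by (simp add: V_def)
      moreover have "0 \<le> (LINT y:S|lborel. (G t y - G m y - (\<mu> t - c))\<^sup>2)"
        unfolding set_lebesgue_integral_def by (intro integral_nonneg_AE AE_I2) simp
      ultimately show ?thesis by simp
    qed
    ultimately show ?thesis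
      using c' set_integral_variance[OF S cGt V, of c] by (simp add: \<mu>_def V_def)
  qed
  have k1: "continuous_on ({0..1} \<times> S) (\<lambda>z. fst z ^ k * (G (fst z) (snd z) - c)\<^sup>2)"
    and k2: "continuous_on ({0..1} \<times> S) (\<lambda>z. fst z ^ k * J (fst z) (snd z))"
    and k3: "continuous_on ({0..1} \<times> S) (\<lambda>z. fst z ^ k * (G (fst z) (snd z) - G m (snd z))\<^sup>2)"
    and k4: "continuous_on ({0..1} \<times> S) (\<lambda>z. fst z ^ k * (fst z * (1 - fst z) * (DG (fst z) (snd z))\<^sup>2) / (real k + 2))"
    by (intro continuous_intros G J Gm DG; simp)+
  have I2: "set_integrable lborel {0..1} (\<lambda>t. LINT y:S|lborel. t ^ k * J t y)"
    by (rule compact_Fubini(1)[OF compact_Icc S k2])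
  have I3: "set_integrable lborel {0..1} (\<lambda>t. LINT y:S|lborel. t ^ k * (G t y - G m y)\<^sup>2)"
    by (rule compact_Fubini(1)[OF compact_Icc S k3])
  have I4: "set_integrable lborel {0..1} (\<lambda>t. LINT y:S|lborel. t ^ k * (t * (1 - t) * (DG t y)\<^sup>2) / (real k + 2))"
    by (rule compact_Fubini(1)[OF compact_Icc S k4])
  \<comment> \<open>With the order of integration exchanged, \<open>y\<close> is fixed and the
    weighted inequality acts along its ray.\<close>
  have "(LINT t:{0..1}|lborel. LINT y:S|lborel. t ^ k * (G t y - G m y)\<^sup>2) =
      (LINT y:S|lborel. LINT t:{0..1}|lborel. t ^ k * (G t y - G m y)\<^sup>2)"
    by (rule compact_Fubini(4)[OF compact_Icc S k3])
  also have "\<dots> \<le> (LINT y:S|lborel. LINT t:{0..1}|lborel. t ^ k * (t * (1 - t) * (DG t y)\<^sup>2) / (real k + 2))"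
  proof (rule set_integral_mono)
    show "set_integrable lborel S (\<lambda>y. LINT t:{0..1}|lborel. t ^ k * (G t y - G m y)\<^sup>2)"
      by (rule compact_Fubini(2)[OF compact_Icc S k3])
    show "set_integrable lborel S (\<lambda>y. LINT t:{0..1}|lborel. t ^ k * (t * (1 - t) * (DG t y)\<^sup>2) / (real k + 2))"
      by (rule compact_Fubini(2)[OF compact_Icc S k4])
    fix y assume y: "y \<in> S"
    have L: "(LINT t:{0..1}|lborel. g t) = integral {0..1} g" if "continuous_on {0..1} g" for g :: "real \<Rightarrow> real"
      using set_borel_integral_eq_integral(2)[OF set_integrable_compact[OF compact_Icc that]] by simp
    have "(LINT t:{0..1}|lborel. t ^ k * (G t y - G m y)\<^sup>2) = integral {0..1} (\<lambda>t. t ^ k * (G t y - G m y)\<^sup>2)"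
      by (intro L continuous_intros sect[OF G y])
    also have "\<dots> \<le> integral {0..1} (\<lambda>t. t ^ k * (t * (1 - t) * (DG t y)\<^sup>2)) / (real k + 2)"
      unfolding m_def by (rule weighted_poincare_1d) (use deriv y sect[OF DG y] in auto)
    also have "\<dots> = (LINT t:{0..1}|lborel. t ^ k * (t * (1 - t) * (DG t y)\<^sup>2)) / (real k + 2)"
      by (subst L) (intro continuous_intros sect[OF DG y] refl)+
    finally show "(LINT t:{0..1}|lborel. t ^ k * (G t y - G m y)\<^sup>2) \<le>
        (LINT t:{0..1}|lborel. t ^ k * (t * (1 - t) * (DG t y)\<^sup>2) / (real k + 2))"
      by simp
  qed
  also have "(LINT y:S|lborel. LINT t:{0..1}|lborel. t ^ k * (t * (1 - t) * (DG t y)\<^sup>2) / (real k + 2)) =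
      (LINT t:{0..1}|lborel. LINT y:S|lborel. t ^ k * (t * (1 - t) * (DG t y)\<^sup>2) / (real k + 2))"
    by (rule compact_Fubini(4)[OF compact_Icc S k4, symmetric])
  finally have outer: "(LINT t:{0..1}|lborel. LINT y:S|lborel. t ^ k * (G t y - G m y)\<^sup>2) \<le>
      (LINT t:{0..1}|lborel. LINT y:S|lborel. t ^ k * (t * (1 - t) * (DG t y)\<^sup>2) / (real k + 2))" .
  have "(LINT t:{0..1}|lborel. LINT y:S|lborel. t ^ k * (G t y - c)\<^sup>2) \<le>
      (LINT t:{0..1}|lborel. (LINT y:S|lborel. t ^ k * J t y) + (LINT y:S|lborel. t ^ k * (G t y - G m y)\<^sup>2))"
  proof (rule set_integral_mono)
    show "set_integrable lborel {0..1} (\<lambda>t. LINT y:S|lborel. t ^ k * (G t y - c)\<^sup>2)"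
      by (rule compact_Fubini(1)[OF compact_Icc S k1])
    show "set_integrable lborel {0..1} (\<lambda>t. (LINT y:S|lborel. t ^ k * J t y) + (LINT y:S|lborel. t ^ k * (G t y - G m y)\<^sup>2))"
      by (intro set_integral_add I2 I3)
    fix t :: real assume "t \<in> {0..1}"
    then show "(LINT y:S|lborel. t ^ k * (G t y - c)\<^sup>2) \<le>
        (LINT y:S|lborel. t ^ k * J t y) + (LINT y:S|lborel. t ^ k * (G t y - G m y)\<^sup>2)"
      using mult_left_mono[OF ptw, of t "t ^ k"] by (simp add: distrib_left)
  qed
  also have "\<dots> = (LINT t:{0..1}|lborel. LINT y:S|lborel. t ^ k * J t y) +
      (LINT t:{0..1}|lborel. LINT y:S|lborel. t ^ k * (G t y - G m y)\<^sup>2)"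
    by (rule set_integral_add(2)[OF I2 I3])
  also have "\<dots> \<le> (LINT t:{0..1}|lborel. LINT y:S|lborel. t ^ k * J t y) +
      (LINT t:{0..1}|lborel. LINT y:S|lborel. t ^ k * (t * (1 - t) * (DG t y)\<^sup>2) / (real k + 2))"
    using outer by simp
  also have "\<dots> =
      (LINT t:{0..1}|lborel. (LINT y:S|lborel. t ^ k * J t y) + (LINT y:S|lborel. t ^ k * (t * (1 - t) * (DG t y)\<^sup>2) / (real k + 2)))"
    by (rule set_integral_add(2)[OF I2 I4, symmetric])
  also have "\<dots> = (LINT t:{0..1}|lborel. LINT y:S|lborel. t ^ k * (J t y + t * (1 - t) * (DG t y)\<^sup>2 / (real k + 2)))"
  proof (rule set_lebesgue_integral_cong)
    show "\<forall>t. t \<in> {0..1} \<longrightarrow> (LINT y:S|lborel. t ^ k * J t y) + (LINT y:S|lborel. t ^ k * (t * (1 - t) * (DG t y)\<^sup>2) / (real k + 2)) =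
        (LINT y:S|lborel. t ^ k * (J t y + t * (1 - t) * (DG t y)\<^sup>2 / (real k + 2)))"
    proof (intro allI impI)
      fix t :: real assume t: "t \<in> {0..1}"
      have "(LINT y:S|lborel. t ^ k * J t y) + (LINT y:S|lborel. t ^ k * (t * (1 - t) * (DG t y)\<^sup>2) / (real k + 2)) =
        (LINT y:S|lborel. t ^ k * J t y + t ^ k * (t * (1 - t) * (DG t y)\<^sup>2) / (real k + 2))"
        by (rule set_integral_add(2)[symmetric]; intro set_integrable_compact S continuous_intros secy[OF J t] secy[OF DG t]; simp)
      then show "(LINT y:S|lborel. t ^ k * J t y) + (LINT y:S|lborel. t ^ k * (t * (1 - t) * (DG t y)\<^sup>2) / (real k + 2)) =
        (LINT y:S|lborel. t ^ k * (J t y + t * (1 - t) * (DG t y)\<^sup>2 / (real k + 2)))"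
        by (simp add: distrib_left)
    qed
  qed simp
  finally show ?thesis by blast
qed

section \<open>Reference triangle and tetrahedron as iterated cones\<close>

definition triangle2 :: "(real \<times> real) set" where
  "triangle2 = cone_over {0..1}"

definition tetrahedron3 :: "(real \<times> real \<times> real) set" where
  "tetrahedron3 = cone_over triangle2"

text \<open>In these coordinates \<open>snd z\<close>, \<open>fst z - snd z\<close> and
  \<open>1 - fst z\<close> are the barycentric coordinates, listed from the end points of the first
  segment to the apex. At the apex the division in the witness fails, hence the separate
  case.\<close>

lemma triangle2_eq: "triangle2 = {z. 0 \<le> snd z \<and> snd z \<le> fst z \<and> fst z \<le> 1}"
proof (intro set_eqI iffI)
  fix z assume "z \<in> triangle2"
  then show "z \<in> {z. 0 \<le> snd z \<and> snd z \<le> fst z \<and> fst z \<le> 1}"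
    by (auto simp: triangle2_def cone_over_def intro: mult_left_le mult_right_le_one_le)
next
  fix z :: "real \<times> real" assume z: "z \<in> {z. 0 \<le> snd z \<and> snd z \<le> fst z \<and> fst z \<le> 1}"
  show "z \<in> triangle2"
  proof (cases "fst z = 0")
    case True
    then have "z = (0, 0 *\<^sub>R 0)" using z by (auto simp: prod_eq_iff)
    then show ?thesis by (force simp: triangle2_def cone_over_def)
  next
    case False
    then have "z = (fst z, fst z *\<^sub>R (snd z / fst z))" "snd z / fst z \<in> {0..1}" "fst z \<in> {0..1}"
      using z by (auto simp: prod_eq_iff field_simps)
    then show ?thesis unfolding triangle2_def cone_over_def
      by (intro image_eqI[of _ _ "(fst z, snd z / fst z)"]) auto
  qed
qed

lemma tetrahedron3_eq: "tetrahedron3 =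
  {z. 0 \<le> snd (snd z) \<and> snd (snd z) \<le> fst (snd z) \<and> fst (snd z) \<le> fst z \<and> fst z \<le> 1}"
proof (intro set_eqI iffI)
  fix z assume "z \<in> tetrahedron3"
  then show "z \<in> {z. 0 \<le> snd (snd z) \<and> snd (snd z) \<le> fst (snd z) \<and> fst (snd z) \<le> fst z \<and> fst z \<le> 1}"
    by (auto simp: tetrahedron3_def cone_over_def triangle2_eq intro: mult_left_le mult_left_mono)
next
  fix z :: "real \<times> real \<times> real"
  assume z: "z \<in> {z. 0 \<le> snd (snd z) \<and> snd (snd z) \<le> fst (snd z) \<and> fst (snd z) \<le> fst z \<and> fst z \<le> 1}"
  show "z \<in> tetrahedron3"
  proof (cases "fst z = 0")
    case True
    then have "z = (0, 0 *\<^sub>R (0, 0))" using z by (auto simp: prod_eq_iff)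
    moreover have "(0, (0, 0)) \<in> {0..1::real} \<times> triangle2" by (simp add: triangle2_eq)
    ultimately show ?thesis unfolding tetrahedron3_def cone_over_def
      by (intro image_eqI[of _ _ "(0, (0, 0))"]) (auto simp: zero_prod_def)
  next
    case False
    then have "z = (fst z, fst z *\<^sub>R (inverse (fst z) *\<^sub>R snd z))" "inverse (fst z) *\<^sub>R snd z \<in> triangle2" "fst z \<in> {0..1}"
      using z by (auto simp: prod_eq_iff field_simps triangle2_eq)
    then show ?thesis unfolding tetrahedron3_def cone_over_def
      by (intro image_eqI[of _ _ "(fst z, inverse (fst z) *\<^sub>R snd z)"]) auto
  qed
qed

lemma compact_triangle2: "compact triangle2"
  by (simp add: triangle2_def compact_cone_over)

lemma compact_tetrahedron3: "compact tetrahedron3"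
  by (simp add: tetrahedron3_def compact_cone_over compact_triangle2)

lemma measure_triangle2: "measure lborel triangle2 = 1 / 2"
proof -
  have L: "(LINT t:{0..1}|lborel. g t) = integral {0..1} g" if "continuous_on {0..1} g" for g :: "real \<Rightarrow> real"
    using set_borel_integral_eq_integral(2)[OF set_integrable_compact[OF compact_Icc that]] by simp
  have "measure lborel triangle2 = (LINT z:triangle2|lborel. 1)"
    using set_integral_const_compact[OF compact_triangle2, of 1] by simp
  also have "\<dots> = (LINT t:{0..1}|lborel. LINT y:{0..1::real}|lborel. t ^ DIM(real) * 1)"
    unfolding triangle2_def by (rule cone_integral) auto
  also have "\<dots> = (LINT t:{0..1}|lborel. t)"
    by (simp add: set_integral_const_compact)
  also have "\<dots> = integral {0..1} (\<lambda>t::real. t)"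
    by (rule L) (intro continuous_intros)
  also have "\<dots> = 1 / 2" using ident_has_integral[of 0 "1::real"] by (simp add: integral_unique)
  finally show ?thesis .
qed

lemma measure_tetrahedron3: "measure lborel tetrahedron3 = 1 / 6"
proof -
  have L: "(LINT t:{0..1}|lborel. g t) = integral {0..1} g" if "continuous_on {0..1} g" for g :: "real \<Rightarrow> real"
    using set_borel_integral_eq_integral(2)[OF set_integrable_compact[OF compact_Icc that]] by simp
  have "((\<lambda>t::real. t ^ 2 / 2) has_integral (1 ^ 3 / 6 - 0 ^ 3 / 6)) {0..1}"
    by (rule fundamental_theorem_of_calculus)
       (auto simp flip: has_real_derivative_iff_has_vector_derivative intro!: derivative_eq_intros)
  then have I: "integral {0..1} (\<lambda>t::real. t ^ 2 / 2) = 1 / 6" by (rule trans[OF integral_unique]) simp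
  have "measure lborel tetrahedron3 = (LINT z:tetrahedron3|lborel. 1)"
    using set_integral_const_compact[OF compact_tetrahedron3, of 1] by simp
  also have "\<dots> = (LINT t:{0..1}|lborel. LINT y:triangle2|lborel. t ^ DIM(real \<times> real) * 1)"
    unfolding tetrahedron3_def by (rule cone_integral) (auto simp: compact_triangle2)
  also have "\<dots> = (LINT t:{0..1}|lborel. t ^ 2 / 2)"
    by (simp add: set_integral_const_compact compact_triangle2 measure_triangle2 numeral_2_eq_2)
  also have "\<dots> = integral {0..1} (\<lambda>t::real. t ^ 2 / 2)"
    by (rule L) (intro continuous_intros, simp)
  also have "\<dots> = 1 / 6" by (rule I)
  finally show ?thesis .
qed

text \<open>Along a ray of a cone the derivative is a convex combination of the derivatives along
  the edges from the apex; convexity of the square turns it into the same combination of squared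
  edge derivatives. The defect is the variance of the two values.\<close>

lemma convex_sq2:
  fixes a b y :: real
  assumes "0 \<le> y" "y \<le> 1"
  shows "((1 - y) * a + y * b)\<^sup>2 \<le> (1 - y) * a\<^sup>2 + y * b\<^sup>2"
proof -
  have "(1 - y) * a\<^sup>2 + y * b\<^sup>2 - ((1 - y) * a + y * b)\<^sup>2 = y * (1 - y) * (a - b)\<^sup>2"
    by (simp add: power2_eq_square algebra_simps)
  moreover have "0 \<le> y * (1 - y) * (a - b)\<^sup>2" using assms by simp
  ultimately show ?thesis by linarith
qed

lemma convex_sq3:
  fixes a b c y z :: real
  assumes "0 \<le> z" "z \<le> y" "y \<le> 1"
  shows "((1 - y) * a + (y - z) * b + z * c)\<^sup>2 \<le> (1 - y) * a\<^sup>2 + (y - z) * b\<^sup>2 + z * c\<^sup>2"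
proof -
  have "(1 - y) * a\<^sup>2 + (y - z) * b\<^sup>2 + z * c\<^sup>2 - ((1 - y) * a + (y - z) * b + z * c)\<^sup>2 =
     (1 - y) * (y - z) * (a - b)\<^sup>2 + (1 - y) * z * (a - c)\<^sup>2 + (y - z) * z * (b - c)\<^sup>2"
    by (simp add: power2_eq_square algebra_simps)
  moreover have "0 \<le> (1 - y) * (y - z) * (a - b)\<^sup>2 + (1 - y) * z * (a - c)\<^sup>2 + (y - z) * z * (b - c)\<^sup>2"
    using assms by simp
  ultimately show ?thesis by linarith
qed

text \<open>The inner inequality on the base segment has \<open>k = 0\<close> and constant 1/2, the
  outer one along the rays \<open>k = 1\<close> and constant 1/3. The factors are products of two
  barycentric coordinates, each multiplying the squared derivative along the edge that joins the two
  vertices.\<close>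

lemma triangle2_poincare:
  fixes g D1 D2 :: "real \<times> real \<Rightarrow> real"
  assumes g: "\<And>z. (g has_derivative (\<lambda>h. D1 z * fst h + D2 z * snd h)) (at z)"
    and D1: "continuous_on UNIV D1" and D2: "continuous_on UNIV D2"
  shows "\<exists>c. (LINT z:triangle2|lborel. (g z - c)\<^sup>2) \<le>
    (LINT z:triangle2|lborel. (fst z - snd z) * snd z * (D2 z)\<^sup>2 / 2 +
      (1 - fst z) * ((fst z - snd z) * (D1 z)\<^sup>2 + snd z * (D1 z + D2 z)\<^sup>2) / 3)"
proof -
  have cg: "continuous_on UNIV g"
    using g by (meson continuous_at_imp_continuous_on has_derivative_continuous)
  have comp: "continuous_on A (\<lambda>z. F (p z, q z))" if "continuous_on UNIV F" "continuous_on A p" "continuous_on A q"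
    for F :: "real \<times> real \<Rightarrow> real" and A :: "'c::topological_space set" and p q
    using continuous_on_compose2[OF that(1) continuous_on_Pair[OF that(2,3)]] by auto
  have comp1: "continuous_on A F" if "continuous_on UNIV F" for F :: "real \<times> real \<Rightarrow> real" and A
    using continuous_on_subset[OF that] by auto
  note cc = comp[OF cg] comp[OF D1] comp[OF D2]
  define G where "G t y = g (t, t * y)" for t y
  define DG where "DG t y = D1 (t, t * y) + y * D2 (t, t * y)" for t y
  define J where "J t y = y * (1 - y) * (t * D2 (t, t * y))\<^sup>2 / 2" for t y
  have "\<exists>c. (LINT t:{0..1}|lborel. LINT y:{0..1}|lborel. t ^ 1 * (G t y - c)\<^sup>2) \<le>
    (LINT t:{0..1}|lborel. LINT y:{0..1}|lborel. t ^ 1 * (J t y + t * (1 - t) * (DG t y)\<^sup>2 / (real 1 + 2)))"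
  proof (rule cone_poincare)
    show "continuous_on ({0..1} \<times> {0..1}) (\<lambda>z. G (fst z) (snd z))"
      "continuous_on ({0..1} \<times> {0..1}) (\<lambda>z. DG (fst z) (snd z))"
      "continuous_on ({0..1} \<times> {0..1}) (\<lambda>z. J (fst z) (snd z))"
      unfolding G_def DG_def J_def by (intro continuous_intros cc; simp)+
    fix t y :: real
    have "((\<lambda>t. (t, t * y)) has_derivative (\<lambda>h. (h, h * y))) (at t within {0..1})"
      by (auto intro!: derivative_eq_intros)
    from has_derivative_compose[OF this g]
    show "((\<lambda>t. G t y) has_real_derivative DG t y) (at t within {0..1})"
      unfolding G_def has_field_derivative_def
      by (rule has_derivative_eq_rhs) (simp add: DG_def fun_eq_iff algebra_simps)
  next
    fix t :: real assume t: "t \<in> {0..1}"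
    have L: "(LINT t:{0..1}|lborel. g t) = integral {0..1} g" if "continuous_on {0..1} g" for g :: "real \<Rightarrow> real"
      using set_borel_integral_eq_integral(2)[OF set_integrable_compact[OF compact_Icc that]] by simp
    have d: "((\<lambda>y. G t y) has_real_derivative t * D2 (t, t * y)) (at y within {0..1})" for y
    proof -
      have "((\<lambda>y. (t, t * y)) has_derivative (\<lambda>h. (0, t * h))) (at y within {0..1})"
        by (auto intro!: derivative_eq_intros)
      from has_derivative_compose[OF this g]
      show ?thesis unfolding G_def has_field_derivative_def
        by (rule has_derivative_eq_rhs) (simp add: fun_eq_iff algebra_simps)
    qed
    \<comment> \<open>For the unweighted interval the comparison point is the midpoint.\<close>
    define m where "m = (real 0 + 1) / (real 0 + 2)"
    have "(LINT y:{0..1}|lborel. (G t y - G t m)\<^sup>2) = integral {0..1} (\<lambda>y. y ^ 0 * (G t y - G t m)\<^sup>2)"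
      by (subst L) (auto simp: G_def intro!: continuous_intros cc)
    also have "\<dots> \<le> integral {0..1} (\<lambda>y. y ^ 0 * (y * (1 - y) * (t * D2 (t, t * y))\<^sup>2)) / (real 0 + 2)"
      unfolding m_def by (rule weighted_poincare_1d[OF d]) (intro continuous_intros cc)
    also have "\<dots> = integral {0..1} (J t)" by (simp add: J_def[abs_def])
    also have "\<dots> = (LINT y:{0..1}|lborel. J t y)"
      by (rule L[symmetric]) (auto simp: J_def[abs_def] intro!: continuous_intros cc)
    finally show "\<exists>c. (LINT y:{0..1}|lborel. (G t y - c)\<^sup>2) \<le> (LINT y:{0..1}|lborel. J t y)" by blast
  qed auto
  then obtain c where c: "(LINT t:{0..1}|lborel. LINT y:{0..1}|lborel. t * (G t y - c)\<^sup>2) \<le>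
    (LINT t:{0..1}|lborel. LINT y:{0..1}|lborel. t * (J t y + t * (1 - t) * (DG t y)\<^sup>2 / 3))"
    by auto
  define R where "R z = (fst z - snd z) * snd z * (D2 z)\<^sup>2 / 2 +
      (1 - fst z) * ((fst z - snd z) * (D1 z)\<^sup>2 + snd z * (D1 z + D2 z)\<^sup>2) / 3" for z
  have "(LINT z:triangle2|lborel. (g z - c)\<^sup>2) = (LINT t:{0..1}|lborel. LINT y:{0..1}|lborel. t ^ DIM(real) * (g (t, t *\<^sub>R y) - c)\<^sup>2)"
    unfolding triangle2_def by (rule cone_integral) (intro compact_Icc continuous_intros comp1[OF cg])+
  also have "\<dots> = (LINT t:{0..1}|lborel. LINT y:{0..1}|lborel. t * (G t y - c)\<^sup>2)"
    by (simp add: G_def)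
  also note c
  also have "(LINT t:{0..1}|lborel. LINT y:{0..1}|lborel. t * (J t y + t * (1 - t) * (DG t y)\<^sup>2 / 3)) \<le>
      (LINT t:{0..1}|lborel. LINT y:{0..1}|lborel. t * R (t, t * y))"
  proof (intro set_integral_mono compact_Fubini(1) set_integrable_compact)
    fix t y :: real assume t: "t \<in> {0..1}" and y: "y \<in> {0..1}"
    have "(DG t y)\<^sup>2 \<le> (1 - y) * (D1 (t, t * y))\<^sup>2 + y * (D1 (t, t * y) + D2 (t, t * y))\<^sup>2"
      using convex_sq2[of y "D1 (t, t * y)" "D1 (t, t * y) + D2 (t, t * y)"] y by (simp add: DG_def algebra_simps)
    then have "t * (1 - t) * (DG t y)\<^sup>2 \<le> t * (1 - t) * ((1 - y) * (D1 (t, t * y))\<^sup>2 + y * (D1 (t, t * y) + D2 (t, t * y))\<^sup>2)"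
      using t by (intro mult_left_mono) auto
    moreover have "R (t, t * y) = J t y + t * (1 - t) * ((1 - y) * (D1 (t, t * y))\<^sup>2 + y * (D1 (t, t * y) + D2 (t, t * y))\<^sup>2) / 3"
      by (simp add: R_def J_def power_mult_distrib) (simp add: power2_eq_square algebra_simps)
    ultimately have "J t y + t * (1 - t) * (DG t y)\<^sup>2 / 3 \<le> R (t, t * y)" by simp
    then show "t * (J t y + t * (1 - t) * (DG t y)\<^sup>2 / 3) \<le> t * R (t, t * y)"
      using t by (intro mult_left_mono) auto
  qed (auto simp: J_def DG_def R_def intro!: continuous_intros cc)
  also have "\<dots> = (LINT z:triangle2|lborel. R z)"
  proof -
    have "continuous_on A R" for A unfolding R_def by (intro continuous_intros comp1[OF D1] comp1[OF D2]; simp)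
    then have "(LINT z:triangle2|lborel. R z) = (LINT t:{0..1}|lborel. LINT y:{0..1}|lborel. t ^ DIM(real) * R (t, t *\<^sub>R y))"
      unfolding triangle2_def by (intro cone_integral) auto
    then show ?thesis by simp
  qed
  finally show ?thesis unfolding R_def by blast
qed

text \<open>The slices are handled by \<open>triangle2_poincare\<close>, which supplies the terms
  with 1/2 and 1/3; the cone step with \<open>k = 2\<close> adds the three edges at the new apex
  with constant 1/4.\<close>

lemma tetrahedron3_poincare:
  fixes g D1 D2 D3 :: "real \<times> real \<times> real \<Rightarrow> real"
  assumes g: "\<And>z. (g has_derivative (\<lambda>h. D1 z * fst h + D2 z * fst (snd h) + D3 z * snd (snd h))) (at z)"
    and D1: "continuous_on UNIV D1" and D2: "continuous_on UNIV D2" and D3: "continuous_on UNIV D3"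
  shows "\<exists>c. (LINT z:tetrahedron3|lborel. (g z - c)\<^sup>2) \<le>
    (LINT z:tetrahedron3|lborel. (fst (snd z) - snd (snd z)) * snd (snd z) * (D3 z)\<^sup>2 / 2 +
      (fst z - fst (snd z)) * ((fst (snd z) - snd (snd z)) * (D2 z)\<^sup>2 + snd (snd z) * (D2 z + D3 z)\<^sup>2) / 3 +
      (1 - fst z) * ((fst z - fst (snd z)) * (D1 z)\<^sup>2 + (fst (snd z) - snd (snd z)) * (D1 z + D2 z)\<^sup>2 +
        snd (snd z) * (D1 z + D2 z + D3 z)\<^sup>2) / 4)"
proof -
  have cg: "continuous_on UNIV g"
    using g by (meson continuous_at_imp_continuous_on has_derivative_continuous)
  have comp: "continuous_on A (\<lambda>z. F (p z, q z))" if "continuous_on UNIV F" "continuous_on A p" "continuous_on A q"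
    for F :: "real \<times> real \<times> real \<Rightarrow> real" and A :: "'c::topological_space set" and p q
    using continuous_on_compose2[OF that(1) continuous_on_Pair[OF that(2,3)]] by auto
  have comp1: "continuous_on A F" if "continuous_on UNIV F" for F :: "real \<times> real \<times> real \<Rightarrow> real" and A
    using continuous_on_subset[OF that] by auto
  note cc = comp[OF cg] comp[OF D1] comp[OF D2] comp[OF D3]
  define G where "G t y = g (t, t *\<^sub>R y)" for t y
  define DG where "DG t y = D1 (t, t *\<^sub>R y) + fst y * D2 (t, t *\<^sub>R y) + snd y * D3 (t, t *\<^sub>R y)" for t y
  define J where "J t y = (fst y - snd y) * snd y * (t * D3 (t, t *\<^sub>R y))\<^sup>2 / 2 +
      (1 - fst y) * ((fst y - snd y) * (t * D2 (t, t *\<^sub>R y))\<^sup>2 + snd y * (t * D2 (t, t *\<^sub>R y) + t * D3 (t, t *\<^sub>R y))\<^sup>2) / 3" for t y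
  have cJ: "continuous_on ({0..1} \<times> triangle2) (\<lambda>z. J (fst z) (snd z))"
    and cDG: "continuous_on ({0..1} \<times> triangle2) (\<lambda>z. DG (fst z) (snd z))"
    unfolding DG_def J_def by (intro continuous_intros cc; simp)+
  have "\<exists>c. (LINT t:{0..1}|lborel. LINT y:triangle2|lborel. t ^ 2 * (G t y - c)\<^sup>2) \<le>
    (LINT t:{0..1}|lborel. LINT y:triangle2|lborel. t ^ 2 * (J t y + t * (1 - t) * (DG t y)\<^sup>2 / (real 2 + 2)))"
  proof (rule cone_poincare[OF compact_triangle2 _ _ cDG cJ])
    show "0 < measure lborel triangle2" by (simp add: measure_triangle2)
    show "continuous_on ({0..1} \<times> triangle2) (\<lambda>z. G (fst z) (snd z))"
      unfolding G_def by (intro continuous_intros cc; simp)+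
    fix t :: real and y :: "real \<times> real"
    have "((\<lambda>t. (t, t *\<^sub>R y)) has_derivative (\<lambda>h. (h, h *\<^sub>R y))) (at t within {0..1})"
      by (auto intro!: derivative_eq_intros)
    from has_derivative_compose[OF this g]
    show "((\<lambda>t. G t y) has_real_derivative DG t y) (at t within {0..1})"
      unfolding G_def has_field_derivative_def
      by (rule has_derivative_eq_rhs) (simp add: DG_def fun_eq_iff algebra_simps)
  next
    fix t :: real assume t: "t \<in> {0..1}"
    show "\<exists>c. (LINT y:triangle2|lborel. (G t y - c)\<^sup>2) \<le> (LINT y:triangle2|lborel. J t y)"
      unfolding J_def
    proof (rule triangle2_poincare)
      fix y :: "real \<times> real"
      have "((\<lambda>y. (t, t *\<^sub>R y)) has_derivative (\<lambda>h. (0, t *\<^sub>R h))) (at y)"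
        by (auto intro!: derivative_eq_intros)
      from has_derivative_compose[OF this g]
      show "(G t has_derivative (\<lambda>h. t * D2 (t, t *\<^sub>R y) * fst h + t * D3 (t, t *\<^sub>R y) * snd h)) (at y)"
        unfolding G_def[abs_def] by (rule has_derivative_eq_rhs) (simp add: fun_eq_iff algebra_simps)
    qed (intro continuous_intros cc)+
  qed
  then obtain c where c: "(LINT t:{0..1}|lborel. LINT y:triangle2|lborel. t ^ 2 * (G t y - c)\<^sup>2) \<le>
    (LINT t:{0..1}|lborel. LINT y:triangle2|lborel. t ^ 2 * (J t y + t * (1 - t) * (DG t y)\<^sup>2 / 4))"
    by auto
  define R where "R z = (fst (snd z) - snd (snd z)) * snd (snd z) * (D3 z)\<^sup>2 / 2 +
      (fst z - fst (snd z)) * ((fst (snd z) - snd (snd z)) * (D2 z)\<^sup>2 + snd (snd z) * (D2 z + D3 z)\<^sup>2) / 3 +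
      (1 - fst z) * ((fst z - fst (snd z)) * (D1 z)\<^sup>2 + (fst (snd z) - snd (snd z)) * (D1 z + D2 z)\<^sup>2 +
        snd (snd z) * (D1 z + D2 z + D3 z)\<^sup>2) / 4" for z
  have "(LINT z:tetrahedron3|lborel. (g z - c)\<^sup>2) = (LINT t:{0..1}|lborel. LINT y:triangle2|lborel. t ^ DIM(real \<times> real) * (g (t, t *\<^sub>R y) - c)\<^sup>2)"
    unfolding tetrahedron3_def by (rule cone_integral) (intro compact_triangle2 continuous_intros comp1[OF cg])+
  also have "\<dots> = (LINT t:{0..1}|lborel. LINT y:triangle2|lborel. t ^ 2 * (G t y - c)\<^sup>2)"
    by (simp add: G_def numeral_2_eq_2)
  also note c
  also have "(LINT t:{0..1}|lborel. LINT y:triangle2|lborel. t ^ 2 * (J t y + t * (1 - t) * (DG t y)\<^sup>2 / 4)) \<le>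
      (LINT t:{0..1}|lborel. LINT y:triangle2|lborel. t ^ 2 * R (t, t *\<^sub>R y))"
  proof (intro set_integral_mono compact_Fubini(1) set_integrable_compact compact_Icc compact_triangle2)
    fix t :: real and y :: "real \<times> real" assume t: "t \<in> {0..1}" and y: "y \<in> triangle2"
    let ?d1 = "D1 (t, t *\<^sub>R y)" and ?d2 = "D2 (t, t *\<^sub>R y)" and ?d3 = "D3 (t, t *\<^sub>R y)"
    let ?C = "(1 - fst y) * ?d1\<^sup>2 + (fst y - snd y) * (?d1 + ?d2)\<^sup>2 + snd y * (?d1 + ?d2 + ?d3)\<^sup>2"
    have "(DG t y)\<^sup>2 \<le> ?C"
      using convex_sq3[of "snd y" "fst y" ?d1 "?d1 + ?d2" "?d1 + ?d2 + ?d3"] y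
      by (simp add: DG_def triangle2_eq algebra_simps)
    then have "t * (1 - t) * (DG t y)\<^sup>2 \<le> t * (1 - t) * ?C"
      using t by (intro mult_left_mono) auto
    moreover have "R (t, t *\<^sub>R y) = J t y + t * (1 - t) * ?C / 4"
      by (simp add: R_def J_def power_mult_distrib flip: distrib_left) (simp add: power2_eq_square algebra_simps)
    ultimately have "J t y + t * (1 - t) * (DG t y)\<^sup>2 / 4 \<le> R (t, t *\<^sub>R y)" by simp
    then show "t ^ 2 * (J t y + t * (1 - t) * (DG t y)\<^sup>2 / 4) \<le> t ^ 2 * R (t, t *\<^sub>R y)"
      using t by (intro mult_left_mono) auto
  qed (auto simp: J_def DG_def R_def intro!: continuous_intros cc)
  also have "\<dots> = (LINT z:tetrahedron3|lborel. R z)"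
  proof -
    have "continuous_on A R" for A unfolding R_def by (intro continuous_intros comp1[OF D1] comp1[OF D2] comp1[OF D3]; simp)
    then have "(LINT z:tetrahedron3|lborel. R z) = (LINT t:{0..1}|lborel. LINT y:triangle2|lborel. t ^ DIM(real \<times> real) * R (t, t *\<^sub>R y))"
      unfolding tetrahedron3_def by (intro cone_integral compact_triangle2) auto
    then show ?thesis by (simp add: numeral_2_eq_2)
  qed
  finally show ?thesis unfolding R_def by blast
qed

section \<open>Surface measure and face integrals\<close>

text \<open>Uniqueness of Haar measure on a subspace, by computing the measure of
  \<open>{(x, y). x \<in> A \<and> x + y \<in> C}\<close> in two ways.\<close>

lemma translation_invariant_reflect:
  fixes \<mu> \<nu> :: "'a::euclidean_space measure"
  assumes s: "sets \<mu> = sets borel" "sets \<nu> = sets borel"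
    and sf: "sigma_finite_measure \<mu>" "sigma_finite_measure \<nu>"
    and V: "subspace V" and ae: "AE x in \<mu>. x \<in> V" "AE x in \<nu>. x \<in> V"
    and inv: "\<And>v. v \<in> V \<Longrightarrow> distr \<mu> borel ((+) v) = \<mu>" "\<And>v. v \<in> V \<Longrightarrow> distr \<nu> borel ((+) v) = \<nu>"
    and AC: "A \<in> sets borel" "C \<in> sets borel"
  shows "emeasure \<mu> A * emeasure \<nu> C = emeasure \<mu> C * emeasure \<nu> (uminus ` A)"
proof -
  interpret pair_sigma_finite \<mu> \<nu> using sf by (simp add: pair_sigma_finite_def)
  have m1: "f \<in> borel_measurable \<mu> \<longleftrightarrow> f \<in> borel_measurable borel" for f :: "'a \<Rightarrow> ennreal"
    by (simp only: measurable_cong_sets[OF s(1) refl])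
  have m2: "f \<in> borel_measurable \<nu> \<longleftrightarrow> f \<in> borel_measurable borel" for f :: "'a \<Rightarrow> ennreal"
    by (simp only: measurable_cong_sets[OF s(2) refl])
  have m3: "g \<in> borel_measurable (\<mu> \<Otimes>\<^sub>M \<nu>) \<longleftrightarrow> g \<in> borel_measurable (borel \<Otimes>\<^sub>M borel)" for g :: "'a \<times> 'a \<Rightarrow> ennreal"
    by (simp only: measurable_cong_sets[OF sets_pair_measure_cong[OF s] refl])
  have sub: "(\<integral>\<^sup>+x. f (v + x) \<partial>M) = (\<integral>\<^sup>+x. f x \<partial>M)"
    if "distr M borel ((+) v) = M" "sets M = sets borel" "f \<in> borel_measurable borel"
    for M v and f :: "'a \<Rightarrow> ennreal"
  proof -
    have "(\<integral>\<^sup>+x. f x \<partial>M) = (\<integral>\<^sup>+x. f x \<partial>distr M borel ((+) v))" using that(1) by simp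
    also have "\<dots> = (\<integral>\<^sup>+x. f (v + x) \<partial>M)"
      using that by (intro nn_integral_distr) (auto simp: measurable_cong_sets[OF that(2) refl])
    finally show ?thesis by simp
  qed
  have [measurable]: "A \<in> sets borel" "C \<in> sets borel" by (rule AC)+
  have A': "uminus ` A = uminus -` A" by (auto simp: image_iff) (metis minus_minus)
  have A'b: "uminus -` A \<in> sets borel"
    using measurable_sets[OF borel_measurable_uminus[OF measurable_ident], of A] AC(1) by simp
  let ?iA = "indicator A :: 'a \<Rightarrow> ennreal" and ?iC = "indicator C :: 'a \<Rightarrow> ennreal"
  have "emeasure \<mu> A * emeasure \<nu> C = (\<integral>\<^sup>+x. ?iA x * emeasure \<nu> C \<partial>\<mu>)"
    using AC s by (simp add: nn_integral_multc m1 nn_integral_indicator)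
  also have "\<dots> = (\<integral>\<^sup>+x. \<integral>\<^sup>+y. ?iA x * ?iC (x + y) \<partial>\<nu> \<partial>\<mu>)"
  proof (rule nn_integral_cong_AE, use ae(1) in eventually_elim)
    fix x assume "x \<in> V"
    have "(\<integral>\<^sup>+y. ?iA x * ?iC (x + y) \<partial>\<nu>) = ?iA x * (\<integral>\<^sup>+y. ?iC (x + y) \<partial>\<nu>)"
      by (intro nn_integral_cmult) (simp add: m2)
    also have "(\<integral>\<^sup>+y. ?iC (x + y) \<partial>\<nu>) = (\<integral>\<^sup>+y. ?iC y \<partial>\<nu>)"
      by (rule sub[OF inv(2)[OF \<open>x \<in> V\<close>] s(2)]) simp
    finally show "?iA x * emeasure \<nu> C = (\<integral>\<^sup>+y. ?iA x * ?iC (x + y) \<partial>\<nu>)"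
      using AC s by simp
  qed
  also have "\<dots> = (\<integral>\<^sup>+y. \<integral>\<^sup>+x. ?iA x * ?iC (x + y) \<partial>\<mu> \<partial>\<nu>)"
    by (intro Fubini'[symmetric], unfold m3) measurable
  also have "\<dots> = (\<integral>\<^sup>+y. \<integral>\<^sup>+x. ?iA (- y + x) * ?iC x \<partial>\<mu> \<partial>\<nu>)"
  proof (rule nn_integral_cong_AE, use ae(2) in eventually_elim)
    fix y assume "y \<in> V"
    then have "- y \<in> V" using V by (rule subspace_neg[rotated])
    have "(\<integral>\<^sup>+x. ?iA (- y + x) * ?iC (- y + x + y) \<partial>\<mu>) = (\<integral>\<^sup>+x. ?iA x * ?iC (x + y) \<partial>\<mu>)"
      by (rule sub[OF inv(1)[OF \<open>- y \<in> V\<close>] s(1)]) simp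
    then show "(\<integral>\<^sup>+x. ?iA x * ?iC (x + y) \<partial>\<mu>) = (\<integral>\<^sup>+x. ?iA (- y + x) * ?iC x \<partial>\<mu>)" by simp
  qed
  also have "\<dots> = (\<integral>\<^sup>+x. \<integral>\<^sup>+y. ?iA (- y + x) * ?iC x \<partial>\<nu> \<partial>\<mu>)"
    by (intro Fubini', unfold m3) measurable
  also have "\<dots> = (\<integral>\<^sup>+x. emeasure \<nu> (uminus ` A) * ?iC x \<partial>\<mu>)"
  proof (rule nn_integral_cong_AE, use ae(1) in eventually_elim)
    fix x assume "x \<in> V"
    have "(\<integral>\<^sup>+y. ?iA (- y + x) * ?iC x \<partial>\<nu>) = (\<integral>\<^sup>+y. ?iA (- y + x) \<partial>\<nu>) * ?iC x"
      by (intro nn_integral_multc) (simp add: m2)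
    also have "(\<integral>\<^sup>+y. ?iA (- y + x) \<partial>\<nu>) = (\<integral>\<^sup>+y. ?iA (- (x + y) + x) \<partial>\<nu>)"
      by (rule sub[OF inv(2)[OF \<open>x \<in> V\<close>] s(2), symmetric]) simp
    also have "\<dots> = (\<integral>\<^sup>+y. indicator (uminus -` A) y \<partial>\<nu>)"
      by (intro nn_integral_cong) (simp add: indicator_def)
    also have "\<dots> = emeasure \<nu> (uminus ` A)"
      using A'b s A' by simp
    finally show "(\<integral>\<^sup>+y. ?iA (- y + x) * ?iC x \<partial>\<nu>) = emeasure \<nu> (uminus ` A) * ?iC x" .
  qed
  also have "\<dots> = emeasure \<nu> (uminus ` A) * (\<integral>\<^sup>+x. ?iC x \<partial>\<mu>)"
    by (rule nn_integral_cmult) (simp add: m1)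
  also have "\<dots> = emeasure \<mu> C * emeasure \<nu> (uminus ` A)"
    using AC s by (simp add: mult.commute)
  finally show ?thesis .
qed

text \<open>Applied with \<open>\<nu>\<close> in both places, the reflection identity shows that
  \<open>\<nu>\<close> is symmetric under \<open>uminus\<close>. Then the reflection drops out of
  the identity for the pair, and the two measures have the constant ratio found on
  \<open>C\<close>.\<close>

lemma translation_invariant_unique:
  fixes \<mu> \<nu> :: "'a::euclidean_space measure"
  assumes s: "sets \<mu> = sets borel" "sets \<nu> = sets borel"
    and sf: "sigma_finite_measure \<mu>" "sigma_finite_measure \<nu>"
    and V: "subspace V" and ae: "AE x in \<mu>. x \<in> V" "AE x in \<nu>. x \<in> V"
    and inv: "\<And>v. v \<in> V \<Longrightarrow> distr \<mu> borel ((+) v) = \<mu>" "\<And>v. v \<in> V \<Longrightarrow> distr \<nu> borel ((+) v) = \<nu>"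
    and C: "C \<in> sets borel" "0 < emeasure \<mu> C" "emeasure \<mu> C < \<infinity>" "0 < emeasure \<nu> C" "emeasure \<nu> C < \<infinity>"
  obtains c :: real where "0 < c" "\<mu> = density \<nu> (\<lambda>_. ennreal c)"
proof -
  define c where "c = enn2real (emeasure \<mu> C) / enn2real (emeasure \<nu> C)"
  have c0: "0 < c" using C by (simp add: c_def enn2real_positive_iff)
  have "\<mu> = density \<nu> (\<lambda>_. ennreal c)"
  proof (rule measure_eqI)
    show "sets \<mu> = sets (density \<nu> (\<lambda>_. ennreal c))" using s by simp
    fix A assume "A \<in> sets \<mu>"
    then have A: "A \<in> sets borel" using s by simp
    have "emeasure \<nu> A * emeasure \<nu> C = emeasure \<nu> C * emeasure \<nu> (uminus ` A)"
      by (rule translation_invariant_reflect[OF s(2,2) sf(2,2) V ae(2,2) inv(2,2) A C(1)])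
    then have sym: "emeasure \<nu> (uminus ` A) = emeasure \<nu> A"
      using C by (metis ennreal_mult_left_cong ennreal_mult_cancel_left infinity_ennreal_def less_irrefl mult.commute)
    have e: "emeasure \<mu> A * emeasure \<nu> C = emeasure \<mu> C * emeasure \<nu> A"
      using translation_invariant_reflect[OF s sf V ae inv A C(1)] sym by simp
    obtain a b where ab: "emeasure \<mu> C = ennreal a" "emeasure \<nu> C = ennreal b" "0 < a" "0 < b"
      using C by (cases "emeasure \<mu> C" rule: ennreal_cases; cases "emeasure \<nu> C" rule: ennreal_cases) auto
    have cab: "c = a / b" using ab by (simp add: c_def)
    have "ennreal c * emeasure \<nu> A = ennreal (1 / b) * (ennreal a * emeasure \<nu> A)"
      using ab by (simp add: cab mult.assoc[symmetric] flip: ennreal_mult)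
    also have "\<dots> = ennreal (1 / b) * (emeasure \<mu> A * ennreal b)" using e ab by simp
    also have "\<dots> = (ennreal (1 / b) * ennreal b) * emeasure \<mu> A" by (simp add: ac_simps)
    also have "ennreal (1 / b) * ennreal b = 1" using ab by (simp flip: ennreal_mult)
    finally show "emeasure \<mu> A = emeasure (density \<nu> (\<lambda>_. ennreal c)) A"
      using A s by (simp add: emeasure_density_const)
  qed
  with c0 show ?thesis by (rule that)
qed

lemma sigma_finite_if_bounded_finite:
  fixes \<mu> :: "'a::euclidean_space measure"
  assumes "sets \<mu> = sets borel" "\<And>r. emeasure \<mu> (cball 0 r) < \<infinity>"
  shows "sigma_finite_measure \<mu>"
proof
  have "space \<mu> = UNIV" using sets_eq_imp_space_eq[OF assms(1)] by simp
  moreover have "\<exists>n. norm x \<le> real n" for x :: 'a by (rule real_arch_simple)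
  ultimately show "\<exists>A. countable A \<and> A \<subseteq> sets \<mu> \<and> \<Union> A = space \<mu> \<and> (\<forall>a\<in>A. emeasure \<mu> a \<noteq> \<infinity>)"
    using assms by (intro exI[of _ "range (\<lambda>n::nat. cball 0 (real n))"]) (auto simp: less_top)
qed

section \<open>Invariant measures on subspaces: linear images of Lebesgue measure and orthonormal
  frames\<close>

definition image_lborel :: "('e::euclidean_space \<Rightarrow> 'a::euclidean_space) \<Rightarrow> 'a measure" where
  "image_lborel L = distr lborel borel L"

text \<open>Collects what \<open>translation_invariant_unique\<close> asks of Lebesgue measure
  transported to the range of \<open>L\<close>: concentration on the range, invariance along it, and
  balls of positive finite measure.\<close>

lemma image_lborel:
  fixes L :: "'e::euclidean_space \<Rightarrow> 'a::euclidean_space"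
  assumes L: "linear L" and inj: "inj L"
  shows "sets (image_lborel L) = sets borel" "AE x in image_lborel L. x \<in> range L"
    "\<And>v. v \<in> range L \<Longrightarrow> distr (image_lborel L) borel ((+) v) = image_lborel L"
    "\<And>r. emeasure (image_lborel L) (cball 0 r) < \<infinity>"
    "\<And>r. 0 < r \<Longrightarrow> 0 < emeasure (image_lborel L) (cball 0 r)"
proof -
  have Lm: "L \<in> borel_measurable borel"
    using L by (intro borel_measurable_continuous_onI linear_continuous_on linear_conv_bounded_linear[THEN iffD1])
  show "sets (image_lborel L) = sets borel" by (simp add: image_lborel_def)
  have "closed (range L)"
    using L by (intro closed_subspace linear_subspace_image) auto
  then show "AE x in image_lborel L. x \<in> range L"
    unfolding image_lborel_def using Lm by (subst AE_distr_iff) (auto simp: borel_closed)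
  show "distr (image_lborel L) borel ((+) v) = image_lborel L" if vL: "v \<in> range L" for v
  proof -
    obtain w where w: "v = L w" using vL by auto
    have "distr (image_lborel L) borel ((+) v) = distr lborel borel ((+) v \<circ> L)"
      unfolding image_lborel_def using Lm by (subst distr_distr) auto
    also have "(+) v \<circ> L = L \<circ> (+) w" by (auto simp: w linear_add[OF L])
    also have "distr lborel borel (L \<circ> (+) w) = distr (distr lborel borel ((+) w)) borel L"
      using Lm by (subst distr_distr) auto
    finally show ?thesis by (simp add: lborel_distr_plus image_lborel_def)
  qed
  have em: "emeasure (image_lborel L) (cball 0 r) = emeasure lborel (L -` cball 0 r)" for r
    unfolding image_lborel_def using Lm by (subst emeasure_distr) auto
  obtain B where B: "B > 0" "\<And>x. B * norm x \<le> norm (L x)"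
    using linear_inj_bounded_below_pos[OF L inj] by blast
  show "emeasure (image_lborel L) (cball 0 r) < \<infinity>" for r
  proof -
    have "bounded (L -` cball 0 r)"
    proof (rule boundedI)
      fix x assume "x \<in> L -` cball 0 r"
      then have "B * norm x \<le> r" using B(2)[of x] by simp
      then show "norm x \<le> r / B" using B(1) by (simp add: field_simps)
    qed
    then show ?thesis unfolding em by (rule emeasure_bounded_finite)
  qed
  show "0 < emeasure (image_lborel L) (cball 0 r)" if "0 < r" for r
  proof -
    have "open (L -` ball 0 r)"
      using L by (intro open_vimage linear_continuous_on linear_conv_bounded_linear[THEN iffD1]) auto
    moreover have "0 \<in> L -` ball 0 r" using that linear_0[OF L] by simp
    then have "L -` ball 0 r \<noteq> {}" by blast
    ultimately have "emeasure lborel (L -` ball 0 r) \<noteq> 0"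
      using open_not_negligible[of "L -` ball 0 r"]
      by (auto simp: negligible_iff_null_sets null_sets_completion_iff null_sets_def borel_open)
    moreover have "emeasure lborel (L -` ball 0 r) \<le> emeasure lborel (L -` cball 0 r)"
      using measurable_sets[OF Lm, of "cball 0 r"] by (intro emeasure_mono) auto
    ultimately show ?thesis unfolding em using zero_less_iff_neq_zero by (metis not_gr_zero le_zero_eq)
  qed
qed

lemma lborel_eq_image:
  fixes L :: "'e::euclidean_space \<Rightarrow> 'a::euclidean_space"
  assumes "linear L" "bij L"
  obtains c where "0 < c" "lborel = density (image_lborel L) (\<lambda>_. ennreal c)"
proof -
  note im = image_lborel[OF assms(1) bij_is_inj[OF assms(2)]]
  have id: "image_lborel (\<lambda>x::'a. x) = lborel" by (simp add: image_lborel_def distr_id2)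
  note id' = image_lborel[OF linear_id[unfolded id_def] inj_on_id2, where 'a='a, unfolded id]
  show ?thesis
  proof (rule translation_invariant_unique[of lborel "image_lborel L" UNIV "cball 0 1"])
    show "sigma_finite_measure (image_lborel L)"
      using im by (intro sigma_finite_if_bounded_finite) auto
    show "sigma_finite_measure (lborel :: 'a measure)" by (rule lborel.sigma_finite_measure_axioms)
    show "distr (image_lborel L) borel ((+) v) = image_lborel L" for v
      using im(3) assms(2) by (auto simp: bij_def)
  qed (use im id' that in \<open>auto simp: lborel_distr_plus\<close>)
qed

lemma lborel_integral_image:
  fixes L :: "'e::euclidean_space \<Rightarrow> 'a::euclidean_space"
  assumes L: "linear L" "bij L"
  obtains c where "0 < c"
    "\<And>f :: 'a \<Rightarrow> real. f \<in> borel_measurable borel \<Longrightarrow> (\<integral>x. f x \<partial>lborel) = c * (\<integral>e. f (p + L e) \<partial>lborel)"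
proof -
  obtain c where c: "0 < c" "lborel = density (image_lborel L) (\<lambda>_. ennreal c)"
    using lborel_eq_image[OF L] by blast
  have Lm: "L \<in> borel_measurable borel"
    using L by (intro borel_measurable_continuous_onI linear_continuous_on linear_conv_bounded_linear[THEN iffD1])
  have "(\<integral>x. f x \<partial>lborel) = c * (\<integral>e. f (p + L e) \<partial>lborel)" if f: "f \<in> borel_measurable borel" for f :: "'a \<Rightarrow> real"
  proof -
    have "(\<integral>x. f x \<partial>lborel) = (\<integral>x. f x \<partial>distr lborel borel ((+) p))" by (simp add: lborel_distr_plus)
    also have "\<dots> = (\<integral>x. f (p + x) \<partial>lborel)" using f by (subst integral_distr) auto
    also have "\<dots> = (\<integral>x. f (p + x) \<partial>density (image_lborel L) (\<lambda>_. ennreal c))" by (subst c(2)) simp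
    also have "\<dots> = (\<integral>x. c *\<^sub>R f (p + x) \<partial>image_lborel L)"
      using f c by (subst integral_density) (auto simp: image_lborel_def)
    also have "\<dots> = (\<integral>e. c *\<^sub>R f (p + L e) \<partial>lborel)"
      unfolding image_lborel_def using f Lm by (subst integral_distr) auto
    finally show ?thesis by simp
  qed
  with c(1) show ?thesis by (rule that)
qed

lemma PiM_lborel_shift:
  assumes "finite B"
  shows "distr (\<Pi>\<^sub>M b\<in>B. (lborel :: real measure)) (\<Pi>\<^sub>M b\<in>B. lborel) (\<lambda>t. \<lambda>b\<in>B. c b + t b) = (\<Pi>\<^sub>M b\<in>B. lborel)"
proof -
  interpret product_sigma_finite "\<lambda>b. lborel :: real measure" ..
  interpret finite_product_sigma_finite "\<lambda>b. lborel :: real measure" B by standard (rule assms)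
  have sm: "(\<lambda>t. \<lambda>b\<in>B. c b + t b) \<in> measurable (\<Pi>\<^sub>M b\<in>B. (lborel :: real measure)) (\<Pi>\<^sub>M b\<in>B. lborel)"
    by measurable
  show ?thesis
  proof (rule PiM_eqI[OF assms])
    fix A :: "'a \<Rightarrow> real set" assume A: "\<And>i. i \<in> B \<Longrightarrow> A i \<in> sets lborel"
    have pre: "(\<lambda>t. \<lambda>b\<in>B. c b + t b) -` Pi\<^sub>E B A \<inter> space (\<Pi>\<^sub>M b\<in>B. (lborel :: real measure)) =
        Pi\<^sub>E B (\<lambda>b. (+) (c b) -` A b)"
      by (auto simp: space_PiM PiE_iff extensional_def)
    have m: "(+) (c b) -` A b \<in> sets borel" if "b \<in> B" for b
      using A[OF that] measurable_sets[of "(+) (c b)" borel borel "A b"] by simp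
    have "emeasure (distr (\<Pi>\<^sub>M b\<in>B. lborel) (\<Pi>\<^sub>M b\<in>B. lborel) (\<lambda>t. \<lambda>b\<in>B. c b + t b)) (Pi\<^sub>E B A) =
        emeasure (\<Pi>\<^sub>M b\<in>B. lborel) (Pi\<^sub>E B (\<lambda>b. (+) (c b) -` A b))"
      using A by (subst emeasure_distr[OF sm]) (auto simp: pre intro!: sets_PiM_I_finite assms)
    also have "\<dots> = (\<Prod>b\<in>B. emeasure lborel ((+) (c b) -` A b))"
      using m by (subst emeasure_PiM[OF assms]) auto
    also have "\<dots> = (\<Prod>b\<in>B. emeasure lborel (A b))"
    proof (rule prod.cong[OF refl])
      fix b assume "b \<in> B"
      have "emeasure lborel (A b) = emeasure (distr lborel borel ((+) (c b))) (A b)"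
        by (simp add: lborel_distr_plus)
      also have "\<dots> = emeasure lborel ((+) (c b) -` A b)"
        using A[OF \<open>b \<in> B\<close>] by (subst emeasure_distr) auto
      finally show "emeasure lborel ((+) (c b) -` A b) = emeasure lborel (A b)" by simp
    qed
    finally show "emeasure (distr (\<Pi>\<^sub>M b\<in>B. lborel) (\<Pi>\<^sub>M b\<in>B. lborel) (\<lambda>t. \<lambda>b\<in>B. c b + t b)) (Pi\<^sub>E B A) =
        (\<Prod>b\<in>B. emeasure lborel (A b))" .
  qed simp
qed

definition frame_measure :: "'a::euclidean_space set \<Rightarrow> 'a measure" where
  "frame_measure B = distr (\<Pi>\<^sub>M b\<in>B. lborel) borel (\<lambda>t. \<Sum>b\<in>B. t b *\<^sub>R b)"

text \<open>The same list of properties for the orthonormal coordinates in the definition of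
  \<open>surface_measure\<close>, with the origin moved to 0; this makes that measure comparable
  with \<open>image_lborel\<close>.\<close>

lemma frame_measure:
  fixes B :: "'a::euclidean_space set"
  assumes B: "pairwise orthogonal B" "\<forall>b\<in>B. norm b = 1"
  shows "sets (frame_measure B) = sets borel" "AE x in frame_measure B. x \<in> span B"
    "\<And>v. v \<in> span B \<Longrightarrow> distr (frame_measure B) borel ((+) v) = frame_measure B"
    "\<And>r. emeasure (frame_measure B) (cball 0 r) < \<infinity>"
    "\<And>r. 0 < r \<Longrightarrow> 0 < emeasure (frame_measure B) (cball 0 r)"
proof -
  have "0 \<notin> B" using B(2) by force
  then have "independent B" using B(1) by (rule pairwise_orthogonal_independent[rotated])
  then have fin: "finite B" by (simp add: finiteI_independent)
  interpret product_sigma_finite "\<lambda>b::'a. lborel :: real measure" ..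
  interpret finite_product_sigma_finite "\<lambda>b. lborel :: real measure" B by standard (rule fin)
  define \<psi> where "\<psi> t = (\<Sum>b\<in>B. t b *\<^sub>R b)" for t :: "'a \<Rightarrow> real"
  have pm: "\<psi> \<in> measurable (\<Pi>\<^sub>M b\<in>B. lborel) borel" unfolding \<psi>_def by measurable
  have fm: "frame_measure B = distr (\<Pi>\<^sub>M b\<in>B. lborel) borel \<psi>" by (simp add: frame_measure_def \<psi>_def[abs_def])
  show "sets (frame_measure B) = sets borel" by (simp add: fm)
  have "\<psi> t \<in> span B" for t unfolding \<psi>_def by (intro span_sum span_scale) (rule span_base)
  then show "AE x in frame_measure B. x \<in> span B"
    unfolding fm using pm by (subst AE_distr_iff) (auto simp: borel_closed closed_span)
  show "distr (frame_measure B) borel ((+) v) = frame_measure B" if v: "v \<in> span B" for v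
  proof -
    obtain c where c: "v = (\<Sum>b\<in>B. c b *\<^sub>R b)" using v span_finite[OF fin] by auto
    have sm: "(\<lambda>t. \<lambda>b\<in>B. c b + t b) \<in> measurable (\<Pi>\<^sub>M b\<in>B. (lborel :: real measure)) (\<Pi>\<^sub>M b\<in>B. lborel)"
      by measurable
    have "distr (frame_measure B) borel ((+) v) = distr (\<Pi>\<^sub>M b\<in>B. lborel) borel ((+) v \<circ> \<psi>)"
      unfolding fm using pm by (subst distr_distr) auto
    also have "(+) v \<circ> \<psi> = \<psi> \<circ> (\<lambda>t. \<lambda>b\<in>B. c b + t b)"
      by (auto simp: c \<psi>_def scaleR_add_left sum.distrib)
    also have "distr (\<Pi>\<^sub>M b\<in>B. lborel) borel (\<psi> \<circ> (\<lambda>t. \<lambda>b\<in>B. c b + t b)) =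
        distr (distr (\<Pi>\<^sub>M b\<in>B. lborel) (\<Pi>\<^sub>M b\<in>B. lborel) (\<lambda>t. \<lambda>b\<in>B. c b + t b)) borel \<psi>"
      using pm sm by (subst distr_distr) auto
    finally show ?thesis by (simp add: PiM_lborel_shift[OF fin] fm)
  qed
  have em: "emeasure (frame_measure B) (cball 0 r) =
      emeasure (\<Pi>\<^sub>M b\<in>B. lborel) (\<psi> -` cball 0 r \<inter> space (\<Pi>\<^sub>M b\<in>B. lborel))" for r
    unfolding fm using pm by (subst emeasure_distr) auto
  have meas: "\<psi> -` cball 0 r \<inter> space (\<Pi>\<^sub>M b\<in>B. lborel) \<in> sets (\<Pi>\<^sub>M b\<in>B. lborel)" for r
    using measurable_sets[OF pm] by auto
  have boxm: "emeasure (\<Pi>\<^sub>M b\<in>B. lborel) (Pi\<^sub>E B (\<lambda>_. {-s..s})) = ennreal ((2 * s) ^ card B)" if "0 \<le> s" for s :: real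
  proof -
    have "emeasure (\<Pi>\<^sub>M b\<in>B. lborel) (Pi\<^sub>E B (\<lambda>_. {-s..s})) = (\<Prod>b\<in>B. ennreal (2 * s))"
      using that by (subst emeasure_PiM[OF fin]) auto
    then show ?thesis using that by (simp add: ennreal_power)
  qed
  show "emeasure (frame_measure B) (cball 0 r) < \<infinity>" for r
  proof -
    have "\<psi> -` cball 0 r \<inter> space (\<Pi>\<^sub>M b\<in>B. lborel) \<subseteq> Pi\<^sub>E B (\<lambda>_. {-\<bar>r\<bar>..\<bar>r\<bar>})"
    proof
      fix t assume t: "t \<in> \<psi> -` cball 0 r \<inter> space (\<Pi>\<^sub>M b\<in>B. (lborel :: real measure))"
      have "\<bar>t b\<bar> \<le> \<bar>r\<bar>" if b: "b \<in> B" for b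
      proof -
        \<comment> \<open>Orthonormality recovers each coordinate as an inner product, so only a
          bounded box of coordinates is mapped into a ball.\<close>
        have "\<psi> t \<bullet> b = (\<Sum>b'\<in>B. t b' * (b' \<bullet> b))" by (simp add: \<psi>_def inner_sum_left)
        also have "\<dots> = (\<Sum>b'\<in>B. if b' = b then t b else 0)"
          using B b by (intro sum.cong refl) (auto simp: pairwise_def orthogonal_def dot_square_norm)
        also have "\<dots> = t b" using fin b by simp
        finally have "t b = \<psi> t \<bullet> b" ..
        then have "\<bar>t b\<bar> \<le> norm (\<psi> t) * norm b" by (simp add: Cauchy_Schwarz_ineq2)
        then show ?thesis using t bspec[OF B(2) b] abs_ge_self[of r] by auto
      qed
      then show "t \<in> Pi\<^sub>E B (\<lambda>_. {-\<bar>r\<bar>..\<bar>r\<bar>})" using t by (auto simp: space_PiM PiE_iff abs_le_iff minus_le_iff)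
    qed
    then have "emeasure (frame_measure B) (cball 0 r) \<le> ennreal ((2 * \<bar>r\<bar>) ^ card B)"
      unfolding em boxm[OF abs_ge_zero, symmetric] by (intro emeasure_mono) (auto intro!: sets_PiM_I_finite fin)
    then show ?thesis by (simp add: order.strict_trans1)
  qed
  show "0 < emeasure (frame_measure B) (cball 0 r)" if r: "0 < r" for r
  proof -
    \<comment> \<open>With \<open>card B\<close> summands of norm at most \<open>s\<close> the sum
      stays within \<open>r\<close>; the added 1 covers an empty \<open>B\<close>.\<close>
    define s where "s = r / (1 + real (card B))"
    have s: "0 < s" using r by (simp add: s_def add_pos_nonneg)
    have "Pi\<^sub>E B (\<lambda>_. {-s..s}) \<subseteq> \<psi> -` cball 0 r \<inter> space (\<Pi>\<^sub>M b\<in>B. lborel)"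
    proof
      fix t assume t: "t \<in> Pi\<^sub>E B (\<lambda>_. {-s..s})"
      have "norm (\<psi> t) \<le> (\<Sum>b\<in>B. norm (t b *\<^sub>R b))" unfolding \<psi>_def by (rule norm_sum)
      also have "\<dots> \<le> (\<Sum>b\<in>B. s)" using t B(2) by (intro sum_mono) (auto simp: PiE_iff abs_le_iff minus_le_iff)
      also have "\<dots> \<le> r" using r by (simp add: s_def field_simps)
      finally show "t \<in> \<psi> -` cball 0 r \<inter> space (\<Pi>\<^sub>M b\<in>B. lborel)" using t by (auto simp: space_PiM PiE_iff)
    qed
    then have "ennreal ((2 * s) ^ card B) \<le> emeasure (frame_measure B) (cball 0 r)"
      unfolding em boxm[OF less_imp_le[OF s], symmetric] by (intro emeasure_mono meas)
    moreover have "0 < ennreal ((2 * s) ^ card B)" using s by simp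
    ultimately show ?thesis by (rule order.strict_trans2[rotated])
  qed
qed

text \<open>The frame picked by \<open>SOME\<close> in \<open>surface_measure\<close> is unknown,
  but both measures are translation invariant on the same direction space and therefore
  proportional. This allows any convenient parametrization of a face in place of an orthonormal
  one.\<close>

lemma surface_measure_image:
  fixes L :: "'e::euclidean_space \<Rightarrow> 'a::euclidean_space" and F :: "'a set"
  assumes L: "linear L" "inj L" and F: "affine hull F = (+) q ` range L"
  obtains c where "0 < c" "surface_measure F = density (distr lborel borel (\<lambda>e. q + L e)) (\<lambda>_. ennreal c)"
proof -
  have sub: "subspace (range L)" using L by (intro linear_subspace_image) auto
  have "\<exists>p B. cartesian_frame F p B"
  proof -
    obtain B where "B \<subseteq> range L" "pairwise orthogonal B" "\<And>x. x \<in> B \<Longrightarrow> norm x = 1" "span B = range L"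
      using orthonormal_basis_subspace[OF sub] by metis
    then show ?thesis using F by (intro exI[of _ q] exI[of _ B]) (auto simp: cartesian_frame_def)
  qed
  then have "cartesian_frame F (fst (SOME (p, B). cartesian_frame F p B)) (snd (SOME (p, B). cartesian_frame F p B))"
    by (metis (mono_tags, lifting) case_prod_beta someI_ex prod.sel)
  then obtain p B where pB: "cartesian_frame F p B" and eq: "(SOME (p, B). cartesian_frame F p B) = (p, B)"
    by (metis prod.collapse)
  have B: "pairwise orthogonal B" "\<forall>b\<in>B. norm b = 1" and aff: "affine hull F = (+) p ` span B"
    using pB by (auto simp: cartesian_frame_def)
  \<comment> \<open>The two origins differ by a vector of the direction space, so translation
    invariance exchanges \<open>p\<close> for \<open>q\<close>.\<close>
  have qp: "q - p \<in> span B" and spanB: "span B = range L"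
  proof -
    have e: "(+) q ` range L = (+) p ` span B" using F aff by simp
    have "q + 0 \<in> (+) q ` range L" using sub subspace_0 by blast
    then obtain w where w: "w \<in> span B" "q = p + w" using e by auto
    then show "q - p \<in> span B" by simp
    have "(+) q ` range L = (+) q ` span B"
    proof -
      have "(+) w ` span B = span B"
      proof (intro equalityI subsetI)
        show "x \<in> span B" if "x \<in> (+) w ` span B" for x using that w by (auto intro: span_add)
        show "x \<in> (+) w ` span B" if "x \<in> span B" for x
          using that w by (intro image_eqI[of _ _ "x - w"]) (auto intro: span_diff)
      qed
      then have "(+) p ` span B = (+) p ` ((+) w ` span B)" by simp
      then show ?thesis using e w by (simp add: image_image add.assoc)
    qed
    then show "span B = range L" using translation_invert by metis
  qed
  note fm = frame_measure[OF B] and im = image_lborel[OF L]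
  obtain c where c: "0 < c" "frame_measure B = density (image_lborel L) (\<lambda>_. ennreal c)"
  proof (rule translation_invariant_unique[of "frame_measure B" "image_lborel L" "range L" "cball 0 1"])
    show "sigma_finite_measure (frame_measure B)" "sigma_finite_measure (image_lborel L)"
      using fm im by (intro sigma_finite_if_bounded_finite; simp)+
  qed (use fm im sub spanB in auto)
  have Lm: "L \<in> borel_measurable borel"
    using L by (intro borel_measurable_continuous_onI linear_continuous_on linear_conv_bounded_linear[THEN iffD1])
  have fin: "finite B"
    using B pairwise_orthogonal_independent[OF B(1)] by (metis finiteI_independent norm_zero zero_neq_one)
  have "surface_measure F = distr (\<Pi>\<^sub>M b\<in>B. lborel) borel (\<lambda>t. p + (\<Sum>b\<in>B. t b *\<^sub>R b))"
    by (simp add: surface_measure_def eq)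
  also have "\<dots> = distr (frame_measure B) borel ((+) p)"
  proof -
    have "(\<lambda>t. \<Sum>b\<in>B. t b *\<^sub>R b) \<in> measurable (\<Pi>\<^sub>M b\<in>B. lborel) borel" by measurable
    then show ?thesis unfolding frame_measure_def by (subst distr_distr) (auto simp: comp_def)
  qed
  also have "frame_measure B = distr (frame_measure B) borel ((+) (q - p))"
    using fm(3)[OF qp] by simp
  also have "distr \<dots> borel ((+) p) = distr (frame_measure B) borel ((+) q)"
    using fm(1) by (subst distr_distr) (auto simp: comp_def measurable_cong_sets[OF fm(1) refl])
  also have "\<dots> = density (distr (image_lborel L) borel ((+) q)) (\<lambda>_. ennreal c)"
  proof (rule measure_eqI)
    fix A assume "A \<in> sets (distr (frame_measure B) borel ((+) q))"
    then have A: "A \<in> sets borel" by simp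
    have A': "(+) q -` A \<in> sets borel" using measurable_sets[of "(+) q" borel borel A] A by simp
    have "emeasure (distr (frame_measure B) borel ((+) q)) A = emeasure (frame_measure B) ((+) q -` A)"
      using A sets_eq_imp_space_eq[OF fm(1)] by (subst emeasure_distr) (auto simp: measurable_cong_sets[OF fm(1) refl])
    also have "\<dots> = ennreal c * emeasure (image_lborel L) ((+) q -` A)"
      using A' im(1) by (subst c(2)) (simp add: emeasure_density_const)
    also have "emeasure (image_lborel L) ((+) q -` A) = emeasure (distr (image_lborel L) borel ((+) q)) A"
      using A sets_eq_imp_space_eq[OF im(1)] by (subst emeasure_distr) (auto simp: measurable_cong_sets[OF im(1) refl])
    finally show "emeasure (distr (frame_measure B) borel ((+) q)) A =
        emeasure (density (distr (image_lborel L) borel ((+) q)) (\<lambda>_. ennreal c)) A"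
      using A by (simp add: emeasure_density_const)
  qed simp
  also have "distr (image_lborel L) borel ((+) q) = distr lborel borel (\<lambda>e. q + L e)"
    unfolding image_lborel_def using Lm by (subst distr_distr) (auto simp: comp_def)
  finally show ?thesis using c(1) that by blast
qed

lemma linear_borel_measurable:
  fixes L :: "'e::euclidean_space \<Rightarrow> 'a::euclidean_space"
  shows "linear L \<Longrightarrow> continuous_on S L"
  by (intro linear_continuous_on linear_conv_bounded_linear[THEN iffD1])

lemma set_integral_image_lborel:
  fixes L :: "'e::euclidean_space \<Rightarrow> 'a::euclidean_space"
  assumes L: "linear L" "bij L" and S: "compact S"
  obtains c where "0 < c"
    "\<And>f :: 'a \<Rightarrow> real. continuous_on ((\<lambda>e. q + L e) ` S) f \<Longrightarrow>
      (LINT x:(\<lambda>e. q + L e) ` S|lborel. f x) = c * (LINT e:S|lborel. f (q + L e))"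
proof -
  let ?T = "(\<lambda>e. q + L e) ` S"
  obtain c where c: "0 < c"
    "\<And>f :: 'a \<Rightarrow> real. f \<in> borel_measurable borel \<Longrightarrow> (\<integral>x. f x \<partial>lborel) = c * (\<integral>e. f (q + L e) \<partial>lborel)"
    using lborel_integral_image[OF L] by metis
  have T: "compact ?T" using S by (intro compact_continuous_image continuous_intros linear_borel_measurable[OF L(1)])
  have "(LINT x:?T|lborel. f x) = c * (LINT e:S|lborel. f (q + L e))" if f: "continuous_on ?T f" for f :: "'a \<Rightarrow> real"
  proof -
    have "integrable lborel (\<lambda>x. indicator ?T x *\<^sub>R f x)" by (rule borel_integrable_compact[OF T f])
    then have "(\<lambda>x. indicator ?T x *\<^sub>R f x) \<in> borel_measurable borel" by auto
    from c(2)[OF this] have "(LINT x:?T|lborel. f x) = c * (\<integral>e. indicator ?T (q + L e) *\<^sub>R f (q + L e) \<partial>lborel)"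
      by (simp add: set_lebesgue_integral_def)
    also have "(\<lambda>e. indicator ?T (q + L e) *\<^sub>R f (q + L e)) = (\<lambda>e. indicator S e *\<^sub>R f (q + L e))"
    proof -
      have "q + L e \<in> ?T \<longleftrightarrow> e \<in> S" for e using bij_is_inj[OF L(2)] by (auto dest: injD)
      then show ?thesis by (simp add: indicator_def)
    qed
    finally show ?thesis by (simp add: set_lebesgue_integral_def)
  qed
  with c(1) show ?thesis by (rule that)
qed

lemma face_integral_image:
  fixes L :: "'e::euclidean_space \<Rightarrow> 'a::euclidean_space"
  assumes L: "linear L" "inj L" and S: "compact S" and F: "F = (\<lambda>e. q + L e) ` S"
    and aff: "affine hull F = (+) q ` range L"
  obtains c where "0 < c"
    "\<And>f :: 'a \<Rightarrow> real. continuous_on F f \<Longrightarrow> face_integral F f = c * (LINT e:S|lborel. f (q + L e))"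
proof -
  obtain c where c: "0 < c" "surface_measure F = density (distr lborel borel (\<lambda>e. q + L e)) (\<lambda>_. ennreal c)"
    using surface_measure_image[OF L aff] by metis
  have Lm: "(\<lambda>e. q + L e) \<in> borel_measurable borel"
    by (intro borel_measurable_continuous_onI continuous_intros linear_borel_measurable[OF L(1)])
  have FC: "compact F" using S unfolding F by (intro compact_continuous_image continuous_intros linear_borel_measurable[OF L(1)])
  have "face_integral F f = c * (LINT e:S|lborel. f (q + L e))" if f: "continuous_on F f" for f :: "'a \<Rightarrow> real"
  proof -
    have "integrable lborel (\<lambda>x. indicator F x *\<^sub>R f x)" by (rule borel_integrable_compact[OF FC f])
    then have m: "(\<lambda>x. indicator F x *\<^sub>R f x) \<in> borel_measurable borel" by auto
    have "face_integral F f = (\<integral>x. indicator F x *\<^sub>R f x \<partial>density (distr lborel borel (\<lambda>e. q + L e)) (\<lambda>_. ennreal c))"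
      by (simp add: face_integral_def set_lebesgue_integral_def c(2))
    also have "\<dots> = (\<integral>x. c *\<^sub>R (indicator F x *\<^sub>R f x) \<partial>distr lborel borel (\<lambda>e. q + L e))"
      using m c by (subst integral_density) auto
    also have "\<dots> = (\<integral>e. c *\<^sub>R (indicator F (q + L e) *\<^sub>R f (q + L e)) \<partial>lborel)"
      using m Lm by (subst integral_distr) auto
    also have "(\<lambda>e. c *\<^sub>R (indicator F (q + L e) *\<^sub>R f (q + L e))) = (\<lambda>e. c *\<^sub>R (indicator S e *\<^sub>R f (q + L e)))"
    proof -
      have "q + L e \<in> F \<longleftrightarrow> e \<in> S" for e using L(2) unfolding F by (auto dest: injD)
      then show ?thesis by (simp add: indicator_def)
    qed
    finally show ?thesis by (simp add: set_lebesgue_integral_def)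
  qed
  with c(1) show ?thesis by (rule that)
qed

section \<open>Simplices as cones over a facet, and the divergence theorem on them\<close>

definition cone_map :: "'a::euclidean_space \<Rightarrow> 'a \<Rightarrow> ('e::euclidean_space \<Rightarrow> 'a) \<Rightarrow> real \<times> 'e \<Rightarrow> 'a" where
  "cone_map p q L z = fst z *\<^sub>R (q - p) + L (snd z)"

lemma linear_cone_map: "linear L \<Longrightarrow> linear (cone_map p q L)"
  by (auto simp: linear_iff cone_map_def algebra_simps)

lemma inj_cone_map:
  assumes L: "linear L" "inj L" and p: "p \<notin> (\<lambda>e. q + L e) ` UNIV"
  shows "inj (cone_map p q L)"
proof (subst linear_injective_0[OF linear_cone_map[OF L(1)]], intro allI impI)
  fix z assume 0: "cone_map p q L z = 0"
  have "fst z = 0"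
  proof (rule ccontr)
    assume "fst z \<noteq> 0"
    have "L (inverse (fst z) *\<^sub>R snd z) = inverse (fst z) *\<^sub>R L (snd z)" by (rule linear_scale[OF L(1)])
    also have "L (snd z) = - (fst z *\<^sub>R (q - p))" using 0 by (simp add: cone_map_def add_eq_0_iff add.commute)
    finally have "p = q + L (inverse (fst z) *\<^sub>R snd z)" using \<open>fst z \<noteq> 0\<close> by simp
    then show False using p by blast
  qed
  moreover have "snd z = 0"
    using 0 \<open>fst z = 0\<close> L linear_injective_0[OF L(1)] by (simp add: cone_map_def)
  ultimately show "z = 0" by (simp add: prod_eq_iff)
qed

text \<open>The point \<open>p + cone_map p q L (t, t *\<^sub>R y)\<close> is the convex combination
  of \<open>p\<close> and the base point \<open>q + L y\<close> with weights \<open>1 - t\<close>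
  and \<open>t\<close>, so joining with an apex is an affine image of
  \<open>cone_over\<close>.\<close>

lemma convex_hull_insert_cone:
  assumes L: "linear L" and C: "convex hull C = (\<lambda>e. q + L e) ` S" "C \<noteq> {}"
  shows "convex hull (insert p C) = (\<lambda>z. p + cone_map p q L z) ` cone_over S"
proof -
  have e: "p + cone_map p q L (t, t *\<^sub>R y) = (1 - t) *\<^sub>R p + t *\<^sub>R (q + L y)" for t y
    by (simp add: cone_map_def linear_scale[OF L] algebra_simps)
  have "(\<lambda>z. p + cone_map p q L z) ` cone_over S = (\<lambda>(t, b). (1 - t) *\<^sub>R p + t *\<^sub>R b) ` ({0..1} \<times> (\<lambda>e. q + L e) ` S)"
    unfolding cone_over_def image_image by (force simp: e image_iff)
  also have "\<dots> = convex hull (insert p C)"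
    unfolding convex_hull_insert[OF C(2)] C(1)[symmetric]
  proof (intro equalityI subsetI)
    fix x assume "x \<in> (\<lambda>(t, b). (1 - t) *\<^sub>R p + t *\<^sub>R b) ` ({0..1} \<times> (convex hull C))"
    then obtain t b where "0 \<le> t" "t \<le> 1" "b \<in> convex hull C" "x = (1 - t) *\<^sub>R p + t *\<^sub>R b" by auto
    then show "x \<in> {x. \<exists>u\<ge>0. \<exists>v\<ge>0. \<exists>b. u + v = 1 \<and> b \<in> convex hull C \<and> x = u *\<^sub>R p + v *\<^sub>R b}"
      by (intro CollectI exI[of _ "1 - t"] conjI exI[of _ t] exI[of _ b]) auto
  next
    fix x assume "x \<in> {x. \<exists>u\<ge>0. \<exists>v\<ge>0. \<exists>b. u + v = 1 \<and> b \<in> convex hull C \<and> x = u *\<^sub>R p + v *\<^sub>R b}"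
    then obtain u v b where "0 \<le> u" "0 \<le> v" "u + v = 1" "b \<in> convex hull C" "x = u *\<^sub>R p + v *\<^sub>R b" by auto
    moreover from this have "u = 1 - v" by simp
    ultimately have "x = (1 - v) *\<^sub>R p + v *\<^sub>R b" "v \<in> {0..1}" by auto
    then show "x \<in> (\<lambda>(t, b). (1 - t) *\<^sub>R p + t *\<^sub>R b) ` ({0..1} \<times> (convex hull C))"
      using \<open>b \<in> convex hull C\<close> by (intro image_eqI[of _ _ "(v, b)"]) auto
  qed
  finally show ?thesis by simp
qed

lemma linear_inj_imp_bij_DIM:
  fixes L :: "'e::euclidean_space \<Rightarrow> 'a::euclidean_space"
  assumes "linear L" "inj L" "DIM('e) = DIM('a)"
  shows "bij L"
proof -
  have "dim (range L) = DIM('a)"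
    using dim_image_eq[OF assms(1), of UNIV] assms by simp
  then have "span (range L) = UNIV" using dim_eq_full by blast
  moreover have "span (range L) = range L"
    using linear_subspace_image[OF assms(1), of UNIV] by (simp only: span_eq_iff subspace_UNIV)
  ultimately have "range L = UNIV" by simp
  then show ?thesis using assms(2) by (simp add: bij_def)
qed

text \<open>Integrating \<open>div (w (x - p))\<close> over a cone with apex \<open>p\<close>: along each ray the integrand
  is the derivative of \<open>t\<^sup>d w\<close>.\<close>

lemma cone_divergence:
  fixes L :: "'e::euclidean_space \<Rightarrow> 'a::euclidean_space" and w :: "'a \<Rightarrow> real"
  assumes L: "linear L" "inj L" and S: "compact S" and dim: "DIM('a) = DIM('e) + 1"
    and p: "p \<notin> (\<lambda>e. q + L e) ` UNIV" and F: "F = (\<lambda>e. q + L e) ` S"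
    and aff: "affine hull F = (+) q ` range L"
  obtains c where "0 < c"
    "\<And>w W. (\<And>x. (w has_derivative (\<lambda>h. W x \<bullet> h)) (at x)) \<Longrightarrow> continuous_on UNIV W \<Longrightarrow>
      face_integral F w = c * (LINT x:(\<lambda>z. p + cone_map p q L z) ` cone_over S|lborel. real DIM('a) * w x + W x \<bullet> (x - p))"
proof -
  let ?T = "(\<lambda>z. p + cone_map p q L z) ` cone_over S"
  have bij: "bij (cone_map p q L)"
    by (rule linear_inj_imp_bij_DIM[OF linear_cone_map[OF L(1)] inj_cone_map[OF L p]]) (simp add: dim)
  obtain c1 where c1: "0 < c1"
    "\<And>f :: 'a \<Rightarrow> real. continuous_on ?T f \<Longrightarrow> (LINT x:?T|lborel. f x) = c1 * (LINT z:cone_over S|lborel. f (p + cone_map p q L z))"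
    using set_integral_image_lborel[OF linear_cone_map[OF L(1)] bij compact_cone_over[OF S], where q=p] by metis
  obtain c2 where c2: "0 < c2"
    "\<And>f :: 'a \<Rightarrow> real. continuous_on F f \<Longrightarrow> face_integral F f = c2 * (LINT e:S|lborel. f (q + L e))"
    using face_integral_image[OF L S F aff] by metis
  have "face_integral F w = (c2 / c1) * (LINT x:?T|lborel. real DIM('a) * w x + W x \<bullet> (x - p))"
    if w: "\<And>x. (w has_derivative (\<lambda>h. W x \<bullet> h)) (at x)" and W: "continuous_on UNIV W" for w :: "'a \<Rightarrow> real" and W
  proof -
    have cw: "continuous_on A w" for A
      using w by (meson continuous_at_imp_continuous_on has_derivative_continuous)
    have cW: "continuous_on A W" for A using W continuous_on_subset by blast
    define H where "H x = real DIM('a) * w x + W x \<bullet> (x - p)" for x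
    have cH: "continuous_on A H" for A unfolding H_def by (intro continuous_intros cw cW)
    have cL: "continuous_on A L" for A by (rule linear_borel_measurable[OF L(1)])
    have cwc: "continuous_on B (\<lambda>x. w (g x))" "continuous_on B (\<lambda>x. H (g x))"
      if "continuous_on B g" for B :: "'c::topological_space set" and g
      using continuous_on_compose2[OF cw[of UNIV] that(1)] continuous_on_compose2[OF cH[of UNIV] that(1)] by auto
    have cLc: "continuous_on B (\<lambda>x. L (h x))" if "continuous_on B h" for B :: "'c::topological_space set" and h
      using continuous_on_compose2[OF cL[of UNIV] that] by auto
    have pt: "p + cone_map p q L (t, t *\<^sub>R y) = p + t *\<^sub>R (q + L y - p)" for t y
      by (simp add: cone_map_def linear_scale[OF L(1)] algebra_simps)
    have "(LINT x:?T|lborel. H x) = c1 * (LINT z:cone_over S|lborel. H (p + cone_map p q L z))"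
      by (rule c1(2)[OF cH])
    also have "(LINT z:cone_over S|lborel. H (p + cone_map p q L z)) =
        (LINT t:{0..1}|lborel. LINT y:S|lborel. t ^ DIM('e) * H (p + t *\<^sub>R (q + L y - p)))"
      unfolding pt[symmetric] using linear_borel_measurable[OF linear_cone_map[OF L(1), of p q]]
      by (intro cone_integral S cwc(2) continuous_intros; simp)
    also have "\<dots> = (LINT y:S|lborel. LINT t:{0..1}|lborel. t ^ DIM('e) * H (p + t *\<^sub>R (q + L y - p)))"
      by (intro compact_Fubini S compact_Icc continuous_intros cwc cLc; simp)
    also have "\<dots> = (LINT y:S|lborel. w (q + L y))"
    proof (rule set_lebesgue_integral_cong)
      show "S \<in> sets lborel" using S by (simp add: borel_compact)
      show "\<forall>y. y \<in> S \<longrightarrow> (LINT t:{0..1}|lborel. t ^ DIM('e) * H (p + t *\<^sub>R (q + L y - p))) = w (q + L y)"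
      proof (intro allI impI)
        fix y
        define v where "v = q + L y - p"
        have d: "((\<lambda>t. t ^ DIM('a) * w (p + t *\<^sub>R v)) has_real_derivative t ^ DIM('e) * H (p + t *\<^sub>R v)) (at t within {0..1})" for t
        proof -
          have "((\<lambda>t. p + t *\<^sub>R v) has_derivative (\<lambda>h. h *\<^sub>R v)) (at t within {0..1})"
            by (auto intro!: derivative_eq_intros)
          from has_derivative_compose[OF this w]
          have wd: "((\<lambda>t. w (p + t *\<^sub>R v)) has_real_derivative W (p + t *\<^sub>R v) \<bullet> v) (at t within {0..1})"
            unfolding has_field_derivative_def by (rule has_derivative_eq_rhs) (simp add: fun_eq_iff)
          have "((\<lambda>t. t ^ DIM('a)) has_real_derivative real DIM('a) * t ^ DIM('e)) (at t within {0..1})"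
            by (rule DERIV_subset[OF _ subset_UNIV], rule DERIV_cong[OF DERIV_pow]) (simp add: dim)
          from DERIV_mult[OF this wd] show ?thesis
            by (rule DERIV_cong) (simp add: H_def dim algebra_simps)
        qed
        \<comment> \<open>The apex contributes nothing, because the factor
          \<open>t ^ DIM('a)\<close> vanishes at 0.\<close>
        have "((\<lambda>t. t ^ DIM('e) * H (p + t *\<^sub>R v)) has_integral (1 ^ DIM('a) * w (p + 1 *\<^sub>R v) - 0 ^ DIM('a) * w (p + 0 *\<^sub>R v))) {0..1}"
          by (rule fundamental_theorem_of_calculus) (use d in \<open>auto simp: has_real_derivative_iff_has_vector_derivative\<close>)
        then have "integral {0..1} (\<lambda>t. t ^ DIM('e) * H (p + t *\<^sub>R v)) = w (q + L y)"
          by (rule trans[OF integral_unique]) (simp add: v_def dim)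
        moreover have "(LINT t:{0..1}|lborel. t ^ DIM('e) * H (p + t *\<^sub>R v)) = integral {0..1} (\<lambda>t. t ^ DIM('e) * H (p + t *\<^sub>R v))"
          by (intro set_borel_integral_eq_integral(2) set_integrable_compact compact_Icc continuous_intros cwc)
        ultimately show "(LINT t:{0..1}|lborel. t ^ DIM('e) * H (p + t *\<^sub>R (q + L y - p))) = w (q + L y)"
          by (simp add: v_def)
      qed
    qed
    finally have "(LINT x:?T|lborel. H x) = c1 * (LINT y:S|lborel. w (q + L y))" .
    moreover have "face_integral F w = c2 * (LINT e:S|lborel. w (q + L e))" by (rule c2(2)[OF cw])
    ultimately show ?thesis using c1(1) by (simp add: H_def)
  qed
  moreover have "0 < c2 / c1" using c1 c2 by simp
  ultimately show ?thesis using that by blast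
qed

definition seg_map :: "'a::euclidean_space \<Rightarrow> 'a \<Rightarrow> real \<Rightarrow> 'a" where
  "seg_map a b e = e *\<^sub>R (b - a)"

lemma linear_seg_map: "linear (seg_map a b)"
  by (auto simp: linear_iff seg_map_def algebra_simps)

lemma inj_seg_map: "a \<noteq> b \<Longrightarrow> inj (seg_map a b)"
  by (auto simp: inj_def seg_map_def)

lemma convex_hull_2_seg_map: "convex hull {a, b} = (\<lambda>e. a + seg_map a b e) ` {0..1}"
  unfolding segment_convex_hull[symmetric] closed_segment_image_interval seg_map_def
  by (rule image_cong) (auto simp: algebra_simps)

lemma affine_hull_2_seg_map: "affine hull {a, b} = (\<lambda>e. a + seg_map a b e) ` UNIV"
proof -
  have "u *\<^sub>R a + v *\<^sub>R b = a + v *\<^sub>R (b - a)" if "u + v = 1" for u v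
    using that by (auto simp: algebra_simps simp flip: scaleR_add_left)
  then show ?thesis unfolding affine_hull_2 seg_map_def
    by (auto simp: image_iff) (metis diff_add_cancel)+
qed

lemma affine_hull_3_cone_map: "affine hull {c, a, b} = (\<lambda>z. c + cone_map c a (seg_map a b) z) ` UNIV"
proof -
  have e: "u *\<^sub>R c + v *\<^sub>R a + w *\<^sub>R b = c + cone_map c a (seg_map a b) (v + w, w)" if "u + v + w = 1" for u v w
  proof -
    have "u = 1 - v - w" using that by simp
    show ?thesis unfolding \<open>u = 1 - v - w\<close> by (simp add: cone_map_def seg_map_def algebra_simps)
  qed
  show ?thesis
  proof (intro equalityI subsetI)
    fix x assume "x \<in> affine hull {c, a, b}"
    then show "x \<in> (\<lambda>z. c + cone_map c a (seg_map a b) z) ` UNIV"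
      using e unfolding affine_hull_3 by blast
  next
    fix x assume "x \<in> (\<lambda>z. c + cone_map c a (seg_map a b) z) ` UNIV"
    then obtain z where "x = c + cone_map c a (seg_map a b) z" by auto
    then have "x = (1 - fst z) *\<^sub>R c + (fst z - snd z) *\<^sub>R a + snd z *\<^sub>R b"
      using e[of "1 - fst z" "fst z - snd z" "snd z"] by simp
    then show "x \<in> affine hull {c, a, b}" unfolding affine_hull_3
      by (intro CollectI exI conjI) (assumption, simp)
  qed
qed

text \<open>On the facets through \<open>p\<close> the field \<open>w (x - p)\<close> has no flux,
  so its divergence integrated over the simplex sees the opposite facet alone. In this form every
  statement on face integrals becomes one on volume integrals, and the unknown surface constant is
  merely a positive factor.\<close>

lemma simplex_facet_divergence:
  fixes C :: "'a::euclidean_space set"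
  assumes dim: "DIM('a) \<in> {2, 3}" and C: "\<not> affine_dependent C" "card C = DIM('a) + 1" and p: "p \<in> C"
  obtains c where "0 < c"
    "\<And>w W. (\<And>x. (w has_derivative (\<lambda>h. W x \<bullet> h)) (at x)) \<Longrightarrow> continuous_on UNIV W \<Longrightarrow>
      face_integral (convex hull (C - {p})) w = c * (LINT x:convex hull C|lborel. real DIM('a) * w x + W x \<bullet> (x - p))"
proof -
  have fin: "finite C" using C(2) card_ge_0_finite by force
  have pn: "p \<notin> affine hull (C - {p})" using C(1) p by (auto simp: affine_dependent_def)
  have Cp: "card (C - {p}) = DIM('a)" using C(2) p fin by simp
  have insC: "insert p (C - {p}) = C" using p by auto
  consider "DIM('a) = 2" | "DIM('a) = 3" using dim by blast
  then show ?thesis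
  proof cases
    case 1
    then have "card (C - {p}) = 2" using Cp by simp
    then obtain a b where ab: "C - {p} = {a, b}" "a \<noteq> b" by (meson card_2_iff)
    let ?L = "seg_map a b"
    have F: "convex hull (C - {p}) = (\<lambda>e. a + ?L e) ` {0..1}" unfolding ab by (rule convex_hull_2_seg_map)
    have A: "affine hull (C - {p}) = (\<lambda>e. a + ?L e) ` UNIV" unfolding ab by (rule affine_hull_2_seg_map)
    have T: "convex hull C = (\<lambda>z. p + cone_map p a ?L z) ` cone_over {0..1}"
      using convex_hull_insert_cone[OF linear_seg_map F, of p] ab insC by simp
    show ?thesis
      using cone_divergence[OF linear_seg_map inj_seg_map[OF ab(2)] compact_Icc _ pn[unfolded A] F] 1 A T that
      by (auto simp: affine_hull_convex_hull image_image)
  next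
    case 3: 2
    then have "card (C - {p}) = 3" using Cp by simp
    then obtain c a b where ab: "C - {p} = {c, a, b}" "a \<noteq> b" "c \<noteq> a" "c \<noteq> b" by (metis card_3_iff)
    let ?L = "cone_map c a (seg_map a b)"
    have cn: "c \<notin> affine hull {a, b}"
    proof
      assume "c \<in> affine hull {a, b}"
      moreover have "affine hull {a, b} \<subseteq> affine hull (C - {c})" using ab by (intro hull_mono) auto
      ultimately show False using C(1) ab by (auto simp: affine_dependent_def)
    qed
    have "inj ?L"
      by (rule inj_cone_map[OF linear_seg_map inj_seg_map[OF ab(2)] cn[unfolded affine_hull_2_seg_map]])
    have linL: "linear ?L" by (rule linear_cone_map[OF linear_seg_map])
    have F: "convex hull (C - {p}) = (\<lambda>e. c + ?L e) ` triangle2" unfolding ab triangle2_def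
      by (rule convex_hull_insert_cone[OF linear_seg_map convex_hull_2_seg_map]) simp
    have A: "affine hull (C - {p}) = (\<lambda>e. c + ?L e) ` UNIV" unfolding ab by (rule affine_hull_3_cone_map)
    have T: "convex hull C = (\<lambda>z. p + cone_map p c ?L z) ` cone_over triangle2"
      using convex_hull_insert_cone[OF linL F, of p] ab insC by simp
    show ?thesis
      using cone_divergence[OF linL \<open>inj ?L\<close> compact_triangle2 _ pn[unfolded A] F] 3 A T that
      by (auto simp: affine_hull_convex_hull image_image)
  qed
qed

text \<open>Popoviciu's inequality. The weighted sum over pairs is the variance of the values under
  the weights, hence at most the second moment about the midrange \<open>m\<close>, from which every
  value differs by at most \<open>l / 2\<close>. The case of three values is
  \<open>b3 = 0\<close>.\<close>

lemma popoviciu4: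
  fixes v0 v1 v2 v3 b0 b1 b2 b3 l :: real
  assumes b: "0 \<le> b0" "0 \<le> b1" "0 \<le> b2" "0 \<le> b3" "b0 + b1 + b2 + b3 = 1"
    and v: "\<bar>v0 - v1\<bar> \<le> l" "\<bar>v0 - v2\<bar> \<le> l" "\<bar>v0 - v3\<bar> \<le> l" "\<bar>v1 - v2\<bar> \<le> l" "\<bar>v1 - v3\<bar> \<le> l" "\<bar>v2 - v3\<bar> \<le> l"
  shows "b0 * b1 * (v0 - v1)\<^sup>2 + b0 * b2 * (v0 - v2)\<^sup>2 + b0 * b3 * (v0 - v3)\<^sup>2 + b1 * b2 * (v1 - v2)\<^sup>2 +
    b1 * b3 * (v1 - v3)\<^sup>2 + b2 * b3 * (v2 - v3)\<^sup>2 \<le> l\<^sup>2 / 4"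
proof -
  define m where "m = (max (max v0 v1) (max v2 v3) + min (min v0 v1) (min v2 v3)) / 2"
  have mi: "\<bar>v0 - m\<bar> \<le> l / 2" "\<bar>v1 - m\<bar> \<le> l / 2" "\<bar>v2 - m\<bar> \<le> l / 2" "\<bar>v3 - m\<bar> \<le> l / 2"
    using v unfolding m_def by (auto simp: max_def min_def abs_if field_simps split: if_splits)
  have sq: "(x - m)\<^sup>2 \<le> l\<^sup>2 / 4" if "\<bar>x - m\<bar> \<le> l / 2" for x
    using power_mono[OF that abs_ge_zero, of 2] by (simp add: power_divide)
  have b3: "b3 = 1 - b0 - b1 - b2" using b by simp
  have "b0 * b1 * (v0 - v1)\<^sup>2 + b0 * b2 * (v0 - v2)\<^sup>2 + b0 * b3 * (v0 - v3)\<^sup>2 + b1 * b2 * (v1 - v2)\<^sup>2 +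
    b1 * b3 * (v1 - v3)\<^sup>2 + b2 * b3 * (v2 - v3)\<^sup>2 =
    b0 * (v0 - m)\<^sup>2 + b1 * (v1 - m)\<^sup>2 + b2 * (v2 - m)\<^sup>2 + b3 * (v3 - m)\<^sup>2 -
    (b0 * (v0 - m) + b1 * (v1 - m) + b2 * (v2 - m) + b3 * (v3 - m))\<^sup>2"
    unfolding b3 by algebra
  also have "\<dots> \<le> b0 * (l\<^sup>2 / 4) + b1 * (l\<^sup>2 / 4) + b2 * (l\<^sup>2 / 4) + b3 * (l\<^sup>2 / 4) - 0"
    by (intro diff_mono add_mono mult_left_mono sq mi b zero_le_power2)
  also have "\<dots> = (b0 + b1 + b2 + b3) * (l\<^sup>2 / 4)" by (simp add: algebra_simps)
  finally show ?thesis using b by simp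
qed

lemma diameter_grad_bound:
  fixes T :: "'a::euclidean_space set"
  assumes "bounded T" "x \<in> T" "y \<in> T"
  shows "\<bar>g \<bullet> (x - y)\<bar> \<le> norm g * diameter T"
proof -
  have "\<bar>g \<bullet> (x - y)\<bar> \<le> norm g * norm (x - y)" by (rule Cauchy_Schwarz_ineq2)
  also have "norm (x - y) \<le> diameter T" using diameter_bounded_bound[OF assms] by (simp add: dist_norm)
  finally show ?thesis by (simp add: mult_left_mono)
qed

section \<open>Parametrization of triangles and tetrahedra by the reference simplices\<close>

lemma triangle_setup:
  fixes p0 p1 p2 :: "'a::euclidean_space"
  assumes dim: "DIM('a) = 2" and ind: "\<not> affine_dependent {p0, p1, p2}" and dist: "distinct [p0, p1, p2]"
  defines "X \<equiv> \<lambda>z. snd z *\<^sub>R p0 + (fst z - snd z) *\<^sub>R p1 + (1 - fst z) *\<^sub>R p2"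
  obtains "convex hull {p0, p1, p2} = X ` triangle2"
    "0 < measure lborel (convex hull {p0, p1, p2})"
    "\<And>f :: 'a \<Rightarrow> real. continuous_on (convex hull {p0, p1, p2}) f \<Longrightarrow>
      (LINT x:convex hull {p0, p1, p2}|lborel. f x) =
      (measure lborel (convex hull {p0, p1, p2}) / measure lborel triangle2) * (LINT z:triangle2|lborel. f (X z))"
    "\<exists>g. continuous_on UNIV g \<and> (\<forall>z. g (X z) = z)"
proof -
  let ?L = "cone_map p2 p1 (seg_map p1 p0)"
  have X: "X z = p2 + ?L z" for z by (simp add: X_def cone_map_def seg_map_def algebra_simps)
  have nn: "p2 \<notin> affine hull {p1, p0}"
  proof
    assume "p2 \<in> affine hull {p1, p0}"
    moreover have "{p0, p1, p2} - {p2} = {p1, p0}" using dist by auto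
    ultimately show False using ind by (auto simp: affine_dependent_def)
  qed
  have L: "linear ?L" "bij ?L"
    using linear_cone_map[OF linear_seg_map] inj_cone_map[OF linear_seg_map inj_seg_map nn[unfolded affine_hull_2_seg_map]] dist dim
    by (auto intro!: linear_inj_imp_bij_DIM)
  have T: "convex hull {p0, p1, p2} = X ` triangle2"
    using convex_hull_insert_cone[OF linear_seg_map convex_hull_2_seg_map, of p1 p0 p2]
    unfolding X triangle2_def by (simp add: insert_commute)
  obtain c where c: "0 < c"
    "\<And>f :: 'a \<Rightarrow> real. continuous_on (convex hull {p0, p1, p2}) f \<Longrightarrow>
      (LINT x:convex hull {p0, p1, p2}|lborel. f x) = c * (LINT z:triangle2|lborel. f (X z))"
    using set_integral_image_lborel[OF L compact_triangle2, of p2] unfolding T X by metis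
  have comp: "compact (convex hull {p0, p1, p2})" by (simp add: finite_imp_compact_convex_hull)
  \<comment> \<open>Testing with the constant 1 identifies the Jacobian as the ratio of the two
    volumes; in particular it is independent of the order of the vertices.\<close>
  have m: "measure lborel (convex hull {p0, p1, p2}) = c * measure lborel triangle2"
    using c(2)[of "\<lambda>x. 1"] by (simp add: set_integral_const_compact comp compact_triangle2)
  obtain g where "linear g" "g \<circ> ?L = id" using linear_injective_left_inverse[OF L(1) bij_is_inj[OF L(2)]] by blast
  then have "g (?L z) = z" for z by (metis comp_apply id_apply)
  then have "g (X z - p2) = z" for z by (simp add: X)
  moreover have "continuous_on UNIV (\<lambda>x. g (x - p2))"
    by (intro continuous_on_compose2[OF linear_borel_measurable[OF \<open>linear g\<close>, of UNIV]] continuous_intros) auto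
  ultimately show ?thesis using that T c m by (simp add: measure_triangle2) (metis mult.commute)
qed

lemma tetrahedron_setup:
  fixes p0 p1 p2 p3 :: "'a::euclidean_space"
  assumes dim: "DIM('a) = 3" and ind: "\<not> affine_dependent {p0, p1, p2, p3}" and dist: "distinct [p0, p1, p2, p3]"
  defines "X \<equiv> \<lambda>z. snd (snd z) *\<^sub>R p0 + (fst (snd z) - snd (snd z)) *\<^sub>R p1 + (fst z - fst (snd z)) *\<^sub>R p2 + (1 - fst z) *\<^sub>R p3"
  obtains "convex hull {p0, p1, p2, p3} = X ` tetrahedron3"
    "0 < measure lborel (convex hull {p0, p1, p2, p3})"
    "\<And>f :: 'a \<Rightarrow> real. continuous_on (convex hull {p0, p1, p2, p3}) f \<Longrightarrow>
      (LINT x:convex hull {p0, p1, p2, p3}|lborel. f x) =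
      (measure lborel (convex hull {p0, p1, p2, p3}) / measure lborel tetrahedron3) * (LINT z:tetrahedron3|lborel. f (X z))"
    "\<exists>g. continuous_on UNIV g \<and> (\<forall>z. g (X z) = z)"
proof -
  let ?K = "cone_map p2 p1 (seg_map p1 p0)"
  let ?L = "cone_map p3 p2 ?K"
  have X: "X z = p3 + ?L z" for z by (simp add: X_def cone_map_def seg_map_def algebra_simps)
  have n2: "p2 \<notin> affine hull {p1, p0}"
  proof
    assume "p2 \<in> affine hull {p1, p0}"
    moreover have "affine hull {p1, p0} \<subseteq> affine hull ({p0, p1, p2, p3} - {p2})" using dist by (intro hull_mono) auto
    ultimately show False using ind by (auto simp: affine_dependent_def)
  qed
  have n3: "p3 \<notin> affine hull {p2, p1, p0}"
  proof
    assume "p3 \<in> affine hull {p2, p1, p0}"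
    moreover have "{p0, p1, p2, p3} - {p3} = {p2, p1, p0}" using dist by auto
    ultimately show False using ind by (auto simp: affine_dependent_def)
  qed
  have linK: "linear ?K" by (rule linear_cone_map[OF linear_seg_map])
  have injK: "inj ?K" using inj_cone_map[OF linear_seg_map inj_seg_map n2[unfolded affine_hull_2_seg_map]] dist by auto
  have L: "linear ?L" "bij ?L"
    using linear_cone_map[OF linK] inj_cone_map[OF linK injK n3[unfolded affine_hull_3_cone_map]] dim
    by (auto intro!: linear_inj_imp_bij_DIM)
  have "convex hull {p2, p1, p0} = (\<lambda>z. p2 + ?K z) ` triangle2"
    unfolding triangle2_def by (rule convex_hull_insert_cone[OF linear_seg_map convex_hull_2_seg_map]) simp
  from convex_hull_insert_cone[OF linK this, of p3]
  have T: "convex hull {p0, p1, p2, p3} = X ` tetrahedron3"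
    unfolding X tetrahedron3_def by (simp add: insert_commute)
  obtain c where c: "0 < c"
    "\<And>f :: 'a \<Rightarrow> real. continuous_on (convex hull {p0, p1, p2, p3}) f \<Longrightarrow>
      (LINT x:convex hull {p0, p1, p2, p3}|lborel. f x) = c * (LINT z:tetrahedron3|lborel. f (X z))"
    using set_integral_image_lborel[OF L compact_tetrahedron3, of p3] unfolding T X by metis
  have comp: "compact (convex hull {p0, p1, p2, p3})" by (simp add: finite_imp_compact_convex_hull)
  have m: "measure lborel (convex hull {p0, p1, p2, p3}) = c * measure lborel tetrahedron3"
    using c(2)[of "\<lambda>x. 1"] by (simp add: set_integral_const_compact comp compact_tetrahedron3)
  obtain g where "linear g" "g \<circ> ?L = id" using linear_injective_left_inverse[OF L(1) bij_is_inj[OF L(2)]] by blast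
  then have "g (?L z) = z" for z by (metis comp_apply id_apply)
  then have "g (X z - p3) = z" for z by (simp add: X)
  moreover have "continuous_on UNIV (\<lambda>x. g (x - p3))"
    by (intro continuous_on_compose2[OF linear_borel_measurable[OF \<open>linear g\<close>, of UNIV]] continuous_intros) auto
  ultimately show ?thesis using that T c m by (simp add: measure_tetrahedron3) (metis mult.commute)
qed

section \<open>The Poincare inequality on a simplex with constant diameter over pi\<close>

text \<open>The barycentric coordinates are parameters characterized by \<open>bary\<close>, so the
  lemma applies to every ordering of the vertices with the coordinates permuted along. The
  right-hand side of the second conclusion does not depend on the ordering; the centroid is computed
  from it.\<close>

lemma triangle_ineq:
  fixes p0 p1 p2 :: "'a::euclidean_space" and f :: "'a \<Rightarrow> real"
  assumes dim: "DIM('a) = 2" and ind: "\<not> affine_dependent {p0, p1, p2}" and dist: "distinct [p0, p1, p2]"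
    and bary: "\<And>b0 b1 b2. b0 + b1 + b2 = 1 \<Longrightarrow> \<beta>0 (b0 *\<^sub>R p0 + b1 *\<^sub>R p1 + b2 *\<^sub>R p2) = b0 \<and>
      \<beta>1 (b0 *\<^sub>R p0 + b1 *\<^sub>R p1 + b2 *\<^sub>R p2) = b1 \<and> \<beta>2 (b0 *\<^sub>R p0 + b1 *\<^sub>R p1 + b2 *\<^sub>R p2) = b2"
    and \<beta>: "continuous_on UNIV \<beta>0" "continuous_on UNIV \<beta>1" "continuous_on UNIV \<beta>2"
    and f: "\<And>x. (f has_derivative (\<lambda>h. G x \<bullet> h)) (at x)" and G: "continuous_on UNIV G"
  shows "\<exists>c. (LINT x:convex hull {p0, p1, p2}|lborel. (f x - c)\<^sup>2) \<le>
      (LINT x:convex hull {p0, p1, p2}|lborel. \<beta>0 x * \<beta>1 x * (G x \<bullet> (p0 - p1))\<^sup>2 / 2 +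
        (\<beta>1 x * \<beta>2 x * (G x \<bullet> (p1 - p2))\<^sup>2 + \<beta>0 x * \<beta>2 x * (G x \<bullet> (p0 - p2))\<^sup>2) / 3)"
    and "(LINT x:convex hull {p0, p1, p2}|lborel. \<beta>0 x) =
      measure lborel (convex hull {p0, p1, p2}) / measure lborel triangle2 * (LINT z:triangle2|lborel. snd z)"
proof -
  define X where "X z = snd z *\<^sub>R p0 + (fst z - snd z) *\<^sub>R p1 + (1 - fst z) *\<^sub>R p2" for z
  define T where "T = convex hull {p0, p1, p2}"
  define k where "k = measure lborel T / measure lborel triangle2"
  have k0: "0 < k" and T: "T = X ` triangle2"
    and kf: "\<And>f :: 'a \<Rightarrow> real. continuous_on T f \<Longrightarrow> (LINT x:T|lborel. f x) = k * (LINT z:triangle2|lborel. f (X z))"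
    by (rule triangle_setup[OF dim ind dist]; simp add: X_def[abs_def] T_def k_def measure_triangle2)+
  have b: "\<beta>0 (X z) = snd z" "\<beta>1 (X z) = fst z - snd z" "\<beta>2 (X z) = 1 - fst z" for z
    using bary[of "snd z" "fst z - snd z" "1 - fst z"] by (auto simp: X_def)
  have cf: "continuous_on A f" for A
    using f by (meson continuous_at_imp_continuous_on has_derivative_continuous)
  have sub: "continuous_on A F" if "continuous_on UNIV F" for A and F :: "'a \<Rightarrow> 'b::topological_space"
    using that continuous_on_subset by blast
  show "\<exists>c. (LINT x:convex hull {p0, p1, p2}|lborel. (f x - c)\<^sup>2) \<le>
      (LINT x:convex hull {p0, p1, p2}|lborel. \<beta>0 x * \<beta>1 x * (G x \<bullet> (p0 - p1))\<^sup>2 / 2 +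
        (\<beta>1 x * \<beta>2 x * (G x \<bullet> (p1 - p2))\<^sup>2 + \<beta>0 x * \<beta>2 x * (G x \<bullet> (p0 - p2))\<^sup>2) / 3)"
  proof -
    have cX: "continuous_on UNIV X" unfolding X_def[abs_def] by (intro continuous_intros)
    have cGX: "continuous_on UNIV (\<lambda>z. G (X z))" by (rule continuous_on_compose2[OF G cX]) simp
    have d: "((\<lambda>z. f (X z)) has_derivative (\<lambda>h. (G (X z) \<bullet> (p1 - p2)) * fst h + (G (X z) \<bullet> (p0 - p1)) * snd h)) (at z)" for z
    proof -
      have "(X has_derivative (\<lambda>h. snd h *\<^sub>R p0 + (fst h - snd h) *\<^sub>R p1 + (- fst h) *\<^sub>R p2)) (at z)"
        unfolding X_def[abs_def] by (auto intro!: derivative_eq_intros simp: fun_eq_iff)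
      from has_derivative_compose[OF this f] show ?thesis
        by (rule has_derivative_eq_rhs) (simp add: fun_eq_iff algebra_simps)
    qed
    have "\<exists>c. (LINT z:triangle2|lborel. (f (X z) - c)\<^sup>2) \<le>
      (LINT z:triangle2|lborel. (fst z - snd z) * snd z * (G (X z) \<bullet> (p0 - p1))\<^sup>2 / 2 +
        (1 - fst z) * ((fst z - snd z) * (G (X z) \<bullet> (p1 - p2))\<^sup>2 + snd z * (G (X z) \<bullet> (p1 - p2) + G (X z) \<bullet> (p0 - p1))\<^sup>2) / 3)"
      by (rule triangle2_poincare[OF d]) (intro continuous_intros cGX)+
    then obtain c where c: "(LINT z:triangle2|lborel. (f (X z) - c)\<^sup>2) \<le>
      (LINT z:triangle2|lborel. (fst z - snd z) * snd z * (G (X z) \<bullet> (p0 - p1))\<^sup>2 / 2 +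
        (1 - fst z) * ((fst z - snd z) * (G (X z) \<bullet> (p1 - p2))\<^sup>2 + snd z * (G (X z) \<bullet> (p1 - p2) + G (X z) \<bullet> (p0 - p1))\<^sup>2) / 3)" by blast
    have e: "G (X z) \<bullet> (p1 - p2) + G (X z) \<bullet> (p0 - p1) = G (X z) \<bullet> (p0 - p2)" for z by (simp add: inner_diff_right)
    have "(LINT x:T|lborel. (f x - c)\<^sup>2) = k * (LINT z:triangle2|lborel. (f (X z) - c)\<^sup>2)"
      by (intro kf continuous_intros cf)
    also have "\<dots> \<le> k * (LINT z:triangle2|lborel. (fst z - snd z) * snd z * (G (X z) \<bullet> (p0 - p1))\<^sup>2 / 2 +
        (1 - fst z) * ((fst z - snd z) * (G (X z) \<bullet> (p1 - p2))\<^sup>2 + snd z * (G (X z) \<bullet> (p0 - p2))\<^sup>2) / 3)"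
      using c k0 unfolding e by (intro mult_left_mono) auto
    also have "\<dots> = (LINT x:T|lborel. \<beta>0 x * \<beta>1 x * (G x \<bullet> (p0 - p1))\<^sup>2 / 2 +
        (\<beta>1 x * \<beta>2 x * (G x \<bullet> (p1 - p2))\<^sup>2 + \<beta>0 x * \<beta>2 x * (G x \<bullet> (p0 - p2))\<^sup>2) / 3)"
      by (subst kf) (auto intro!: continuous_intros sub[OF G] sub[OF \<beta>(1)] sub[OF \<beta>(2)] sub[OF \<beta>(3)] simp: b algebra_simps)
    finally show ?thesis unfolding T_def by blast
  qed
  have "(LINT x:T|lborel. \<beta>0 x) = k * (LINT z:triangle2|lborel. snd z)"
    by (subst kf) (auto intro!: sub[OF \<beta>(1)] simp: b)
  then show "(LINT x:convex hull {p0, p1, p2}|lborel. \<beta>0 x) =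
      measure lborel (convex hull {p0, p1, p2}) / measure lborel triangle2 * (LINT z:triangle2|lborel. snd z)"
    by (simp add: T_def k_def)
qed

lemma tetrahedron_ineq:
  fixes p0 p1 p2 p3 :: "'a::euclidean_space" and f :: "'a \<Rightarrow> real"
  assumes dim: "DIM('a) = 3" and ind: "\<not> affine_dependent {p0, p1, p2, p3}" and dist: "distinct [p0, p1, p2, p3]"
    and bary: "\<And>b0 b1 b2 b3. b0 + b1 + b2 + b3 = 1 \<Longrightarrow>
      \<beta>0 (b0 *\<^sub>R p0 + b1 *\<^sub>R p1 + b2 *\<^sub>R p2 + b3 *\<^sub>R p3) = b0 \<and> \<beta>1 (b0 *\<^sub>R p0 + b1 *\<^sub>R p1 + b2 *\<^sub>R p2 + b3 *\<^sub>R p3) = b1 \<and>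
      \<beta>2 (b0 *\<^sub>R p0 + b1 *\<^sub>R p1 + b2 *\<^sub>R p2 + b3 *\<^sub>R p3) = b2 \<and> \<beta>3 (b0 *\<^sub>R p0 + b1 *\<^sub>R p1 + b2 *\<^sub>R p2 + b3 *\<^sub>R p3) = b3"
    and \<beta>: "continuous_on UNIV \<beta>0" "continuous_on UNIV \<beta>1" "continuous_on UNIV \<beta>2" "continuous_on UNIV \<beta>3"
    and f: "\<And>x. (f has_derivative (\<lambda>h. G x \<bullet> h)) (at x)" and G: "continuous_on UNIV G"
  shows "\<exists>c. (LINT x:convex hull {p0, p1, p2, p3}|lborel. (f x - c)\<^sup>2) \<le>
      (LINT x:convex hull {p0, p1, p2, p3}|lborel. \<beta>0 x * \<beta>1 x * (G x \<bullet> (p0 - p1))\<^sup>2 / 2 +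
        (\<beta>1 x * \<beta>2 x * (G x \<bullet> (p1 - p2))\<^sup>2 + \<beta>0 x * \<beta>2 x * (G x \<bullet> (p0 - p2))\<^sup>2) / 3 +
        (\<beta>2 x * \<beta>3 x * (G x \<bullet> (p2 - p3))\<^sup>2 + \<beta>1 x * \<beta>3 x * (G x \<bullet> (p1 - p3))\<^sup>2 + \<beta>0 x * \<beta>3 x * (G x \<bullet> (p0 - p3))\<^sup>2) / 4)"
    and "(LINT x:convex hull {p0, p1, p2, p3}|lborel. \<beta>0 x) =
      measure lborel (convex hull {p0, p1, p2, p3}) / measure lborel tetrahedron3 * (LINT z:tetrahedron3|lborel. snd (snd z))"
proof -
  define X where "X z = snd (snd z) *\<^sub>R p0 + (fst (snd z) - snd (snd z)) *\<^sub>R p1 + (fst z - fst (snd z)) *\<^sub>R p2 + (1 - fst z) *\<^sub>R p3" for z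
  define T where "T = convex hull {p0, p1, p2, p3}"
  define k where "k = measure lborel T / measure lborel tetrahedron3"
  have k0: "0 < k" and T: "T = X ` tetrahedron3"
    and kf: "\<And>f :: 'a \<Rightarrow> real. continuous_on T f \<Longrightarrow> (LINT x:T|lborel. f x) = k * (LINT z:tetrahedron3|lborel. f (X z))"
    by (rule tetrahedron_setup[OF dim ind dist]; simp add: X_def[abs_def] T_def k_def measure_tetrahedron3)+
  have b: "\<beta>0 (X z) = snd (snd z)" "\<beta>1 (X z) = fst (snd z) - snd (snd z)" "\<beta>2 (X z) = fst z - fst (snd z)" "\<beta>3 (X z) = 1 - fst z" for z
    using bary[of "snd (snd z)" "fst (snd z) - snd (snd z)" "fst z - fst (snd z)" "1 - fst z"] by (auto simp: X_def)
  have cf: "continuous_on A f" for A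
    using f by (meson continuous_at_imp_continuous_on has_derivative_continuous)
  have sub: "continuous_on A F" if "continuous_on UNIV F" for A and F :: "'a \<Rightarrow> 'b::topological_space"
    using that continuous_on_subset by blast
  let ?D = "\<lambda>x p q. (G x \<bullet> (p - q))\<^sup>2"
  show "\<exists>c. (LINT x:convex hull {p0, p1, p2, p3}|lborel. (f x - c)\<^sup>2) \<le>
      (LINT x:convex hull {p0, p1, p2, p3}|lborel. \<beta>0 x * \<beta>1 x * ?D x p0 p1 / 2 +
        (\<beta>1 x * \<beta>2 x * ?D x p1 p2 + \<beta>0 x * \<beta>2 x * ?D x p0 p2) / 3 +
        (\<beta>2 x * \<beta>3 x * ?D x p2 p3 + \<beta>1 x * \<beta>3 x * ?D x p1 p3 + \<beta>0 x * \<beta>3 x * ?D x p0 p3) / 4)"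
  proof -
    have cX: "continuous_on UNIV X" unfolding X_def[abs_def] by (intro continuous_intros)
    have cGX: "continuous_on UNIV (\<lambda>z. G (X z))" by (rule continuous_on_compose2[OF G cX]) simp
    have d: "((\<lambda>z. f (X z)) has_derivative (\<lambda>h. (G (X z) \<bullet> (p2 - p3)) * fst h + (G (X z) \<bullet> (p1 - p2)) * fst (snd h) +
        (G (X z) \<bullet> (p0 - p1)) * snd (snd h))) (at z)" for z
    proof -
      have "(X has_derivative (\<lambda>h. snd (snd h) *\<^sub>R p0 + (fst (snd h) - snd (snd h)) *\<^sub>R p1 + (fst h - fst (snd h)) *\<^sub>R p2 + (- fst h) *\<^sub>R p3)) (at z)"
        unfolding X_def[abs_def] by (auto intro!: derivative_eq_intros simp: fun_eq_iff)
      from has_derivative_compose[OF this f] show ?thesis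
        by (rule has_derivative_eq_rhs) (simp add: fun_eq_iff algebra_simps)
    qed
    have e: "G (X z) \<bullet> (p2 - p3) + G (X z) \<bullet> (p1 - p2) + G (X z) \<bullet> (p0 - p1) = G (X z) \<bullet> (p0 - p3)"
      "G (X z) \<bullet> (p2 - p3) + G (X z) \<bullet> (p1 - p2) = G (X z) \<bullet> (p1 - p3)"
      "G (X z) \<bullet> (p1 - p2) + G (X z) \<bullet> (p0 - p1) = G (X z) \<bullet> (p0 - p2)" for z
      by (simp_all add: inner_diff_right)
    define R where "R z = (fst (snd z) - snd (snd z)) * snd (snd z) * ?D (X z) p0 p1 / 2 +
        (fst z - fst (snd z)) * ((fst (snd z) - snd (snd z)) * ?D (X z) p1 p2 + snd (snd z) * ?D (X z) p0 p2) / 3 +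
        (1 - fst z) * ((fst z - fst (snd z)) * ?D (X z) p2 p3 + (fst (snd z) - snd (snd z)) * ?D (X z) p1 p3 + snd (snd z) * ?D (X z) p0 p3) / 4" for z
    have "\<exists>c. (LINT z:tetrahedron3|lborel. (f (X z) - c)\<^sup>2) \<le> (LINT z:tetrahedron3|lborel. R z)"
      unfolding R_def e[symmetric] by (rule tetrahedron3_poincare[OF d]) (intro continuous_intros cGX)+
    then obtain c where c: "(LINT z:tetrahedron3|lborel. (f (X z) - c)\<^sup>2) \<le> (LINT z:tetrahedron3|lborel. R z)" by blast
    have "(LINT x:T|lborel. (f x - c)\<^sup>2) = k * (LINT z:tetrahedron3|lborel. (f (X z) - c)\<^sup>2)"
      by (intro kf continuous_intros cf)
    also have "\<dots> \<le> k * (LINT z:tetrahedron3|lborel. R z)"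
      using c k0 by (intro mult_left_mono) auto
    also have "\<dots> = (LINT x:T|lborel. \<beta>0 x * \<beta>1 x * ?D x p0 p1 / 2 +
        (\<beta>1 x * \<beta>2 x * ?D x p1 p2 + \<beta>0 x * \<beta>2 x * ?D x p0 p2) / 3 +
        (\<beta>2 x * \<beta>3 x * ?D x p2 p3 + \<beta>1 x * \<beta>3 x * ?D x p1 p3 + \<beta>0 x * \<beta>3 x * ?D x p0 p3) / 4)"
    proof (subst kf)
      have "R z = \<beta>0 (X z) * \<beta>1 (X z) * ?D (X z) p0 p1 / 2 +
        (\<beta>1 (X z) * \<beta>2 (X z) * ?D (X z) p1 p2 + \<beta>0 (X z) * \<beta>2 (X z) * ?D (X z) p0 p2) / 3 +
        (\<beta>2 (X z) * \<beta>3 (X z) * ?D (X z) p2 p3 + \<beta>1 (X z) * \<beta>3 (X z) * ?D (X z) p1 p3 + \<beta>0 (X z) * \<beta>3 (X z) * ?D (X z) p0 p3) / 4" for z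
        unfolding R_def b by (simp add: mult_ac distrib_left)
      then show "k * (LINT z:tetrahedron3|lborel. R z) = k * (LINT z:tetrahedron3|lborel. \<beta>0 (X z) * \<beta>1 (X z) * ?D (X z) p0 p1 / 2 +
        (\<beta>1 (X z) * \<beta>2 (X z) * ?D (X z) p1 p2 + \<beta>0 (X z) * \<beta>2 (X z) * ?D (X z) p0 p2) / 3 +
        (\<beta>2 (X z) * \<beta>3 (X z) * ?D (X z) p2 p3 + \<beta>1 (X z) * \<beta>3 (X z) * ?D (X z) p1 p3 + \<beta>0 (X z) * \<beta>3 (X z) * ?D (X z) p0 p3) / 4)"
        by simp
    qed (intro continuous_intros sub[OF G] sub[OF \<beta>(1)] sub[OF \<beta>(2)] sub[OF \<beta>(3)] sub[OF \<beta>(4)]; simp)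
    finally show ?thesis unfolding T_def by blast
  qed
  have "(LINT x:T|lborel. \<beta>0 x) = k * (LINT z:tetrahedron3|lborel. snd (snd z))"
    by (subst kf) (auto intro!: sub[OF \<beta>(1)] simp: b)
  then show "(LINT x:convex hull {p0, p1, p2, p3}|lborel. \<beta>0 x) =
      measure lborel (convex hull {p0, p1, p2, p3}) / measure lborel tetrahedron3 * (LINT z:tetrahedron3|lborel. snd (snd z))"
    by (simp add: T_def k_def)
qed

text \<open>Averaging the ordered inequalities; \<open>A\<close> bounds the sum of the \<open>n\<close> quadratic forms.\<close>

lemma average_poincare:
  fixes f :: "'a::euclidean_space \<Rightarrow> real"
  assumes T: "compact T" "0 < measure lborel T" and f: "continuous_on T f" and G: "continuous_on T G"
    and Q: "\<And>i. i < n \<Longrightarrow> continuous_on T (Q i)"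
    and ineq: "\<And>i. i < n \<Longrightarrow> \<exists>c. (LINT x:T|lborel. (f x - c)\<^sup>2) \<le> (LINT x:T|lborel. Q i x)"
    and sum: "\<And>x. x \<in> T \<Longrightarrow> (\<Sum>i<n. Q i x) \<le> A * (norm (G x * diameter T))\<^sup>2"
    and A: "A * pi\<^sup>2 \<le> real n" "0 < n" and G0: "\<And>x. 0 \<le> G x"
  shows "\<exists>c. (LINT x:T|lborel. (f x - c)\<^sup>2) \<le> (diameter T / pi)\<^sup>2 * (LINT x:T|lborel. (G x)\<^sup>2)"
proof -
  define \<mu> where "\<mu> = (LINT x:T|lborel. f x) / measure lborel T"
  define V where "V = (LINT x:T|lborel. (f x - \<mu>)\<^sup>2)"
  \<comment> \<open>The orderings come with different constants \<open>c\<close>, but the mean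
    minimizes the deviation, so one and the same \<open>V\<close> is below every right-hand side and
    the inequalities can be added.\<close>
  have "V \<le> (LINT x:T|lborel. Q i x)" if i: "i < n" for i
  proof -
    obtain c where "(LINT x:T|lborel. (f x - c)\<^sup>2) \<le> (LINT x:T|lborel. Q i x)" using ineq[OF i] by blast
    moreover have "V \<le> (LINT x:T|lborel. (f x - c)\<^sup>2)"
      using set_integral_variance[OF T(1) f T(2), of c] T(2) by (simp add: V_def \<mu>_def)
    ultimately show ?thesis by linarith
  qed
  then have "(\<Sum>i<n. V) \<le> (\<Sum>i<n. LINT x:T|lborel. Q i x)" by (intro sum_mono) auto
  also have "\<dots> = (LINT x:T|lborel. \<Sum>i<n. Q i x)"
    unfolding set_lebesgue_integral_def scaleR_sum_right using set_integrable_compact[OF T(1) Q]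
    by (subst Bochner_Integration.integral_sum) (auto simp: set_integrable_def)
  also have "\<dots> \<le> (LINT x:T|lborel. A * (norm (G x * diameter T))\<^sup>2)"
    by (intro set_integral_mono set_integrable_compact T continuous_intros Q G sum) auto
  also have "\<dots> = A * (diameter T)\<^sup>2 * (LINT x:T|lborel. (G x)\<^sup>2)"
    by (simp add: power_mult_distrib mult_ac flip: set_integral_mult_right)
  finally have "real n * V \<le> A * ((diameter T)\<^sup>2 * (LINT x:T|lborel. (G x)\<^sup>2))" by (simp add: mult.assoc)
  moreover have "A \<le> real n / pi\<^sup>2" using A by (simp add: field_simps)
  moreover have "0 \<le> (diameter T)\<^sup>2 * (LINT x:T|lborel. (G x)\<^sup>2)"
    unfolding set_lebesgue_integral_def by (intro mult_nonneg_nonneg integral_nonneg_AE AE_I2) auto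
  ultimately have "real n * V \<le> real n / pi\<^sup>2 * ((diameter T)\<^sup>2 * (LINT x:T|lborel. (G x)\<^sup>2))"
    by (meson mult_right_mono order_trans)
  then have "V \<le> (diameter T / pi)\<^sup>2 * (LINT x:T|lborel. (G x)\<^sup>2)"
    using A(2) by (simp add: power_divide field_simps)
  then show ?thesis unfolding V_def by blast
qed

lemma has_grad_continuous_on:
  assumes "\<And>x. (f has_derivative (\<lambda>h. G x \<bullet> h)) (at x)"
  shows "continuous_on A f"
  by (intro continuous_at_imp_continuous_on ballI has_derivative_continuous[OF assms])

lemma simplex_vertices:
  fixes T :: "'a::euclidean_space set"
  assumes "int DIM('a) simplex T"
  obtains C where "\<not> affine_dependent C" "card C = DIM('a) + 1" "finite C" "T = convex hull C"
    "{x. x extreme_point_of T} = C"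
proof -
  obtain C where C: "\<not> affine_dependent C" "int (card C) = int DIM('a) + 1" "T = convex hull C"
    using assms by (auto simp: simplex_def)
  then show ?thesis
    using that[of C] extreme_point_of_convex_hull_affine_independent[OF C(1)] by (auto simp: aff_independent_finite)
qed

lemma barycentre_convex_hull:
  assumes "\<not> affine_dependent C"
  shows "barycentre (convex hull C) = (\<Sum>x\<in>C. x) /\<^sub>R real (card C)"
proof -
  have "{x. x extreme_point_of (convex hull C)} = C"
    using extreme_point_of_convex_hull_affine_independent[OF assms] by auto
  then show ?thesis by (simp add: barycentre_def)
qed

text \<open>The left inverse of the parametrization is defined on the whole space, so the
  coordinates extend continuously beyond the triangle.\<close>

lemma triangle_barycentric:
  fixes p0 p1 p2 :: "'a::euclidean_space"
  assumes dim: "DIM('a) = 2" and ind: "\<not> affine_dependent {p0, p1, p2}" and dist: "distinct [p0, p1, p2]"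
  obtains \<beta>0 \<beta>1 \<beta>2 where "continuous_on UNIV \<beta>0" "continuous_on UNIV \<beta>1" "continuous_on UNIV \<beta>2"
    "\<And>b0 b1 b2. b0 + b1 + b2 = 1 \<Longrightarrow> \<beta>0 (b0 *\<^sub>R p0 + b1 *\<^sub>R p1 + b2 *\<^sub>R p2) = b0 \<and>
      \<beta>1 (b0 *\<^sub>R p0 + b1 *\<^sub>R p1 + b2 *\<^sub>R p2) = b1 \<and> \<beta>2 (b0 *\<^sub>R p0 + b1 *\<^sub>R p1 + b2 *\<^sub>R p2) = b2"
    "\<And>x. x \<in> convex hull {p0, p1, p2} \<Longrightarrow> 0 \<le> \<beta>0 x \<and> 0 \<le> \<beta>1 x \<and> 0 \<le> \<beta>2 x \<and> \<beta>0 x + \<beta>1 x + \<beta>2 x = 1 \<and>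
      x = \<beta>0 x *\<^sub>R p0 + \<beta>1 x *\<^sub>R p1 + \<beta>2 x *\<^sub>R p2"
proof (rule triangle_setup[OF dim ind dist], elim exE conjE)
  let ?X = "\<lambda>z. snd z *\<^sub>R p0 + (fst z - snd z) *\<^sub>R p1 + (1 - fst z) *\<^sub>R p2"
  fix g assume g: "continuous_on UNIV g" "\<forall>z. g (?X z) = z"
  define \<beta>0 where "\<beta>0 x = snd (g x)" for x
  define \<beta>1 where "\<beta>1 x = fst (g x) - snd (g x)" for x
  define \<beta>2 where "\<beta>2 x = 1 - fst (g x)" for x
  have b: "\<beta>0 (b0 *\<^sub>R p0 + b1 *\<^sub>R p1 + b2 *\<^sub>R p2) = b0 \<and>
      \<beta>1 (b0 *\<^sub>R p0 + b1 *\<^sub>R p1 + b2 *\<^sub>R p2) = b1 \<and> \<beta>2 (b0 *\<^sub>R p0 + b1 *\<^sub>R p1 + b2 *\<^sub>R p2) = b2"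
    if s: "b0 + b1 + b2 = 1" for b0 b1 b2
  proof -
    have "1 - (b0 + b1) = b2" using s by simp
    then have "g (b0 *\<^sub>R p0 + b1 *\<^sub>R p1 + b2 *\<^sub>R p2) = (b0 + b1, b0)"
      using g(2)[rule_format, of "(b0 + b1, b0)"] by simp
    then show ?thesis using s by (simp add: \<beta>0_def \<beta>1_def \<beta>2_def)
  qed
  show ?thesis
  proof (rule that[OF _ _ _ b])
    show "continuous_on UNIV \<beta>0" "continuous_on UNIV \<beta>1" "continuous_on UNIV \<beta>2"
      unfolding \<beta>0_def \<beta>1_def \<beta>2_def by (intro continuous_intros g(1))+
    fix x assume "x \<in> convex hull {p0, p1, p2}"
    then obtain u v w where "0 \<le> u" "0 \<le> v" "0 \<le> w" "u + v + w = 1" "x = u *\<^sub>R p0 + v *\<^sub>R p1 + w *\<^sub>R p2"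
      unfolding convex_hull_3 by blast
    then show "0 \<le> \<beta>0 x \<and> 0 \<le> \<beta>1 x \<and> 0 \<le> \<beta>2 x \<and> \<beta>0 x + \<beta>1 x + \<beta>2 x = 1 \<and>
      x = \<beta>0 x *\<^sub>R p0 + \<beta>1 x *\<^sub>R p1 + \<beta>2 x *\<^sub>R p2" using b[of u v w] by simp
  qed
qed

lemma tetrahedron_barycentric:
  fixes p0 p1 p2 p3 :: "'a::euclidean_space"
  assumes dim: "DIM('a) = 3" and ind: "\<not> affine_dependent {p0, p1, p2, p3}" and dist: "distinct [p0, p1, p2, p3]"
  obtains \<beta>0 \<beta>1 \<beta>2 \<beta>3 where "continuous_on UNIV \<beta>0" "continuous_on UNIV \<beta>1" "continuous_on UNIV \<beta>2" "continuous_on UNIV \<beta>3"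
    "\<And>b0 b1 b2 b3. b0 + b1 + b2 + b3 = 1 \<Longrightarrow>
      \<beta>0 (b0 *\<^sub>R p0 + b1 *\<^sub>R p1 + b2 *\<^sub>R p2 + b3 *\<^sub>R p3) = b0 \<and> \<beta>1 (b0 *\<^sub>R p0 + b1 *\<^sub>R p1 + b2 *\<^sub>R p2 + b3 *\<^sub>R p3) = b1 \<and>
      \<beta>2 (b0 *\<^sub>R p0 + b1 *\<^sub>R p1 + b2 *\<^sub>R p2 + b3 *\<^sub>R p3) = b2 \<and> \<beta>3 (b0 *\<^sub>R p0 + b1 *\<^sub>R p1 + b2 *\<^sub>R p2 + b3 *\<^sub>R p3) = b3"
    "\<And>x. x \<in> convex hull {p0, p1, p2, p3} \<Longrightarrow> 0 \<le> \<beta>0 x \<and> 0 \<le> \<beta>1 x \<and> 0 \<le> \<beta>2 x \<and> 0 \<le> \<beta>3 x \<and>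
      \<beta>0 x + \<beta>1 x + \<beta>2 x + \<beta>3 x = 1 \<and> x = \<beta>0 x *\<^sub>R p0 + \<beta>1 x *\<^sub>R p1 + \<beta>2 x *\<^sub>R p2 + \<beta>3 x *\<^sub>R p3"
proof (rule tetrahedron_setup[OF dim ind dist], elim exE conjE)
  let ?X = "\<lambda>z. snd (snd z) *\<^sub>R p0 + (fst (snd z) - snd (snd z)) *\<^sub>R p1 + (fst z - fst (snd z)) *\<^sub>R p2 + (1 - fst z) *\<^sub>R p3"
  fix g assume T: "convex hull {p0, p1, p2, p3} = ?X ` tetrahedron3" and g: "continuous_on UNIV g" "\<forall>z. g (?X z) = z"
  define \<beta>0 where "\<beta>0 x = snd (snd (g x))" for x
  define \<beta>1 where "\<beta>1 x = fst (snd (g x)) - snd (snd (g x))" for x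
  define \<beta>2 where "\<beta>2 x = fst (g x) - fst (snd (g x))" for x
  define \<beta>3 where "\<beta>3 x = 1 - fst (g x)" for x
  have b: "\<beta>0 (b0 *\<^sub>R p0 + b1 *\<^sub>R p1 + b2 *\<^sub>R p2 + b3 *\<^sub>R p3) = b0 \<and> \<beta>1 (b0 *\<^sub>R p0 + b1 *\<^sub>R p1 + b2 *\<^sub>R p2 + b3 *\<^sub>R p3) = b1 \<and>
      \<beta>2 (b0 *\<^sub>R p0 + b1 *\<^sub>R p1 + b2 *\<^sub>R p2 + b3 *\<^sub>R p3) = b2 \<and> \<beta>3 (b0 *\<^sub>R p0 + b1 *\<^sub>R p1 + b2 *\<^sub>R p2 + b3 *\<^sub>R p3) = b3"
    if s: "b0 + b1 + b2 + b3 = 1" for b0 b1 b2 b3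
  proof -
    have "1 - (b0 + b1 + b2) = b3" using s by simp
    then have "g (b0 *\<^sub>R p0 + b1 *\<^sub>R p1 + b2 *\<^sub>R p2 + b3 *\<^sub>R p3) = (b0 + b1 + b2, b0 + b1, b0)"
      using g(2)[rule_format, of "(b0 + b1 + b2, b0 + b1, b0)"] by simp
    then show ?thesis using s by (simp add: \<beta>0_def \<beta>1_def \<beta>2_def \<beta>3_def)
  qed
  show ?thesis
  proof (rule that[OF _ _ _ _ b])
    show "continuous_on UNIV \<beta>0" "continuous_on UNIV \<beta>1" "continuous_on UNIV \<beta>2" "continuous_on UNIV \<beta>3"
      unfolding \<beta>0_def \<beta>1_def \<beta>2_def \<beta>3_def by (intro continuous_intros g(1))+
    fix x assume "x \<in> convex hull {p0, p1, p2, p3}"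
    then obtain z where z: "z \<in> tetrahedron3" "x = ?X z" using T by auto
    then have "g x = z" using g(2) by simp
    then show "0 \<le> \<beta>0 x \<and> 0 \<le> \<beta>1 x \<and> 0 \<le> \<beta>2 x \<and> 0 \<le> \<beta>3 x \<and>
      \<beta>0 x + \<beta>1 x + \<beta>2 x + \<beta>3 x = 1 \<and> x = \<beta>0 x *\<^sub>R p0 + \<beta>1 x *\<^sub>R p1 + \<beta>2 x *\<^sub>R p2 + \<beta>3 x *\<^sub>R p3"
      using z(1) by (simp add: \<beta>0_def \<beta>1_def \<beta>2_def \<beta>3_def tetrahedron3_eq) (use z(2) in simp)
  qed
qed

text \<open>The averaged coefficients 7/72 and 3/32 have to stay below
  \<open>1 / pi\<^sup>2\<close>; the crude bound \<open>pi \<le> 3.2\<close> is enough.\<close>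

lemma pi_sq_bounds: "7 * pi\<^sup>2 \<le> 72" "3 * pi\<^sup>2 \<le> 32"
proof -
  have "pi\<^sup>2 \<le> 3.2\<^sup>2" using pi_approx(2) by (intro power_mono) auto
  then show "7 * pi\<^sup>2 \<le> 72" "3 * pi\<^sup>2 \<le> 32" by (auto simp: power2_eq_square)
qed

text \<open>At a fixed point \<open>x\<close> the quadratic form of an ordering is a sum over edges
  of products of barycentric coordinates times squared differences of the vertex values
  \<open>G x \<bullet> p\<close>. Its sum over a few orderings is compared with the variance of
  these values, which Popoviciu bounds by a quarter of the squared gradient times the squared
  diameter.\<close>

theorem simplex_poincare:
  fixes T :: "'a::euclidean_space set"
  assumes dim: "DIM('a) \<in> {2, 3}" and T: "int DIM('a) simplex T"
    and f: "\<And>x. (f has_derivative (\<lambda>h. G x \<bullet> h)) (at x)" and G: "continuous_on UNIV G"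
  shows "\<exists>c. (LINT x:T|lborel. (f x - c)\<^sup>2) \<le> (diameter T / pi)\<^sup>2 * (LINT x:T|lborel. (norm (G x))\<^sup>2)"
proof -
  obtain C where C: "\<not> affine_dependent C" "card C = DIM('a) + 1" "finite C" "T = convex hull C"
    using simplex_vertices[OF T] by metis
  have comp: "compact T" using C by (simp add: finite_imp_compact_convex_hull)
  have sub: "continuous_on A F" if "continuous_on UNIV F" for A and F :: "'a \<Rightarrow> 'b::topological_space"
    using that continuous_on_subset by blast
  have cf: "continuous_on A f" for A
    by (rule has_grad_continuous_on[OF f])
  have cn: "continuous_on T (\<lambda>x. norm (G x))" by (intro continuous_intros sub[OF G])
  have vd: "\<bar>G x \<bullet> p - G x \<bullet> q\<bar> \<le> norm (norm (G x) * diameter T)" if "p \<in> C" "q \<in> C" for x p q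
  proof -
    have "p \<in> T" "q \<in> T" using that C(4) by (auto intro: hull_inc)
    then show ?thesis
      using diameter_grad_bound[OF compact_imp_bounded[OF comp], of p q "G x"] by (simp add: inner_diff_right)
  qed
  have cm: "(G x \<bullet> (p - q))\<^sup>2 = (G x \<bullet> p - G x \<bullet> q)\<^sup>2" "(G x \<bullet> (p - q))\<^sup>2 = (G x \<bullet> q - G x \<bullet> p)\<^sup>2" for x p q
    by (simp only: inner_diff_right) (simp only: inner_diff_right power2_commute[of "G x \<bullet> p"])
  consider "DIM('a) = 2" | "DIM('a) = 3" using dim by blast
  then show ?thesis
  proof cases
    case d2: 1
    have "card C = 3" using C(2) d2 by simp
    then obtain p0 p1 p2 where p: "C = {p0, p1, p2}" "distinct [p0, p1, p2]" by (auto simp: card_3_iff)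
    have ind: "\<not> affine_dependent {p0, p1, p2}" using C p by simp
    obtain \<beta>0 \<beta>1 \<beta>2 where \<beta>: "continuous_on UNIV \<beta>0" "continuous_on UNIV \<beta>1" "continuous_on UNIV \<beta>2"
      and b: "\<And>b0 b1 b2. b0 + b1 + b2 = 1 \<Longrightarrow> \<beta>0 (b0 *\<^sub>R p0 + b1 *\<^sub>R p1 + b2 *\<^sub>R p2) = b0 \<and>
      \<beta>1 (b0 *\<^sub>R p0 + b1 *\<^sub>R p1 + b2 *\<^sub>R p2) = b1 \<and> \<beta>2 (b0 *\<^sub>R p0 + b1 *\<^sub>R p1 + b2 *\<^sub>R p2) = b2"
      and n: "\<And>x. x \<in> T \<Longrightarrow> 0 \<le> \<beta>0 x \<and> 0 \<le> \<beta>1 x \<and> 0 \<le> \<beta>2 x \<and> \<beta>0 x + \<beta>1 x + \<beta>2 x = 1 \<and>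
        x = \<beta>0 x *\<^sub>R p0 + \<beta>1 x *\<^sub>R p1 + \<beta>2 x *\<^sub>R p2"
      by (rule triangle_barycentric[OF d2 ind p(2), folded p(1) C(4)]) (rule that, assumption+)
    define Q where "Q a b c \<beta>a \<beta>b \<beta>c x = \<beta>a x * \<beta>b x * (G x \<bullet> (a - b))\<^sup>2 / 2 +
        (\<beta>b x * \<beta>c x * (G x \<bullet> (b - c))\<^sup>2 + \<beta>a x * \<beta>c x * (G x \<bullet> (a - c))\<^sup>2) / 3" for a b c :: 'a and \<beta>a \<beta>b \<beta>c x
    \<comment> \<open>Cyclic orderings: each edge comes first once, with coefficient 1/2, and later
      twice, with 1/3. The sum is 7/6 times the variance, whence 7/24 for \<open>A\<close>
      below.\<close>
    define q where "q i = (if i = 0 then Q p0 p1 p2 \<beta>0 \<beta>1 \<beta>2 else if i = 1 then Q p1 p2 p0 \<beta>1 \<beta>2 \<beta>0 else Q p2 p0 p1 \<beta>2 \<beta>0 \<beta>1)" for i :: nat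
    have I0: "\<exists>c. (LINT x:T|lborel. (f x - c)\<^sup>2) \<le> (LINT x:T|lborel. Q p0 p1 p2 \<beta>0 \<beta>1 \<beta>2 x)"
      unfolding Q_def C(4) p(1) by (rule triangle_ineq(1)[OF d2 ind p(2) b \<beta> f G])
    have I1: "\<exists>c. (LINT x:T|lborel. (f x - c)\<^sup>2) \<le> (LINT x:T|lborel. Q p1 p2 p0 \<beta>1 \<beta>2 \<beta>0 x)"
    proof -
      have e: "{p0, p1, p2} = {p1, p2, p0}" by auto
      have bb: "\<beta>1 (b0 *\<^sub>R p1 + b1 *\<^sub>R p2 + b2 *\<^sub>R p0) = b0 \<and> \<beta>2 (b0 *\<^sub>R p1 + b1 *\<^sub>R p2 + b2 *\<^sub>R p0) = b1 \<and> \<beta>0 (b0 *\<^sub>R p1 + b1 *\<^sub>R p2 + b2 *\<^sub>R p0) = b2"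
        if "b0 + b1 + b2 = 1" for b0 b1 b2 using b[of b2 b0 b1] that by (simp add: add_ac)
      show ?thesis unfolding Q_def C(4) p(1) e
        by (rule triangle_ineq(1)[OF d2 ind[unfolded e] _ bb \<beta>(2,3,1) f G]) (use p(2) in auto)
    qed
    have I2: "\<exists>c. (LINT x:T|lborel. (f x - c)\<^sup>2) \<le> (LINT x:T|lborel. Q p2 p0 p1 \<beta>2 \<beta>0 \<beta>1 x)"
    proof -
      have e: "{p0, p1, p2} = {p2, p0, p1}" by auto
      have bb: "\<beta>2 (b0 *\<^sub>R p2 + b1 *\<^sub>R p0 + b2 *\<^sub>R p1) = b0 \<and> \<beta>0 (b0 *\<^sub>R p2 + b1 *\<^sub>R p0 + b2 *\<^sub>R p1) = b1 \<and> \<beta>1 (b0 *\<^sub>R p2 + b1 *\<^sub>R p0 + b2 *\<^sub>R p1) = b2"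
        if "b0 + b1 + b2 = 1" for b0 b1 b2 using b[of b1 b2 b0] that by (simp add: add_ac)
      show ?thesis unfolding Q_def C(4) p(1) e
        by (rule triangle_ineq(1)[OF d2 ind[unfolded e] _ bb \<beta>(3,1,2) f G]) (use p(2) in auto)
    qed
    show ?thesis
    proof (rule average_poincare[OF comp _ cf cn, where n=3 and Q=q and A="7/24"])
      show "0 < measure lborel T" unfolding C(4) p(1) by (rule triangle_setup[OF d2 ind p(2)])
      show "continuous_on T (q i)" for i
        unfolding q_def Q_def by (auto intro!: continuous_intros sub[OF G] sub[OF \<beta>(1)] sub[OF \<beta>(2)] sub[OF \<beta>(3)])
      show "\<exists>c. (LINT x:T|lborel. (f x - c)\<^sup>2) \<le> (LINT x:T|lborel. q i x)" for i
        using I0 I1 I2 by (simp add: q_def)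
      fix x assume x: "x \<in> T"
      let ?v0 = "G x \<bullet> p0" and ?v1 = "G x \<bullet> p1" and ?v2 = "G x \<bullet> p2"
      have "(\<Sum>i<3. q i x) = 7/6 * (\<beta>0 x * \<beta>1 x * (?v0 - ?v1)\<^sup>2 + \<beta>0 x * \<beta>2 x * (?v0 - ?v2)\<^sup>2 + \<beta>1 x * \<beta>2 x * (?v1 - ?v2)\<^sup>2)"
      proof -
        have "(\<Sum>i<3. q i x) = Q p0 p1 p2 \<beta>0 \<beta>1 \<beta>2 x + Q p1 p2 p0 \<beta>1 \<beta>2 \<beta>0 x + Q p2 p0 p1 \<beta>2 \<beta>0 \<beta>1 x"
          by (simp add: q_def eval_nat_numeral)
        then show ?thesis
          unfolding Q_def cm(1)[of x p0 p1] cm(1)[of x p0 p2] cm(1)[of x p1 p2] cm(2)[of x p1 p0] cm(2)[of x p2 p0] cm(2)[of x p2 p1]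
          by (simp add: field_simps)
      qed
      also have "\<dots> \<le> 7/6 * ((norm (norm (G x) * diameter T))\<^sup>2 / 4)"
        \<comment> \<open>The fourth value is a copy of \<open>?v0\<close> with weight 0.\<close>
        using popoviciu4[of "\<beta>0 x" "\<beta>1 x" "\<beta>2 x" 0 ?v0 ?v1 "norm (norm (G x) * diameter T)" ?v2 ?v0] n[OF x] vd[of p0 p1 x] vd[of p0 p2 x] vd[of p1 p2 x] vd[of p0 p0 x] vd[of p1 p0 x] vd[of p2 p0 x] p(1)
        by (intro mult_left_mono) (simp_all del: norm_mult)
      finally show "(\<Sum>i<3. q i x) \<le> 7/24 * (norm (norm (G x) * diameter T))\<^sup>2" by simp
    qed (use pi_sq_bounds in auto)
  next
    case d3: 2
    have c4: "card C = 4" using C(2) d3 by simp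
    then obtain p3 where p3: "p3 \<in> C" by fastforce
    then have "card (C - {p3}) = 3" using c4 C(3) by simp
    then obtain p0 p1 p2 where "C - {p3} = {p0, p1, p2}" "p0 \<noteq> p1" "p1 \<noteq> p2" "p0 \<noteq> p2" by (auto simp: card_3_iff)
    then have p: "C = {p0, p1, p2, p3}" "distinct [p0, p1, p2, p3]" using p3 by auto
    have ind: "\<not> affine_dependent {p0, p1, p2, p3}" using C p by simp
    obtain \<beta>0 \<beta>1 \<beta>2 \<beta>3 where \<beta>: "continuous_on UNIV \<beta>0" "continuous_on UNIV \<beta>1" "continuous_on UNIV \<beta>2" "continuous_on UNIV \<beta>3"
      and b: "\<And>b0 b1 b2 b3. b0 + b1 + b2 + b3 = 1 \<Longrightarrow>
      \<beta>0 (b0 *\<^sub>R p0 + b1 *\<^sub>R p1 + b2 *\<^sub>R p2 + b3 *\<^sub>R p3) = b0 \<and> \<beta>1 (b0 *\<^sub>R p0 + b1 *\<^sub>R p1 + b2 *\<^sub>R p2 + b3 *\<^sub>R p3) = b1 \<and>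
      \<beta>2 (b0 *\<^sub>R p0 + b1 *\<^sub>R p1 + b2 *\<^sub>R p2 + b3 *\<^sub>R p3) = b2 \<and> \<beta>3 (b0 *\<^sub>R p0 + b1 *\<^sub>R p1 + b2 *\<^sub>R p2 + b3 *\<^sub>R p3) = b3"
      and n: "\<And>x. x \<in> T \<Longrightarrow> 0 \<le> \<beta>0 x \<and> 0 \<le> \<beta>1 x \<and> 0 \<le> \<beta>2 x \<and> 0 \<le> \<beta>3 x \<and> \<beta>0 x + \<beta>1 x + \<beta>2 x + \<beta>3 x = 1 \<and>
        x = \<beta>0 x *\<^sub>R p0 + \<beta>1 x *\<^sub>R p1 + \<beta>2 x *\<^sub>R p2 + \<beta>3 x *\<^sub>R p3"
      by (rule tetrahedron_barycentric[OF d3 ind p(2), folded p(1) C(4)]) (rule that, assumption+)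
    define Q where "Q a b c d \<beta>a \<beta>b \<beta>c \<beta>d x = \<beta>a x * \<beta>b x * (G x \<bullet> (a - b))\<^sup>2 / 2 +
        (\<beta>b x * \<beta>c x * (G x \<bullet> (b - c))\<^sup>2 + \<beta>a x * \<beta>c x * (G x \<bullet> (a - c))\<^sup>2) / 3 +
        (\<beta>c x * \<beta>d x * (G x \<bullet> (c - d))\<^sup>2 + \<beta>b x * \<beta>d x * (G x \<bullet> (b - d))\<^sup>2 + \<beta>a x * \<beta>d x * (G x \<bullet> (a - d))\<^sup>2) / 4"
      for a b c d :: 'a and \<beta>a \<beta>b \<beta>c \<beta>d x
    \<comment> \<open>Two orderings suffice. The edges \<open>p0 p1\<close> and \<open>p2 p3\<close>
      collect 1/2 + 1/4 and all other edges less, so the sum is at most 3/4 of the variance, whence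
      3/16 for \<open>A\<close> below.\<close>
    define q where "q i = (if i = 0 then Q p0 p1 p2 p3 \<beta>0 \<beta>1 \<beta>2 \<beta>3 else Q p2 p3 p0 p1 \<beta>2 \<beta>3 \<beta>0 \<beta>1)" for i :: nat
    have I0: "\<exists>c. (LINT x:T|lborel. (f x - c)\<^sup>2) \<le> (LINT x:T|lborel. Q p0 p1 p2 p3 \<beta>0 \<beta>1 \<beta>2 \<beta>3 x)"
      unfolding Q_def C(4) p(1) by (rule tetrahedron_ineq(1)[OF d3 ind p(2) b \<beta> f G])
    have I1: "\<exists>c. (LINT x:T|lborel. (f x - c)\<^sup>2) \<le> (LINT x:T|lborel. Q p2 p3 p0 p1 \<beta>2 \<beta>3 \<beta>0 \<beta>1 x)"
    proof -
      have e: "{p0, p1, p2, p3} = {p2, p3, p0, p1}" by auto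
      have bb: "\<beta>2 (b0 *\<^sub>R p2 + b1 *\<^sub>R p3 + b2 *\<^sub>R p0 + b3 *\<^sub>R p1) = b0 \<and> \<beta>3 (b0 *\<^sub>R p2 + b1 *\<^sub>R p3 + b2 *\<^sub>R p0 + b3 *\<^sub>R p1) = b1 \<and> \<beta>0 (b0 *\<^sub>R p2 + b1 *\<^sub>R p3 + b2 *\<^sub>R p0 + b3 *\<^sub>R p1) = b2 \<and> \<beta>1 (b0 *\<^sub>R p2 + b1 *\<^sub>R p3 + b2 *\<^sub>R p0 + b3 *\<^sub>R p1) = b3"
        if "b0 + b1 + b2 + b3 = 1" for b0 b1 b2 b3 using b[of b2 b3 b0 b1] that by (simp add: add_ac)
      show ?thesis unfolding Q_def C(4) p(1) e
        by (rule tetrahedron_ineq(1)[OF d3 ind[unfolded e] _ bb \<beta>(3,4,1,2) f G]) (use p(2) in auto)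
    qed
    show ?thesis
    proof (rule average_poincare[OF comp _ cf cn, where n=2 and Q=q and A="3/16"])
      show "0 < measure lborel T" unfolding C(4) p(1) by (rule tetrahedron_setup[OF d3 ind p(2)])
      show "continuous_on T (q i)" for i
        unfolding q_def Q_def by (auto intro!: continuous_intros sub[OF G] sub[OF \<beta>(1)] sub[OF \<beta>(2)] sub[OF \<beta>(3)] sub[OF \<beta>(4)])
      show "\<exists>c. (LINT x:T|lborel. (f x - c)\<^sup>2) \<le> (LINT x:T|lborel. q i x)" for i
        using I0 I1 by (simp add: q_def)
      fix x assume x: "x \<in> T"
      let ?v0 = "G x \<bullet> p0" and ?v1 = "G x \<bullet> p1" and ?v2 = "G x \<bullet> p2" and ?v3 = "G x \<bullet> p3"
      define S where "S = \<beta>0 x * \<beta>1 x * (?v0 - ?v1)\<^sup>2 + \<beta>0 x * \<beta>2 x * (?v0 - ?v2)\<^sup>2 +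
          \<beta>0 x * \<beta>3 x * (?v0 - ?v3)\<^sup>2 + \<beta>1 x * \<beta>2 x * (?v1 - ?v2)\<^sup>2 + \<beta>1 x * \<beta>3 x * (?v1 - ?v3)\<^sup>2 + \<beta>2 x * \<beta>3 x * (?v2 - ?v3)\<^sup>2"
      have "(\<Sum>i<2. q i x) \<le> 3/4 * S"
      proof -
        have "(\<Sum>i<2. q i x) = Q p0 p1 p2 p3 \<beta>0 \<beta>1 \<beta>2 \<beta>3 x + Q p2 p3 p0 p1 \<beta>2 \<beta>3 \<beta>0 \<beta>1 x"
          by (simp add: q_def eval_nat_numeral)
        also have "\<dots> = 3/4 * S - (\<beta>0 x * \<beta>2 x * (?v0 - ?v2)\<^sup>2 / 12 + \<beta>0 x * \<beta>3 x * (?v0 - ?v3)\<^sup>2 / 6 +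
            \<beta>1 x * \<beta>2 x * (?v1 - ?v2)\<^sup>2 / 6 + \<beta>1 x * \<beta>3 x * (?v1 - ?v3)\<^sup>2 / 4)"
          unfolding Q_def S_def cm(1)[of x p0 p1] cm(1)[of x p0 p2] cm(1)[of x p1 p2] cm(1)[of x p0 p3] cm(1)[of x p1 p3] cm(1)[of x p2 p3]
            cm(2)[of x p2 p0] cm(2)[of x p2 p1] cm(2)[of x p3 p0] cm(2)[of x p3 p1]
          by (simp add: field_simps)
        also have "\<dots> \<le> 3/4 * S"
        proof -
          have "0 \<le> (\<beta>0 x * \<beta>2 x * (?v0 - ?v2)\<^sup>2 / 12 + \<beta>0 x * \<beta>3 x * (?v0 - ?v3)\<^sup>2 / 6 +
            \<beta>1 x * \<beta>2 x * (?v1 - ?v2)\<^sup>2 / 6 + \<beta>1 x * \<beta>3 x * (?v1 - ?v3)\<^sup>2 / 4)"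
            using n[OF x] by (intro add_nonneg_nonneg divide_nonneg_nonneg mult_nonneg_nonneg) auto
          then show ?thesis by linarith
        qed
        finally show ?thesis .
      qed
      also have "\<dots> \<le> 3/4 * ((norm (norm (G x) * diameter T))\<^sup>2 / 4)" unfolding S_def
        using n[OF x] p(1) by (intro mult_left_mono popoviciu4 vd) auto
      finally show "(\<Sum>i<2. q i x) \<le> 3/16 * (norm (norm (G x) * diameter T))\<^sup>2" by simp
    qed (use pi_sq_bounds in auto)
  qed
qed

text \<open>All barycentric coordinates have the same integral \<open>K\<close>, because any vertex
  can be put in first place without changing the formula for it. Writing \<open>x\<close> and 1 in
  these coordinates gives the integral of \<open>x\<close> and the volume, and their quotient is the
  mean of the vertices.\<close>

lemma simplex_centroid:
  fixes T :: "'a::euclidean_space set"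
  assumes dim: "DIM('a) \<in> {2, 3}" and T: "int DIM('a) simplex T"
  shows "(LINT x:T|lborel. (x - barycentre T) \<bullet> a) = 0"
proof -
  obtain C where C: "\<not> affine_dependent C" "card C = DIM('a) + 1" "finite C" "T = convex hull C"
    using simplex_vertices[OF T] by metis
  have comp: "compact T" using C by (simp add: finite_imp_compact_convex_hull)
  have sub: "continuous_on A F" if "continuous_on UNIV F" for A and F :: "'a \<Rightarrow> 'b::topological_space"
    using that continuous_on_subset by blast
  \<comment> \<open>The zero function instantiates \<open>f\<close> in the lemmas from which the
    integral of a coordinate is read off.\<close>
  have f0: "((\<lambda>x. 0) has_derivative (\<lambda>h. 0 \<bullet> h)) (at x)" for x :: 'a by simp
  have c0: "continuous_on UNIV (\<lambda>x::'a. 0::'a)" by simp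
  have key: "\<exists>K. (LINT x:T|lborel. x \<bullet> a) = K * (\<Sum>p\<in>C. p \<bullet> a) \<and> measure lborel T = K * real (card C)"
  proof -
    consider "DIM('a) = 2" | "DIM('a) = 3" using dim by blast
    then show ?thesis
    proof cases
      case d2: 1
      have "card C = 3" using C(2) d2 by simp
      then obtain p0 p1 p2 where p: "C = {p0, p1, p2}" "distinct [p0, p1, p2]" by (auto simp: card_3_iff)
      have ind: "\<not> affine_dependent {p0, p1, p2}" using C p by simp
      obtain \<beta>0 \<beta>1 \<beta>2 where \<beta>: "continuous_on UNIV \<beta>0" "continuous_on UNIV \<beta>1" "continuous_on UNIV \<beta>2"
        and b: "\<And>b0 b1 b2. b0 + b1 + b2 = 1 \<Longrightarrow> \<beta>0 (b0 *\<^sub>R p0 + b1 *\<^sub>R p1 + b2 *\<^sub>R p2) = b0 \<and>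
        \<beta>1 (b0 *\<^sub>R p0 + b1 *\<^sub>R p1 + b2 *\<^sub>R p2) = b1 \<and> \<beta>2 (b0 *\<^sub>R p0 + b1 *\<^sub>R p1 + b2 *\<^sub>R p2) = b2"
        and n: "\<And>x. x \<in> T \<Longrightarrow> 0 \<le> \<beta>0 x \<and> 0 \<le> \<beta>1 x \<and> 0 \<le> \<beta>2 x \<and> \<beta>0 x + \<beta>1 x + \<beta>2 x = 1 \<and>
          x = \<beta>0 x *\<^sub>R p0 + \<beta>1 x *\<^sub>R p1 + \<beta>2 x *\<^sub>R p2"
        by (rule triangle_barycentric[OF d2 ind p(2), folded p(1) C(4)]) (rule that, assumption+)
      define K where "K = measure lborel T / measure lborel triangle2 * (LINT z:triangle2|lborel. snd z)"
      have K0: "(LINT x:T|lborel. \<beta>0 x) = K"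
        unfolding K_def C(4) p(1) by (rule triangle_ineq(2)[OF d2 ind p(2) b \<beta> f0 c0])
      have K1: "(LINT x:T|lborel. \<beta>1 x) = K"
      proof -
        have e: "{p0, p1, p2} = {p1, p2, p0}" by auto
        have bb: "\<beta>1 (b0 *\<^sub>R p1 + b1 *\<^sub>R p2 + b2 *\<^sub>R p0) = b0 \<and> \<beta>2 (b0 *\<^sub>R p1 + b1 *\<^sub>R p2 + b2 *\<^sub>R p0) = b1 \<and>
          \<beta>0 (b0 *\<^sub>R p1 + b1 *\<^sub>R p2 + b2 *\<^sub>R p0) = b2" if "b0 + b1 + b2 = 1" for b0 b1 b2
          using b[of b2 b0 b1] that by (simp add: add_ac)
        show ?thesis unfolding K_def C(4) p(1) e
          by (rule triangle_ineq(2)[OF d2 ind[unfolded e] _ bb \<beta>(2,3,1) f0 c0]) (use p(2) in auto)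
      qed
      have K2: "(LINT x:T|lborel. \<beta>2 x) = K"
      proof -
        have e: "{p0, p1, p2} = {p2, p0, p1}" by auto
        have bb: "\<beta>2 (b0 *\<^sub>R p2 + b1 *\<^sub>R p0 + b2 *\<^sub>R p1) = b0 \<and> \<beta>0 (b0 *\<^sub>R p2 + b1 *\<^sub>R p0 + b2 *\<^sub>R p1) = b1 \<and>
          \<beta>1 (b0 *\<^sub>R p2 + b1 *\<^sub>R p0 + b2 *\<^sub>R p1) = b2" if "b0 + b1 + b2 = 1" for b0 b1 b2
          using b[of b1 b2 b0] that by (simp add: add_ac)
        show ?thesis unfolding K_def C(4) p(1) e
          by (rule triangle_ineq(2)[OF d2 ind[unfolded e] _ bb \<beta>(3,1,2) f0 c0]) (use p(2) in auto)
      qed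
      have lin: "(LINT x:T|lborel. \<beta>0 x * u + \<beta>1 x * v + \<beta>2 x * w) = K * u + K * v + K * w" for u v w
      proof -
        have i: "set_integrable lborel T (\<lambda>x. \<beta>0 x * u)" "set_integrable lborel T (\<lambda>x. \<beta>1 x * v)" "set_integrable lborel T (\<lambda>x. \<beta>2 x * w)"
          by (intro set_integrable_compact comp continuous_intros sub[OF \<beta>(1)] sub[OF \<beta>(2)] sub[OF \<beta>(3)])+
        show ?thesis
          by (subst set_integral_add(2)[OF set_integral_add(1)[OF i(1,2)] i(3)], subst set_integral_add(2)[OF i(1,2)])
            (simp add: K0 K1 K2)
      qed
      have "(LINT x:T|lborel. x \<bullet> a) = (LINT x:T|lborel. \<beta>0 x * (p0 \<bullet> a) + \<beta>1 x * (p1 \<bullet> a) + \<beta>2 x * (p2 \<bullet> a))"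
      proof (rule set_lebesgue_integral_cong)
        have "x \<bullet> a = \<beta>0 x * (p0 \<bullet> a) + \<beta>1 x * (p1 \<bullet> a) + \<beta>2 x * (p2 \<bullet> a)" if "x \<in> T" for x
          using n[OF that] by (metis inner_add_left inner_scaleR_left)
        then show "\<forall>x. x \<in> T \<longrightarrow> x \<bullet> a = \<beta>0 x * (p0 \<bullet> a) + \<beta>1 x * (p1 \<bullet> a) + \<beta>2 x * (p2 \<bullet> a)" by blast
      qed (use comp in \<open>simp add: borel_compact\<close>)
      also have "\<dots> = K * (\<Sum>p\<in>C. p \<bullet> a)" unfolding lin using p by (simp add: algebra_simps)
      finally have 1: "(LINT x:T|lborel. x \<bullet> a) = K * (\<Sum>p\<in>C. p \<bullet> a)" .
      have "(LINT x:T|lborel. 1) = (LINT x:T|lborel. \<beta>0 x * 1 + \<beta>1 x * 1 + \<beta>2 x * 1)"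
        by (rule set_lebesgue_integral_cong) (use comp n in \<open>auto simp: borel_compact\<close>)
      then have "measure lborel T = K * real (card C)"
        unfolding lin using p comp by (simp add: set_integral_const_compact)
      with 1 show ?thesis by blast
    next
      case d3: 2
      have c4: "card C = 4" using C(2) d3 by simp
      then obtain p3 where p3: "p3 \<in> C" by fastforce
      then have "card (C - {p3}) = 3" using c4 C(3) by simp
      then obtain p0 p1 p2 where "C - {p3} = {p0, p1, p2}" "p0 \<noteq> p1" "p1 \<noteq> p2" "p0 \<noteq> p2" by (auto simp: card_3_iff)
      then have p: "C = {p0, p1, p2, p3}" "distinct [p0, p1, p2, p3]" using p3 by auto
      have ind: "\<not> affine_dependent {p0, p1, p2, p3}" using C p by simp
      obtain \<beta>0 \<beta>1 \<beta>2 \<beta>3 where \<beta>: "continuous_on UNIV \<beta>0" "continuous_on UNIV \<beta>1" "continuous_on UNIV \<beta>2" "continuous_on UNIV \<beta>3"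
        and b: "\<And>b0 b1 b2 b3. b0 + b1 + b2 + b3 = 1 \<Longrightarrow>
        \<beta>0 (b0 *\<^sub>R p0 + b1 *\<^sub>R p1 + b2 *\<^sub>R p2 + b3 *\<^sub>R p3) = b0 \<and> \<beta>1 (b0 *\<^sub>R p0 + b1 *\<^sub>R p1 + b2 *\<^sub>R p2 + b3 *\<^sub>R p3) = b1 \<and>
        \<beta>2 (b0 *\<^sub>R p0 + b1 *\<^sub>R p1 + b2 *\<^sub>R p2 + b3 *\<^sub>R p3) = b2 \<and> \<beta>3 (b0 *\<^sub>R p0 + b1 *\<^sub>R p1 + b2 *\<^sub>R p2 + b3 *\<^sub>R p3) = b3"
        and n: "\<And>x. x \<in> T \<Longrightarrow> 0 \<le> \<beta>0 x \<and> 0 \<le> \<beta>1 x \<and> 0 \<le> \<beta>2 x \<and> 0 \<le> \<beta>3 x \<and> \<beta>0 x + \<beta>1 x + \<beta>2 x + \<beta>3 x = 1 \<and>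
          x = \<beta>0 x *\<^sub>R p0 + \<beta>1 x *\<^sub>R p1 + \<beta>2 x *\<^sub>R p2 + \<beta>3 x *\<^sub>R p3"
        by (rule tetrahedron_barycentric[OF d3 ind p(2), folded p(1) C(4)]) (rule that, assumption+)
      define K where "K = measure lborel T / measure lborel tetrahedron3 * (LINT z:tetrahedron3|lborel. snd (snd z))"
      have K: "(LINT x:T|lborel. \<gamma>0 x) = K"
        if e: "{p0, p1, p2, p3} = {q0, q1, q2, q3}" and d: "distinct [q0, q1, q2, q3]"
          and c: "continuous_on UNIV \<gamma>0" "continuous_on UNIV \<gamma>1" "continuous_on UNIV \<gamma>2" "continuous_on UNIV \<gamma>3"
          and bb: "\<And>b0 b1 b2 b3. b0 + b1 + b2 + b3 = 1 \<Longrightarrow>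
        \<gamma>0 (b0 *\<^sub>R q0 + b1 *\<^sub>R q1 + b2 *\<^sub>R q2 + b3 *\<^sub>R q3) = b0 \<and> \<gamma>1 (b0 *\<^sub>R q0 + b1 *\<^sub>R q1 + b2 *\<^sub>R q2 + b3 *\<^sub>R q3) = b1 \<and>
        \<gamma>2 (b0 *\<^sub>R q0 + b1 *\<^sub>R q1 + b2 *\<^sub>R q2 + b3 *\<^sub>R q3) = b2 \<and> \<gamma>3 (b0 *\<^sub>R q0 + b1 *\<^sub>R q1 + b2 *\<^sub>R q2 + b3 *\<^sub>R q3) = b3"
        for q0 q1 q2 q3 \<gamma>0 \<gamma>1 \<gamma>2 \<gamma>3
        unfolding K_def C(4) p(1) e by (rule tetrahedron_ineq(2)[OF d3 ind[unfolded e] d bb c f0 c0])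
      have K0: "(LINT x:T|lborel. \<beta>0 x) = K" by (rule K[OF refl p(2) \<beta> b])
      have K1: "(LINT x:T|lborel. \<beta>1 x) = K"
      proof (rule K[of p1 p2 p3 p0 \<beta>1 \<beta>2 \<beta>3 \<beta>0])
        show "\<beta>1 (b0 *\<^sub>R p1 + b1 *\<^sub>R p2 + b2 *\<^sub>R p3 + b3 *\<^sub>R p0) = b0 \<and> \<beta>2 (b0 *\<^sub>R p1 + b1 *\<^sub>R p2 + b2 *\<^sub>R p3 + b3 *\<^sub>R p0) = b1 \<and> \<beta>3 (b0 *\<^sub>R p1 + b1 *\<^sub>R p2 + b2 *\<^sub>R p3 + b3 *\<^sub>R p0) = b2 \<and> \<beta>0 (b0 *\<^sub>R p1 + b1 *\<^sub>R p2 + b2 *\<^sub>R p3 + b3 *\<^sub>R p0) = b3"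
          if "b0 + b1 + b2 + b3 = 1" for b0 b1 b2 b3 using b[of b3 b0 b1 b2] that by (simp add: add_ac)
      qed (use p(2) \<beta> in auto)
      have K2: "(LINT x:T|lborel. \<beta>2 x) = K"
      proof (rule K[of p2 p3 p0 p1 \<beta>2 \<beta>3 \<beta>0 \<beta>1])
        show "\<beta>2 (b0 *\<^sub>R p2 + b1 *\<^sub>R p3 + b2 *\<^sub>R p0 + b3 *\<^sub>R p1) = b0 \<and> \<beta>3 (b0 *\<^sub>R p2 + b1 *\<^sub>R p3 + b2 *\<^sub>R p0 + b3 *\<^sub>R p1) = b1 \<and> \<beta>0 (b0 *\<^sub>R p2 + b1 *\<^sub>R p3 + b2 *\<^sub>R p0 + b3 *\<^sub>R p1) = b2 \<and> \<beta>1 (b0 *\<^sub>R p2 + b1 *\<^sub>R p3 + b2 *\<^sub>R p0 + b3 *\<^sub>R p1) = b3"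
          if "b0 + b1 + b2 + b3 = 1" for b0 b1 b2 b3 using b[of b2 b3 b0 b1] that by (simp add: add_ac)
      qed (use p(2) \<beta> in auto)
      have K3: "(LINT x:T|lborel. \<beta>3 x) = K"
      proof (rule K[of p3 p0 p1 p2 \<beta>3 \<beta>0 \<beta>1 \<beta>2])
        show "\<beta>3 (b0 *\<^sub>R p3 + b1 *\<^sub>R p0 + b2 *\<^sub>R p1 + b3 *\<^sub>R p2) = b0 \<and> \<beta>0 (b0 *\<^sub>R p3 + b1 *\<^sub>R p0 + b2 *\<^sub>R p1 + b3 *\<^sub>R p2) = b1 \<and> \<beta>1 (b0 *\<^sub>R p3 + b1 *\<^sub>R p0 + b2 *\<^sub>R p1 + b3 *\<^sub>R p2) = b2 \<and> \<beta>2 (b0 *\<^sub>R p3 + b1 *\<^sub>R p0 + b2 *\<^sub>R p1 + b3 *\<^sub>R p2) = b3"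
          if "b0 + b1 + b2 + b3 = 1" for b0 b1 b2 b3 using b[of b1 b2 b3 b0] that by (simp add: add_ac)
      qed (use p(2) \<beta> in auto)
      have lin: "(LINT x:T|lborel. \<beta>0 x * u + \<beta>1 x * v + \<beta>2 x * w + \<beta>3 x * r) = K * u + K * v + K * w + K * r" for u v w r
      proof -
        have i: "set_integrable lborel T (\<lambda>x. \<beta>0 x * u)" "set_integrable lborel T (\<lambda>x. \<beta>1 x * v)" "set_integrable lborel T (\<lambda>x. \<beta>2 x * w)"
          "set_integrable lborel T (\<lambda>x. \<beta>3 x * r)"
          by (intro set_integrable_compact comp continuous_intros sub[OF \<beta>(1)] sub[OF \<beta>(2)] sub[OF \<beta>(3)] sub[OF \<beta>(4)])+
        show ?thesis
          by (subst set_integral_add(2)[OF set_integral_add(1)[OF set_integral_add(1)[OF i(1,2)] i(3)] i(4)],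
              subst set_integral_add(2)[OF set_integral_add(1)[OF i(1,2)] i(3)], subst set_integral_add(2)[OF i(1,2)])
            (simp add: K0 K1 K2 K3)
      qed
      have "(LINT x:T|lborel. x \<bullet> a) = (LINT x:T|lborel. \<beta>0 x * (p0 \<bullet> a) + \<beta>1 x * (p1 \<bullet> a) + \<beta>2 x * (p2 \<bullet> a) + \<beta>3 x * (p3 \<bullet> a))"
      proof (rule set_lebesgue_integral_cong)
        have "x \<bullet> a = \<beta>0 x * (p0 \<bullet> a) + \<beta>1 x * (p1 \<bullet> a) + \<beta>2 x * (p2 \<bullet> a) + \<beta>3 x * (p3 \<bullet> a)" if "x \<in> T" for x
          using n[OF that] by (metis inner_add_left inner_scaleR_left)
        then show "\<forall>x. x \<in> T \<longrightarrow> x \<bullet> a = \<beta>0 x * (p0 \<bullet> a) + \<beta>1 x * (p1 \<bullet> a) + \<beta>2 x * (p2 \<bullet> a) + \<beta>3 x * (p3 \<bullet> a)" by blast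
      qed (use comp in \<open>simp add: borel_compact\<close>)
      also have "\<dots> = K * (\<Sum>p\<in>C. p \<bullet> a)" unfolding lin using p by (simp add: algebra_simps)
      finally have 1: "(LINT x:T|lborel. x \<bullet> a) = K * (\<Sum>p\<in>C. p \<bullet> a)" .
      have "(LINT x:T|lborel. 1) = (LINT x:T|lborel. \<beta>0 x * 1 + \<beta>1 x * 1 + \<beta>2 x * 1 + \<beta>3 x * 1)"
        by (rule set_lebesgue_integral_cong) (use comp n in \<open>auto simp: borel_compact\<close>)
      then have "measure lborel T = K * real (card C)"
        unfolding lin using p comp by (simp add: set_integral_const_compact)
      with 1 show ?thesis by blast
    qed
  qed
  then obtain K where K: "(LINT x:T|lborel. x \<bullet> a) = K * (\<Sum>p\<in>C. p \<bullet> a)" "measure lborel T = K * real (card C)" by blast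
  have "(LINT x:T|lborel. (x - barycentre T) \<bullet> a) = (LINT x:T|lborel. x \<bullet> a - barycentre T \<bullet> a)"
    by (simp add: inner_diff_left)
  also have "\<dots> = (LINT x:T|lborel. x \<bullet> a) - (LINT x:T|lborel. barycentre T \<bullet> a)"
    by (intro set_integral_diff set_integrable_compact comp continuous_intros)
  also have "\<dots> = 0"
  proof -
    have "barycentre T \<bullet> a = (\<Sum>p\<in>C. p \<bullet> a) / real (card C)"
      by (simp add: C(4) barycentre_convex_hull[OF C(1)] inner_sum_left divide_inverse)
    then show ?thesis using C(2) unfolding K(1) set_integral_const_compact[OF comp] K(2) by simp
  qed
  finally show ?thesis .
qed

section \<open>Triangulations\<close>

text \<open>Slits are excluded: below the graph near a boundary point lie points outside the closure
  of the domain. It follows later that the interior of an element, an open subset of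
  \<open>closure \<Omega>\<close>, lies in \<open>\<Omega>\<close>.\<close>

lemma lipschitz_boundary_interior_closure:
  fixes \<Omega> :: "'a::euclidean_space set"
  assumes "open \<Omega>" "lipschitz_boundary \<Omega>"
  shows "interior (closure \<Omega>) \<subseteq> \<Omega>"
proof
  fix x assume x: "x \<in> interior (closure \<Omega>)"
  show "x \<in> \<Omega>"
  proof (rule ccontr)
    assume "x \<notin> \<Omega>"
    then have "x \<in> frontier \<Omega>"
      using x interior_subset assms(1) by (auto simp: frontier_def interior_open)
    then obtain e r L \<gamma> where e: "norm e = 1" "r > 0" "L-lipschitz_on {y. y \<bullet> e = 0} (\<gamma> :: 'a \<Rightarrow> real)"
      and g: "\<And>y. y \<in> ball x r \<Longrightarrow> y \<in> \<Omega> \<longleftrightarrow> \<gamma> (y - (y \<bullet> e) *\<^sub>R e) < y \<bullet> e"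
      using assms(2) unfolding lipschitz_boundary_def by blast
    have ee: "e \<bullet> e = 1" using e(1) by (simp add: dot_square_norm)
    have c\<gamma>: "continuous_on UNIV (\<lambda>y. \<gamma> (y - (y \<bullet> e) *\<^sub>R e))"
      by (rule continuous_on_compose2[OF lipschitz_on_continuous_on[OF e(3)]])
         (auto intro!: continuous_intros simp: inner_diff_left ee)
    define U where "U = ball x r \<inter> {y. y \<bullet> e < \<gamma> (y - (y \<bullet> e) *\<^sub>R e)}"
    have "open U" unfolding U_def
      by (intro open_Int open_ball open_Collect_less continuous_intros c\<gamma>)
    moreover have "U \<inter> \<Omega> = {}" using g by (force simp: U_def)
    ultimately have U: "U \<inter> closure \<Omega> = {}" by (simp add: open_Int_closure_eq_empty)
    obtain d where d: "d > 0" "ball x d \<subseteq> closure \<Omega>" using x by (auto simp: mem_interior)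
    define s where "s = min d r / 2"
    have s: "0 < s" "s < d" "s < r" using d(1) e(2) by (auto simp: s_def)
    \<comment> \<open>Moving against \<open>e\<close> keeps the projection, hence the value of
      \<open>\<gamma>\<close>, and lowers the height strictly below the graph.\<close>
    define y where "y = x - s *\<^sub>R e"
    have dist: "dist x y = s" using e(1) s(1) by (simp add: y_def dist_norm)
    have "\<not> \<gamma> (x - (x \<bullet> e) *\<^sub>R e) < x \<bullet> e" using g[of x] \<open>x \<notin> \<Omega>\<close> e(2) by simp
    moreover have "y - (y \<bullet> e) *\<^sub>R e = x - (x \<bullet> e) *\<^sub>R e"
      by (simp add: y_def inner_diff_left ee algebra_simps)
    moreover have "y \<bullet> e < x \<bullet> e" using s(1) by (simp add: y_def inner_diff_left ee)
    ultimately have "y \<in> U" using dist s by (simp add: U_def)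
    moreover have "y \<in> closure \<Omega>" using d(2) dist s by auto
    ultimately show False using U by blast
  qed
qed

section \<open>Restriction of integrals, square integrability and weak gradients to
  subdomains\<close>

lemma integrable_lebesgue_on_indicator:
  fixes f :: "'a::euclidean_space \<Rightarrow> 'b::euclidean_space"
  shows "S \<in> sets lebesgue \<Longrightarrow> integrable (lebesgue_on S) f \<longleftrightarrow> integrable lebesgue (\<lambda>x. indicator S x *\<^sub>R f x)"
  by (simp add: integrable_restrict_space)

lemma integral_lebesgue_on_indicator:
  fixes f :: "'a::euclidean_space \<Rightarrow> 'b::euclidean_space"
  shows "S \<in> sets lebesgue \<Longrightarrow> (\<integral>x. f x \<partial>lebesgue_on S) = (\<integral>x. indicator S x *\<^sub>R f x \<partial>lebesgue)"
  by (simp add: integral_restrict_space)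

lemma L2_space_subset:
  fixes f :: "'a::euclidean_space \<Rightarrow> 'b::euclidean_space"
  assumes "f \<in> L2_space S" "U \<subseteq> S" "U \<in> sets lebesgue" "S \<in> sets lebesgue"
  shows "f \<in> L2_space U"
proof -
  have "integrable lebesgue (\<lambda>x. indicator S x *\<^sub>R (norm (f x))\<^sup>2)"
    using assms(1) integrable_lebesgue_on_indicator[OF assms(4), of "\<lambda>x. (norm (f x))\<^sup>2"] by (simp add: L2_space_def)
  from integrable_mult_indicator[OF assms(3) this]
  have "integrable lebesgue (\<lambda>x. indicator U x *\<^sub>R (indicator S x *\<^sub>R (norm (f x))\<^sup>2))" .
  moreover have "indicator U x *\<^sub>R (indicator S x *\<^sub>R (norm (f x))\<^sup>2) = indicator U x *\<^sub>R (norm (f x))\<^sup>2" for x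
    using assms(2) by (auto simp: indicator_def)
  ultimately have "integrable (lebesgue_on U) (\<lambda>x. (norm (f x))\<^sup>2)"
    unfolding integrable_lebesgue_on_indicator[OF assms(3)] by (simp only:)
  moreover have "f \<in> borel_measurable (lebesgue_on U)"
    by (rule measurable_restrict_mono[OF _ assms(2)]) (use assms(1) in \<open>simp add: L2_space_def\<close>)
  ultimately show ?thesis by (simp add: L2_space_def)
qed

lemma weak_grad_subset:
  assumes "is_weak_grad S v G" "U \<subseteq> S" "open U" "open S"
  shows "is_weak_grad U v G"
proof -
  have m: "U \<in> sets lebesgue" "S \<in> sets lebesgue" using assms by auto
  have eq: "(\<integral>x. w x * \<psi> x \<partial>lebesgue_on U) = (\<integral>x. w x * \<psi> x \<partial>lebesgue_on S)"
    if \<psi>: "\<And>x. x \<notin> U \<Longrightarrow> \<psi> x = 0" for w \<psi> :: "'a \<Rightarrow> real"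
  proof -
    have "indicator U x *\<^sub>R (w x * \<psi> x) = indicator S x *\<^sub>R (w x * \<psi> x)" for x
      using \<psi>[of x] assms(2) by (cases "x \<in> U") (auto simp: indicator_def)
    then show ?thesis unfolding integral_lebesgue_on_indicator[OF m(1)] integral_lebesgue_on_indicator[OF m(2)] by (simp only:)
  qed
  have "(\<integral>x. v x * frechet_derivative \<phi> (at x) i \<partial>lebesgue_on U) = - (\<integral>x. (G x \<bullet> i) * \<phi> x \<partial>lebesgue_on U)"
    if phi: "\<phi> \<in> test_functions U" and i: "i \<in> Basis" for \<phi> i
  proof -
    obtain K where K: "K \<subseteq> U" "\<And>x. x \<notin> K \<Longrightarrow> \<phi> x = 0" "\<And>x. x \<notin> K \<Longrightarrow> classical_grad \<phi> x = 0"
      using phi by (elim test_functionsE) blast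
    have z: "frechet_derivative \<phi> (at x) i = 0" if x: "x \<notin> U" for x
    proof -
      have "x \<notin> K" using K(1) x by blast
      then show ?thesis using K(3)[of x] classical_grad_inner_Basis[OF i, of \<phi> x] by simp
    qed
    have "\<phi> \<in> test_functions S" using phi test_functions_mono[OF assms(2)] by blast
    then have "(\<integral>x. v x * frechet_derivative \<phi> (at x) i \<partial>lebesgue_on S) = - (\<integral>x. (G x \<bullet> i) * \<phi> x \<partial>lebesgue_on S)"
      using assms(1) i by (simp add: is_weak_grad_def)
    moreover have "\<phi> x = 0" if "x \<notin> U" for x using K(1,2) that by blast
    ultimately show ?thesis using z by (simp add: eq)
  qed
  then show ?thesis
    using assms(1) m assms(2) by (auto simp: is_weak_grad_def intro: L2_space_subset)
qed

lemma weak_grad_lincomb: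
  assumes v: "is_weak_grad S v G" and w: "is_weak_grad S w H" and S: "S \<in> sets lebesgue"
  shows "is_weak_grad S (\<lambda>x. v x + c * w x) (\<lambda>x. G x + c *\<^sub>R H x)"
proof -
  have L: "v \<in> L2_space S" "G \<in> L2_space S" "w \<in> L2_space S" "H \<in> L2_space S"
    using v w by (auto simp: is_weak_grad_def)
  have "(\<integral>x. (v x + c * w x) * frechet_derivative \<phi> (at x) i \<partial>lebesgue_on S) = - (\<integral>x. ((G x + c *\<^sub>R H x) \<bullet> i) * \<phi> x \<partial>lebesgue_on S)"
    if phi: "\<phi> \<in> test_functions S" and i: "i \<in> Basis" for \<phi> i
  proof -
    have p: "\<phi> \<in> L2_space S" "(\<lambda>x. frechet_derivative \<phi> (at x) i) \<in> L2_space S"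
      using test_functions_L2[OF phi S] L2_space_inner_const[of "classical_grad \<phi>" S i] i
      by (simp_all add: classical_grad_inner_Basis)
    have "(\<integral>x. (v x + c * w x) * frechet_derivative \<phi> (at x) i \<partial>lebesgue_on S) =
        L2_inner S (\<lambda>x. v x + c * w x) (\<lambda>x. frechet_derivative \<phi> (at x) i)" by (simp add: L2_inner_def)
    also have "\<dots> = (\<integral>x. v x * frechet_derivative \<phi> (at x) i \<partial>lebesgue_on S) + c * (\<integral>x. w x * frechet_derivative \<phi> (at x) i \<partial>lebesgue_on S)"
      using L p by (simp add: L2_inner_simps) (simp add: L2_inner_def)
    also have "\<dots> = - (\<integral>x. (G x \<bullet> i) * \<phi> x \<partial>lebesgue_on S) + c * - (\<integral>x. (H x \<bullet> i) * \<phi> x \<partial>lebesgue_on S)"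
      using v w phi i by (simp add: is_weak_grad_def)
    also have "\<dots> = - (L2_inner S (\<lambda>x. G x \<bullet> i) \<phi> + c * L2_inner S (\<lambda>x. H x \<bullet> i) \<phi>)" by (simp add: L2_inner_def)
    also have "\<dots> = - L2_inner S (\<lambda>x. (G x \<bullet> i) + c * (H x \<bullet> i)) \<phi>"
      using L p by (simp add: L2_inner_simps)
    finally show ?thesis by (simp add: L2_inner_def inner_add_left)
  qed
  then show ?thesis using L by (auto simp: is_weak_grad_def)
qed

section \<open>Meshes: null skeleton and splitting of integrals over the elements\<close>

locale mesh =
  fixes \<Omega> :: "'a::euclidean_space set" and \<T> :: "'a set set"
  assumes dim: "DIM('a) \<in> {2, 3}"
    and dom: "polyhedral_lipschitz_domain \<Omega>"
    and mesh: "conforming_triangulation \<Omega> \<T>"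
begin

lemma open_dom: "open \<Omega>" and bounded_dom: "bounded \<Omega>" and dom_nonempty: "\<Omega> \<noteq> {}"
  and lip_dom: "lipschitz_boundary \<Omega>"
  using dom by (auto simp: polyhedral_lipschitz_domain_def)

lemma dom_sets [simp]: "\<Omega> \<in> sets lebesgue"
  using open_dom by auto

lemma finite_mesh: "finite \<T>" and simplex_mesh: "T \<in> \<T> \<Longrightarrow> int DIM('a) simplex T"
  and Union_mesh: "\<Union>\<T> = closure \<Omega>"
  and face_mesh: "T \<in> \<T> \<Longrightarrow> T' \<in> \<T> \<Longrightarrow> (T \<inter> T') face_of T"
  using mesh by (auto simp: conforming_triangulation_def triangulation_def)

lemma mesh_compact: "T \<in> \<T> \<Longrightarrow> compact T" and mesh_convex: "T \<in> \<T> \<Longrightarrow> convex T"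
  and mesh_polytope: "T \<in> \<T> \<Longrightarrow> polytope T"
  using simplex_imp_polytope[OF simplex_mesh]
  by (auto simp: polytope_imp_compact polytope_imp_convex)

lemma mesh_interior_nonempty: "T \<in> \<T> \<Longrightarrow> interior T \<noteq> {}"
  using aff_dim_simplex[OF simplex_mesh, of T] mesh_convex[of T]
  by (auto simp: interior_rel_interior_gen rel_interior_eq_empty)

lemma interior_mesh_sets [simp]: "interior T \<in> sets lebesgue" "interior T \<in> sets borel"
  by (auto simp: borel_open)

lemma interior_mesh_subset: "T \<in> \<T> \<Longrightarrow> interior T \<subseteq> \<Omega>"
  using lipschitz_boundary_interior_closure[OF open_dom lip_dom] Union_mesh
  by (metis Union_upper interior_mono order_trans)

lemma interior_mesh_bounded: "T \<in> \<T> \<Longrightarrow> bounded (interior T)"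
  using mesh_compact compact_imp_bounded bounded_interior by blast

text \<open>The intersection is a face of both elements, and a proper face misses the
  interior.\<close>

lemma interior_mesh_disjoint:
  assumes "T \<in> \<T>" "T' \<in> \<T>" "T \<noteq> T'"
  shows "interior T \<inter> interior T' = {}"
proof (cases "T \<inter> T' = T")
  case True
  then have "T face_of T'" using face_mesh[OF assms(2,1)] by (simp add: Int_commute)
  then have "T \<inter> interior T' = {}" using assms(3) by (rule face_of_disjoint_interior)
  then show ?thesis using interior_subset by blast
next
  case False
  then have "(T \<inter> T') \<inter> interior T = {}" using face_mesh[OF assms(1,2)] by (intro face_of_disjoint_interior)
  then show ?thesis using interior_subset by blast
qed

lemma skeleton_null: "AE x in lebesgue. \<forall>T\<in>\<T>. x \<in> T \<longrightarrow> x \<in> interior T"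
proof (subst AE_ball_countable)
  show "countable \<T>" using finite_mesh by (rule countable_finite)
  show "\<forall>T\<in>\<T>. AE x in lebesgue. x \<in> T \<longrightarrow> x \<in> interior T"
  proof
    fix T assume T: "T \<in> \<T>"
    have "AE x in lebesgue. x \<notin> frontier T"
      using negligible_convex_frontier[OF mesh_convex[OF T]] by (intro AE_not_in) (simp add: negligible_iff_null_sets)
    then show "AE x in lebesgue. x \<in> T \<longrightarrow> x \<in> interior T"
      by eventually_elim (use closure_subset in \<open>auto simp: frontier_def\<close>)
  qed
qed

lemma AE_mesh: "AE x in lebesgue. x \<in> \<Omega> \<longrightarrow> (\<exists>T\<in>\<T>. x \<in> interior T)"
proof -
  have "\<Omega> \<subseteq> \<Union>\<T>" using Union_mesh closure_subset[of \<Omega>] by simp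
  then show ?thesis using skeleton_null by (auto elim!: eventually_mono)
qed

lemma AE_domI:
  assumes "\<And>T. T \<in> \<T> \<Longrightarrow> AE x in lebesgue_on (interior T). P x"
  shows "AE x in lebesgue_on \<Omega>. P x"
proof -
  have "AE x in lebesgue. \<forall>T\<in>\<T>. x \<in> interior T \<longrightarrow> P x"
    using assms by (subst AE_ball_countable) (auto simp: AE_restrict_space_iff finite_mesh countable_finite)
  with AE_mesh have "AE x in lebesgue. x \<in> \<Omega> \<longrightarrow> P x" by eventually_elim blast
  then show ?thesis by (simp add: AE_restrict_space_iff)
qed

lemma AE_domI_interior:
  assumes "\<And>T x. T \<in> \<T> \<Longrightarrow> x \<in> interior T \<Longrightarrow> P x"
  shows "AE x in lebesgue_on \<Omega>. P x"
  using assms by (intro AE_domI AE_I2) auto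

lemma AE_domD:
  assumes "AE x in lebesgue_on \<Omega>. P x" "T \<in> \<T>"
  shows "AE x in lebesgue_on (interior T). P x"
proof -
  have "AE x in lebesgue. x \<in> \<Omega> \<longrightarrow> P x" using assms by (simp add: AE_restrict_space_iff)
  then have "AE x in lebesgue. x \<in> interior T \<longrightarrow> P x"
    by eventually_elim (use interior_mesh_subset[OF assms(2)] in blast)
  then show ?thesis by (simp add: AE_restrict_space_iff)
qed

lemma indicator_split:
  fixes f :: "'a \<Rightarrow> 'b::euclidean_space"
  shows "AE x in lebesgue. indicator \<Omega> x *\<^sub>R f x = (\<Sum>T\<in>\<T>. indicator (interior T) x *\<^sub>R f x)"
  using AE_mesh
proof eventually_elim
  fix x assume x: "x \<in> \<Omega> \<longrightarrow> (\<exists>T\<in>\<T>. x \<in> interior T)"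
  show "indicator \<Omega> x *\<^sub>R f x = (\<Sum>T\<in>\<T>. indicator (interior T) x *\<^sub>R f x)"
  proof (cases "x \<in> \<Omega>")
    case True
    then obtain T where T: "T \<in> \<T>" "x \<in> interior T" using x by blast
    have "(\<Sum>T'\<in>\<T>. indicator (interior T') x *\<^sub>R f x) = (\<Sum>T'\<in>\<T>. if T' = T then f x else 0)"
      using T interior_mesh_disjoint by (intro sum.cong refl) (auto simp: indicator_def)
    then show ?thesis using True T finite_mesh by simp
  next
    case False
    have "(\<Sum>T\<in>\<T>. indicator (interior T) x *\<^sub>R f x) = 0"
    proof (intro sum.neutral ballI)
      fix T assume "T \<in> \<T>"
      then have "x \<notin> interior T" using interior_mesh_subset False by blast
      then show "indicator (interior T) x *\<^sub>R f x = 0" by simp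
    qed
    then show ?thesis using False by simp
  qed
qed

lemma integral_split:
  fixes f :: "'a \<Rightarrow> 'b::euclidean_space"
  assumes "\<And>T. T \<in> \<T> \<Longrightarrow> integrable (lebesgue_on (interior T)) f"
  shows "integrable (lebesgue_on \<Omega>) f" "(\<integral>x. f x \<partial>lebesgue_on \<Omega>) = (\<Sum>T\<in>\<T>. \<integral>x. f x \<partial>lebesgue_on (interior T))"
proof -
  have i: "integrable lebesgue (\<lambda>x. indicator (interior T) x *\<^sub>R f x)" if "T \<in> \<T>" for T
    using assms[OF that] by (simp add: integrable_lebesgue_on_indicator)
  then have s: "integrable lebesgue (\<lambda>x. \<Sum>T\<in>\<T>. indicator (interior T) x *\<^sub>R f x)" by simp
  have m: "(\<lambda>x. indicator \<Omega> x *\<^sub>R f x) \<in> borel_measurable lebesgue"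
    by (rule borel_measurable_AE[OF borel_measurable_integrable[OF s]])
      (use indicator_split[of f] in eventually_elim, simp)
  show "integrable (lebesgue_on \<Omega>) f"
    unfolding integrable_lebesgue_on_indicator[OF dom_sets]
    using s by (subst integrable_cong_AE[OF m borel_measurable_integrable[OF s] indicator_split])
  have "(\<integral>x. f x \<partial>lebesgue_on \<Omega>) = (\<integral>x. (\<Sum>T\<in>\<T>. indicator (interior T) x *\<^sub>R f x) \<partial>lebesgue)"
    unfolding integral_lebesgue_on_indicator[OF dom_sets]
    by (rule integral_cong_AE[OF m borel_measurable_integrable[OF s] indicator_split])
  also have "\<dots> = (\<Sum>T\<in>\<T>. \<integral>x. f x \<partial>lebesgue_on (interior T))"
    using i by (simp add: integral_lebesgue_on_indicator)
  finally show "(\<integral>x. f x \<partial>lebesgue_on \<Omega>) = (\<Sum>T\<in>\<T>. \<integral>x. f x \<partial>lebesgue_on (interior T))" .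
qed

end

lemma L2_space_bounded_mult:
  fixes f :: "'a::euclidean_space \<Rightarrow> 'b::euclidean_space"
  assumes "f \<in> L2_space S" "continuous_on UNIV m" "\<And>x. x \<in> S \<Longrightarrow> \<bar>m x\<bar> \<le> B"
  shows "(\<lambda>x. m x *\<^sub>R f x) \<in> L2_space S"
proof -
  have [measurable]: "f \<in> borel_measurable (lebesgue_on S)" using assms(1) by (simp add: L2_space_def)
  have [measurable]: "m \<in> borel_measurable (lebesgue_on S)"
    using assms(2) by (intro measurable_restrict_space1 measurable_completion) (simp add: borel_measurable_continuous_onI)
  have "integrable (lebesgue_on S) (\<lambda>x. (norm (m x *\<^sub>R f x))\<^sup>2)"
  proof (rule Bochner_Integration.integrable_bound[where f="\<lambda>x. B\<^sup>2 * (norm (f x))\<^sup>2"])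
    have "norm ((norm (m x *\<^sub>R f x))\<^sup>2) \<le> norm (B\<^sup>2 * (norm (f x))\<^sup>2)" if "x \<in> S" for x
      using power_mono[OF assms(3)[OF that] abs_ge_zero, of 2] by (simp add: power_mult_distrib mult_right_mono)
    then show "AE x in lebesgue_on S. norm ((norm (m x *\<^sub>R f x))\<^sup>2) \<le> norm (B\<^sup>2 * (norm (f x))\<^sup>2)"
      by (intro AE_I2) simp
  qed (use assms(1) in \<open>auto simp: L2_space_def\<close>)
  then show ?thesis by (simp add: L2_space_def)
qed

lemma L2_space_cong:
  assumes "f \<in> L2_space S" "\<And>x. x \<in> S \<Longrightarrow> f x = g x"
  shows "g \<in> L2_space S"
proof -
  have "g \<in> borel_measurable (lebesgue_on S)"
    using assms by (subst measurable_cong[where g=f]) (auto simp: L2_space_def)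
  moreover have "integrable (lebesgue_on S) (\<lambda>x. (norm (g x))\<^sup>2)"
    using assms by (subst Bochner_Integration.integrable_cong[OF refl, where g="\<lambda>x. (norm (f x))\<^sup>2"]) (auto simp: L2_space_def)
  ultimately show ?thesis by (simp add: L2_space_def)
qed

lemma weak_grad_cong:
  assumes "is_weak_grad S v G" "\<And>x. x \<in> S \<Longrightarrow> G x = G' x"
  shows "is_weak_grad S v G'"
proof -
  have "(\<integral>x. (G x \<bullet> i) * \<phi> x \<partial>lebesgue_on S) = (\<integral>x. (G' x \<bullet> i) * \<phi> x \<partial>lebesgue_on S)" for i \<phi>
    by (rule Bochner_Integration.integral_cong) (auto simp: assms(2))
  then show ?thesis using assms L2_space_cong[of G S G'] by (simp add: is_weak_grad_def)
qed

section \<open>Broken gradients, piecewise functions and \<open>H01_space\<close>\<close>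

context mesh
begin

abbreviation L2 :: "('a \<Rightarrow> 'b::euclidean_space) set" where "L2 \<equiv> L2_space \<Omega>"
abbreviation ip :: "('a \<Rightarrow> 'b::euclidean_space) \<Rightarrow> ('a \<Rightarrow> 'b) \<Rightarrow> real" where "ip \<equiv> L2_inner \<Omega>"
abbreviation nrm :: "('a \<Rightarrow> 'b::euclidean_space) \<Rightarrow> real" where "nrm \<equiv> L2_norm \<Omega>"
abbreviation D :: "('a \<Rightarrow> real) \<Rightarrow> 'a \<Rightarrow> 'a" where "D \<equiv> broken_grad \<T>"
abbreviation P1 :: "('a \<Rightarrow> real) set" where "P1 \<equiv> conforming_P1 \<Omega> \<T>"
abbreviation CR :: "('a \<Rightarrow> real) set" where "CR \<equiv> crouzeix_raviart \<Omega> \<T>"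
abbreviation zCR :: "('a \<Rightarrow> real) \<Rightarrow> 'a \<Rightarrow> real" where "zCR \<equiv> CR_solution \<Omega> \<T>"
abbreviation flux :: "('a \<Rightarrow> real) \<Rightarrow> 'a \<Rightarrow> 'a" where "flux \<equiv> marini_flux \<Omega> \<T>"

text \<open>The common space of the conforming and the Crouzeix-Raviart functions, on which the
  energy form is defined. Its elements are functions and not classes, so the form has null
  vectors.\<close>

definition broken_H1 :: "('a \<Rightarrow> real) set" where
  "broken_H1 = {v. \<exists>G. is_broken_grad \<T> v G}"

definition piecewise :: "('a set \<Rightarrow> 'a \<Rightarrow> 'b::real_vector) \<Rightarrow> 'a \<Rightarrow> 'b" where
  "piecewise h x = (\<Sum>T\<in>\<T>. indicator (interior T) x *\<^sub>R h T x)"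

lemma piecewise_eq:
  assumes "T \<in> \<T>" "x \<in> interior T"
  shows "piecewise h x = h T x"
proof -
  have "piecewise h x = (\<Sum>T'\<in>\<T>. if T' = T then h T x else 0)"
    unfolding piecewise_def using assms interior_mesh_disjoint by (intro sum.cong refl) (auto simp: indicator_def)
  then show ?thesis using assms finite_mesh by simp
qed

lemma L2_domI:
  fixes f :: "'a \<Rightarrow> 'b::euclidean_space"
  assumes "\<And>T. T \<in> \<T> \<Longrightarrow> f \<in> L2_space (interior T)"
  shows "f \<in> L2"
proof -
  have "(\<lambda>x. \<Sum>T\<in>\<T>. indicator (interior T) x *\<^sub>R f x) \<in> borel_measurable lebesgue"
  proof (rule borel_measurable_sum)
    fix T assume "T \<in> \<T>"
    then have "(\<lambda>x. if x \<in> interior T then f x else 0) \<in> borel_measurable lebesgue"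
      using assms borel_measurable_if[of "interior T" f] by (simp add: L2_space_def)
    also have "(\<lambda>x. if x \<in> interior T then f x else 0) = (\<lambda>x. indicator (interior T) x *\<^sub>R f x)"
      by (auto simp: indicator_def)
    finally show "(\<lambda>x. indicator (interior T) x *\<^sub>R f x) \<in> borel_measurable lebesgue" .
  qed
  then have "(\<lambda>x. indicator \<Omega> x *\<^sub>R f x) \<in> borel_measurable lebesgue"
    by (rule borel_measurable_AE) (use indicator_split[of f] in eventually_elim, simp)
  also have "(\<lambda>x. indicator \<Omega> x *\<^sub>R f x) = (\<lambda>x. if x \<in> \<Omega> then f x else 0)" by (auto simp: indicator_def)
  finally have "f \<in> borel_measurable (lebesgue_on \<Omega>)" using borel_measurable_if[of \<Omega> f] by simp
  moreover have "integrable (lebesgue_on \<Omega>) (\<lambda>x. (norm (f x))\<^sup>2)"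
    using assms by (intro integral_split) (simp add: L2_space_def)
  ultimately show ?thesis by (simp add: L2_space_def)
qed

lemma L2_domD: "f \<in> L2 \<Longrightarrow> T \<in> \<T> \<Longrightarrow> (f :: 'a \<Rightarrow> 'b::euclidean_space) \<in> L2_space (interior T)"
  by (rule L2_space_subset[OF _ interior_mesh_subset]) auto

lemma L2_inner_split:
  fixes f g :: "'a \<Rightarrow> 'b::euclidean_space"
  assumes "f \<in> L2" "g \<in> L2"
  shows "ip f g = (\<Sum>T\<in>\<T>. L2_inner (interior T) f g)"
  unfolding L2_inner_def by (rule integral_split(2)) (use assms L2_domD L2_inner_integrable in blast)

lemma broken_grad_works: "v \<in> broken_H1 \<Longrightarrow> is_broken_grad \<T> v (D v)"
  by (auto simp: broken_H1_def broken_grad_def intro: someI_ex[of "is_broken_grad \<T> v"])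

lemma broken_grad_AE_interior:
  assumes "is_weak_grad (interior T) v G" "T \<in> \<T>" "v \<in> broken_H1"
  shows "AE x in lebesgue_on (interior T). D v x = G x"
  using assms broken_grad_works[OF assms(3)]
  by (intro weak_grad_unique[of _ v]) (auto simp: is_broken_grad_def interior_mesh_bounded)

lemma broken_grad_AE:
  assumes "is_broken_grad \<T> v G"
  shows "AE x in lebesgue_on \<Omega>. D v x = G x"
  using assms by (intro AE_domI broken_grad_AE_interior) (auto simp: is_broken_grad_def broken_H1_def)

lemma broken_H1_L2:
  assumes "v \<in> broken_H1"
  shows "v \<in> L2" "D v \<in> L2"
  using broken_grad_works[OF assms] by (auto simp: is_broken_grad_def is_weak_grad_def intro!: L2_domI)

lemma broken_H1_lincomb:
  assumes "v \<in> broken_H1" "w \<in> broken_H1"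
  shows "(\<lambda>x. v x + c * w x) \<in> broken_H1"
    and "AE x in lebesgue_on \<Omega>. D (\<lambda>x. v x + c * w x) x = D v x + c *\<^sub>R D w x"
proof -
  have "is_broken_grad \<T> (\<lambda>x. v x + c * w x) (\<lambda>x. D v x + c *\<^sub>R D w x)"
    using assms[THEN broken_grad_works] by (auto simp: is_broken_grad_def intro!: weak_grad_lincomb)
  then show "(\<lambda>x. v x + c * w x) \<in> broken_H1"
    and "AE x in lebesgue_on \<Omega>. D (\<lambda>x. v x + c * w x) x = D v x + c *\<^sub>R D w x"
    by (auto simp: broken_H1_def intro: broken_grad_AE)
qed

lemma pw_affine_broken_grad:
  assumes "\<And>T x. T \<in> \<T> \<Longrightarrow> x \<in> interior T \<Longrightarrow> v x = a T \<bullet> x + b T"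
  shows "is_broken_grad \<T> v (piecewise (\<lambda>T x. a T))"
  unfolding is_broken_grad_def
proof
  fix T assume T: "T \<in> \<T>"
  have "is_weak_grad (interior T) v (\<lambda>x. a T)"
    by (rule affine_weak_grad[OF open_interior interior_mesh_bounded[OF T] assms[OF T]])
  then show "is_weak_grad (interior T) v (piecewise (\<lambda>T x. a T))"
    by (rule weak_grad_cong) (simp add: piecewise_eq[OF T])
qed

lemma pw_affine_coeffs:
  assumes "v \<in> pw_affine \<T>"
  obtains a b where "\<And>T x. T \<in> \<T> \<Longrightarrow> x \<in> interior T \<Longrightarrow> v x = a T \<bullet> x + b T"
proof -
  have "\<forall>T\<in>\<T>. \<exists>ab. \<forall>x\<in>interior T. v x = fst ab \<bullet> x + snd ab"
    using assms by (fastforce simp: pw_affine_def)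
  from bchoice[OF this] obtain ab where "\<forall>T\<in>\<T>. \<forall>x\<in>interior T. v x = fst (ab T) \<bullet> x + snd (ab T)"
    by blast
  then show ?thesis using that[of "\<lambda>T. fst (ab T)" "\<lambda>T. snd (ab T)"] by blast
qed

lemma pw_affineE:
  assumes "v \<in> pw_affine \<T>"
  obtains a b where "\<And>T x. T \<in> \<T> \<Longrightarrow> x \<in> interior T \<Longrightarrow> v x = a T \<bullet> x + b T"
    "v \<in> broken_H1" "AE x in lebesgue_on \<Omega>. D v x = piecewise (\<lambda>T x. a T) x"
proof (rule pw_affine_coeffs[OF assms])
  fix a b assume ab: "\<And>T x. T \<in> \<T> \<Longrightarrow> x \<in> interior T \<Longrightarrow> v x = a T \<bullet> x + b T"
  have g: "is_broken_grad \<T> v (piecewise (\<lambda>T x. a T))" by (rule pw_affine_broken_grad[OF ab])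
  show ?thesis
  proof (rule that[of a b])
    show "v x = a T \<bullet> x + b T" if "T \<in> \<T>" "x \<in> interior T" for T x using that by (rule ab)
    show "v \<in> broken_H1" using g by (auto simp: broken_H1_def)
    show "AE x in lebesgue_on \<Omega>. D v x = piecewise (\<lambda>T x. a T) x" by (rule broken_grad_AE[OF g])
  qed
qed

lemma pw_affine_broken_H1: "v \<in> pw_affine \<T> \<Longrightarrow> v \<in> broken_H1"
  by (erule pw_affineE)

lemma pw_affine_lincomb:
  assumes "v \<in> pw_affine \<T>" "w \<in> pw_affine \<T>"
  shows "(\<lambda>x. v x + c * w x) \<in> pw_affine \<T>"
proof -
  obtain a b where v: "\<And>T x. T \<in> \<T> \<Longrightarrow> x \<in> interior T \<Longrightarrow> v x = a T \<bullet> x + b T" using pw_affine_coeffs[OF assms(1)] by blast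
  obtain a' b' where w: "\<And>T x. T \<in> \<T> \<Longrightarrow> x \<in> interior T \<Longrightarrow> w x = a' T \<bullet> x + b' T" using pw_affine_coeffs[OF assms(2)] by blast
  have "\<forall>x\<in>interior T. v x + c * w x = (a T + c *\<^sub>R a' T) \<bullet> x + (b T + c * b' T)" if "T \<in> \<T>" for T
    using v[OF that] w[OF that] by (simp add: inner_add_left algebra_simps)
  then show ?thesis unfolding pw_affine_def by blast
qed

text \<open>The global weak gradient restricts to each element and so is a broken gradient. This
  allows both kinds of solutions to be compared through the single operator
  \<open>D\<close>.\<close>

lemma H01_weak_grad:
  assumes "v \<in> H01_space \<Omega>"
  shows "is_weak_grad \<Omega> v (weak_grad \<Omega> v)" "v \<in> broken_H1"
    "AE x in lebesgue_on \<Omega>. D v x = weak_grad \<Omega> v x"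
proof -
  show g: "is_weak_grad \<Omega> v (weak_grad \<Omega> v)"
    using assms by (auto simp: H01_space_def H1_space_def weak_grad_def intro: someI_ex[of "is_weak_grad \<Omega> v"])
  have "is_broken_grad \<T> v (weak_grad \<Omega> v)"
    using weak_grad_subset[OF g interior_mesh_subset _ open_dom] by (auto simp: is_broken_grad_def)
  then show "v \<in> broken_H1" "AE x in lebesgue_on \<Omega>. D v x = weak_grad \<Omega> v x"
    by (auto simp: broken_H1_def intro: broken_grad_AE)
qed

lemma H01_weak_grad_L2: "v \<in> H01_space \<Omega> \<Longrightarrow> weak_grad \<Omega> v \<in> L2"
  using H01_weak_grad(1) by (auto simp: is_weak_grad_def)

lemma H01_inner_weak_grad:
  assumes "v \<in> H01_space \<Omega>" "w \<in> H01_space \<Omega>"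
  shows "ip (weak_grad \<Omega> v) (weak_grad \<Omega> w) = ip (D v) (D w)"
  using assms[THEN H01_weak_grad(3)] assms[THEN H01_weak_grad(2)] assms[THEN H01_weak_grad_L2]
  by (intro L2_inner_cong_AE) (auto simp: eq_commute intro: L2_space_measurable broken_H1_L2 elim: eventually_mono)

lemma test_functions_L2_dom:
  "\<phi> \<in> test_functions \<Omega> \<Longrightarrow> \<phi> \<in> L2" "\<phi> \<in> test_functions \<Omega> \<Longrightarrow> classical_grad \<phi> \<in> L2"
  by (auto intro: test_functions_L2)

lemma H01_approx:
  assumes "v \<in> H01_space \<Omega>" "0 < \<epsilon>"
  obtains \<phi> where "\<phi> \<in> test_functions \<Omega>" "nrm (\<lambda>x. v x - \<phi> x) < \<epsilon>"
    "nrm (\<lambda>x. D v x - classical_grad \<phi> x) < \<epsilon>"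
proof -
  obtain \<phi> where \<phi>: "\<phi> \<in> test_functions \<Omega>" "nrm (\<lambda>x. v x - \<phi> x) < \<epsilon>"
    "nrm (\<lambda>x. weak_grad \<Omega> v x - classical_grad \<phi> x) < \<epsilon>"
    using assms unfolding H01_space_def by blast
  have "nrm (\<lambda>x. D v x - classical_grad \<phi> x) = nrm (\<lambda>x. weak_grad \<Omega> v x - classical_grad \<phi> x)"
    using H01_weak_grad(3)[OF assms(1)] broken_H1_L2(2)[OF H01_weak_grad(2)[OF assms(1)]]
      H01_weak_grad_L2[OF assms(1)] test_functions_L2_dom[OF \<phi>(1)]
    by (intro L2_norm_cong_AE) (auto elim: eventually_mono)
  with \<phi> show ?thesis using that by metis
qed

lemma H01_lincomb:
  assumes "v \<in> H01_space \<Omega>" "w \<in> H01_space \<Omega>"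
  shows "(\<lambda>x. v x + c * w x) \<in> H01_space \<Omega>"
proof -
  let ?s = "\<lambda>x. v x + c * w x"
  let ?G = "\<lambda>x. weak_grad \<Omega> v x + c *\<^sub>R weak_grad \<Omega> w x"
  have g: "is_weak_grad \<Omega> ?s ?G"
    by (rule weak_grad_lincomb[OF H01_weak_grad(1)[OF assms(1)] H01_weak_grad(1)[OF assms(2)]]) simp
  then have H1: "?s \<in> H1_space \<Omega>" by (auto simp: H1_space_def)
  have g': "is_weak_grad \<Omega> ?s (weak_grad \<Omega> ?s)" unfolding weak_grad_def by (rule someI[of "is_weak_grad \<Omega> ?s", OF g])
  have ae: "AE x in lebesgue_on \<Omega>. weak_grad \<Omega> ?s x = ?G x"
    by (rule weak_grad_unique[OF open_dom bounded_dom g' g])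
  have L: "v \<in> L2" "w \<in> L2" "weak_grad \<Omega> v \<in> L2" "weak_grad \<Omega> w \<in> L2" "weak_grad \<Omega> ?s \<in> L2"
    using assms[THEN H01_weak_grad(1)] g' by (auto simp: is_weak_grad_def)
  have "\<exists>\<phi>\<in>test_functions \<Omega>. nrm (\<lambda>x. ?s x - \<phi> x) < \<epsilon> \<and> nrm (\<lambda>x. weak_grad \<Omega> ?s x - classical_grad \<phi> x) < \<epsilon>"
    if \<epsilon>: "0 < \<epsilon>" for \<epsilon>
  proof -
    \<comment> \<open>Chosen so that the two errors \<open>\<delta>\<close> and
      \<open>\<bar>c\<bar> * \<delta>\<close> add up to \<open>\<epsilon>\<close>.\<close>
    define \<delta> where "\<delta> = \<epsilon> / (1 + \<bar>c\<bar>)"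
    have c1: "1 + \<bar>c\<bar> > 0" by (simp add: add_pos_nonneg)
    have "(1 + \<bar>c\<bar>) * \<delta> = \<epsilon>" using c1 by (simp add: \<delta>_def)
    moreover have "(1 + \<bar>c\<bar>) * \<delta> = \<delta> + \<bar>c\<bar> * \<delta>" by (simp add: distrib_right)
    moreover have "0 < \<delta>" using \<epsilon> c1 by (simp add: \<delta>_def)
    ultimately have \<delta>: "0 < \<delta>" "\<delta> + \<bar>c\<bar> * \<delta> = \<epsilon>" by auto
    obtain \<phi> where \<phi>: "\<phi> \<in> test_functions \<Omega>" "nrm (\<lambda>x. v x - \<phi> x) < \<delta>" "nrm (\<lambda>x. weak_grad \<Omega> v x - classical_grad \<phi> x) < \<delta>"
      using assms(1) \<delta>(1) unfolding H01_space_def by blast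
    obtain \<psi> where \<psi>: "\<psi> \<in> test_functions \<Omega>" "nrm (\<lambda>x. w x - \<psi> x) < \<delta>" "nrm (\<lambda>x. weak_grad \<Omega> w x - classical_grad \<psi> x) < \<delta>"
      using assms(2) \<delta>(1) unfolding H01_space_def by blast
    note P = test_functions_L2_dom[OF \<phi>(1)] test_functions_L2_dom[OF \<psi>(1)]
    let ?p = "\<lambda>x. \<phi> x + c * \<psi> x"
    have gp: "classical_grad ?p x = classical_grad \<phi> x + c *\<^sub>R classical_grad \<psi> x" for x
      using classical_grad_add[where k=0, OF test_functions_C_k[OF \<phi>(1)] test_functions_C_k[OF test_functions_cmult[OF \<psi>(1), of c]], of x]
        classical_grad_cmult[where k=0, OF test_functions_C_k[OF \<psi>(1)], of c x] by simp
    have tri: "nrm (\<lambda>x. (f x - f' x) + c *\<^sub>R (g x - g' x)) < \<epsilon>"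
      if "f \<in> L2" "f' \<in> L2" "g \<in> L2" "g' \<in> L2"
        "nrm (\<lambda>x. f x - f' x) < \<delta>" "nrm (\<lambda>x. g x - g' x) < \<delta>"
      for f f' g g' :: "'a \<Rightarrow> 'c::euclidean_space"
    proof -
      have "nrm (\<lambda>x. (f x - f' x) + c *\<^sub>R (g x - g' x)) \<le> nrm (\<lambda>x. f x - f' x) + \<bar>c\<bar> * nrm (\<lambda>x. g x - g' x)"
        using L2_norm_triangle[of "\<lambda>x. f x - f' x" \<Omega> "\<lambda>x. c *\<^sub>R (g x - g' x)"] that by (simp add: L2_norm_scaleR)
      also have "\<dots> < \<delta> + \<bar>c\<bar> * \<delta>" using that by (intro add_less_le_mono mult_left_mono) auto
      finally show ?thesis using \<delta> by simp
    qed
    have "nrm (\<lambda>x. ?s x - ?p x) < \<epsilon>"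
      using tri[of v \<phi> w \<psi>] L P \<phi> \<psi> by (simp add: algebra_simps)
    moreover have "nrm (\<lambda>x. weak_grad \<Omega> ?s x - classical_grad ?p x) < \<epsilon>"
    proof -
      have "nrm (\<lambda>x. weak_grad \<Omega> ?s x - classical_grad ?p x) = nrm (\<lambda>x. ?G x - (classical_grad \<phi> x + c *\<^sub>R classical_grad \<psi> x))"
        unfolding gp using ae L P by (intro L2_norm_cong_AE) (auto elim: eventually_mono)
      also have "(\<lambda>x. ?G x - (classical_grad \<phi> x + c *\<^sub>R classical_grad \<psi> x)) =
          (\<lambda>x. (weak_grad \<Omega> v x - classical_grad \<phi> x) + c *\<^sub>R (weak_grad \<Omega> w x - classical_grad \<psi> x))"
        by (simp add: algebra_simps)
      also have "nrm \<dots> < \<epsilon>" by (rule tri) (use L P \<phi> \<psi> in auto)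
      finally show ?thesis .
    qed
    ultimately show ?thesis
      using test_functions_add[OF \<phi>(1) test_functions_cmult[OF \<psi>(1), of c]] by (intro bexI[of _ ?p]) auto
  qed
  then show ?thesis using H1 by (simp add: H01_space_def)
qed

text \<open>A weak form of Friedrichs' inequality, from testing the weak gradient with
  \<open>x\<^sub>i \<phi>\<close> and letting \<open>\<phi>\<close> tend to \<open>v\<close>.\<close>

lemma H01_friedrichs:
  assumes v: "v \<in> H01_space \<Omega>" and 0: "ip (D v) (D v) = 0"
  shows "AE x in lebesgue_on \<Omega>. v x = 0"
proof -
  obtain i :: 'a where i: "i \<in> Basis" using nonempty_Basis by blast
  note v1 = H01_weak_grad[OF v]
  note vL = broken_H1_L2[OF v1(2)] H01_weak_grad_L2[OF v]
  have g0: "AE x in lebesgue_on \<Omega>. D v x = 0" by (rule L2_norm_zero_AE[OF vL(2) 0])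
  then have g0': "AE x in lebesgue_on \<Omega>. weak_grad \<Omega> v x = 0" using v1(3) by eventually_elim simp
  obtain R where R: "\<And>x. x \<in> \<Omega> \<Longrightarrow> norm x \<le> R" using bounded_dom bounded_iff by metis
  have "(\<lambda>x. (x \<bullet> i) *\<^sub>R v x) \<in> L2"
  proof (rule L2_space_bounded_mult[OF vL(1)])
    show "\<bar>x \<bullet> i\<bar> \<le> R" if "x \<in> \<Omega>" for x
      using Basis_le_norm[OF i, of x] R[OF that] by linarith
  qed (intro continuous_intros)
  then have xv: "(\<lambda>x. (x \<bullet> i) * v x) \<in> L2" by simp
  have F: "(\<lambda>x. - ((x \<bullet> i) * v x) *\<^sub>R i) \<in> L2"
  proof -
    have [measurable]: "(\<lambda>x. (x \<bullet> i) * v x) \<in> borel_measurable (lebesgue_on \<Omega>)" using xv by (simp add: L2_space_def)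
    show ?thesis using xv i by (simp add: L2_space_def)
  qed
  \<comment> \<open>For \<open>\<psi>\<close> equal to \<open>x \<bullet> i\<close> times
    \<open>\<phi>\<close>, the derivative in direction \<open>i\<close> is \<open>\<phi>\<close>
    plus \<open>x \<bullet> i\<close> times the derivative of \<open>\<phi>\<close>, and testing
    gives zero because the weak gradient of \<open>v\<close> vanishes. The limit turns the first
    term into the squared norm of \<open>v\<close>.\<close>
  have "ip v v = ip (\<lambda>x. - ((x \<bullet> i) * v x) *\<^sub>R i) (D v)"
  proof (rule L2_approx_eqI[OF vL(1) F vL(1,2)])
    fix \<epsilon> :: real assume "0 < \<epsilon>"
    then obtain \<phi> where \<phi>: "\<phi> \<in> test_functions \<Omega>" "nrm (\<lambda>x. v x - \<phi> x) < \<epsilon>"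
      "nrm (\<lambda>x. D v x - classical_grad \<phi> x) < \<epsilon>" using H01_approx[OF v] by metis
    note P = test_functions_L2_dom[OF \<phi>(1)]
    define \<psi> where "\<psi> x = (x \<bullet> i) * \<phi> x" for x
    have \<psi>: "\<psi> \<in> test_functions \<Omega>" unfolding \<psi>_def by (rule test_functions_mult[OF \<phi>(1) C_k_inner])
    have d: "frechet_derivative \<psi> (at x) i = (x \<bullet> i) * (classical_grad \<phi> x \<bullet> i) + \<phi> x" for x
      using classical_grad_mult[where k=0, OF C_k_inner test_functions_C_k[OF \<phi>(1)], of i x] i
      unfolding \<psi>_def classical_grad_inner_Basis[OF i, symmetric] by (simp add: classical_grad_inner inner_add_left)
    have "(\<integral>x. v x * frechet_derivative \<psi> (at x) i \<partial>lebesgue_on \<Omega>) = - (\<integral>x. (weak_grad \<Omega> v x \<bullet> i) * \<psi> x \<partial>lebesgue_on \<Omega>)"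
      using v1(1) \<psi> i by (simp add: is_weak_grad_def)
    also have "(\<integral>x. (weak_grad \<Omega> v x \<bullet> i) * \<psi> x \<partial>lebesgue_on \<Omega>) = (\<integral>x. 0 \<partial>lebesgue_on \<Omega>)"
    proof (rule integral_cong_AE)
      show "(\<lambda>x. (weak_grad \<Omega> v x \<bullet> i) * \<psi> x) \<in> borel_measurable (lebesgue_on \<Omega>)"
        using L2_space_measurable[OF L2_space_inner_const[OF vL(3)]] L2_space_measurable[OF test_functions_L2_dom(1)[OF \<psi>]] by simp
      show "AE x in lebesgue_on \<Omega>. (weak_grad \<Omega> v x \<bullet> i) * \<psi> x = 0" using g0' by eventually_elim simp
    qed simp
    finally have "0 = (\<integral>x. ((x \<bullet> i) * v x) * (classical_grad \<phi> x \<bullet> i) + v x * \<phi> x \<partial>lebesgue_on \<Omega>)"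
      by (simp add: d distrib_left mult_ac)
    also have "\<dots> = (\<integral>x. ((x \<bullet> i) * v x) * (classical_grad \<phi> x \<bullet> i) \<partial>lebesgue_on \<Omega>) + ip v \<phi>"
      using L2_inner_integrable[OF xv L2_space_inner_const[OF P(2)], of i] L2_inner_integrable[OF vL(1) P(1)]
      by (simp add: L2_inner_def)
    finally have "ip v \<phi> = ip (\<lambda>x. - ((x \<bullet> i) * v x) *\<^sub>R i) (classical_grad \<phi>)"
      by (simp add: L2_inner_def inner_commute[of i])
    then show "\<exists>g' G'. g' \<in> L2 \<and> G' \<in> L2 \<and> nrm (\<lambda>x. v x - g' x) < \<epsilon> \<and>
       nrm (\<lambda>x. D v x - G' x) < \<epsilon> \<and> ip v g' = ip (\<lambda>x. - ((x \<bullet> i) * v x) *\<^sub>R i) G'"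
      using \<phi> P by blast
  qed
  also have "\<dots> = ip (\<lambda>x. - ((x \<bullet> i) * v x) *\<^sub>R i) (\<lambda>x. 0)"
    unfolding L2_inner_commute[of _ "\<lambda>x. - ((x \<bullet> i) * v x) *\<^sub>R i"]
    by (rule L2_inner_cong_AE_left[OF g0 vL(2) L2_space_zero F])
  finally have "ip v v = 0" by simp
  then show ?thesis by (rule L2_norm_zero_AE[OF vL(1)])
qed

end

section \<open>Representers in subspaces\<close>

text \<open>Positivity of the form enters through \<open>a_CS\<close>: null vectors are orthogonal
  to everything. This spares the passage to a quotient by the null functions.\<close>

locale semi_inner_functions =
  fixes H :: "('x \<Rightarrow> real) set" and a :: "('x \<Rightarrow> real) \<Rightarrow> ('x \<Rightarrow> real) \<Rightarrow> real"
  assumes H_lin: "v \<in> H \<Longrightarrow> w \<in> H \<Longrightarrow> (\<lambda>x. v x + c * w x) \<in> H"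
    and a_sym: "v \<in> H \<Longrightarrow> w \<in> H \<Longrightarrow> a v w = a w v"
    and a_lin: "u \<in> H \<Longrightarrow> v \<in> H \<Longrightarrow> w \<in> H \<Longrightarrow> a (\<lambda>x. u x + c * v x) w = a u w + c * a v w"
    and a_CS: "v \<in> H \<Longrightarrow> w \<in> H \<Longrightarrow> a w w = 0 \<Longrightarrow> a v w = 0"
begin

definition fun_subspace :: "('x \<Rightarrow> real) set \<Rightarrow> bool" where
  "fun_subspace W \<longleftrightarrow> W \<subseteq> H \<and> W \<noteq> {} \<and> (\<forall>v\<in>W. \<forall>w\<in>W. \<forall>c. (\<lambda>x. v x + c * w x) \<in> W)"

definition linear_on_funs :: "('x \<Rightarrow> real) set \<Rightarrow> (('x \<Rightarrow> real) \<Rightarrow> real) \<Rightarrow> bool" where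
  "linear_on_funs W l \<longleftrightarrow> (\<forall>v\<in>W. \<forall>w\<in>W. \<forall>c. l (\<lambda>x. v x + c * w x) = l v + c * l w)"

text \<open>A functional of the form \<open>a z\<close> vanishes on null vectors by
  \<open>a_CS\<close>, so the same is demanded of \<open>l\<close>. The representer is unique only
  up to null vectors.\<close>

definition riesz :: "('x \<Rightarrow> real) set \<Rightarrow> bool" where
  "riesz W \<longleftrightarrow> (\<forall>l. linear_on_funs W l \<longrightarrow> (\<forall>v\<in>W. a v v = 0 \<longrightarrow> l v = 0) \<longrightarrow>
     (\<exists>z\<in>W. \<forall>v\<in>W. a z v = l v))"

lemma a_lin_right: "u \<in> H \<Longrightarrow> v \<in> H \<Longrightarrow> w \<in> H \<Longrightarrow> a w (\<lambda>x. u x + c * v x) = a w u + c * a w v"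
  by (simp add: a_sym[of w] a_lin H_lin)

lemma rieszD:
  assumes "riesz W" "linear_on_funs W l" "\<And>v. v \<in> W \<Longrightarrow> a v v = 0 \<Longrightarrow> l v = 0"
  obtains z where "z \<in> W" "\<And>v. v \<in> W \<Longrightarrow> a z v = l v"
  using assms unfolding riesz_def by blast

lemma fun_subspaceD: "fun_subspace W \<Longrightarrow> v \<in> W \<Longrightarrow> w \<in> W \<Longrightarrow> (\<lambda>x. v x + c * w x) \<in> W"
  by (simp add: fun_subspace_def)

lemma zero_fun_subspace:
  assumes "fun_subspace W"
  shows "(\<lambda>x. 0) \<in> W"
proof -
  obtain v where "v \<in> W" using assms by (auto simp: fun_subspace_def)
  then have "(\<lambda>x. v x + (-1) * v x) \<in> W" using assms unfolding fun_subspace_def by blast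
  then show ?thesis by simp
qed

lemma fun_subspace_extend:
  assumes W: "fun_subspace W" and u: "u \<in> H"
  shows "fun_subspace {(\<lambda>x. v x + c * u x) |v c. v \<in> W}"
  unfolding fun_subspace_def
proof (intro conjI ballI allI)
  show "{(\<lambda>x. v x + c * u x) |v c. v \<in> W} \<subseteq> H"
    using W u H_lin by (auto simp: fun_subspace_def)
  obtain v0 where "v0 \<in> W" using W by (auto simp: fun_subspace_def)
  then show "{(\<lambda>x. v x + c * u x) |v c. v \<in> W} \<noteq> {}" by blast
  fix v w c assume "v \<in> {(\<lambda>x. v x + c * u x) |v c. v \<in> W}" "w \<in> {(\<lambda>x. v x + c * u x) |v c. v \<in> W}"
  then obtain v' w' p q where *: "v' \<in> W" "w' \<in> W" "v = (\<lambda>x. v' x + p * u x)" "w = (\<lambda>x. w' x + q * u x)" by blast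
  then have "(\<lambda>x. v x + c * w x) = (\<lambda>x. (v' x + c * w' x) + (p + c * q) * u x)" by (simp add: algebra_simps)
  moreover have "(\<lambda>x. v' x + c * w' x) \<in> W" using W * by (simp add: fun_subspace_def)
  ultimately show "(\<lambda>x. v x + c * w x) \<in> {(\<lambda>x. v x + c * u x) |v c. v \<in> W}"
    by (intro CollectI exI[of _ "\<lambda>x. v' x + c * w' x"] exI[of _ "p + c * q"] conjI)
qed

text \<open>One Gram-Schmidt step: \<open>uh\<close> is \<open>u\<close> minus its representer
  \<open>z0\<close> in \<open>W\<close>, hence orthogonal to \<open>W\<close>, and the representer
  of \<open>l\<close> on \<open>W\<close> is corrected by a multiple of \<open>uh\<close>. This is
  what lets the exact solution be adjoined to the conforming discrete space.\<close>

lemma riesz_extend: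
  assumes W: "fun_subspace W" and r: "riesz W" and u: "u \<in> H"
  shows "riesz {(\<lambda>x. v x + c * u x) |v c. v \<in> W}" (is "riesz ?W'")
  unfolding riesz_def
proof (intro allI impI)
  fix l assume l: "linear_on_funs ?W' l" and ker: "\<forall>v\<in>?W'. a v v = 0 \<longrightarrow> l v = 0"
  have WH: "W \<subseteq> H" using W by (simp add: fun_subspace_def)
  have W'H: "?W' \<subseteq> H" using fun_subspace_extend[OF W u] by (simp add: fun_subspace_def)
  have WW': "v \<in> ?W'" if "v \<in> W" for v
    using that by (intro CollectI exI[of _ v] exI[of _ 0]) auto
  have uW': "u \<in> ?W'" using zero_fun_subspace[OF W] by (intro CollectI exI[of _ "\<lambda>x. 0"] exI[of _ 1]) auto
  obtain z0 where z0: "z0 \<in> W" "\<And>v. v \<in> W \<Longrightarrow> a z0 v = a u v"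
  proof (rule rieszD[OF r, of "a u"])
    show "linear_on_funs W (a u)" using u by (auto simp: linear_on_funs_def intro!: a_lin_right subsetD[OF WH])
    show "a u v = 0" if "v \<in> W" "a v v = 0" for v using a_CS[OF u _ that(2)] that WH by blast
  qed blast
  obtain z1 where z1: "z1 \<in> W" "\<And>v. v \<in> W \<Longrightarrow> a z1 v = l v"
  proof (rule rieszD[OF r, of l])
    show "linear_on_funs W l" using l WW' by (simp add: linear_on_funs_def)
    show "l v = 0" if "v \<in> W" "a v v = 0" for v using ker WW' that by blast
  qed blast
  define uh where "uh = (\<lambda>x. u x + (-1) * z0 x)"
  have H: "z0 \<in> H" "z1 \<in> H" using z0 z1 WH by auto
  have uhH: "uh \<in> H" unfolding uh_def by (rule H_lin[OF u H(1)])
  have uhW': "uh \<in> ?W'"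
  proof -
    have "(\<lambda>x. 0 + (-1) * z0 x) \<in> W" by (rule fun_subspaceD[OF W zero_fun_subspace[OF W] z0(1)])
    then show ?thesis by (intro CollectI exI[of _ "\<lambda>x. 0 + (-1) * z0 x"] exI[of _ 1]) (auto simp: uh_def)
  qed
  have orth: "a uh v = 0" if "v \<in> W" for v
  proof -
    have "v \<in> H" using that WH by blast
    then show ?thesis using a_lin[OF u H(1), of v "-1"] z0(2)[OF that] by (simp add: uh_def)
  qed
  \<comment> \<open>If \<open>uh\<close> is a null vector, then \<open>l uh = 0\<close> by
    assumption and the correction is zero.\<close>
  define k where "k = (if a uh uh = 0 then 0 else l uh / a uh uh)"
  define z where "z = (\<lambda>x. z1 x + k * uh x)"
  have zW': "z \<in> ?W'"
    unfolding z_def by (rule fun_subspaceD[OF fun_subspace_extend[OF W u] WW'[OF z1(1)] uhW'])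
  have zu: "a z uh = l uh"
  proof -
    have "a z uh = a z1 uh + k * a uh uh" unfolding z_def by (rule a_lin[OF H(2) uhH uhH])
    also have "a z1 uh = 0" using orth[OF z1(1)] a_sym[OF H(2) uhH] by simp
    also have "0 + k * a uh uh = l uh" using ker uhW' by (auto simp: k_def)
    finally show ?thesis .
  qed
  have zv: "a z v = l v" if "v \<in> W" for v
  proof -
    have "a z v = a z1 v + k * a uh v" unfolding z_def using that WH by (intro a_lin[OF H(2) uhH]) auto
    then show ?thesis using orth[OF that] z1(2)[OF that] by simp
  qed
  have "a z w = l w" if w: "w \<in> ?W'" for w
  proof -
    obtain v c where v: "v \<in> W" "w = (\<lambda>x. v x + c * u x)" using w by blast
    define v' where "v' = (\<lambda>x. v x + c * z0 x)"
    have v'W: "v' \<in> W" unfolding v'_def by (rule fun_subspaceD[OF W v(1) z0(1)])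
    have eq: "w = (\<lambda>x. v' x + c * uh x)" unfolding v(2) v'_def uh_def by (simp add: algebra_simps)
    have zH: "z \<in> H" using zW' W'H by blast
    have "a z w = a z v' + c * a z uh" unfolding eq using v'W WH by (intro a_lin_right[OF _ uhH zH]) auto
    also have "\<dots> = l v' + c * l uh" using zv[OF v'W] zu by simp
    also have "\<dots> = l w" unfolding eq using l WW'[OF v'W] uhW' by (simp add: linear_on_funs_def)
    finally show ?thesis .
  qed
  then show "\<exists>z\<in>?W'. \<forall>v\<in>?W'. a z v = l v" using zW' by blast
qed

text \<open>Induction on the number of functionals that detect the energy: the kernel of one of them
  falls under the induction hypothesis, and the space is this kernel or its extension by one vector.
  With no functionals the form vanishes on \<open>W\<close>, so \<open>l\<close> is zero there and
  every element represents it.\<close>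

lemma riesz_finite:
  assumes "finite I" "fun_subspace W" "\<And>i. i \<in> I \<Longrightarrow> linear_on_funs W (\<Lambda> i)"
    "\<And>v. v \<in> W \<Longrightarrow> (\<And>i. i \<in> I \<Longrightarrow> \<Lambda> i v = 0) \<Longrightarrow> a v v = 0"
  shows "riesz W"
  using assms
proof (induction I arbitrary: W rule: finite_induct)
  case empty
  have "\<exists>z\<in>W. \<forall>v\<in>W. a z v = l v" if "\<forall>v\<in>W. a v v = 0 \<longrightarrow> l v = 0" for l
  proof -
    obtain z where z: "z \<in> W" using empty(1) by (auto simp: fun_subspace_def)
    have WH: "W \<subseteq> H" using empty(1) by (simp add: fun_subspace_def)
    have "a z v = l v" if v: "v \<in> W" for v
    proof -
      have "a v v = 0" using empty(3)[OF v] by simp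
      then show ?thesis using a_CS[of z v] z v WH \<open>\<forall>v\<in>W. a v v = 0 \<longrightarrow> l v = 0\<close> by auto
    qed
    then show ?thesis using z by blast
  qed
  then show ?case by (simp add: riesz_def)
next
  case (insert i I)
  note W = insert.prems(1)
  have li: "linear_on_funs W (\<Lambda> i)" using insert.prems(2) by simp
  define W0 where "W0 = {v \<in> W. \<Lambda> i v = 0}"
  have i0: "\<Lambda> i (\<lambda>x. 0) = 0"
  proof -
    have z: "(\<lambda>x. 0) \<in> W" by (rule zero_fun_subspace[OF W])
    have "\<Lambda> i (\<lambda>x. 0 + 1 * 0) = \<Lambda> i (\<lambda>x. 0) + 1 * \<Lambda> i (\<lambda>x. 0)"
      using li[unfolded linear_on_funs_def, rule_format, OF z z, of 1] .
    then show ?thesis by simp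
  qed
  have W0: "fun_subspace W0"
    using W zero_fun_subspace[OF W] i0 li by (auto simp: fun_subspace_def W0_def linear_on_funs_def)
  have r0: "riesz W0"
  proof (rule insert.IH[OF W0])
    show "linear_on_funs W0 (\<Lambda> j)" if "j \<in> I" for j
      using insert.prems(2)[of j] that by (auto simp: linear_on_funs_def W0_def)
    show "a v v = 0" if "v \<in> W0" "\<And>j. j \<in> I \<Longrightarrow> \<Lambda> j v = 0" for v
      using insert.prems(3)[of v] that by (auto simp: W0_def)
  qed
  show ?case
  proof (cases "W0 = W")
    case True
    then show ?thesis using r0 by simp
  next
    case False
    then obtain w where w: "w \<in> W" "\<Lambda> i w \<noteq> 0" by (auto simp: W0_def)
    have wH: "w \<in> H" using w W by (auto simp: fun_subspace_def)
    have "W = {(\<lambda>x. v x + c * w x) |v c. v \<in> W0}"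
    proof (intro equalityI subsetI)
      fix v assume v: "v \<in> W"
      define k where "k = \<Lambda> i v / \<Lambda> i w"
      define v' where "v' = (\<lambda>x. v x + (- k) * w x)"
      have "v' \<in> W" unfolding v'_def by (rule fun_subspaceD[OF W v w(1)])
      moreover have "\<Lambda> i v' = \<Lambda> i v + (- k) * \<Lambda> i w" unfolding v'_def by (rule li[unfolded linear_on_funs_def, rule_format, OF v w(1)])
      then have "\<Lambda> i v' = 0" using w(2) by (simp add: k_def)
      moreover have "v = (\<lambda>x. v' x + k * w x)" by (simp add: v'_def)
      ultimately show "v \<in> {(\<lambda>x. v x + c * w x) |v c. v \<in> W0}" unfolding W0_def by blast
    next
      fix v assume "v \<in> {(\<lambda>x. v x + c * w x) |v c. v \<in> W0}"
      then show "v \<in> W" using W w by (auto simp: W0_def fun_subspace_def)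
    qed
    then show ?thesis using riesz_extend[OF W0 r0 wH] by simp
  qed
qed

end

section \<open>Crouzeix-Raviart functions\<close>

context mesh
begin

lemma has_derivative_affine: "((\<lambda>x. a \<bullet> x + b) has_derivative (\<lambda>h. a \<bullet> h)) (at x)"
  by (auto intro!: derivative_eq_intros)

text \<open>The volume formula for face integrals is stated for functions differentiable on the
  whole space; the affine pieces of a discrete function are therefore used in their global extension
  and not as functions on one element.\<close>

definition C1_grad :: "('a \<Rightarrow> real) \<Rightarrow> ('a \<Rightarrow> 'a) \<Rightarrow> bool" where
  "C1_grad w W \<longleftrightarrow> (\<forall>x. (w has_derivative (\<lambda>h. W x \<bullet> h)) (at x)) \<and> continuous_on UNIV W"

lemma mesh_facetE:
  assumes T: "T \<in> \<T>" and F: "F facet_of T"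
  obtains p c where "0 < c"
    "\<And>w W. C1_grad w W \<Longrightarrow> face_integral F w = c * (LINT x:T|lborel. real DIM('a) * w x + W x \<bullet> (x - p))"
proof -
  obtain C where C: "\<not> affine_dependent C" "card C = DIM('a) + 1" "T = convex hull C"
    using simplex_vertices[OF simplex_mesh[OF T]] by metis
  obtain p where p: "p \<in> C" "F = convex hull (C - {p})"
    using F unfolding C(3) facet_of_convex_hull_affine_independent[OF C(1)] by blast
  obtain c where "0 < c"
    "\<And>w W. (\<And>x. (w has_derivative (\<lambda>h. W x \<bullet> h)) (at x)) \<Longrightarrow> continuous_on UNIV W \<Longrightarrow>
      face_integral (convex hull (C - {p})) w = c * (LINT x:convex hull C|lborel. real DIM('a) * w x + W x \<bullet> (x - p))"
    using simplex_facet_divergence[OF dim C(1,2) p(1)] by blast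
  then show ?thesis by (intro that[of c p]) (simp_all add: C(3) p(2) C1_grad_def)
qed

lemma C1_grad_affine: "C1_grad (\<lambda>x. a \<bullet> x + b) (\<lambda>x. a)"
  by (simp add: C1_grad_def has_derivative_affine)

lemma C1_grad_lincomb:
  assumes "C1_grad v V" "C1_grad w W"
  shows "C1_grad (\<lambda>x. v x + c * w x) (\<lambda>x. V x + c *\<^sub>R W x)"
proof -
  have "((\<lambda>x. v x + c * w x) has_derivative (\<lambda>h. V x \<bullet> h + c * (W x \<bullet> h))) (at x)" for x
    using assms by (auto simp: C1_grad_def intro!: has_derivative_add has_derivative_mult_right)
  then show ?thesis using assms by (auto simp: C1_grad_def inner_add_left intro!: continuous_intros)
qed

lemma C1_grad_test: "\<phi> \<in> test_functions S \<Longrightarrow> C1_grad \<phi> (classical_grad \<phi>)"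
  unfolding C1_grad_def
  by (intro conjI allI C_1_has_derivative[of 0] C_1_continuous_grad[of 0] test_functions_C_k)

lemma C1_grad_continuous: "C1_grad w W \<Longrightarrow> continuous_on A w" "C1_grad w W \<Longrightarrow> continuous_on A W"
proof -
  assume w: "C1_grad w W"
  then show "continuous_on A W" unfolding C1_grad_def by (meson continuous_on_subset subset_UNIV)
  have "(w has_derivative (\<lambda>h. W x \<bullet> h)) (at x within A)" for x
    using w unfolding C1_grad_def by (auto intro: has_derivative_at_withinI)
  then show "continuous_on A w" by (auto simp: continuous_on_eq_continuous_within intro: has_derivative_continuous)
qed

text \<open>Linearity is read off from the volume formula, where integrability follows from
  continuity on a compact element.\<close>

lemma face_integral_lincomb:
  assumes T: "T \<in> \<T>" and F: "F facet_of T" and v: "C1_grad v V" and w: "C1_grad w W"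
  shows "face_integral F (\<lambda>x. v x + k * w x) = face_integral F v + k * face_integral F w"
proof -
  obtain p c where f: "\<And>w W. C1_grad w W \<Longrightarrow> face_integral F w = c * (LINT x:T|lborel. real DIM('a) * w x + W x \<bullet> (x - p))"
    using mesh_facetE[OF T F] by metis
  have i: "set_integrable lborel T (\<lambda>x. real DIM('a) * w x + W x \<bullet> (x - p))" if "C1_grad w W" for w W
    by (intro set_integrable_compact mesh_compact[OF T] continuous_intros C1_grad_continuous[OF that])
  have "(LINT x:T|lborel. real DIM('a) * (v x + k * w x) + (V x + k *\<^sub>R W x) \<bullet> (x - p)) =
    (LINT x:T|lborel. (real DIM('a) * v x + V x \<bullet> (x - p)) + k * (real DIM('a) * w x + W x \<bullet> (x - p)))"
    by (simp add: inner_add_left algebra_simps)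
  also have "\<dots> = (LINT x:T|lborel. real DIM('a) * v x + V x \<bullet> (x - p)) + k * (LINT x:T|lborel. real DIM('a) * w x + W x \<bullet> (x - p))"
    using i[OF v] i[OF w] by (subst set_integral_add) (auto intro!: set_integrable_mult_right)
  finally show ?thesis by (simp add: f[OF C1_grad_lincomb[OF v w]] f[OF v] f[OF w] algebra_simps)
qed

lemma mesh_measure_pos: "T \<in> \<T> \<Longrightarrow> 0 < measure lborel T"
proof -
  assume T: "T \<in> \<T>"
  have "\<not> negligible T"
    using mesh_interior_nonempty[OF T] open_not_negligible[of "interior T"] negligible_subset[OF _ interior_subset] by blast
  then have "measure lborel T \<noteq> 0"
    using mesh_compact[OF T] by (simp add: negligible_iff_measure lmeasurable_compact borel_compact)
  then show ?thesis by (simp add: zero_less_measure_iff)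
qed

lemma face_integral_const_eq_0:
  assumes T: "T \<in> \<T>" and F: "F facet_of T" and 0: "face_integral F (\<lambda>x. k) = 0"
  shows "k = 0"
proof -
  obtain p c where pc: "0 < c" "\<And>w W. C1_grad w W \<Longrightarrow> face_integral F w = c * (LINT x:T|lborel. real DIM('a) * w x + W x \<bullet> (x - p))"
    using mesh_facetE[OF T F] by metis
  have "face_integral F (\<lambda>x. k) = c * (LINT x:T|lborel. real DIM('a) * k)"
    using pc(2)[OF C1_grad_affine[of 0 k]] by simp
  also have "\<dots> = c * (real DIM('a) * k * measure lborel T)"
    by (simp add: set_integral_const_compact[OF mesh_compact[OF T]])
  finally have "k = 0 \<or> measure lborel T = 0" using 0 pc(1) by simp
  then show ?thesis using mesh_measure_pos[OF T] by simp
qed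

lemma mesh_closure_interior: "T \<in> \<T> \<Longrightarrow> closure (interior T) = T"
  using convex_closure_interior[OF mesh_convex mesh_interior_nonempty] mesh_compact
  by (simp add: compact_imp_closed)

lemma elem_trace_affine:
  assumes T: "T \<in> \<T>" and v: "\<And>x. x \<in> interior T \<Longrightarrow> v x = a \<bullet> x + b" and x: "x \<in> T"
  shows "elem_trace T v x = a \<bullet> x + b"
  unfolding elem_trace_def
proof (rule tendsto_Lim)
  have "x islimpt interior T"
  proof (cases "x \<in> interior T")
    case True
    then show ?thesis by (metis interior_limit_point interior_interior)
  next
    case False
    then show ?thesis using x mesh_closure_interior[OF T] by (auto simp: closure_def)
  qed
  then show "at x within interior T \<noteq> bot" by (simp add: trivial_limit_within)
  have "((\<lambda>x. a \<bullet> x + b) \<longlongrightarrow> a \<bullet> x + b) (at x within interior T)" by (intro tendsto_intros)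
  then show "(v \<longlongrightarrow> a \<bullet> x + b) (at x within interior T)"
    by (rule Lim_transform_eventually) (auto simp: eventually_at_filter v)
qed

lemma face_integral_cong: "(\<And>x. x \<in> F \<Longrightarrow> f x = g x) \<Longrightarrow> face_integral F f = face_integral F g"
  unfolding face_integral_def set_lebesgue_integral_def
  by (intro Bochner_Integration.integral_cong refl) (auto simp: indicator_def)

lemma face_integral_jump:
  assumes "T \<in> \<T>" "T' \<in> \<T>" "F facet_of T" "F facet_of T'"
    and "\<And>x. x \<in> interior T \<Longrightarrow> v x = a \<bullet> x + b" "\<And>x. x \<in> interior T' \<Longrightarrow> v x = a' \<bullet> x + b'"
  shows "face_integral F (\<lambda>x. elem_trace T v x - elem_trace T' v x) =
    face_integral F (\<lambda>x. a \<bullet> x + b) - face_integral F (\<lambda>x. a' \<bullet> x + b')"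
proof -
  have "elem_trace T v x = a \<bullet> x + b" "elem_trace T' v x = a' \<bullet> x + b'" if "x \<in> F" for x
    using elem_trace_affine[of T v a b x, OF assms(1,5)] elem_trace_affine[of T' v a' b' x, OF assms(2,6)]
      facet_of_imp_subset[OF assms(3)] facet_of_imp_subset[OF assms(4)] that by blast+
  then have "face_integral F (\<lambda>x. elem_trace T v x - elem_trace T' v x) =
      face_integral F (\<lambda>x. (a \<bullet> x + b) + (-1) * (a' \<bullet> x + b'))"
    by (intro face_integral_cong) simp
  then show ?thesis
    using face_integral_lincomb[OF assms(1,3) C1_grad_affine[of a b] C1_grad_affine[of a' b'], of "-1"] by simp
qed

lemma face_integral_trace:
  assumes "T \<in> \<T>" "F facet_of T" "\<And>x. x \<in> interior T \<Longrightarrow> v x = a \<bullet> x + b"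
  shows "face_integral F (elem_trace T v) = face_integral F (\<lambda>x. a \<bullet> x + b)"
  using elem_trace_affine[of T v a b, OF assms(1,3)] facet_of_imp_subset[OF assms(2)]
  by (intro face_integral_cong) blast

text \<open>Traces are replaced by the affine extensions of the pieces, after which all conditions
  concern face integrals of globally smooth functions.\<close>

lemma crouzeix_raviart_iff:
  assumes v: "\<forall>T\<in>\<T>. \<forall>x\<in>interior T. v x = a T \<bullet> x + b T"
  shows "v \<in> CR \<longleftrightarrow>
    (\<forall>T\<in>\<T>. \<forall>T'\<in>\<T>. \<forall>F. T \<noteq> T' \<and> F facet_of T \<and> F facet_of T' \<longrightarrow>
      face_integral F (\<lambda>x. a T \<bullet> x + b T) = face_integral F (\<lambda>x. a T' \<bullet> x + b T')) \<and>
    (\<forall>T\<in>\<T>. \<forall>F. F facet_of T \<and> F \<subseteq> frontier \<Omega> \<longrightarrow> face_integral F (\<lambda>x. a T \<bullet> x + b T) = 0)"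
proof -
  have "v \<in> pw_affine \<T>" using v unfolding pw_affine_def by blast
  moreover have "face_integral F (\<lambda>x. elem_trace T v x - elem_trace T' v x) =
    face_integral F (\<lambda>x. a T \<bullet> x + b T) - face_integral F (\<lambda>x. a T' \<bullet> x + b T')"
    if "T \<in> \<T>" "T' \<in> \<T>" "F facet_of T" "F facet_of T'" for T T' F
    using v that by (intro face_integral_jump) auto
  moreover have "face_integral F (elem_trace T v) = face_integral F (\<lambda>x. a T \<bullet> x + b T)"
    if "T \<in> \<T>" "F facet_of T" for T F
    using v that by (intro face_integral_trace) auto
  ultimately show ?thesis unfolding crouzeix_raviart_def by auto
qed

lemma crouzeix_raviart_pw_affine: "v \<in> CR \<Longrightarrow> v \<in> pw_affine \<T>"
  by (simp add: crouzeix_raviart_def)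

lemma crouzeix_raviart_lincomb:
  assumes v: "v \<in> CR" and w: "w \<in> CR"
  shows "(\<lambda>x. v x + c * w x) \<in> CR"
proof -
  obtain a b where ab: "\<forall>T\<in>\<T>. \<forall>x\<in>interior T. v x = a T \<bullet> x + b T"
    using pw_affine_coeffs[OF crouzeix_raviart_pw_affine[OF v]] by metis
  obtain a' b' where ab': "\<forall>T\<in>\<T>. \<forall>x\<in>interior T. w x = a' T \<bullet> x + b' T"
    using pw_affine_coeffs[OF crouzeix_raviart_pw_affine[OF w]] by metis
  have s: "\<forall>T\<in>\<T>. \<forall>x\<in>interior T. v x + c * w x = (a T + c *\<^sub>R a' T) \<bullet> x + (b T + c * b' T)"
    using ab ab' by (simp add: inner_add_left algebra_simps)
  have f: "face_integral F (\<lambda>x. (a T + c *\<^sub>R a' T) \<bullet> x + (b T + c * b' T)) =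
      face_integral F (\<lambda>x. a T \<bullet> x + b T) + c * face_integral F (\<lambda>x. a' T \<bullet> x + b' T)" if "T \<in> \<T>" "F facet_of T" for T F
    using face_integral_lincomb[OF that C1_grad_affine[of "a T" "b T"] C1_grad_affine[of "a' T" "b' T"], of c]
    by (simp add: inner_add_left algebra_simps)
  show ?thesis
    using v w unfolding crouzeix_raviart_iff[OF ab] crouzeix_raviart_iff[OF ab'] crouzeix_raviart_iff[OF s]
    by (simp add: f)
qed

text \<open>Connects two kinds of integrals: \<open>L2_inner\<close> lives on open elements with
  Lebesgue measure, where discrete functions are prescribed, while the calculus takes place on
  closed simplices with \<open>lborel\<close>. The boundary of an element is a null set.\<close>

lemma integral_interior_mesh:
  assumes T: "T \<in> \<T>" and f: "continuous_on T f" and g: "\<And>x. x \<in> interior T \<Longrightarrow> g x = f x"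
  shows "(\<integral>x. g x \<partial>lebesgue_on (interior T)) = (LINT x:T|lborel. f x :: real)"
    "integrable (lebesgue_on (interior T)) g"
proof -
  have i: "integrable lborel (\<lambda>x. indicator T x *\<^sub>R f x)" by (rule borel_integrable_compact[OF mesh_compact[OF T] f])
  have il: "integrable lebesgue (\<lambda>x. indicator T x *\<^sub>R f x)" using i by (subst integrable_completion) auto
  have eq: "(\<lambda>x. indicator (interior T) x *\<^sub>R g x) = (\<lambda>x. indicator (interior T) x *\<^sub>R (indicator T x *\<^sub>R f x))"
  proof
    show "indicator (interior T) x *\<^sub>R g x = indicator (interior T) x *\<^sub>R (indicator T x *\<^sub>R f x)" for x
      using g[of x] interior_subset[of T] by (cases "x \<in> interior T") auto
  qed
  have i2: "integrable lebesgue (\<lambda>x. indicator (interior T) x *\<^sub>R (indicator T x *\<^sub>R f x))"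
    by (rule integrable_mult_indicator[OF _ il]) simp
  show "integrable (lebesgue_on (interior T)) g"
    unfolding integrable_lebesgue_on_indicator[OF interior_mesh_sets(1)] eq by (rule i2)
  have "(\<integral>x. g x \<partial>lebesgue_on (interior T)) = (\<integral>x. indicator (interior T) x *\<^sub>R (indicator T x *\<^sub>R f x) \<partial>lebesgue)"
    unfolding integral_lebesgue_on_indicator[OF interior_mesh_sets(1)] eq ..
  also have "\<dots> = (\<integral>x. indicator T x *\<^sub>R f x \<partial>lebesgue)"
  proof (rule integral_cong_AE)
    show "AE x in lebesgue. indicator (interior T) x *\<^sub>R (indicator T x *\<^sub>R f x) = indicator T x *\<^sub>R f x"
      using skeleton_null by eventually_elim (use T in \<open>auto simp: indicator_def\<close>)
  qed (use i2 il in auto)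
  also have "\<dots> = (LINT x:T|lborel. f x)" using i by (simp add: set_lebesgue_integral_def integral_completion)
  finally show "(\<integral>x. g x \<partial>lebesgue_on (interior T)) = (LINT x:T|lborel. f x)" .
qed

end

section \<open>Crossing facets, and elementwise constant Crouzeix-Raviart functions\<close>

context mesh
begin

text \<open>The point \<open>q + t *\<^sub>R w\<close> is a convex combination of \<open>p\<close>,
  with weight \<open>t * l\<close>, and a point of the facet near \<open>q\<close>; the condition
  \<open>0 \<le> l\<close> says that \<open>w\<close> does not point away from
  \<open>p\<close>.\<close>

lemma facet_step:
  fixes F T :: "'a set"
  assumes T: "convex T" "F \<subseteq> T" "p \<in> T" and q: "q \<in> rel_interior F"
    and w: "w = l *\<^sub>R (p - q) + w'" "0 \<le> l" "q + w' \<in> affine hull F"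
  obtains e where "0 < e" "\<And>t. 0 \<le> t \<Longrightarrow> t \<le> e \<Longrightarrow> q + t *\<^sub>R w \<in> T"
proof -
  obtain d where d: "0 < d" "ball q d \<inter> affine hull F \<subseteq> F" using q unfolding mem_rel_interior_ball by blast
  have qF: "q \<in> affine hull F" using q rel_interior_subset[of F] hull_inc[of q F affine] by blast
  \<comment> \<open>The first bound gives \<open>t * l \<le> 1 / 2\<close>, so the rescaled step
    \<open>s\<close> below is at most \<open>2 * t\<close>; the second bound then keeps the
    displacement along \<open>w'\<close> shorter than \<open>d\<close>.\<close>
  define e where "e = min (1 / (2 * (l + 1))) (d / (4 * (norm w' + 1)))"
  have l1: "0 < l + 1" and n1: "0 < norm w' + 1" using w(2) by (auto simp: add_nonneg_pos)
  have e0: "0 < e" using l1 n1 d(1) by (simp add: e_def)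
  have "q + t *\<^sub>R w \<in> T" if t: "0 \<le> t" "t \<le> e" for t
  proof -
    have "t * l \<le> 1 / (2 * (l + 1)) * l" using t w(2) by (intro mult_right_mono) (auto simp: e_def)
    also have "\<dots> = (1 / 2) * (l / (l + 1))" by simp
    also have "\<dots> \<le> (1 / 2) * 1" using w(2) l1 by (intro mult_left_mono) auto
    also have "\<dots> = 1 / 2" by simp
    finally have tl: "t * l \<le> 1 / 2" .
    define s where "s = t / (1 - t * l)"
    have "t / (1 - t * l) \<le> t / (1 / 2)" using t(1) tl by (intro divide_left_mono) auto
    then have s: "0 \<le> s" "s \<le> 2 * t" using t tl by (auto simp: s_def)
    have "norm (s *\<^sub>R w') \<le> (2 * e) * norm w'" using s t by (simp add: mult_right_mono)
    also have "\<dots> \<le> (2 * (d / (4 * (norm w' + 1)))) * norm w'" by (intro mult_right_mono) (auto simp: e_def)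
    also have "\<dots> = (d / 2) * (norm w' / (norm w' + 1))"
    proof -
      have "2 * (d / (4 * N)) * m = d / 2 * (m / N)" for N m by simp
      then show ?thesis .
    qed
    also have "\<dots> \<le> (d / 2) * 1" using d(1) n1 by (intro mult_left_mono) auto
    also have "\<dots> < d" using d(1) by simp
    finally have "norm (s *\<^sub>R w') < d" by simp
    moreover have "q + s *\<^sub>R w' \<in> affine hull F"
    proof -
      have "(1 - s) *\<^sub>R q + s *\<^sub>R (q + w') \<in> affine hull F"
        by (rule mem_affine[OF affine_affine_hull qF w(3)]) simp
      moreover have "(1 - s) *\<^sub>R q + s *\<^sub>R (q + w') = q + s *\<^sub>R w'" by (simp add: algebra_simps)
      ultimately show ?thesis by simp
    qed
    ultimately have "q + s *\<^sub>R w' \<in> F" using d(2) by (auto simp: dist_norm)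
    then have "(t * l) *\<^sub>R p + (1 - t * l) *\<^sub>R (q + s *\<^sub>R w') \<in> T"
      using T w(2) t tl by (intro convexD[OF T(1)]) auto
    moreover have "(t * l) *\<^sub>R p + (1 - t * l) *\<^sub>R (q + s *\<^sub>R w') = q + t *\<^sub>R w"
    proof -
      have "(1 - t * l) * s = t" using tl by (simp add: s_def)
      then have "(1 - t * l) *\<^sub>R (q + s *\<^sub>R w') = (1 - t * l) *\<^sub>R q + t *\<^sub>R w'"
        by (simp add: scaleR_add_right)
      then have "(t * l) *\<^sub>R p + (1 - t * l) *\<^sub>R (q + s *\<^sub>R w') = (t * l) *\<^sub>R p + ((1 - t * l) *\<^sub>R q + t *\<^sub>R w')"
        by (rule arg_cong)
      also have "\<dots> = q + t *\<^sub>R (l *\<^sub>R (p - q) + w')" by (simp add: algebra_simps)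
      finally show ?thesis unfolding w(1) .
    qed
    ultimately show ?thesis by simp
  qed
  with e0 show ?thesis by (rule that)
qed

text \<open>The hull of a facet and a point off it span the space, so \<open>w\<close> splits into a
  multiple of \<open>p - q\<close> and a part parallel to the facet.\<close>

lemma facet_decompose:
  fixes F :: "'a set"
  assumes "aff_dim F = int DIM('a) - 1" "p \<notin> affine hull F" "q \<in> affine hull F"
  obtains l w' where "w = l *\<^sub>R (p - q) + w'" "q + w' \<in> affine hull F"
proof -
  have "aff_dim (insert p F) = int DIM('a)" using assms(1,2) by (simp add: aff_dim_insert)
  then have U: "affine hull (insert p F) = UNIV" by (simp add: aff_dim_eq_full)
  have "affine hull (insert q (insert p F)) = UNIV" using U hull_mono[of "insert p F" "insert q (insert p F)" affine] by blast
  then have "q + w \<in> (+) q ` span ((\<lambda>x. - q + x) ` insert p F)" using affine_hull_insert_span_gen[of q "insert p F"] by simp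
  then have "w \<in> span (insert (- q + p) ((\<lambda>x. - q + x) ` F))" by auto
  then obtain l where l: "w - l *\<^sub>R (- q + p) \<in> span ((\<lambda>x. - q + x) ` F)" unfolding span_insert by blast
  have "affine hull F = affine hull (insert q F)" using hull_redundant[OF assms(3)] by simp
  also have "\<dots> = (+) q ` span ((\<lambda>x. - q + x) ` F)" by (rule affine_hull_insert_span_gen)
  finally have "q + (w - l *\<^sub>R (- q + p)) \<in> affine hull F" using l by blast
  then show ?thesis by (intro that[of l "w - l *\<^sub>R (- q + p)"]) (simp_all add: algebra_simps)
qed

lemma mesh_aff_dim: "T \<in> \<T> \<Longrightarrow> aff_dim T = int DIM('a)"
  by (rule aff_dim_simplex[OF simplex_mesh])

lemma facet_opposite_point:
  assumes T: "T \<in> \<T>" and F: "F facet_of T"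
  obtains p where "p \<in> T" "p \<notin> affine hull F"
proof -
  have "\<not> T \<subseteq> affine hull F"
  proof
    assume "T \<subseteq> affine hull F"
    then have "aff_dim T \<le> aff_dim F" using aff_dim_subset[of T "affine hull F"] by simp
    then show False using F by (simp add: facet_of_def)
  qed
  then show ?thesis using that by blast
qed

text \<open>Some relative interior point \<open>z\<close> of the facet lies in the open domain.
  Points just beyond \<open>T\<close> belong to other elements, and as these are finitely many
  closed sets, \<open>z\<close> itself lies in one of them. The common face with that element
  contains the facet and is proper, so the dimensions force equality.\<close>

lemma inner_facet_neighbour:
  assumes T: "T \<in> \<T>" and F: "F facet_of T" and in_dom: "\<not> F \<subseteq> frontier \<Omega>"
  obtains T' where "T' \<in> \<T>" "T' \<noteq> T" "F facet_of T'" "T \<inter> T' = F"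
proof -
  have Ff: "F face_of T" "F \<noteq> {}" "aff_dim F = int DIM('a) - 1"
    using F mesh_aff_dim[OF T] by (auto simp: facet_of_def)
  have cF: "convex F" "closed F"
    using Ff(1) face_of_imp_convex face_of_imp_closed[OF mesh_convex[OF T] compact_imp_closed[OF mesh_compact[OF T]]]
      mesh_convex[OF T] by blast+
  have "F \<subseteq> closure \<Omega>" using Union_mesh T face_of_imp_subset[OF Ff(1)] by blast
  then have "\<Omega> \<inter> closure (rel_interior F) \<noteq> {}"
    using in_dom open_dom convex_closure_rel_interior[OF cF(1)] cF(2) by (auto simp: frontier_def interior_open)
  then have "\<Omega> \<inter> rel_interior F \<noteq> {}" using open_Int_closure_eq_empty[OF open_dom] by blast
  then obtain z where z: "z \<in> \<Omega>" "z \<in> rel_interior F" by blast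
  have zF: "z \<in> F" using z(2) rel_interior_subset by blast
  obtain p where p: "p \<in> T" "p \<notin> affine hull F" using facet_opposite_point[OF T F] by blast
  \<comment> \<open>Otherwise \<open>z\<close> would lie inside a segment of \<open>T\<close> that
    ends at \<open>p\<close>, and the face property would put \<open>p\<close> into
    \<open>F\<close>.\<close>
  have out: "z - s *\<^sub>R (p - z) \<notin> T" if s: "0 < s" for s
  proof
    assume "z - s *\<^sub>R (p - z) \<in> T"
    moreover have "z \<in> open_segment (z - s *\<^sub>R (p - z)) p"
      unfolding in_segment
    proof (intro conjI exI[of _ "s / (1 + s)"])
      show "z - s *\<^sub>R (p - z) \<noteq> p"
      proof
        assume "z - s *\<^sub>R (p - z) = p"
        then have "(1 + s) *\<^sub>R (p - z) = 0" by (simp add: algebra_simps)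
        then show False using s p(2) zF hull_inc[of z F affine] by auto
      qed
      have "(1 - s / (1 + s)) = 1 / (1 + s)" using s by (simp add: field_simps)
      moreover have "(1 / (1 + s)) *\<^sub>R (z - s *\<^sub>R (p - z)) + (s / (1 + s)) *\<^sub>R p =
          (1 / (1 + s)) *\<^sub>R ((1 + s) *\<^sub>R z)" using s by (simp add: algebra_simps)
      ultimately show "z = (1 - s / (1 + s)) *\<^sub>R (z - s *\<^sub>R (p - z)) + (s / (1 + s)) *\<^sub>R p" using s by simp
    qed (use s in auto)
    ultimately have "p \<in> F" using Ff(1) p(1) zF unfolding face_of_def by blast
    then show False using p(2) hull_inc[of p F affine] by blast
  qed
  have "((\<lambda>s. z - s *\<^sub>R (p - z)) \<longlongrightarrow> z - 0 *\<^sub>R (p - z)) (at_right 0)" by (intro tendsto_intros)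
  then have lim: "((\<lambda>s. z - s *\<^sub>R (p - z)) \<longlongrightarrow> z) (at_right 0)" by simp
  have "\<forall>\<^sub>F s in at_right 0. z - s *\<^sub>R (p - z) \<in> \<Omega>"
    using topological_tendstoD[OF lim open_dom z(1)] .
  then have "\<forall>\<^sub>F s in at_right 0. z - s *\<^sub>R (p - z) \<in> \<Union>(\<T> - {T})"
    using eventually_at_right_less[of 0]
  proof eventually_elim
    case (elim s)
    then have "z - s *\<^sub>R (p - z) \<in> \<Union>\<T>" using Union_mesh closure_subset[of \<Omega>] by auto
    then show ?case using out[OF elim(2)] by blast
  qed
  moreover have "closed (\<Union>(\<T> - {T}))"
  proof (rule closed_Union)
    show "finite (\<T> - {T})" using finite_mesh by simp
    show "\<forall>U\<in>\<T> - {T}. closed U" using mesh_compact compact_imp_closed by blast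
  qed
  ultimately have "z \<in> \<Union>(\<T> - {T})"
    by (intro Lim_in_closed_set[OF _ _ _ lim]) simp_all
  then obtain T' where T': "T' \<in> \<T>" "T' \<noteq> T" "z \<in> T'" by blast
  define G where "G = T \<inter> T'"
  have G: "G face_of T" "G face_of T'"
    using face_mesh[OF T T'(1)] face_mesh[OF T'(1) T] by (auto simp: G_def Int_commute)
  have FG: "F \<subseteq> G"
    using subset_of_face_of[OF G(1) face_of_imp_subset[OF Ff(1)]] z(2) zF T'(3) face_of_imp_subset[OF Ff(1)]
    by (auto simp: G_def)
  have GT: "G \<noteq> T"
  proof
    assume "G = T"
    then have "interior T \<subseteq> interior T'" by (intro interior_mono) (auto simp: G_def)
    then show False using interior_mesh_disjoint[OF T T'(1)] T'(2) mesh_interior_nonempty[OF T] by blast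
  qed
  have "aff_dim G < int DIM('a)"
    using face_of_aff_dim_lt[OF mesh_convex[OF T] G(1) GT] mesh_aff_dim[OF T] by simp
  moreover have "F face_of G" by (rule face_of_subset[OF Ff(1) FG face_of_imp_subset[OF G(1)]])
  ultimately have "F = G"
    using face_of_aff_dim_lt[of G F] face_of_imp_convex[OF G(1)] mesh_convex[OF T] Ff(3) by fastforce
  then have "F face_of T'" "T \<inter> T' = F" using G(2) by (auto simp: G_def)
  moreover from this(1) have "F facet_of T'" using Ff(2,3) mesh_aff_dim[OF T'(1)] by (simp add: facet_of_def)
  ultimately show ?thesis using T'(1,2) by (intro that)
qed

lemma interior_step:
  fixes T :: "'a set"
  assumes "q \<in> interior T"
  obtains e where "0 < e" "\<And>t. 0 \<le> t \<Longrightarrow> t \<le> e \<Longrightarrow> q + t *\<^sub>R w \<in> T"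
proof -
  obtain d where d: "0 < d" "ball q d \<subseteq> T" using assms mem_interior by blast
  show ?thesis
  proof (rule that[of "d / (2 * (norm w + 1))"])
    show "0 < d / (2 * (norm w + 1))" using d(1) by (simp add: add_nonneg_pos)
    fix t assume t: "0 \<le> t" "t \<le> d / (2 * (norm w + 1))"
    have "t * norm w \<le> t * (norm w + 1)" using t by (intro mult_left_mono) auto
    also have "\<dots> \<le> d / (2 * (norm w + 1)) * (norm w + 1)" using t by (intro mult_right_mono) auto
    also have "\<dots> = d / 2" 
    proof -
      have "norm w + 1 \<noteq> 0" using norm_ge_zero[of w] by linarith
      then have "d / (2 * (norm w + 1)) * (norm w + 1) = d / 2" by (metis divide_divide_eq_left' nonzero_divide_eq_eq divide_divide_eq_left mult.commute)
      then show ?thesis .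
    qed
    also have "\<dots> < d" using d(1) by simp
    finally have "q + t *\<^sub>R w \<in> ball q d" using t(1) by (simp add: dist_norm)
    then show "q + t *\<^sub>R w \<in> T" using d(2) by blast
  qed
qed

text \<open>At a relative interior point of a common facet every direction enters one of the two
  elements. If it pointed out of both, the opposite direction would enter both, and a short step
  along it would stay in \<open>T \<inter> T' = F\<close>, although it has a nonzero component off
  the hull of \<open>F\<close>.\<close>

lemma cross_facet:
  assumes T: "T \<in> \<T>" "T' \<in> \<T>" and F: "F facet_of T" "F facet_of T'" "T \<inter> T' = F" and q: "q \<in> rel_interior F"
  obtains e S where "0 < e" "S = T \<or> S = T'" "\<And>t. 0 \<le> t \<Longrightarrow> t \<le> e \<Longrightarrow> q + t *\<^sub>R w \<in> S"
proof -
  have dF: "aff_dim F = int DIM('a) - 1" using F(1) mesh_aff_dim[OF T(1)] by (simp add: facet_of_def)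
  have qA: "q \<in> affine hull F" using q rel_interior_subset hull_inc[of q F] by blast
  have sub: "F \<subseteq> T" "F \<subseteq> T'" using F(3) by auto
  obtain p where p: "p \<in> T" "p \<notin> affine hull F" using facet_opposite_point[OF T(1) F(1)] by blast
  obtain p' where p': "p' \<in> T'" "p' \<notin> affine hull F" using facet_opposite_point[OF T(2) F(2)] by blast
  obtain l v where l: "w = l *\<^sub>R (p - q) + v" "q + v \<in> affine hull F" using facet_decompose[OF dF p(2) qA] by blast
  obtain l' v' where l': "w = l' *\<^sub>R (p' - q) + v'" "q + v' \<in> affine hull F" using facet_decompose[OF dF p'(2) qA] by blast
  have neg: "q - u \<in> affine hull F" if "q + u \<in> affine hull F" for u
  proof -
    have "2 *\<^sub>R q + (-1) *\<^sub>R (q + u) \<in> affine hull F" by (rule mem_affine[OF affine_affine_hull qA that]) simp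
    then show ?thesis by (simp add: scaleR_2)
  qed
  consider "0 \<le> l" | "0 \<le> l'" | "l < 0" "l' < 0" by linarith
  then show ?thesis
  proof cases
    case 1
    obtain e where "0 < e" "\<And>t. 0 \<le> t \<Longrightarrow> t \<le> e \<Longrightarrow> q + t *\<^sub>R w \<in> T"
      using facet_step[OF mesh_convex[OF T(1)] sub(1) p(1) q l(1) 1 l(2)] by blast
    then show ?thesis using that[of e T] by blast
  next
    case 2
    obtain e where "0 < e" "\<And>t. 0 \<le> t \<Longrightarrow> t \<le> e \<Longrightarrow> q + t *\<^sub>R w \<in> T'"
      using facet_step[OF mesh_convex[OF T(2)] sub(2) p'(1) q l'(1) 2 l'(2)] by blast
    then show ?thesis using that[of e T'] by blast
  next
    case 3
    have m: "- w = (- l) *\<^sub>R (p - q) + (- v)" "0 \<le> - l" "q + (- v) \<in> affine hull F"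
      "- w = (- l') *\<^sub>R (p' - q) + (- v')" "0 \<le> - l'" "q + (- v') \<in> affine hull F"
      using 3 neg[OF l(2)] neg[OF l'(2)] by (simp_all) (subst l(1), simp add: algebra_simps, subst l'(1), simp add: algebra_simps)
    obtain e where e: "0 < e" "\<And>t. 0 \<le> t \<Longrightarrow> t \<le> e \<Longrightarrow> q + t *\<^sub>R (- w) \<in> T"
      using facet_step[OF mesh_convex[OF T(1)] sub(1) p(1) q m(1-3)] by blast
    obtain e' where e': "0 < e'" "\<And>t. 0 \<le> t \<Longrightarrow> t \<le> e' \<Longrightarrow> q + t *\<^sub>R (- w) \<in> T'"
      using facet_step[OF mesh_convex[OF T(2)] sub(2) p'(1) q m(4-6)] by blast
    define t where "t = min e e'"
    have t: "0 < t" using e(1) e'(1) by (simp add: t_def)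
    have "q + t *\<^sub>R (- w) \<in> T \<inter> T'" using e(2)[of t] e'(2)[of t] t by (simp add: t_def)
    then have "q + t *\<^sub>R (- w) \<in> affine hull F" using F(3) hull_inc[of _ F affine] by blast
    \<comment> \<open>The decomposition of \<open>w\<close> is solved for \<open>p\<close>; the
      coefficients sum to 1, so \<open>p\<close> becomes an affine combination of points of the
      hull.\<close>
    then have "(1 + 1 / (l * t) + 1 / l) *\<^sub>R q + (- (1 / (l * t))) *\<^sub>R (q + t *\<^sub>R (- w)) + (- (1 / l)) *\<^sub>R (q + v)
        \<in> affine hull F" (is "?z \<in> _")
      using qA l(2) by (intro mem_affine_3 affine_affine_hull) auto
    moreover have "?z = p"
    proof -
      have "?z = q + (1 / l) *\<^sub>R (w - v)" using t 3 by (simp add: algebra_simps)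
      also have "\<dots> = q + (1 / l) *\<^sub>R (l *\<^sub>R (p - q))" by (simp add: l(1))
      also have "\<dots> = p" using 3 by simp
      finally show ?thesis .
    qed
    ultimately show ?thesis using p(2) by simp
  qed
qed

text \<open>Suppose the value on \<open>T0\<close> is nonzero, and let \<open>K\<close> be the
  elements with this value. No facet of an element of \<open>K\<close> is on the boundary, and the
  neighbour across it is in \<open>K\<close> again. A segment from inside \<open>T0\<close> to a
  point outside the domain that misses all faces of lower dimension than the facets could therefore
  never leave \<open>K\<close>.\<close>

lemma crouzeix_raviart_constant_eq_0:
  assumes v: "v \<in> CR" and c: "\<forall>T\<in>\<T>. \<forall>x\<in>interior T. v x = c T" and T0: "T0 \<in> \<T>"
  shows "c T0 = 0"
proof (rule ccontr)
  assume k0: "c T0 \<noteq> 0"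
  define K where "K = {T\<in>\<T>. c T = c T0}"
  have aff: "\<forall>T\<in>\<T>. \<forall>x\<in>interior T. v x = 0 \<bullet> x + c T" using c by simp
  note cr = v[unfolded crouzeix_raviart_iff[OF aff], simplified]
  have K_bdry: "\<not> F \<subseteq> frontier \<Omega>" if "T \<in> K" "F facet_of T" for T F
  proof
    assume "F \<subseteq> frontier \<Omega>"
    then have "face_integral F (\<lambda>x. c T) = 0" using cr that by (auto simp: K_def)
    then show False using face_integral_const_eq_0[of T F] that k0 by (auto simp: K_def)
  qed
  have K_nb: "T' \<in> K" if T: "T \<in> K" "T' \<in> \<T>" "T' \<noteq> T" "F facet_of T" "F facet_of T'" for T T' F
  proof -
    have TT: "T \<in> \<T>" "c T = c T0" using T by (auto simp: K_def)
    have e: "face_integral F (\<lambda>x. c T) = face_integral F (\<lambda>x. c T')" using cr T TT by metis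
    have "face_integral F (\<lambda>x. c T + (-1) * c T') = 0"
      using face_integral_lincomb[OF TT(1) T(4) C1_grad_affine[of 0 "c T"] C1_grad_affine[of 0 "c T'"], of "-1"] e by simp
    then have "c T + (-1) * c T' = 0" by (rule face_integral_const_eq_0[OF TT(1) T(4)])
    then show ?thesis using T TT by (simp add: K_def)
  qed
  have KT: "K \<subseteq> \<T>" "finite K" using finite_mesh by (auto simp: K_def)
  obtain x where x: "x \<in> interior T0" using mesh_interior_nonempty[OF T0] by blast
  \<comment> \<open>Faces of codimension at least two: each of them spans a null set together with
    \<open>x\<close>, while the complement of the closed domain has positive measure. So an end
    point \<open>y\<close> outside all these hulls exists.\<close>
  define \<E> where "\<E> = {E. \<exists>T\<in>\<T>. E face_of T \<and> aff_dim E \<le> int DIM('a) - 2}"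
  have "finite (\<Union>T\<in>\<T>. {E. E face_of T})"
    using finite_mesh finite_polytope_faces mesh_polytope by auto
  then have finE: "finite \<E>" by (rule rev_finite_subset) (auto simp: \<E>_def)
  have "negligible (affine hull (insert x E))" if "E \<in> \<E>" for E
  proof -
    have "aff_dim (insert x E) < int DIM('a)" using that by (auto simp: \<E>_def aff_dim_insert)
    then have "aff_dim (affine hull (insert x E)) < int DIM('a)" by simp
    then have "interior (affine hull (insert x E)) = {}" using aff_dim_nonempty_interior by force
    then show ?thesis by (simp add: negligible_convex_interior affine_imp_convex)
  qed
  then have "negligible (\<Union>E\<in>\<E>. affine hull (insert x E))" using finE by (intro negligible_Union) auto
  moreover have "\<not> negligible (- closure \<Omega>)"
  proof -
    have "- closure \<Omega> \<noteq> {}"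
    proof
      assume "- closure \<Omega> = {}"
      then have "closure \<Omega> = (UNIV :: 'a set)" by auto
      then show False using bounded_closure[OF bounded_dom] not_bounded_UNIV by simp
    qed
    then show ?thesis by (intro open_not_negligible) (auto simp: open_Compl)
  qed
  ultimately have "\<not> - closure \<Omega> \<subseteq> (\<Union>E\<in>\<E>. affine hull (insert x E))" using negligible_subset by blast
  then obtain y where y: "y \<notin> closure \<Omega>" "\<And>E. E \<in> \<E> \<Longrightarrow> y \<notin> affine hull (insert x E)" by blast
  define w where "w = y - x"
  define S where "S = {t. 0 \<le> t \<and> t \<le> 1 \<and> x + t *\<^sub>R w \<in> \<Union>K}"
  have SI: "t \<in> S" if "0 \<le> t" "t \<le> 1" "x + t *\<^sub>R w \<in> T" "T \<in> K" for t T using that by (auto simp: S_def)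
  have clK: "closed (\<Union>K)"
  proof (rule closed_Union[OF KT(2)])
    show "\<forall>T\<in>K. closed T" using KT(1) mesh_compact compact_imp_closed by blast
  qed
  have "continuous_on UNIV (\<lambda>t. x + t *\<^sub>R w)" by (intro continuous_intros)
  then have "closed ((\<lambda>t. x + t *\<^sub>R w) -` \<Union>K)" by (rule closed_vimage[OF clK])
  then have "closed ({0..1} \<inter> (\<lambda>t. x + t *\<^sub>R w) -` \<Union>K)" by (intro closed_Int) auto
  moreover have "S = {0..1} \<inter> (\<lambda>t. x + t *\<^sub>R w) -` \<Union>K" by (auto simp: S_def)
  ultimately have clS: "closed S" by simp
  have bS: "bdd_above S" by (rule bdd_aboveI[of _ 1]) (simp add: S_def)
  have T0K: "T0 \<in> K" using T0 by (simp add: K_def)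
  obtain e where e: "0 < e" "\<And>t. 0 \<le> t \<Longrightarrow> t \<le> e \<Longrightarrow> x + t *\<^sub>R w \<in> T0" using interior_step[OF x] by blast
  have eS: "min e 1 \<in> S" using e by (intro SI[OF _ _ _ T0K]) auto
  \<comment> \<open>The last parameter at which the segment is in \<open>K\<close>; it is attained
    because \<open>K\<close> is a finite family of compact sets.\<close>
  define t where "t = Sup S"
  have tS: "t \<in> S" unfolding t_def using closed_contains_Sup[OF _ bS clS] eS by blast
  have "min e 1 \<le> t" unfolding t_def by (rule cSup_upper[OF eS bS])
  then have t0: "0 < t" using e(1) by simp
  have "y \<notin> \<Union>K" using y(1) Union_mesh KT(1) by blast
  then have "t \<noteq> 1" using tS by (auto simp: S_def w_def)
  then have t1: "t < 1" using tS by (auto simp: S_def)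
  define q where "q = x + t *\<^sub>R w"
  \<comment> \<open>Continuing past \<open>t\<close> within an element of \<open>K\<close>
    contradicts maximality; the cases below all end here.\<close>
  have stuck: False if T: "T \<in> K" and e: "0 < e" "\<And>s. 0 \<le> s \<Longrightarrow> s \<le> e \<Longrightarrow> q + s *\<^sub>R w \<in> T" for T e
  proof -
    define s where "s = min e (1 - t)"
    have s: "0 < s" "s \<le> e" "t + s \<le> 1" using e(1) t1 by (auto simp: s_def)
    have "x + (t + s) *\<^sub>R w = q + s *\<^sub>R w" by (simp add: q_def algebra_simps)
    then have "x + (t + s) *\<^sub>R w \<in> T" using e(2)[of s] s by simp
    then have "t + s \<in> S" using s t0 by (intro SI[OF _ _ _ T]) auto
    then have "t + s \<le> t" unfolding t_def by (rule cSup_upper[OF _ bS])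
    then show False using s by simp
  qed
  obtain T1 where T1: "T1 \<in> K" "q \<in> T1" using tS by (auto simp: S_def q_def)
  have T1T: "T1 \<in> \<T>" using T1 KT by blast
  have "q \<notin> interior T1"
  proof
    assume "q \<in> interior T1"
    then obtain e where "0 < e" "\<And>s. 0 \<le> s \<Longrightarrow> s \<le> e \<Longrightarrow> q + s *\<^sub>R w \<in> T1" using interior_step by blast
    then show False by (rule stuck[OF T1(1)])
  qed
  then have "q \<in> rel_frontier T1"
    using T1(2) compact_imp_closed[OF mesh_compact[OF T1T]] mesh_aff_dim[OF T1T]
    by (simp add: rel_frontier_def interior_rel_interior_gen)
  then obtain F where F: "F facet_of T1" "q \<in> F"
    using rel_frontier_of_polyhedron[OF polytope_imp_polyhedron[OF mesh_polytope[OF T1T]]] by blast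
  have Ff: "F face_of T1" "aff_dim F = int DIM('a) - 1" using F(1) mesh_aff_dim[OF T1T] by (auto simp: facet_of_def)
  have pF: "polytope F" by (rule face_of_polytope_polytope[OF mesh_polytope[OF T1T] Ff(1)])
  have qF: "q \<in> rel_interior F"
  proof (rule ccontr)
    assume "q \<notin> rel_interior F"
    then have "q \<in> rel_frontier F" using F(2) polytope_imp_closed[OF pF] by (simp add: rel_frontier_def)
    then obtain E where E: "E facet_of F" "q \<in> E"
      using rel_frontier_of_polyhedron[OF polytope_imp_polyhedron[OF pF]] by blast
    have "E face_of T1" using E(1) Ff(1) face_of_trans by (auto simp: facet_of_def)
    moreover have "aff_dim E \<le> int DIM('a) - 2" using E(1) Ff(2) by (simp add: facet_of_def)
    ultimately have "E \<in> \<E>" using T1T by (auto simp: \<E>_def)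
    \<comment> \<open>If \<open>q\<close> were on a face of codimension two, then \<open>y\<close>,
      being on the line through \<open>x\<close> and \<open>q\<close>, would lie in a hull that its
      choice excludes.\<close>
    moreover have "y \<in> affine hull (insert x E)"
    proof -
      have "x \<in> affine hull (insert x E)" "q \<in> affine hull (insert x E)" using E(2) by (auto intro: hull_inc)
      then have "(1 - 1 / t) *\<^sub>R x + (1 / t) *\<^sub>R q \<in> affine hull (insert x E)"
        by (intro mem_affine affine_affine_hull) auto
      moreover have "(1 - 1 / t) *\<^sub>R x + (1 / t) *\<^sub>R q = y" using t0 by (simp add: q_def w_def algebra_simps)
      ultimately show ?thesis by simp
    qed
    ultimately show False using y(2) by blast
  qed
  obtain T2 where T2: "T2 \<in> \<T>" "T2 \<noteq> T1" "F facet_of T2" "T1 \<inter> T2 = F"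
    using inner_facet_neighbour[OF T1T F(1) K_bdry[OF T1(1) F(1)]] by blast
  have "T2 \<in> K" by (rule K_nb[OF T1(1) T2(1,2) F(1) T2(3)])
  moreover obtain e S where "0 < e" "S = T1 \<or> S = T2" "\<And>t. 0 \<le> t \<Longrightarrow> t \<le> e \<Longrightarrow> q + t *\<^sub>R w \<in> S"
    using cross_facet[OF T1T T2(1) F(1) T2(3,4) qF] by blast
  ultimately show False using stuck[of S e] T1(1) by blast
qed

end

section \<open>Existence of the discrete solutions\<close>

context mesh
begin

lemma const_L2_interior: "T \<in> \<T> \<Longrightarrow> (\<lambda>x. c :: 'b::euclidean_space) \<in> L2_space (interior T)"
proof -
  assume T: "T \<in> \<T>"
  interpret finite_measure "lebesgue_on (interior T)"
    by (rule finite_measure_lebesgue_on[OF lmeasurable_open[OF interior_mesh_bounded[OF T] open_interior]])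
  show ?thesis by (simp add: L2_space_def)
qed

lemma piecewise_const_L2: "piecewise (\<lambda>T x. c T :: 'b::euclidean_space) \<in> L2"
proof (rule L2_domI)
  show "piecewise (\<lambda>T x. c T) \<in> L2_space (interior T)" if "T \<in> \<T>" for T
    by (rule L2_space_cong[OF const_L2_interior[OF that, of "c T"]]) (simp add: piecewise_eq[OF that])
qed

lemma pw_constant_L2:
  assumes "g \<in> pw_constant \<T>"
  shows "g \<in> L2"
proof -
  have "\<forall>T\<in>\<T>. \<exists>c. \<forall>x\<in>interior T. g x = c" using assms by (simp add: pw_constant_def)
  from bchoice[OF this] obtain c where c: "\<forall>T\<in>\<T>. \<forall>x\<in>interior T. g x = c T" ..
  show ?thesis
  proof (rule L2_domI)
    show "g \<in> L2_space (interior T)" if "T \<in> \<T>" for T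
      by (rule L2_space_cong[OF const_L2_interior[OF that, of "c T"]]) (use c that in simp)
  qed
qed


lemma D_inner_lincomb:
  assumes "v \<in> broken_H1" "w \<in> broken_H1" "g \<in> L2"
  shows "ip (D (\<lambda>x. v x + c * w x)) g = ip (D v) g + c * ip (D w) g"
proof -
  note L = broken_H1_L2(2)[OF assms(1)] broken_H1_L2(2)[OF assms(2)]
  have "ip (D (\<lambda>x. v x + c * w x)) g = ip (\<lambda>x. D v x + c *\<^sub>R D w x) g"
    using L assms(3) by (intro L2_inner_cong_AE_left broken_H1_lincomb(2) assms broken_H1_L2(2)[OF broken_H1_lincomb(1)]) auto
  then show ?thesis using L assms(3) by (simp add: L2_inner_simps)
qed

lemma L2_inner_AE_zero:
  fixes v g :: "'a \<Rightarrow> real"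
  assumes "AE x in lebesgue_on \<Omega>. v x = 0" "v \<in> L2" "g \<in> L2"
  shows "ip g v = 0"
proof -
  have "ip v g = ip (\<lambda>x. 0) g" by (rule L2_inner_cong_AE_left[OF assms(1,2) L2_space_zero assms(3)])
  then show ?thesis by (subst L2_inner_commute) simp
qed

sublocale semi_inner_functions broken_H1 "\<lambda>v w. ip (D v) (D w)"
proof
  fix u v w :: "'a \<Rightarrow> real" and c
  assume vw: "v \<in> broken_H1" "w \<in> broken_H1"
  show "(\<lambda>x. v x + c * w x) \<in> broken_H1" by (rule broken_H1_lincomb(1)[OF vw])
  show "ip (D v) (D w) = ip (D w) (D v)" by (rule L2_inner_commute)
  show "ip (D v) (D w) = 0" if "ip (D w) (D w) = 0"
    using L2_Cauchy_Schwarz[OF broken_H1_L2(2)[OF vw(1)] broken_H1_L2(2)[OF vw(2)]] that by (simp add: L2_norm_def)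
  show "ip (D (\<lambda>x. u x + c * v x)) (D w) = ip (D u) (D w) + c * ip (D v) (D w)"
    if "u \<in> broken_H1" by (rule D_inner_lincomb[OF that vw(1) broken_H1_L2(2)[OF vw(2)]])
qed

lemma fun_subspaceI:
  assumes "\<And>v. v \<in> W \<Longrightarrow> v \<in> broken_H1" "(\<lambda>x. 0) \<in> W"
    and "\<And>v w c. v \<in> W \<Longrightarrow> w \<in> W \<Longrightarrow> (\<lambda>x. v x + c * w x) \<in> W"
  shows "fun_subspace W"
proof -
  have "W \<noteq> {}" using assms(2) by blast
  then show ?thesis unfolding fun_subspace_def by (intro conjI subsetI ballI allI assms) auto
qed

lemma L2_linear_functional:
  assumes "fun_subspace W" "g \<in> L2"
  shows "linear_on_funs W (ip g)"
proof -
  have W: "v \<in> L2" if "v \<in> W" for v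
    using assms(1) that broken_H1_L2(1) unfolding fun_subspace_def by blast
  show ?thesis unfolding linear_on_funs_def
    by (intro ballI allI) (simp add: L2_inner_simps L2_space_mult_left W assms(2))
qed

text \<open>The detecting functionals are the gradient components on the elements, up to the volume
  of the element: they are finitely many, and together they determine the energy of an elementwise
  affine function.\<close>

lemma pw_affine_riesz:
  assumes W: "fun_subspace W" "W \<subseteq> pw_affine \<T>"
  shows "riesz W"
proof (rule riesz_finite)
  let ?e = "\<lambda>(T, i) x. piecewise (\<lambda>S x. if S = T then i else 0 :: 'a) x"
  let ?L = "\<lambda>k v. ip (D v) (?e k)"
  have WH: "W \<subseteq> broken_H1" using W(1) by (simp add: fun_subspace_def)
  have e: "?e k \<in> L2" for k
    using piecewise_const_L2[of "\<lambda>S. if S = fst k then snd k else 0"] by (simp add: case_prod_beta)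
  show "finite (\<T> \<times> (Basis :: 'a set))" using finite_mesh by simp
  show "fun_subspace W" by fact
  show "linear_on_funs W (?L k)" for k
    unfolding linear_on_funs_def using WH by (intro ballI allI D_inner_lincomb e) auto
  fix v assume v: "v \<in> W" and 0: "\<And>k. k \<in> \<T> \<times> Basis \<Longrightarrow> ?L k v = 0"
  obtain a b where ab: "AE x in lebesgue_on \<Omega>. D v x = piecewise (\<lambda>T x. a T) x"
    using pw_affineE[of v] v W(2) by (metis subsetD)
  have vL: "D v \<in> L2" using v WH broken_H1_L2(2) by blast
  have sum: "piecewise (\<lambda>T x. a T) x = (\<Sum>k\<in>\<T> \<times> Basis. (a (fst k) \<bullet> snd k) *\<^sub>R ?e k x)" for x
  proof -
    have "(\<Sum>k\<in>\<T> \<times> Basis. (a (fst k) \<bullet> snd k) *\<^sub>R ?e k x) =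
        (\<Sum>T\<in>\<T>. \<Sum>i\<in>Basis. (a T \<bullet> i) *\<^sub>R (indicator (interior T) x *\<^sub>R i))"
      unfolding piecewise_def sum.cartesian_product
      by (intro sum.cong refl) (auto simp: if_distrib[of "\<lambda>y. _ *\<^sub>R y"] finite_mesh cong: if_cong)
    also have "\<dots> = (\<Sum>T\<in>\<T>. indicator (interior T) x *\<^sub>R (\<Sum>i\<in>Basis. (a T \<bullet> i) *\<^sub>R i))"
      by (simp add: scaleR_sum_right mult.commute)
    finally show ?thesis by (simp add: piecewise_def euclidean_representation)
  qed
  have "ip (D v) (D v) = ip (piecewise (\<lambda>T x. a T)) (D v)"
    by (intro L2_inner_cong_AE_left ab vL piecewise_const_L2)
  also have "\<dots> = (\<Sum>k\<in>\<T> \<times> Basis. (a (fst k) \<bullet> snd k) * ip (?e k) (D v))"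
    unfolding sum using e vL by (subst L2_inner_sum_left) (auto simp: L2_inner_scaleR_left)
  also have "\<dots> = 0" using 0 by (intro sum.neutral) (auto simp: L2_inner_commute[of \<Omega> _ "D v"])
  finally show "ip (D v) (D v) = 0" .
qed

lemma AE_interior_const:
  assumes T: "T \<in> \<T>" and P: "AE x in lebesgue_on (interior T). P"
  shows P
proof (rule ccontr)
  assume "\<not> P"
  then have "AE x in lebesgue. x \<notin> interior T" using P by (simp add: AE_restrict_space_iff)
  then have "interior T \<in> null_sets lebesgue" by (subst AE_iff_null_sets) auto
  then have "negligible (interior T)" by (simp add: negligible_iff_null_sets)
  then show False using mesh_interior_nonempty[OF T] open_not_negligible[of "interior T"] by simp
qed

text \<open>With zero energy the function is elementwise constant, and the crossing argument
  applies. Besides uniqueness this makes the load functional vanish on null vectors, as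
  \<open>riesz\<close> demands.\<close>

lemma crouzeix_raviart_kernel:
  assumes v: "v \<in> CR" and 0: "ip (D v) (D v) = 0"
  shows "AE x in lebesgue_on \<Omega>. v x = 0"
proof -
  obtain a b where ab: "\<And>T x. T \<in> \<T> \<Longrightarrow> x \<in> interior T \<Longrightarrow> v x = a T \<bullet> x + b T"
    "v \<in> broken_H1" "AE x in lebesgue_on \<Omega>. D v x = piecewise (\<lambda>T x. a T) x"
    using pw_affineE[OF crouzeix_raviart_pw_affine[OF v]] by metis
  have "AE x in lebesgue_on \<Omega>. D v x = 0" by (rule L2_norm_zero_AE[OF broken_H1_L2(2)[OF ab(2)] 0])
  with ab(3) have a: "AE x in lebesgue_on \<Omega>. piecewise (\<lambda>T x. a T) x = 0" by eventually_elim simp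
  have "a T = 0" if T: "T \<in> \<T>" for T
  proof (rule AE_interior_const[OF T])
    show "AE x in lebesgue_on (interior T). a T = 0"
      using AE_domD[OF a T] AE_space by eventually_elim (simp add: piecewise_eq[OF T])
  qed
  then have b: "\<forall>T\<in>\<T>. \<forall>x\<in>interior T. v x = b T" using ab(1) by simp
  show ?thesis
    by (rule AE_domI_interior) (use b crouzeix_raviart_constant_eq_0[OF v b] in simp)
qed

lemma crouzeix_raviart_zero: "(\<lambda>x. 0) \<in> CR"
proof -
  have 0: "\<forall>T\<in>\<T>. \<forall>x\<in>interior T. 0 = 0 \<bullet> x + (0::real)" by simp
  have "face_integral F (\<lambda>x. 0 \<bullet> x + 0) = 0" for F :: "'a set"
    by (simp add: face_integral_def set_lebesgue_integral_def)
  then show ?thesis unfolding crouzeix_raviart_iff[OF 0] by simp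
qed

lemma crouzeix_raviart_broken_H1: "v \<in> CR \<Longrightarrow> v \<in> broken_H1"
  by (rule pw_affine_broken_H1[OF crouzeix_raviart_pw_affine])

lemma crouzeix_raviart_subspace: "fun_subspace CR"
  by (rule fun_subspaceI[OF crouzeix_raviart_broken_H1 crouzeix_raviart_zero crouzeix_raviart_lincomb])

lemma H01_zero: "(\<lambda>x. 0) \<in> H01_space \<Omega>"
proof -
  have t: "(\<lambda>x. 0) \<in> test_functions \<Omega>" 
    by (intro test_functionsI[of _ "{}"]) (auto intro: C_k_const)
  have w: "is_weak_grad \<Omega> (\<lambda>x. 0) (\<lambda>x. 0)" by (simp add: is_weak_grad_def)
  have wg: "is_weak_grad \<Omega> (\<lambda>x. 0) (weak_grad \<Omega> (\<lambda>x. 0))" unfolding weak_grad_def by (rule someI[of "is_weak_grad \<Omega> (\<lambda>x. 0)", OF w])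
  have "AE x in lebesgue_on \<Omega>. weak_grad \<Omega> (\<lambda>x. 0) x = 0" by (rule weak_grad_unique[OF open_dom bounded_dom wg w])
  moreover have cg: "classical_grad (\<lambda>x. 0 :: real) x = (0 :: 'a)" for x
    by (rule classical_grad_unique) simp
  ultimately have "nrm (\<lambda>x. weak_grad \<Omega> (\<lambda>x. 0) x - classical_grad (\<lambda>x. 0) x) = 0"
    using L2_norm_cong_AE[where \<Omega>=\<Omega> and f="weak_grad \<Omega> (\<lambda>x. 0)" and f'="\<lambda>x. 0"] wg by (simp add: is_weak_grad_def L2_norm_def)
  moreover have "nrm (\<lambda>x. 0 - 0 :: real) = 0" by (simp add: L2_norm_def)
  moreover have "(\<lambda>x. 0) \<in> H1_space \<Omega>" using w unfolding H1_space_def by blast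
  ultimately show ?thesis
    unfolding H01_space_def mem_Collect_eq by (intro conjI allI impI bexI[OF _ t]) simp_all
qed

lemma conforming_P1_subspace: "fun_subspace P1"
proof -
  have "(\<lambda>x. 0) \<in> pw_affine \<T>" by (rule crouzeix_raviart_pw_affine[OF crouzeix_raviart_zero])
  then show ?thesis
    by (intro fun_subspaceI) (auto simp: conforming_P1_def intro: H01_weak_grad(2) H01_zero H01_lincomb pw_affine_lincomb)
qed

lemma riesz_solution:
  assumes "riesz W" "fun_subspace W" "g \<in> L2"
    and "\<And>v. v \<in> W \<Longrightarrow> ip (D v) (D v) = 0 \<Longrightarrow> AE x in lebesgue_on \<Omega>. v x = 0"
  shows "\<exists>z\<in>W. \<forall>v\<in>W. ip (D z) (D v) = ip g v"
proof -
  have "ip g v = 0" if v: "v \<in> W" "ip (D v) (D v) = 0" for v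
  proof (rule L2_inner_AE_zero[OF assms(4)[OF v] _ assms(3)])
    show "v \<in> L2" using broken_H1_L2(1) assms(2) v(1) unfolding fun_subspace_def by blast
  qed
  then show ?thesis using assms(1) L2_linear_functional[OF assms(2,3)] unfolding riesz_def by blast
qed

lemma conforming_P1_kernel:
  "v \<in> P1 \<Longrightarrow> ip (D v) (D v) = 0 \<Longrightarrow> AE x in lebesgue_on \<Omega>. v x = 0"
  by (rule H01_friedrichs) (simp_all add: conforming_P1_def)

lemma conforming_P1_pw_affine: "P1 \<subseteq> pw_affine \<T>"
  and conforming_P1_H01: "P1 \<subseteq> H01_space \<Omega>"
  by (auto simp: conforming_P1_def)

lemma CR_solution_works:
  assumes "g \<in> L2"
  shows "is_CR_solution \<Omega> \<T> g (zCR g)"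
proof -
  have "CR \<subseteq> pw_affine \<T>" using crouzeix_raviart_pw_affine by blast
  then have "\<exists>z. is_CR_solution \<Omega> \<T> g z"
    using riesz_solution[OF pw_affine_riesz[OF crouzeix_raviart_subspace] crouzeix_raviart_subspace assms crouzeix_raviart_kernel]
    unfolding is_CR_solution_def by blast
  then show ?thesis unfolding CR_solution_def by (rule someI_ex)
qed

lemma is_P1_solution_iff:
  "is_P1_solution \<Omega> \<T> g z \<longleftrightarrow> z \<in> P1 \<and>
    (\<forall>v\<in>P1. ip (D z) (D v) = ip g v)"
proof (cases "z \<in> P1")
  case True
  then have "ip (weak_grad \<Omega> z) (weak_grad \<Omega> v) = ip (D z) (D v)"
    if "v \<in> P1" for v
    using that by (intro H01_inner_weak_grad) (auto simp: conforming_P1_def)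
  then show ?thesis using True by (simp add: is_P1_solution_def)
qed (simp add: is_P1_solution_def)

lemma P1_solution_works:
  assumes "g \<in> L2"
  shows "is_P1_solution \<Omega> \<T> g (P1_solution \<Omega> \<T> g)"
proof -
  have "\<exists>z. is_P1_solution \<Omega> \<T> g z"
    using riesz_solution[OF pw_affine_riesz[OF conforming_P1_subspace conforming_P1_pw_affine] conforming_P1_subspace assms conforming_P1_kernel]
    unfolding is_P1_solution_iff by blast
  then show ?thesis unfolding P1_solution_def by (rule someI_ex)
qed

end

section \<open>The Marini flux\<close>

context mesh
begin

lemma mesh_set_integrable: "T \<in> \<T> \<Longrightarrow> continuous_on UNIV f \<Longrightarrow> set_integrable lborel T (f :: 'a \<Rightarrow> real)"
  by (rule set_integrable_compact[OF mesh_compact]) (auto intro: continuous_on_subset)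

lemma L2_mesh:
  fixes f :: "'a \<Rightarrow> 'b::euclidean_space"
  assumes "\<And>T. T \<in> \<T> \<Longrightarrow> continuous_on UNIV (h T)" "\<And>T x. T \<in> \<T> \<Longrightarrow> x \<in> interior T \<Longrightarrow> f x = h T x"
  shows "f \<in> L2"
proof (rule L2_domI)
  fix T assume T: "T \<in> \<T>"
  have c: "continuous_on A (h T)" for A using assms(1)[OF T] continuous_on_subset by blast
  have "h T \<in> L2_space (interior T)" unfolding L2_space_def mem_Collect_eq
  proof
    show "h T \<in> borel_measurable (lebesgue_on (interior T))"
      by (rule continuous_imp_measurable_on_sets_lebesgue[OF c]) simp
    show "integrable (lebesgue_on (interior T)) (\<lambda>x. (norm (h T x))\<^sup>2)"
      by (rule integral_interior_mesh(2)[OF T, of "\<lambda>x. (norm (h T x))\<^sup>2"]) (intro continuous_intros c, rule refl)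
  qed
  then show "f \<in> L2_space (interior T)" by (rule L2_space_cong) (simp add: assms(2)[OF T])
qed

text \<open>The continuous representatives \<open>h\<close> and \<open>k\<close> may change from
  element to element, so values on the skeleton never have to be known.\<close>

lemma L2_inner_mesh:
  fixes f g :: "'a \<Rightarrow> 'b::euclidean_space"
  assumes "\<And>T. T \<in> \<T> \<Longrightarrow> continuous_on UNIV (h T)" "\<And>T x. T \<in> \<T> \<Longrightarrow> x \<in> interior T \<Longrightarrow> f x = h T x"
    and "\<And>T. T \<in> \<T> \<Longrightarrow> continuous_on UNIV (k T)" "\<And>T x. T \<in> \<T> \<Longrightarrow> x \<in> interior T \<Longrightarrow> g x = k T x"
  shows "ip f g = (\<Sum>T\<in>\<T>. LINT x:T|lborel. h T x \<bullet> k T x)"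
proof -
  have "L2_inner (interior T) f g = (LINT x:T|lborel. h T x \<bullet> k T x)" if T: "T \<in> \<T>" for T
    unfolding L2_inner_def
  proof (rule integral_interior_mesh(1)[OF T])
    have "continuous_on T (h T)" "continuous_on T (k T)"
      using assms(1)[OF T] assms(3)[OF T] continuous_on_subset by blast+
    then show "continuous_on T (\<lambda>x. h T x \<bullet> k T x)" by (intro continuous_intros)
  qed (simp add: assms(2,4)[OF T])
  then show ?thesis by (simp add: L2_inner_split[OF L2_mesh[OF assms(1,2)] L2_mesh[OF assms(3,4)]])
qed

text \<open>The coefficient \<open>a\<close> is the mean gradient, and \<open>b\<close> makes the
  volume expression of a face integral vanish. Its dependence on the opposite vertex
  \<open>p\<close> is the integral of \<open>(W x - a) \<bullet> p\<close>, which is zero, so one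
  \<open>b\<close> works for all facets. The form with arbitrary \<open>p\<close> is used again in
  the proof of \<open>marini_test\<close>.\<close>

lemma facet_affine_interpolant:
  assumes T: "T \<in> \<T>" and w: "C1_grad w W"
  shows "\<exists>a b. (\<forall>p. (LINT x:T|lborel. real DIM('a) * (w x - (a \<bullet> x + b)) + (W x - a) \<bullet> (x - p)) = 0) \<and>
    (\<forall>F. F facet_of T \<longrightarrow> face_integral F w = face_integral F (\<lambda>x. a \<bullet> x + b))"
proof -
  let ?m = "measure lborel T" and ?d = "real DIM('a)"
  have m: "0 < ?m" by (rule mesh_measure_pos[OF T])
  have cW: "continuous_on UNIV W" "continuous_on UNIV w" using C1_grad_continuous[OF w] by auto
  have iW: "integrable lborel (\<lambda>x. indicator T x *\<^sub>R W x)"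
    by (rule borel_integrable_compact[OF mesh_compact[OF T] C1_grad_continuous(2)[OF w]])
  define a where "a = (LINT x:T|lborel. W x) /\<^sub>R ?m"
  have a: "(LINT x:T|lborel. W x \<bullet> p) = ?m * (a \<bullet> p)" for p
  proof -
    have "(LINT x:T|lborel. W x \<bullet> p) = (LINT x:T|lborel. W x) \<bullet> p"
      using integral_inner_left[of p lborel "\<lambda>x. indicator T x *\<^sub>R W x"] iW
      by (simp add: set_lebesgue_integral_def)
    then show ?thesis using m by (simp add: a_def)
  qed
  define b where "b = (LINT x:T|lborel. ?d * (w x - a \<bullet> x) + (W x - a) \<bullet> x) / (?d * ?m)"
  have P: "(LINT x:T|lborel. ?d * (w x - (a \<bullet> x + b)) + (W x - a) \<bullet> (x - p)) = 0" for p
  proof -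
    have i: "set_integrable lborel T (\<lambda>x. ?d * (w x - a \<bullet> x) + (W x - a) \<bullet> x)"
        "set_integrable lborel T (\<lambda>x. W x \<bullet> p)" "set_integrable lborel T (\<lambda>x. a \<bullet> p - ?d * b)"
      by (intro mesh_set_integrable[OF T] continuous_intros cW)+
    have "(LINT x:T|lborel. ?d * (w x - (a \<bullet> x + b)) + (W x - a) \<bullet> (x - p)) =
        (LINT x:T|lborel. ((?d * (w x - a \<bullet> x) + (W x - a) \<bullet> x) - W x \<bullet> p) + (a \<bullet> p - ?d * b))"
      by (simp add: inner_diff_left inner_diff_right algebra_simps)
    also have "\<dots> = (LINT x:T|lborel. ?d * (w x - a \<bullet> x) + (W x - a) \<bullet> x) - (LINT x:T|lborel. W x \<bullet> p)
        + (LINT x:T|lborel. a \<bullet> p - ?d * b)"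
      using i by (simp only: set_integral_add set_integral_diff)
    also have "\<dots> = b * (?d * ?m) - ?m * (a \<bullet> p) + (a \<bullet> p - ?d * b) * ?m"
      using m by (simp add: b_def a set_integral_const_compact[OF mesh_compact[OF T]])
    finally show ?thesis by (simp add: algebra_simps)
  qed
  show ?thesis
  proof (rule exI[of _ a], rule exI[of _ b], intro conjI allI impI P)
    fix F assume F: "F facet_of T"
    obtain p c where f: "\<And>w W. C1_grad w W \<Longrightarrow> face_integral F w = c * (LINT x:T|lborel. ?d * w x + W x \<bullet> (x - p))"
      using mesh_facetE[OF T F] by metis
    have "face_integral F (\<lambda>x. w x + (-1) * (a \<bullet> x + b)) = c * (LINT x:T|lborel. ?d * (w x - (a \<bullet> x + b)) + (W x - a) \<bullet> (x - p))"
    proof -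
      have "w x + (-1) * (a \<bullet> x + b) = w x - (a \<bullet> x + b)" "W x + (-1) *\<^sub>R a = W x - a" for x by simp_all
      then show ?thesis using f[OF C1_grad_lincomb[OF w C1_grad_affine[of a b], of "-1"]] by (simp only:)
    qed
    also have "\<dots> = 0" using P[of p] by simp
    finally show "face_integral F w = face_integral F (\<lambda>x. a \<bullet> x + b)"
      using face_integral_lincomb[OF T F w C1_grad_affine[of a b], of "-1"] by simp
  qed
qed

text \<open>The face integrals of the elementwise interpolants equal those of one global function,
  so the jumps have mean zero.\<close>

lemma crouzeix_raviart_interpolant:
  assumes \<phi>: "\<phi> \<in> test_functions \<Omega>"
  obtains v a b where "v \<in> CR"
    "\<And>T x. T \<in> \<T> \<Longrightarrow> x \<in> interior T \<Longrightarrow> v x = a T \<bullet> x + b T"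
    "\<And>T p. T \<in> \<T> \<Longrightarrow> (LINT x:T|lborel. real DIM('a) * (\<phi> x - (a T \<bullet> x + b T)) + (classical_grad \<phi> x - a T) \<bullet> (x - p)) = 0"
proof -
  note c1 = C1_grad_test[OF \<phi>]
  have "\<forall>T\<in>\<T>. \<exists>a b. (\<forall>p. (LINT x:T|lborel. real DIM('a) * (\<phi> x - (a \<bullet> x + b)) + (classical_grad \<phi> x - a) \<bullet> (x - p)) = 0) \<and>
     (\<forall>F. F facet_of T \<longrightarrow> face_integral F \<phi> = face_integral F (\<lambda>x. a \<bullet> x + b))"
    by (intro ballI facet_affine_interpolant c1)
  from bchoice[OF this] obtain a where "\<forall>T\<in>\<T>. \<exists>b. (\<forall>p. (LINT x:T|lborel. real DIM('a) * (\<phi> x - (a T \<bullet> x + b)) + (classical_grad \<phi> x - a T) \<bullet> (x - p)) = 0) \<and>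
     (\<forall>F. F facet_of T \<longrightarrow> face_integral F \<phi> = face_integral F (\<lambda>x. a T \<bullet> x + b))" ..
  from bchoice[OF this] obtain b where ab: "\<forall>T\<in>\<T>. (\<forall>p. (LINT x:T|lborel. real DIM('a) * (\<phi> x - (a T \<bullet> x + b T)) + (classical_grad \<phi> x - a T) \<bullet> (x - p)) = 0) \<and>
     (\<forall>F. F facet_of T \<longrightarrow> face_integral F \<phi> = face_integral F (\<lambda>x. a T \<bullet> x + b T))" ..
  have ab2: "face_integral F \<phi> = face_integral F (\<lambda>x. a T \<bullet> x + b T)" if "T \<in> \<T>" "F facet_of T" for T F
    using ab that by blast
  define v where "v = piecewise (\<lambda>T x. a T \<bullet> x + b T)"
  have v: "\<forall>T\<in>\<T>. \<forall>x\<in>interior T. v x = a T \<bullet> x + b T" by (simp add: v_def piecewise_eq)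
  obtain K where K: "K \<subseteq> \<Omega>" "\<And>x. x \<notin> K \<Longrightarrow> \<phi> x = 0" by (rule test_functionsE[OF \<phi>]) (rule that)
  \<comment> \<open>The support lies in the open domain, so the test function vanishes on boundary
    faces.\<close>
  have z: "face_integral F \<phi> = 0" if "F \<subseteq> frontier \<Omega>" for F
  proof -
    have "\<phi> x = 0" if "x \<in> F" for x
      using that \<open>F \<subseteq> frontier \<Omega>\<close> K frontier_disjoint_eq[of \<Omega>] open_dom by blast
    then have "face_integral F \<phi> = face_integral F (\<lambda>x. 0)" by (rule face_integral_cong)
    then show ?thesis by (simp add: face_integral_def set_lebesgue_integral_def)
  qed
  have "v \<in> CR"
    unfolding crouzeix_raviart_iff[OF v] by (auto simp: ab2[symmetric] z)
  then show ?thesis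
    by (rule that[of v a b]) (use v ab in blast)+
qed

lemma CR_gradE:
  assumes "z \<in> pw_affine \<T>"
  obtains q where "AE x in lebesgue_on \<Omega>. D z x = piecewise (\<lambda>T x. q T) x"
  by (rule pw_affineE[OF assms]) (rule that)

lemma pw_constantE:
  assumes "g \<in> pw_constant \<T>"
  obtains c where "\<And>T x. T \<in> \<T> \<Longrightarrow> x \<in> interior T \<Longrightarrow> g x = c T"
proof -
  have "\<forall>T\<in>\<T>. \<exists>c. \<forall>x\<in>interior T. g x = c" using assms by (simp add: pw_constant_def)
  from bchoice[OF this] obtain c where c: "\<forall>T\<in>\<T>. \<forall>x\<in>interior T. g x = c T" ..
  show ?thesis by (rule that[of c]) (use c in blast)
qed

lemma marini_correctionE:
  assumes g: "g \<in> pw_constant \<T>"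
  obtains c where "\<And>T x. T \<in> \<T> \<Longrightarrow> x \<in> interior T \<Longrightarrow> g x = c T"
    "AE x in lebesgue_on \<Omega>. flux g x =
      D (zCR g) x + piecewise (\<lambda>T x. (- c T / real DIM('a)) *\<^sub>R (x - barycentre T)) x"
proof -
  obtain c where c: "\<And>T x. T \<in> \<T> \<Longrightarrow> x \<in> interior T \<Longrightarrow> g x = c T" by (rule pw_constantE[OF g]) (rule that)
  have "flux g x = D (zCR g) x + piecewise (\<lambda>T x. (- c T / real DIM('a)) *\<^sub>R (x - barycentre T)) x"
    if T: "T \<in> \<T>" "x \<in> interior T" for T x
  proof -
    have "flux g x = piecewise (\<lambda>T x. D (zCR g) x - (g x / real DIM('a)) *\<^sub>R (x - barycentre T)) x"
      by (simp add: marini_flux_def piecewise_def)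
    then show ?thesis by (simp add: piecewise_eq[OF T] c[OF T])
  qed
  then show ?thesis by (intro that[OF c] AE_domI_interior) auto
qed

lemma CR_solution_in: "g \<in> pw_constant \<T> \<Longrightarrow> zCR g \<in> CR"
  and CR_solution_eq: "g \<in> pw_constant \<T> \<Longrightarrow> v \<in> CR \<Longrightarrow>
    ip (D (zCR g)) (D v) = ip g v"
  using CR_solution_works[OF pw_constant_L2] by (auto simp: is_CR_solution_def)

lemma CR_solution_L2: "g \<in> pw_constant \<T> \<Longrightarrow> D (zCR g) \<in> L2"
  by (rule broken_H1_L2(2)[OF crouzeix_raviart_broken_H1[OF CR_solution_in]])

lemma marini_correction_L2: "piecewise (\<lambda>T x. c T *\<^sub>R (x - barycentre T)) \<in> L2"
  by (rule L2_mesh[where h="\<lambda>T x. c T *\<^sub>R (x - barycentre T)"]) (auto intro!: continuous_intros simp: piecewise_eq)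

lemma marini_measurable: "flux g \<in> borel_measurable (lebesgue_on \<Omega>)" if g: "g \<in> pw_constant \<T>"
proof -
  have [measurable]: "g \<in> borel_measurable (lebesgue_on \<Omega>)" "D (zCR g) \<in> borel_measurable (lebesgue_on \<Omega>)"
    using L2_space_measurable[OF pw_constant_L2[OF g]] L2_space_measurable[OF CR_solution_L2[OF g]] by auto
  have [measurable]: "(\<lambda>x. indicator (interior T) x :: real) \<in> borel_measurable (lebesgue_on \<Omega>)" for T :: "'a set"
    by (intro measurable_restrict_space1 borel_measurable_indicator) simp
  have [measurable]: "(\<lambda>x. x - y) \<in> borel_measurable (lebesgue_on \<Omega>)" for y :: 'a
    by (rule continuous_imp_measurable_on_sets_lebesgue) (auto intro!: continuous_intros)
  have "(\<lambda>x. flux g x) \<in> borel_measurable (lebesgue_on \<Omega>)"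
    unfolding marini_flux_def by measurable
  then show ?thesis by simp
qed

lemma L2_space_AE:
  fixes f :: "'a \<Rightarrow> 'b::euclidean_space"
  assumes "AE x in lebesgue_on \<Omega>. f x = f' x" "f' \<in> L2" "f \<in> borel_measurable (lebesgue_on \<Omega>)"
  shows "f \<in> L2"
proof -
  have [measurable]: "f \<in> borel_measurable (lebesgue_on \<Omega>)" "f' \<in> borel_measurable (lebesgue_on \<Omega>)"
    using assms L2_space_measurable by auto
  have "integrable (lebesgue_on \<Omega>) (\<lambda>x. (norm (f x))\<^sup>2) \<longleftrightarrow> integrable (lebesgue_on \<Omega>) (\<lambda>x. (norm (f' x))\<^sup>2)"
    by (rule integrable_cong_AE) (use assms(1) in \<open>auto elim: eventually_mono\<close>)
  then show ?thesis using assms by (simp add: L2_space_def)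
qed

lemma marini_L2:
  assumes g: "g \<in> pw_constant \<T>"
  shows "flux g \<in> L2"
proof -
  obtain c where c: "AE x in lebesgue_on \<Omega>. flux g x =
      D (zCR g) x + piecewise (\<lambda>T x. (- c T / real DIM('a)) *\<^sub>R (x - barycentre T)) x"
    by (rule marini_correctionE[OF g]) (rule that)
  show ?thesis
    by (rule L2_space_AE[OF c L2_space_add[OF CR_solution_L2[OF g] marini_correction_L2] marini_measurable[OF g]])
qed

text \<open>On each element the correction is a multiple of \<open>x - barycentre T\<close> and has
  mean zero, while the gradient of an elementwise affine function is constant.\<close>

lemma marini_orthogonal:
  assumes g: "g \<in> pw_constant \<T>" and w: "w \<in> pw_affine \<T>"
  shows "ip (\<lambda>x. flux g x - D (zCR g) x) (D w) = 0"
proof -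
  obtain c where c: "AE x in lebesgue_on \<Omega>. flux g x =
      D (zCR g) x + piecewise (\<lambda>T x. (- c T / real DIM('a)) *\<^sub>R (x - barycentre T)) x"
    by (rule marini_correctionE[OF g]) (rule that)
  let ?r = "piecewise (\<lambda>T x. (- c T / real DIM('a)) *\<^sub>R (x - barycentre T))"
  obtain q where q: "AE x in lebesgue_on \<Omega>. D w x = piecewise (\<lambda>T x. q T) x" by (rule CR_gradE[OF w]) (rule that)
  have m: "D w \<in> L2" "?r \<in> L2" "(\<lambda>x. flux g x - D (zCR g) x) \<in> L2"
    by (intro broken_H1_L2(2) pw_affine_broken_H1 w marini_correction_L2 L2_space_diff marini_L2 CR_solution_L2 g)+
  have "ip (\<lambda>x. flux g x - D (zCR g) x) (D w) = ip ?r (piecewise (\<lambda>T x. q T))"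
    by (rule L2_inner_cong_AE) (use c q m piecewise_const_L2[of q] in \<open>auto intro: L2_space_measurable elim: eventually_mono\<close>)
  also have "\<dots> = (\<Sum>T\<in>\<T>. LINT x:T|lborel. ((- c T / real DIM('a)) *\<^sub>R (x - barycentre T)) \<bullet> q T)"
    by (rule L2_inner_mesh) (auto intro!: continuous_intros simp: piecewise_eq)
  also have "\<dots> = 0"
    by (intro sum.neutral ballI)
      (simp only: inner_scaleR_left set_integral_mult_right simplex_centroid[OF dim simplex_mesh] mult_zero_right)
  finally show ?thesis .
qed

text \<open>Integration by parts for the flux without normal traces: on each element the volume
  identities of the interpolant exchange \<open>\<phi>\<close> for its affine interpolant, and the
  discrete equation for \<open>zCR g\<close>, tested with the interpolant, cancels the remaining
  terms.\<close>

lemma marini_test: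
  assumes g: "g \<in> pw_constant \<T>" and \<phi>: "\<phi> \<in> test_functions \<Omega>"
  shows "ip (flux g) (classical_grad \<phi>) = ip g \<phi>"
proof -
  let ?d = "real DIM('a)" and ?z = "zCR g" and ?G = "classical_grad \<phi>"
  have cc: "continuous_on UNIV \<phi>" "continuous_on UNIV ?G" using C1_grad_continuous[OF C1_grad_test[OF \<phi>]] by auto
  obtain c where c: "\<And>T x. T \<in> \<T> \<Longrightarrow> x \<in> interior T \<Longrightarrow> g x = c T" "AE x in lebesgue_on \<Omega>. flux g x =
      D ?z x + piecewise (\<lambda>T x. (- c T / ?d) *\<^sub>R (x - barycentre T)) x"
    by (rule marini_correctionE[OF g]) (rule that)
  obtain q where q: "AE x in lebesgue_on \<Omega>. D ?z x = piecewise (\<lambda>T x. q T) x"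
    by (rule CR_gradE[OF crouzeix_raviart_pw_affine[OF CR_solution_in[OF g]]]) (rule that)
  obtain v a b where v: "v \<in> CR"
    "\<And>T x. T \<in> \<T> \<Longrightarrow> x \<in> interior T \<Longrightarrow> v x = a T \<bullet> x + b T"
    "\<And>T p. T \<in> \<T> \<Longrightarrow> (LINT x:T|lborel. ?d * (\<phi> x - (a T \<bullet> x + b T)) + (?G x - a T) \<bullet> (x - p)) = 0"
    by (rule crouzeix_raviart_interpolant[OF \<phi>]) (rule that)
  have Dv: "AE x in lebesgue_on \<Omega>. D v x = piecewise (\<lambda>T x. a T) x"
    by (rule broken_grad_AE[OF pw_affine_broken_grad[OF v(2)]])
  let ?s = "piecewise (\<lambda>T x. q T + (- c T / ?d) *\<^sub>R (x - barycentre T))"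
  have s: "AE x in lebesgue_on \<Omega>. flux g x = ?s x"
  proof -
    have "?s x = piecewise (\<lambda>T x. q T) x + piecewise (\<lambda>T x. (- c T / ?d) *\<^sub>R (x - barycentre T)) x" for x
      by (simp only: piecewise_def scaleR_add_right sum.distrib)
    note eq = this
    show ?thesis using c(2) q by eventually_elim (simp only: eq)
  qed
  have sL: "?s \<in> L2"
    by (rule L2_mesh[where h="\<lambda>T x. q T + (- c T / ?d) *\<^sub>R (x - barycentre T)"]) (auto intro!: continuous_intros simp: piecewise_eq)
  have loc: "(LINT x:T|lborel. (q T + (- c T / ?d) *\<^sub>R (x - barycentre T)) \<bullet> ?G x) =
      (LINT x:T|lborel. q T \<bullet> a T) + (LINT x:T|lborel. c T * \<phi> x) - (LINT x:T|lborel. c T * (a T \<bullet> x + b T))"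
    if T: "T \<in> \<T>" for T
  proof -
    let ?xT = "barycentre T"
    define E where "E p x = ?d * (\<phi> x - (a T \<bullet> x + b T)) + (?G x - a T) \<bullet> (x - p)" for p x
    have E0: "(LINT x:T|lborel. E p x) = 0" for p unfolding E_def by (rule v(3)[OF T])
    have i: "set_integrable lborel T (\<lambda>x. q T \<bullet> a T)" "set_integrable lborel T (E p)"
      "set_integrable lborel T (\<lambda>x. (x - ?xT) \<bullet> a T)" "set_integrable lborel T \<phi>" "set_integrable lborel T (\<lambda>x. a T \<bullet> x + b T)" for p
      unfolding E_def by (intro mesh_set_integrable[OF T] continuous_intros cc)+
    \<comment> \<open>The difference \<open>E 0 x - E (q T) x\<close> is the product of
      \<open>q T\<close> with the gradient error, and \<open>E\<close> at the barycentre converts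
      the linear part of the flux; every integral of \<open>E\<close> vanishes.\<close>
    have "(q T + (- c T / ?d) *\<^sub>R (x - ?xT)) \<bullet> ?G x = q T \<bullet> a T + (E 0 x - E (q T) x)
      + (- c T / ?d) * (E ?xT x + (x - ?xT) \<bullet> a T) + c T * \<phi> x - c T * (a T \<bullet> x + b T)" for x
      by (simp add: E_def inner_diff_left inner_diff_right inner_add_left inner_add_right inner_commute field_simps)
    then have "(LINT x:T|lborel. (q T + (- c T / ?d) *\<^sub>R (x - ?xT)) \<bullet> ?G x) =
      (LINT x:T|lborel. q T \<bullet> a T + (E 0 x - E (q T) x)
      + (- c T / ?d) * (E ?xT x + (x - ?xT) \<bullet> a T) + c T * \<phi> x - c T * (a T \<bullet> x + b T))" by simp
    also have "\<dots> = (LINT x:T|lborel. q T \<bullet> a T) + ((LINT x:T|lborel. E 0 x) - (LINT x:T|lborel. E (q T) x))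
      + (- c T / ?d) * ((LINT x:T|lborel. E ?xT x) + (LINT x:T|lborel. (x - ?xT) \<bullet> a T))
      + (LINT x:T|lborel. c T * \<phi> x) - (LINT x:T|lborel. c T * (a T \<bullet> x + b T))"
      by (simp only: set_integral_add set_integral_diff set_integral_mult_right set_integrable_mult_right i simp_thms implies_True_equals)
    finally show ?thesis by (simp add: E0 simplex_centroid[OF dim simplex_mesh[OF T]])
  qed
  have "ip (flux g) ?G = ip ?s ?G"
    by (intro L2_inner_cong_AE_left s marini_L2 g sL test_functions_L2_dom \<phi>)
  also have "\<dots> = (\<Sum>T\<in>\<T>. LINT x:T|lborel. (q T + (- c T / ?d) *\<^sub>R (x - barycentre T)) \<bullet> ?G x)"
    by (rule L2_inner_mesh) (auto intro!: continuous_intros cc simp: piecewise_eq)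
  also have "\<dots> = (\<Sum>T\<in>\<T>. LINT x:T|lborel. q T \<bullet> a T) + (\<Sum>T\<in>\<T>. LINT x:T|lborel. c T * \<phi> x) -
      (\<Sum>T\<in>\<T>. LINT x:T|lborel. c T * (a T \<bullet> x + b T))"
    unfolding sum.distrib[symmetric] sum_subtractf[symmetric] by (rule sum.cong[OF refl loc])
  also have "(\<Sum>T\<in>\<T>. LINT x:T|lborel. q T \<bullet> a T) = ip (piecewise (\<lambda>T x. q T)) (piecewise (\<lambda>T x. a T))"
    by (rule L2_inner_mesh[symmetric]) (auto simp: piecewise_eq)
  also have "\<dots> = ip (D ?z) (D v)"
    by (rule L2_inner_cong_AE)
      (use q Dv CR_solution_L2[OF g] broken_H1_L2(2)[OF crouzeix_raviart_broken_H1[OF v(1)]] piecewise_const_L2[of q] piecewise_const_L2[of a]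
       in \<open>auto intro: L2_space_measurable elim: eventually_mono\<close>)
  also have "\<dots> = ip g v" by (rule CR_solution_eq[OF g v(1)])
  also have "\<dots> = (\<Sum>T\<in>\<T>. LINT x:T|lborel. c T \<bullet> (a T \<bullet> x + b T))"
    by (rule L2_inner_mesh) (auto intro!: continuous_intros simp: c v)
  also have "(\<Sum>T\<in>\<T>. LINT x:T|lborel. c T * \<phi> x) = ip g \<phi>"
    using L2_inner_mesh[of "\<lambda>T x. c T" g "\<lambda>T. \<phi>" \<phi>] c cc by simp
  finally show ?thesis by simp
qed

lemma marini_H01:
  assumes g: "g \<in> pw_constant \<T>" and v: "v \<in> H01_space \<Omega>"
  shows "ip (flux g) (D v) = ip g v"
proof (rule L2_approx_eqI)
  show "\<exists>G' \<phi>. G' \<in> L2 \<and> \<phi> \<in> L2 \<and> nrm (\<lambda>x. D v x - G' x) < \<epsilon> \<and>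
      nrm (\<lambda>x. v x - \<phi> x) < \<epsilon> \<and> ip (flux g) G' = ip g \<phi>" if e: "0 < \<epsilon>" for \<epsilon> :: real
  proof -
    obtain \<phi> where "\<phi> \<in> test_functions \<Omega>" "nrm (\<lambda>x. v x - \<phi> x) < \<epsilon>" "nrm (\<lambda>x. D v x - classical_grad \<phi> x) < \<epsilon>"
      by (rule H01_approx[OF v e]) (rule that)
    then show ?thesis using marini_test[OF g] test_functions_L2_dom
      by (intro exI[of _ "classical_grad \<phi>"] exI[of _ \<phi>]) simp
  qed
qed (use g in \<open>auto intro: marini_L2 pw_constant_L2 broken_H1_L2 H01_weak_grad(2)[OF v]\<close>)

end

section \<open>Piecewise constant projection\<close>

context mesh
begin

lemma L2_inner_domain_const:
  assumes T: "T \<in> \<T>"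
  shows "L2_inner (interior T) (\<lambda>x. 1) (\<lambda>x. 1 :: real) = measure lborel T"
proof -
  have "(\<integral>x. 1 \<bullet> (1 :: real) \<partial>lebesgue_on (interior T)) = (LINT x:T|lborel. 1)"
    by (rule integral_interior_mesh(1)[OF T]) auto
  then show ?thesis by (simp add: L2_inner_def set_integral_const_compact[OF mesh_compact[OF T]])
qed

lemma piecewise_pw_constant: "piecewise (\<lambda>T x. c T) \<in> pw_constant \<T>"
  by (auto simp: pw_constant_def piecewise_eq)

lemma proj0_works:
  assumes f: "f \<in> L2"
  shows "proj0 \<Omega> \<T> f \<in> pw_constant \<T>"
    and "w \<in> pw_constant \<T> \<Longrightarrow> ip (\<lambda>x. f x - proj0 \<Omega> \<T> f x) w = 0"
proof -
  define c where "c T = L2_inner (interior T) f (\<lambda>x. 1) / measure lborel T" for T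
  let ?g = "piecewise (\<lambda>T x. c T)"
  have g: "?g \<in> pw_constant \<T>" by (rule piecewise_pw_constant)
  have o: "ip (\<lambda>x. f x - ?g x) w = 0" if w: "w \<in> pw_constant \<T>" for w
  proof -
    obtain k where k: "\<And>T x. T \<in> \<T> \<Longrightarrow> x \<in> interior T \<Longrightarrow> w x = k T" by (rule pw_constantE[OF w]) (rule that)
    have "L2_inner (interior T) (\<lambda>x. f x - ?g x) w = 0" if T: "T \<in> \<T>" for T
    proof -
      have "L2_inner (interior T) (\<lambda>x. f x - ?g x) w = L2_inner (interior T) (\<lambda>x. f x - c T * 1) (\<lambda>x. k T * 1)"
        unfolding L2_inner_def by (intro Bochner_Integration.integral_cong) (auto simp: k[OF T] piecewise_eq[OF T])
      also have "\<dots> = k T * (L2_inner (interior T) f (\<lambda>x. 1) - c T * measure lborel T)"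
        using L2_domD[OF f T] const_L2_interior[OF T, of "1::real"] L2_inner_domain_const[OF T]
        by (subst L2_inner_mult_right, subst L2_inner_diff_left) (auto simp: L2_inner_mult_left simp del: mult_1_right)
      also have "\<dots> = 0" using mesh_measure_pos[OF T] by (simp add: c_def)
      finally show ?thesis .
    qed
    then show ?thesis
      by (subst L2_inner_split) (auto intro: L2_space_diff f pw_constant_L2[OF g] pw_constant_L2[OF w])
  qed
  have "proj0 \<Omega> \<T> f \<in> pw_constant \<T> \<and> (\<forall>w\<in>pw_constant \<T>. ip (\<lambda>x. f x - proj0 \<Omega> \<T> f x) w = 0)"
    unfolding proj0_def by (rule someI[of _ ?g]) (use g o in blast)
  then show "proj0 \<Omega> \<T> f \<in> pw_constant \<T>" "w \<in> pw_constant \<T> \<Longrightarrow> ip (\<lambda>x. f x - proj0 \<Omega> \<T> f x) w = 0"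
    by auto
qed

lemma diameter_le_mesh_size: "T \<in> \<T> \<Longrightarrow> diameter T \<le> mesh_size \<T>"
  unfolding mesh_size_def using finite_mesh by (intro Max_ge) auto

lemma mesh_nonempty: "\<T> \<noteq> {}"
  using Union_mesh dom_nonempty closure_subset[of \<Omega>] by auto

lemma mesh_size_nonneg: "0 \<le> mesh_size \<T>"
proof -
  obtain T where T: "T \<in> \<T>" using mesh_nonempty by blast
  have "0 \<le> diameter T" by (rule diameter_ge_0[OF compact_imp_bounded[OF mesh_compact[OF T]]])
  then show ?thesis using diameter_le_mesh_size[OF T] by simp
qed

text \<open>Orthogonality of \<open>f\<close> to elementwise constants allows these to be subtracted
  before the Poincare inequality is applied on each element. The combination with an elementwise
  affine \<open>\<psi>\<close> serves differences of a conforming and a Crouzeix-Raviart function,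
  where the gradient of the difference is the controlled quantity.\<close>

lemma poincare_test:
  assumes f: "f \<in> L2" "\<And>w. w \<in> pw_constant \<T> \<Longrightarrow> ip f w = 0"
    and \<phi>: "\<phi> \<in> test_functions \<Omega>" and \<psi>: "\<psi> \<in> pw_affine \<T>"
  shows "\<bar>ip f (\<lambda>x. \<phi> x + c * \<psi> x)\<bar> \<le>
    mesh_size \<T> / pi * nrm f * nrm (\<lambda>x. classical_grad \<phi> x + c *\<^sub>R D \<psi> x)"
proof -
  obtain a b where ab: "\<And>T x. T \<in> \<T> \<Longrightarrow> x \<in> interior T \<Longrightarrow> \<psi> x = a T \<bullet> x + b T"
    by (rule pw_affine_coeffs[OF \<psi>]) (rule that)
  have Da: "AE x in lebesgue_on \<Omega>. D \<psi> x = piecewise (\<lambda>T x. a T) x"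
    by (rule broken_grad_AE[OF pw_affine_broken_grad[OF ab]])
  let ?v = "\<lambda>T x. \<phi> x + c * (a T \<bullet> x + b T)" and ?V = "\<lambda>T x. classical_grad \<phi> x + c *\<^sub>R a T"
  have C1: "C1_grad (?v T) (?V T)" for T by (rule C1_grad_lincomb[OF C1_grad_test[OF \<phi>] C1_grad_affine])
  have "\<exists>k. (LINT x:T|lborel. (?v T x - k)\<^sup>2) \<le> (diameter T / pi)\<^sup>2 * (LINT x:T|lborel. (norm (?V T x))\<^sup>2)" if "T \<in> \<T>" for T
    using C1[of T] by (intro simplex_poincare dim simplex_mesh that) (simp_all add: C1_grad_def)
  then have "\<forall>T\<in>\<T>. \<exists>k. (LINT x:T|lborel. (?v T x - k)\<^sup>2) \<le> (diameter T / pi)\<^sup>2 * (LINT x:T|lborel. (norm (?V T x))\<^sup>2)" by blast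
  from bchoice[OF this] obtain k where k: "\<forall>T\<in>\<T>. (LINT x:T|lborel. (?v T x - k T)\<^sup>2) \<le> (diameter T / pi)\<^sup>2 * (LINT x:T|lborel. (norm (?V T x))\<^sup>2)" ..
  let ?w = "piecewise (\<lambda>T x. k T)" and ?vv = "\<lambda>x. \<phi> x + c * \<psi> x" and ?VV = "\<lambda>x. classical_grad \<phi> x + c *\<^sub>R piecewise (\<lambda>T x. a T) x"
  let ?h = "mesh_size \<T> / pi"
  have cc: "continuous_on UNIV (?v T)" "continuous_on UNIV (?V T)" for T using C1_grad_continuous[OF C1[of T]] by auto
  have vL: "?vv \<in> L2" by (rule L2_mesh[where h="?v", OF cc(1)]) (simp add: ab)
  have wL: "?w \<in> L2" by (rule piecewise_const_L2)
  have VL: "?VV \<in> L2" by (rule L2_mesh[where h="?V", OF cc(2)]) (simp add: piecewise_eq)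
  have DL: "D \<psi> \<in> L2" by (rule broken_H1_L2(2)[OF pw_affine_broken_H1[OF \<psi>]])
  have "(nrm (\<lambda>x. ?vv x - ?w x))\<^sup>2 = (\<Sum>T\<in>\<T>. LINT x:T|lborel. (?v T x - k T) \<bullet> (?v T x - k T))"
    unfolding L2_norm_sq by (rule L2_inner_mesh) (auto simp: ab piecewise_eq intro!: continuous_intros cc(1))
  also have "\<dots> = (\<Sum>T\<in>\<T>. LINT x:T|lborel. (?v T x - k T)\<^sup>2)" by (simp add: power2_eq_square)
  also have "\<dots> \<le> (\<Sum>T\<in>\<T>. ?h\<^sup>2 * (LINT x:T|lborel. (norm (?V T x))\<^sup>2))"
  proof (rule sum_mono)
    fix T assume T: "T \<in> \<T>"
    have "0 \<le> diameter T" by (rule diameter_ge_0[OF compact_imp_bounded[OF mesh_compact[OF T]]])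
    then have "(diameter T / pi)\<^sup>2 \<le> ?h\<^sup>2" using diameter_le_mesh_size[OF T] by (intro power_mono divide_right_mono) auto
    moreover have "0 \<le> (LINT x:T|lborel. (norm (?V T x))\<^sup>2)"
      unfolding set_lebesgue_integral_def by (intro Bochner_Integration.integral_nonneg) auto
    ultimately have "(diameter T / pi)\<^sup>2 * (LINT x:T|lborel. (norm (?V T x))\<^sup>2) \<le> ?h\<^sup>2 * (LINT x:T|lborel. (norm (?V T x))\<^sup>2)"
      by (rule mult_right_mono)
    then show "(LINT x:T|lborel. (?v T x - k T)\<^sup>2) \<le> ?h\<^sup>2 * (LINT x:T|lborel. (norm (?V T x))\<^sup>2)"
      using k T by fastforce
  qed
  also have "\<dots> = ?h\<^sup>2 * (\<Sum>T\<in>\<T>. LINT x:T|lborel. ?V T x \<bullet> ?V T x)"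
    by (simp add: sum_distrib_left power2_norm_eq_inner)
  also have "(\<Sum>T\<in>\<T>. LINT x:T|lborel. ?V T x \<bullet> ?V T x) = (nrm ?VV)\<^sup>2"
    unfolding L2_norm_sq by (rule L2_inner_mesh[symmetric]) (auto simp: piecewise_eq intro!: cc(2))
  also have "?h\<^sup>2 * (nrm ?VV)\<^sup>2 = (?h * nrm ?VV)\<^sup>2" by (rule power_mult_distrib[symmetric])
  finally have le: "nrm (\<lambda>x. ?vv x - ?w x) \<le> ?h * nrm ?VV"
    by (rule power2_le_imp_le) (simp add: mesh_size_nonneg)
  have "ip f ?vv = ip f (\<lambda>x. ?vv x - ?w x)"
    using f(2)[OF piecewise_pw_constant] by (simp add: L2_inner_diff_right[OF vL wL f(1)])
  then have "\<bar>ip f ?vv\<bar> \<le> nrm f * nrm (\<lambda>x. ?vv x - ?w x)"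
    using L2_Cauchy_Schwarz[OF f(1) L2_space_diff[OF vL wL]] by simp
  also have "\<dots> \<le> nrm f * (?h * nrm ?VV)" by (intro mult_left_mono le) simp
  also have "nrm ?VV = nrm (\<lambda>x. classical_grad \<phi> x + c *\<^sub>R D \<psi> x)"
  proof (rule L2_norm_cong_AE)
    show "AE x in lebesgue_on \<Omega>. ?VV x = classical_grad \<phi> x + c *\<^sub>R D \<psi> x" using Da by eventually_elim simp
  qed (simp_all add: VL DL test_functions_L2_dom[OF \<phi>])
  finally show ?thesis by (simp add: mult_ac)
qed

text \<open>Density in the first function, with \<open>\<psi>\<close> fixed, so that the gradient of
  the sum converges as well.\<close>

lemma poincare_H01:
  assumes f: "f \<in> L2" "\<And>w. w \<in> pw_constant \<T> \<Longrightarrow> ip f w = 0"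
    and v: "v \<in> H01_space \<Omega>" and \<psi>: "\<psi> \<in> pw_affine \<T>"
  shows "\<bar>ip f (\<lambda>x. v x + c * \<psi> x)\<bar> \<le>
    mesh_size \<T> / pi * nrm f * nrm (\<lambda>x. D v x + c *\<^sub>R D \<psi> x)"
proof (rule field_le_epsilon)
  fix e :: real assume e: "0 < e"
  let ?F = "nrm f" and ?h = "mesh_size \<T> / pi" and ?N = "nrm (\<lambda>x. D v x + c *\<^sub>R D \<psi> x)"
  have h: "0 \<le> ?h" using mesh_size_nonneg by simp
  \<comment> \<open>The approximation costs \<open>(1 + ?h) * ?F * \<epsilon>\<close> in total; the
    summand 1 avoids division by zero.\<close>
  define \<epsilon> where "\<epsilon> = e / ((1 + ?h) * ?F + 1)"
  have d0: "0 < (1 + ?h) * ?F + 1" using h by (intro add_nonneg_pos mult_nonneg_nonneg) auto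
  have \<epsilon>: "0 < \<epsilon>" using e d0 by (simp add: \<epsilon>_def)
  obtain \<phi> where \<phi>: "\<phi> \<in> test_functions \<Omega>" "nrm (\<lambda>x. v x - \<phi> x) < \<epsilon>" "nrm (\<lambda>x. D v x - classical_grad \<phi> x) < \<epsilon>"
    by (rule H01_approx[OF v \<epsilon>]) (rule that)
  note L = H01_weak_grad(2)[OF v, THEN broken_H1_L2(1)] H01_weak_grad(2)[OF v, THEN broken_H1_L2(2)]
    pw_affine_broken_H1[OF \<psi>, THEN broken_H1_L2(1)] pw_affine_broken_H1[OF \<psi>, THEN broken_H1_L2(2)]
    test_functions_L2_dom(1)[OF \<phi>(1)] test_functions_L2_dom(2)[OF \<phi>(1)]
  have "ip f (\<lambda>x. v x + c * \<psi> x) = ip f (\<lambda>x. v x - \<phi> x) + ip f (\<lambda>x. \<phi> x + c * \<psi> x)"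
    using L f(1) by (simp add: L2_inner_simps L2_space_mult_left)
  also have "\<bar>\<dots>\<bar> \<le> ?F * \<epsilon> + ?h * ?F * nrm (\<lambda>x. classical_grad \<phi> x + c *\<^sub>R D \<psi> x)"
  proof -
    have "\<bar>ip f (\<lambda>x. v x - \<phi> x)\<bar> \<le> ?F * nrm (\<lambda>x. v x - \<phi> x)"
      using L by (intro L2_Cauchy_Schwarz f(1)) simp
    also have "\<dots> \<le> ?F * \<epsilon>" using \<phi>(2) by (intro mult_left_mono) auto
    finally show ?thesis using poincare_test[OF f \<phi>(1) \<psi>, of c] by linarith
  qed
  also have "\<dots> \<le> ?F * \<epsilon> + ?h * ?F * (?N + \<epsilon>)"
  proof -
    have "nrm (\<lambda>x. (D v x + c *\<^sub>R D \<psi> x) - (D v x - classical_grad \<phi> x)) \<le> ?N + nrm (\<lambda>x. D v x - classical_grad \<phi> x)"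
      using L by (intro L2_norm_diff_triangle) simp_all
    moreover have "(\<lambda>x. (D v x + c *\<^sub>R D \<psi> x) - (D v x - classical_grad \<phi> x)) = (\<lambda>x. classical_grad \<phi> x + c *\<^sub>R D \<psi> x)"
      by (simp add: fun_eq_iff)
    ultimately have "nrm (\<lambda>x. classical_grad \<phi> x + c *\<^sub>R D \<psi> x) \<le> ?N + \<epsilon>" using \<phi>(3) by simp
    moreover have "0 \<le> ?h * ?F" by (intro mult_nonneg_nonneg h) simp
    ultimately show ?thesis by (intro add_left_mono mult_left_mono)
  qed
  also have "\<dots> = ?h * ?F * ?N + (1 + ?h) * ?F * \<epsilon>" by (simp add: algebra_simps)
  also have "(1 + ?h) * ?F * \<epsilon> \<le> e"
  proof -
    have "(1 + ?h) * ?F * \<epsilon> \<le> ((1 + ?h) * ?F + 1) * \<epsilon>" using \<epsilon> by (intro mult_right_mono) auto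
    also have "\<dots> = e" using d0 by (simp add: \<epsilon>_def)
    finally show ?thesis .
  qed
  finally show "\<bar>ip f (\<lambda>x. v x + c * \<psi> x)\<bar> \<le> ?h * ?F * ?N + e" by simp
qed

end

section \<open>The constant of the flux\<close>

context mesh
begin

lemma pw_constant_norm:
  assumes "\<And>T x. T \<in> \<T> \<Longrightarrow> x \<in> interior T \<Longrightarrow> g x = c T"
  shows "(nrm g)\<^sup>2 = (\<Sum>T\<in>\<T>. (c T)\<^sup>2 * measure lborel T)"
proof -
  have "(nrm g)\<^sup>2 = (\<Sum>T\<in>\<T>. LINT x:T|lborel. c T \<bullet> c T)"
    unfolding L2_norm_sq by (rule L2_inner_mesh) (auto simp: assms)
  also have "\<dots> = (\<Sum>T\<in>\<T>. (c T)\<^sup>2 * measure lborel T)"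
    by (intro sum.cong refl) (simp add: set_integral_const_compact[OF mesh_compact] power2_eq_square mult_ac)
  finally show ?thesis .
qed

lemma pw_constant_value_le:
  assumes "\<And>T x. T \<in> \<T> \<Longrightarrow> x \<in> interior T \<Longrightarrow> g x = c T" and T: "T \<in> \<T>"
  shows "(c T)\<^sup>2 * measure lborel T \<le> (nrm g)\<^sup>2"
proof -
  have "(c T)\<^sup>2 * measure lborel T \<le> (\<Sum>T\<in>\<T>. (c T)\<^sup>2 * measure lborel T)"
    by (rule member_le_sum[OF T _ finite_mesh, of "\<lambda>T. (c T)\<^sup>2 * measure lborel T"]) simp
  then show ?thesis using pw_constant_norm[of g c, OF assms(1)] by simp
qed

text \<open>The Galerkin solution with load \<open>r\<close> in an arbitrary space \<open>W\<close>,
  so that the conforming space, the Crouzeix-Raviart space and the span containing the exact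
  solution are treated alike.\<close>

definition rep :: "('a \<Rightarrow> real) set \<Rightarrow> ('a \<Rightarrow> real) \<Rightarrow> ('a \<Rightarrow> real) \<Rightarrow> bool" where
  "rep W r z \<longleftrightarrow> z \<in> W \<and> (\<forall>v\<in>W. ip (D z) (D v) = ip r v)"

lemma rep_energy: "rep W r z \<Longrightarrow> (nrm (D z))\<^sup>2 = ip r z"
  by (simp add: rep_def L2_norm_sq)

text \<open>Symmetry of the solution operator; it later lets two loads change places.\<close>

lemma rep_sym: "rep W r z \<Longrightarrow> rep W s y \<Longrightarrow> ip r y = ip s z"
  unfolding rep_def by (metis L2_inner_commute)

lemma CR_rep: "g \<in> pw_constant \<T> \<Longrightarrow> rep CR g (zCR g)"
  by (simp add: rep_def CR_solution_in CR_solution_eq)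

lemma P1_rep: "g \<in> pw_constant \<T> \<Longrightarrow> rep P1 g (P1_solution \<Omega> \<T> g)"
  using P1_solution_works[OF pw_constant_L2] by (simp add: rep_def is_P1_solution_iff)

lemma le_of_sq_le_mult:
  fixes x y :: real
  assumes "x\<^sup>2 \<le> y * x" "0 \<le> x" "0 \<le> y"
  shows "x \<le> y"
proof (cases "x = 0")
  case False
  then have "0 < x" using assms by simp
  then show ?thesis using assms(1) by (simp add: power2_eq_square)
qed (use assms in simp)

text \<open>The discrete solution operators are bounded because the pieces of the right-hand side
  are multiples of finitely many indicator functions.\<close>

lemma galerkin_bound:
  assumes W: "fun_subspace W" and sol: "\<And>g. g \<in> pw_constant \<T> \<Longrightarrow> \<exists>z. rep W g z"
  shows "\<exists>C\<ge>0. \<forall>g\<in>pw_constant \<T>. \<forall>z. rep W g z \<longrightarrow> nrm (D z) \<le> C * nrm g"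
proof -
  define e where "e T = piecewise (\<lambda>S x. if S = T then 1 else 0 :: real)" for T
  have e: "e T \<in> pw_constant \<T>" for T unfolding e_def by (rule piecewise_pw_constant)
  have "\<exists>s. \<forall>T. rep W (e T) (s T)" using sol[OF e] by (intro choice) blast
  then obtain s where s: "\<And>T. rep W (e T) (s T)" by blast
  define C where "C = (\<Sum>T\<in>\<T>. nrm (D (s T)) / sqrt (measure lborel T))"
  have C: "0 \<le> C" unfolding C_def by (intro sum_nonneg) simp
  have "nrm (D z) \<le> C * nrm g" if g: "g \<in> pw_constant \<T>" and z: "rep W g z" for g z
  proof (rule le_of_sq_le_mult)
    obtain c where c: "\<And>T x. T \<in> \<T> \<Longrightarrow> x \<in> interior T \<Longrightarrow> g x = c T" by (rule pw_constantE[OF g]) (rule that)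
    have zW: "z \<in> W" using z by (simp add: rep_def)
    then have zL: "z \<in> L2" "D z \<in> L2"
      using W broken_H1_L2 unfolding fun_subspace_def by blast+
    have sL: "D (s T) \<in> L2" for T
      using W s[of T] broken_H1_L2(2) unfolding fun_subspace_def rep_def by blast
    have "AE x in lebesgue_on \<Omega>. g x = (\<Sum>T\<in>\<T>. c T * e T x)"
    proof (rule AE_domI_interior)
      fix S x assume S: "S \<in> \<T>" "x \<in> interior S"
      have "(\<Sum>T\<in>\<T>. c T * e T x) = (\<Sum>T\<in>\<T>. if T = S then c S else 0)"
        by (intro sum.cong refl) (auto simp: e_def piecewise_eq[OF S])
      then show "g x = (\<Sum>T\<in>\<T>. c T * e T x)" using S finite_mesh by (simp add: c[OF S])
    qed
    then have "ip g z = ip (\<lambda>x. \<Sum>T\<in>\<T>. c T * e T x) z"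
      by (rule L2_inner_cong_AE_left) (use pw_constant_L2[OF e] pw_constant_L2[OF g] zL in auto)
    also have "\<dots> = (\<Sum>T\<in>\<T>. c T * ip (D (s T)) (D z))"
      using s zW pw_constant_L2[OF e] zL by (subst L2_inner_sum_left) (auto simp: L2_inner_mult_left rep_def)
    also have "\<dots> \<le> (\<Sum>T\<in>\<T>. (nrm (D (s T)) / sqrt (measure lborel T)) * nrm g * nrm (D z))"
    proof (rule sum_mono)
      fix T assume T: "T \<in> \<T>"
      let ?m = "measure lborel T"
      have m: "0 < ?m" by (rule mesh_measure_pos[OF T])
      have "(\<bar>c T\<bar> * sqrt ?m)\<^sup>2 \<le> (nrm g)\<^sup>2"
        using pw_constant_value_le[of g c, OF c T] m by (simp add: power_mult_distrib)
      then have "\<bar>c T\<bar> * sqrt ?m \<le> nrm g" by (rule power2_le_imp_le) simp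
      then have "\<bar>c T\<bar> \<le> nrm g / sqrt ?m" using m by (simp add: field_simps)
      moreover have "\<bar>ip (D (s T)) (D z)\<bar> \<le> nrm (D (s T)) * nrm (D z)"
        by (rule L2_Cauchy_Schwarz[OF sL zL(2)])
      ultimately have "\<bar>c T\<bar> * \<bar>ip (D (s T)) (D z)\<bar> \<le> (nrm g / sqrt ?m) * (nrm (D (s T)) * nrm (D z))"
        using m by (intro mult_mono) auto
      moreover have "c T * ip (D (s T)) (D z) \<le> \<bar>c T\<bar> * \<bar>ip (D (s T)) (D z)\<bar>"
        by (metis abs_ge_self abs_mult)
      ultimately show "c T * ip (D (s T)) (D z) \<le> (nrm (D (s T)) / sqrt ?m) * nrm g * nrm (D z)"
        by (simp add: mult_ac)
    qed
    finally show "(nrm (D z))\<^sup>2 \<le> C * nrm g * nrm (D z)"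
      unfolding rep_energy[OF z] by (simp add: C_def sum_distrib_right)
  qed (use C in auto)
  with C show ?thesis by blast
qed

text \<open>On one element the correction is the value of \<open>g\<close> times a fixed function,
  so each element has its own constant; what matters is that there are finitely many.\<close>

lemma marini_correction_bound:
  "\<exists>C\<ge>0. \<forall>g\<in>pw_constant \<T>. nrm (\<lambda>x. flux g x - D (zCR g) x) \<le> C * nrm g"
proof -
  define K where "K T = (LINT x:T|lborel. (norm (x - barycentre T))\<^sup>2) / (real DIM('a))\<^sup>2" for T :: "'a set"
  have K: "0 \<le> K T" for T unfolding K_def set_lebesgue_integral_def
    by (intro divide_nonneg_nonneg Bochner_Integration.integral_nonneg) auto
  define C where "C = sqrt (\<Sum>T\<in>\<T>. K T / measure lborel T)"
  have S0: "0 \<le> (\<Sum>T\<in>\<T>. K T / measure lborel T)" by (intro sum_nonneg divide_nonneg_nonneg K) simp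
  have "nrm (\<lambda>x. flux g x - D (zCR g) x) \<le> C * nrm g" if g: "g \<in> pw_constant \<T>" for g
  proof (rule power2_le_imp_le)
    obtain c where c: "\<And>T x. T \<in> \<T> \<Longrightarrow> x \<in> interior T \<Longrightarrow> g x = c T"
      "AE x in lebesgue_on \<Omega>. flux g x =
      D (zCR g) x + piecewise (\<lambda>T x. (- c T / real DIM('a)) *\<^sub>R (x - barycentre T)) x"
      by (rule marini_correctionE[OF g]) (rule that)
    let ?r = "piecewise (\<lambda>T x. (- c T / real DIM('a)) *\<^sub>R (x - barycentre T))"
    have "nrm (\<lambda>x. flux g x - D (zCR g) x) = nrm ?r"
    proof (rule L2_norm_cong_AE)
      show "AE x in lebesgue_on \<Omega>. flux g x - D (zCR g) x = ?r x"
        using c(2) by eventually_elim simp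
      show "?r \<in> L2" by (rule marini_correction_L2)
    qed (simp add: marini_L2[OF g] CR_solution_L2[OF g])
    then have "(nrm (\<lambda>x. flux g x - D (zCR g) x))\<^sup>2 = ip ?r ?r" by (simp add: L2_norm_sq)
    also have "\<dots> = (\<Sum>T\<in>\<T>. LINT x:T|lborel. ((- c T / real DIM('a)) *\<^sub>R (x - barycentre T)) \<bullet> ((- c T / real DIM('a)) *\<^sub>R (x - barycentre T)))"
      by (rule L2_inner_mesh) (auto intro!: continuous_intros simp: piecewise_eq)
    also have "\<dots> = (\<Sum>T\<in>\<T>. (c T)\<^sup>2 * K T)"
    proof (rule sum.cong[OF refl])
      fix T
      have "((- c T / real DIM('a)) *\<^sub>R (x - barycentre T)) \<bullet> ((- c T / real DIM('a)) *\<^sub>R (x - barycentre T))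
          = ((c T)\<^sup>2 / (real DIM('a))\<^sup>2) * (norm (x - barycentre T))\<^sup>2" for x
        unfolding power2_norm_eq_inner by (simp add: power2_eq_square)
      then show "(LINT x:T|lborel. ((- c T / real DIM('a)) *\<^sub>R (x - barycentre T)) \<bullet> ((- c T / real DIM('a)) *\<^sub>R (x - barycentre T)))
          = (c T)\<^sup>2 * K T"
        unfolding K_def by (simp only: set_integral_mult_right) simp
    qed
    also have "\<dots> \<le> (\<Sum>T\<in>\<T>. (nrm g)\<^sup>2 * (K T / measure lborel T))"
    proof (rule sum_mono)
      fix T assume T: "T \<in> \<T>"
      have m: "0 < measure lborel T" by (rule mesh_measure_pos[OF T])
      have "(c T)\<^sup>2 * K T = ((c T)\<^sup>2 * measure lborel T) * (K T / measure lborel T)" using m by simp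
      also have "\<dots> \<le> (nrm g)\<^sup>2 * (K T / measure lborel T)"
        using pw_constant_value_le[of g c, OF c(1) T] K m by (intro mult_right_mono) auto
      finally show "(c T)\<^sup>2 * K T \<le> (nrm g)\<^sup>2 * (K T / measure lborel T)" .
    qed
    also have "\<dots> = (C * nrm g)\<^sup>2"
      unfolding power_mult_distrib C_def real_sqrt_pow2[OF S0] sum_distrib_left[symmetric] by (rule mult.commute)
    finally show "(nrm (\<lambda>x. flux g x - D (zCR g) x))\<^sup>2 \<le> (C * nrm g)\<^sup>2" .
    show "0 \<le> C * nrm g" using S0 by (simp add: C_def)
  qed
  moreover have "0 \<le> C" using S0 by (simp add: C_def)
  ultimately show ?thesis by blast
qed

lemma P1_solution_H01: "g \<in> pw_constant \<T> \<Longrightarrow> P1_solution \<Omega> \<T> g \<in> H01_space \<Omega>"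
  using P1_rep[of g] by (simp add: rep_def conforming_P1_def)

lemma P1_solution_L2: "g \<in> pw_constant \<T> \<Longrightarrow> D (P1_solution \<Omega> \<T> g) \<in> L2"
  by (rule broken_H1_L2(2)[OF H01_weak_grad(2)[OF P1_solution_H01]])

text \<open>A real supremum is meaningful for a nonempty set that is bounded above. Boundedness
  comes from bounds for the three parts of the flux error on a finite-dimensional space, and
  nonemptiness from the constant 1.\<close>

lemma kappa_bound:
  shows "0 \<le> kappa_M \<Omega> \<T>"
    and "g \<in> pw_constant \<T> \<Longrightarrow>
      nrm (\<lambda>x. flux g x - D (P1_solution \<Omega> \<T> g) x) \<le> kappa_M \<Omega> \<T> * nrm g"
proof -
  let ?N = "\<lambda>g. nrm (\<lambda>x. flux g x - D (P1_solution \<Omega> \<T> g) x)"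
  let ?N' = "\<lambda>g. nrm (\<lambda>x. flux g x - weak_grad \<Omega> (P1_solution \<Omega> \<T> g) x)"
  have NN: "?N' g = ?N g" if g: "g \<in> pw_constant \<T>" for g
    by (rule L2_norm_cong_AE) (use H01_weak_grad(3)[OF P1_solution_H01[OF g]] H01_weak_grad_L2[OF P1_solution_H01[OF g]]
      marini_L2[OF g] P1_solution_L2[OF g] in \<open>auto elim: eventually_mono\<close>)
  obtain C1 where C1: "0 \<le> C1" "\<And>g. g \<in> pw_constant \<T> \<Longrightarrow> nrm (D (zCR g)) \<le> C1 * nrm g"
    using galerkin_bound[OF crouzeix_raviart_subspace] CR_rep by blast
  obtain C2 where C2: "0 \<le> C2" "\<And>g. g \<in> pw_constant \<T> \<Longrightarrow> nrm (D (P1_solution \<Omega> \<T> g)) \<le> C2 * nrm g"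
    using galerkin_bound[OF conforming_P1_subspace] P1_rep by blast
  obtain C3 where C3: "0 \<le> C3" "\<And>g. g \<in> pw_constant \<T> \<Longrightarrow>
      nrm (\<lambda>x. flux g x - D (zCR g) x) \<le> C3 * nrm g"
    using marini_correction_bound by blast
  define C where "C = C3 + C1 + C2"
  have bnd: "?N g \<le> C * nrm g" if g: "g \<in> pw_constant \<T>" for g
  proof -
    let ?s = "\<lambda>x. flux g x - D (zCR g) x" and ?q = "D (zCR g)" and ?z = "D (P1_solution \<Omega> \<T> g)"
    have L: "?s \<in> L2" "?q \<in> L2" "?z \<in> L2"
      using marini_L2[OF g] CR_solution_L2[OF g] P1_solution_L2[OF g] by simp_all
    have "?N g = nrm (\<lambda>x. ?s x + (?q x - ?z x))" by simp
    also have "\<dots> \<le> nrm ?s + nrm (\<lambda>x. ?q x - ?z x)" by (rule L2_norm_triangle[OF L(1) L2_space_diff[OF L(2,3)]])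
    also have "\<dots> \<le> nrm ?s + (nrm ?q + nrm ?z)" by (intro add_left_mono L2_norm_diff_triangle L)
    also have "\<dots> \<le> C3 * nrm g + (C1 * nrm g + C2 * nrm g)"
      using C1(2)[OF g] C2(2)[OF g] C3(2)[OF g] by linarith
    finally show ?thesis by (simp add: C_def algebra_simps)
  qed
  let ?S = "{g \<in> pw_constant \<T>. nrm g \<noteq> 0}"
  have bdd: "bdd_above ((\<lambda>g. ?N' g / nrm g) ` ?S)"
  proof (rule bdd_aboveI2)
    fix g assume g: "g \<in> ?S"
    then have "0 < nrm g" by (auto simp: less_le)
    then show "?N' g / nrm g \<le> C" using bnd[of g] NN[of g] g by (simp add: divide_le_eq)
  qed
  have le: "?N g / nrm g \<le> kappa_M \<Omega> \<T>" if "g \<in> ?S" for g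
    using cSUP_upper[OF that bdd] NN[of g] that by (simp add: kappa_M_def)
  show "?N g \<le> kappa_M \<Omega> \<T> * nrm g" if g: "g \<in> pw_constant \<T>"
  proof (cases "nrm g = 0")
    case True
    \<comment> \<open>The supremum skips functions of norm zero; for these the finite bound already
      makes the left side vanish.\<close>
    then show ?thesis using bnd[OF g] by simp
  next
    case False
    then have "0 < nrm g" by (auto simp: less_le)
    then show ?thesis using le[of g] g False by (simp add: divide_le_eq)
  qed
  have one: "(\<lambda>x. 1) \<in> pw_constant \<T>" by (auto simp: pw_constant_def)
  have "(nrm (\<lambda>x. 1 :: real))\<^sup>2 = (\<Sum>T\<in>\<T>. 1\<^sup>2 * measure lborel T)" by (rule pw_constant_norm) simp
  also have "\<dots> > 0" using mesh_measure_pos mesh_nonempty finite_mesh by (intro sum_pos) auto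
  finally have "nrm (\<lambda>x. 1 :: real) \<noteq> 0" by auto
  then have "?N (\<lambda>x. 1) / nrm (\<lambda>x. 1 :: real) \<le> kappa_M \<Omega> \<T>" using one by (intro le) simp
  moreover have "0 \<le> ?N (\<lambda>x. 1) / nrm (\<lambda>x. 1 :: real)" by simp
  ultimately show "0 \<le> kappa_M \<Omega> \<T>" by linarith
qed

end

section \<open>Error estimates\<close>

text \<open>Both quadratics lie between 0 and \<open>A\<close> times the norm polynomial, so their
  difference lies between plus and minus that bound. Evaluating at \<open>t\<close> and
  \<open>- t\<close> removes the term with \<open>p\<close> and leaves a discriminant. Bounding
  \<open>a1\<close> and \<open>b1\<close> separately would give twice the constant.\<close>

lemma polarization_bound:
  fixes A :: real
  assumes "\<And>t. 0 \<le> a0 + 2 * t * a1 + t\<^sup>2 * a2" "\<And>t. a0 + 2 * t * a1 + t\<^sup>2 * a2 \<le> A * (G\<^sup>2 + 2 * t * p + t\<^sup>2 * F\<^sup>2)"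
    and "\<And>t. 0 \<le> b0 + 2 * t * b1 + t\<^sup>2 * b2" "\<And>t. b0 + 2 * t * b1 + t\<^sup>2 * b2 \<le> A * (G\<^sup>2 + 2 * t * p + t\<^sup>2 * F\<^sup>2)"
    and "0 \<le> A" "0 \<le> F" "0 \<le> G"
  shows "a1 - b1 \<le> A * F * G"
proof -
  have "0 \<le> A * G\<^sup>2 + 2 * t * (- (a1 - b1)) + t\<^sup>2 * (A * F\<^sup>2)" for t
    using assms(2)[of t] assms(3)[of t] assms(1)[of "- t"] assms(4)[of "- t"] by (simp add: algebra_simps)
  then have "(- (a1 - b1))\<^sup>2 \<le> (A * G\<^sup>2) * (A * F\<^sup>2)"
    by (rule discriminant_nonneg_le) (simp add: assms(5))
  also have "(A * G\<^sup>2) * (A * F\<^sup>2) = (A * F * G)\<^sup>2" by (simp add: power2_eq_square)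
  finally have "(a1 - b1)\<^sup>2 \<le> (A * F * G)\<^sup>2" by (simp only: power2_minus)
  then show ?thesis by (rule power2_le_imp_le) (intro mult_nonneg_nonneg assms(5-7))
qed

context mesh
begin

lemma rep_lincomb:
  assumes W: "fun_subspace W" and z: "rep W r z" and y: "rep W s y" and L: "r \<in> L2" "s \<in> L2"
  shows "rep W (\<lambda>x. r x + c * s x) (\<lambda>x. z x + c * y x)"
  unfolding rep_def
proof (intro conjI ballI)
  have zy: "z \<in> W" "y \<in> W" using z y by (auto simp: rep_def)
  have WH: "v \<in> broken_H1" if "v \<in> W" for v using W that by (auto simp: fun_subspace_def)
  show "(\<lambda>x. z x + c * y x) \<in> W" by (rule fun_subspaceD[OF W zy])
  fix v assume v: "v \<in> W"
  have "ip (D (\<lambda>x. z x + c * y x)) (D v) = ip r v + c * ip s v"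
    using z y v by (simp add: D_inner_lincomb[OF WH[OF zy(1)] WH[OF zy(2)] broken_H1_L2(2)[OF WH[OF v]]] rep_def)
  also have "\<dots> = ip (\<lambda>x. r x + c * s x) v"
    using L broken_H1_L2(1)[OF WH[OF v]] by (simp add: L2_inner_simps L2_space_mult_left)
  finally show "ip (D (\<lambda>x. z x + c * y x)) (D v) = ip (\<lambda>x. r x + c * s x) v" .
qed

lemma poincare_pw_affine:
  assumes "f \<in> L2" "\<And>w. w \<in> pw_constant \<T> \<Longrightarrow> ip f w = 0" "\<psi> \<in> pw_affine \<T>"
  shows "\<bar>ip f \<psi>\<bar> \<le> mesh_size \<T> / pi * nrm f * nrm (D \<psi>)"
proof -
  have t: "(\<lambda>x. 0) \<in> test_functions \<Omega>" by (intro test_functionsI[of _ "{}"]) (auto intro: C_k_const)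
  have "classical_grad (\<lambda>x. 0 :: real) x = (0 :: 'a)" for x by (rule classical_grad_unique) simp
  then show ?thesis using poincare_test[OF assms(1,2) t assms(3), of 1] by simp
qed

lemma poincare_H01':
  assumes "f \<in> L2" "\<And>w. w \<in> pw_constant \<T> \<Longrightarrow> ip f w = 0" "v \<in> H01_space \<Omega>"
  shows "\<bar>ip f v\<bar> \<le> mesh_size \<T> / pi * nrm f * nrm (D v)"
  using poincare_H01[OF assms crouzeix_raviart_pw_affine[OF crouzeix_raviart_zero], of 0] by simp

abbreviation "\<alpha> \<equiv> mesh_size \<T> / pi"
abbreviation "\<kappa> \<equiv> kappa_M \<Omega> \<T>"

lemma \<alpha>_nonneg: "0 \<le> \<alpha>" using mesh_size_nonneg by simp

lemma rep_oscillation: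
  assumes z: "rep W r z" and r: "r \<in> L2" "\<And>w. w \<in> pw_constant \<T> \<Longrightarrow> ip r w = 0"
    and W: "W \<subseteq> H01_space \<Omega> \<or> W \<subseteq> pw_affine \<T>"
  shows "nrm (D z) \<le> \<alpha> * nrm r"
proof (rule le_of_sq_le_mult)
  have "z \<in> W" using z by (simp add: rep_def)
  then have "\<bar>ip r z\<bar> \<le> \<alpha> * nrm r * nrm (D z)"
    using W poincare_pw_affine[OF r, of z] poincare_H01'[OF r, of z] by blast
  then show "(nrm (D z))\<^sup>2 \<le> \<alpha> * nrm r * nrm (D z)"
    unfolding rep_energy[OF z] by simp
  show "0 \<le> \<alpha> * nrm r" by (intro mult_nonneg_nonneg \<alpha>_nonneg) simp
qed simp

lemma L2_norm_lincomb_sq: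
  fixes f g :: "'a \<Rightarrow> 'b::euclidean_space"
  assumes "f \<in> L2" "g \<in> L2"
  shows "(nrm (\<lambda>x. f x + t *\<^sub>R g x))\<^sup>2 = (nrm f)\<^sup>2 + 2 * t * ip f g + t\<^sup>2 * (nrm g)\<^sup>2"
  unfolding L2_norm_sq using assms
  by (simp add: L2_inner_simps L2_inner_commute[of \<Omega> g f] power2_eq_square algebra_simps)

lemma rep_energy_lincomb:
  assumes W: "fun_subspace W" and z: "rep W r z" and y: "rep W s y" and L: "r \<in> L2" "s \<in> L2"
  shows "(nrm (D (\<lambda>x. z x + t * y x)))\<^sup>2 =
    ip r z + 2 * t * ip r y + t\<^sup>2 * ip s y"
proof -
  have zy: "z \<in> L2" "y \<in> L2"
    using W z y broken_H1_L2(1) unfolding fun_subspace_def rep_def by blast+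
  have "(nrm (D (\<lambda>x. z x + t * y x)))\<^sup>2 = ip (\<lambda>x. r x + t * s x) (\<lambda>x. z x + t * y x)"
    by (rule rep_energy[OF rep_lincomb[OF W z y L]])
  also have "\<dots> = ip r z + t * ip r y + t * ip s z + t\<^sup>2 * ip s y"
    using zy L by (simp add: L2_inner_simps L2_space_mult_left power2_eq_square algebra_simps)
  finally show ?thesis using rep_sym[OF z y] by (simp add: algebra_simps)
qed

text \<open>The conforming and the Crouzeix-Raviart energy of an oscillation are each at most
  \<open>\<alpha>\<^sup>2\<close> times its squared norm, so the polarized difference costs a single
  \<open>\<alpha>\<^sup>2\<close>. The representers \<open>V\<close> and \<open>K\<close> of
  \<open>s\<close> provide diagonal entries of the two quadratic polynomials.\<close>

lemma block_oscillation:
  assumes W: "fun_subspace W" "W \<subseteq> H01_space \<Omega>"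
    and L: "r \<in> L2" "s \<in> L2"
    and o: "\<And>w. w \<in> pw_constant \<T> \<Longrightarrow> ip r w = 0" "\<And>w. w \<in> pw_constant \<T> \<Longrightarrow> ip s w = 0"
    and U: "rep W r U" "rep CR r C" and V: "rep W s V" "rep CR s K"
  shows "ip s U - ip s C \<le> \<alpha>\<^sup>2 * nrm r * nrm s"
proof (rule polarization_bound)
  have CR: "CR \<subseteq> pw_affine \<T>" using crouzeix_raviart_pw_affine by blast
  fix t :: real
  let ?n = "(nrm s)\<^sup>2 + 2 * t * ip s r + t\<^sup>2 * (nrm r)\<^sup>2"
  have n: "(nrm (\<lambda>x. s x + t * r x))\<^sup>2 = ?n" using L2_norm_lincomb_sq[OF L(2,1), of t] by simp
  have st: "(\<lambda>x. s x + t * r x) \<in> L2" using L by (simp add: L2_space_mult_left)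
  have ot: "ip (\<lambda>x. s x + t * r x) w = 0" if "w \<in> pw_constant \<T>" for w
    using L o[OF that] pw_constant_L2[OF that] by (simp add: L2_inner_simps L2_space_mult_left)
  have b: "(nrm (D (\<lambda>x. v x + t * u x)))\<^sup>2 \<le> \<alpha>\<^sup>2 * ?n"
    if "fun_subspace X" "X \<subseteq> H01_space \<Omega> \<or> X \<subseteq> pw_affine \<T>" "rep X s v" "rep X r u" for X v u
  proof -
    have "nrm (D (\<lambda>x. v x + t * u x)) \<le> \<alpha> * nrm (\<lambda>x. s x + t * r x)"
      by (rule rep_oscillation[OF rep_lincomb[OF that(1,3,4) L(2,1)] st ot that(2)])
    then have "(nrm (D (\<lambda>x. v x + t * u x)))\<^sup>2 \<le> (\<alpha> * nrm (\<lambda>x. s x + t * r x))\<^sup>2" by (intro power_mono) auto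
    then show ?thesis unfolding power_mult_distrib n .
  qed
  note eW = rep_energy_lincomb[OF W(1) V(1) U(1) L(2,1), of t]
  note eC = rep_energy_lincomb[OF crouzeix_raviart_subspace V(2) U(2) L(2,1), of t]
  show "0 \<le> ip s V + 2 * t * ip s U + t\<^sup>2 * ip r U"
    unfolding eW[symmetric] by simp
  show "ip s V + 2 * t * ip s U + t\<^sup>2 * ip r U \<le> \<alpha>\<^sup>2 * ?n"
    unfolding eW[symmetric] by (rule b[OF W(1) disjI1[OF W(2)] V(1) U(1)])
  show "0 \<le> ip s K + 2 * t * ip s C + t\<^sup>2 * ip r C"
    unfolding eC[symmetric] by simp
  show "ip s K + 2 * t * ip s C + t\<^sup>2 * ip r C \<le> \<alpha>\<^sup>2 * ?n"
    unfolding eC[symmetric] by (rule b[OF crouzeix_raviart_subspace disjI2[OF CR] V(2) U(2)])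
qed simp_all

text \<open>By orthogonality, the squared distance of the Marini flux from the conforming discrete
  gradient splits into the squared distance of the two gradients below and a remainder.\<close>

lemma representer_gap:
  assumes W: "fun_subspace W" "W \<subseteq> H01_space \<Omega>" "P1 \<subseteq> W"
    and r: "r \<in> pw_constant \<T>" and U: "rep W r U"
  shows "nrm (\<lambda>x. D U x - D (zCR r) x) \<le> \<kappa> * nrm r"
proof -
  define \<sigma> where "\<sigma> = flux r"
  define q where "q = D (zCR r)"
  define z where "z = D (P1_solution \<Omega> \<T> r)"
  define t where "t = D U"
  have UW: "U \<in> W" using U by (simp add: rep_def)
  have zP: "P1_solution \<Omega> \<T> r \<in> P1" using P1_rep[OF r] by (simp add: rep_def)
  have L: "\<sigma> \<in> L2" "q \<in> L2" "z \<in> L2" "t \<in> L2"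
    using marini_L2[OF r] CR_solution_L2[OF r] P1_solution_L2[OF r] broken_H1_L2(2)[OF H01_weak_grad(2), of U] W(2) UW
    by (auto simp: \<sigma>_def q_def z_def t_def)
  have orth: "ip \<sigma> (D w) = ip q (D w)" if "w \<in> pw_affine \<T>" for w
    using marini_orthogonal[OF r that] L(1,2) broken_H1_L2(2)[OF pw_affine_broken_H1[OF that]]
    by (simp add: \<sigma>_def q_def L2_inner_diff_left)
  have e1: "ip \<sigma> q = ip q q"
    unfolding q_def using orth[OF crouzeix_raviart_pw_affine[OF CR_solution_in[OF r]]] by (simp add: q_def)
  have e2: "ip \<sigma> t = ip t t"
    using marini_H01[OF r, of U] W(2) UW U by (auto simp: \<sigma>_def t_def rep_def)
  have e3: "ip t z = ip z z"
  proof -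
    have "ip t z = ip r (P1_solution \<Omega> \<T> r)" using U W(3) zP by (auto simp: t_def z_def rep_def)
    also have "\<dots> = ip z z" using P1_rep[OF r] zP by (simp add: z_def rep_def)
    finally show ?thesis .
  qed
  have e4: "ip \<sigma> z = ip z z"
  proof -
    have "ip \<sigma> z = ip r (P1_solution \<Omega> \<T> r)"
      using marini_H01[OF r P1_solution_H01[OF r]] by (simp add: \<sigma>_def z_def)
    also have "\<dots> = ip z z" using P1_rep[OF r] zP by (simp add: z_def rep_def)
    finally show ?thesis .
  qed
  have e5: "ip q z = ip z z"
    using orth[of "P1_solution \<Omega> \<T> r"] zP e4 conforming_P1_pw_affine by (auto simp: z_def)
  \<comment> \<open>The product of \<open>t\<close> and \<open>q\<close> is unknown but cancels; all
    other mixed products reduce to squares by \<open>e1\<close> to \<open>e5\<close>.\<close>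
  have "(nrm (\<lambda>x. \<sigma> x - z x))\<^sup>2 =
      (nrm (\<lambda>x. t x - q x))\<^sup>2 + (nrm (\<lambda>x. (\<sigma> x - q x) - (t x - z x)))\<^sup>2"
    unfolding L2_norm_sq using L e1 e2 e3 e4 e5
    by (simp add: L2_inner_diff_left L2_inner_diff_right L2_inner_commute[of \<Omega> q \<sigma>] L2_inner_commute[of \<Omega> t \<sigma>]
      L2_inner_commute[of \<Omega> z \<sigma>] L2_inner_commute[of \<Omega> z t] L2_inner_commute[of \<Omega> z q] L2_inner_commute[of \<Omega> t q])
  then have "(nrm (\<lambda>x. t x - q x))\<^sup>2 \<le> (nrm (\<lambda>x. \<sigma> x - z x))\<^sup>2" by simp
  then have "nrm (\<lambda>x. t x - q x) \<le> nrm (\<lambda>x. \<sigma> x - z x)" by (rule power2_le_imp_le) simp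
  also have "\<dots> \<le> \<kappa> * nrm r" using kappa_bound(2)[OF r] by (simp add: \<sigma>_def z_def)
  finally show ?thesis by (simp add: t_def q_def)
qed

text \<open>The gradient difference for \<open>r\<close> is orthogonal to the gradient of the
  conforming discrete solution with load \<open>s\<close>, which may therefore be subtracted from
  the flux of \<open>s\<close>. This makes the block a product of two differences, each controlled
  by \<open>\<kappa>\<close>.\<close>

lemma block_constant:
  assumes W: "fun_subspace W" "W \<subseteq> H01_space \<Omega>" "P1 \<subseteq> W"
    and rs: "r \<in> pw_constant \<T>" "s \<in> pw_constant \<T>" and U: "rep W r U"
  shows "ip s U - ip s (zCR r) \<le> \<kappa>\<^sup>2 * nrm r * nrm s"
proof -
  let ?q = "D (zCR r)" and ?\<sigma> = "flux s" and ?z = "P1_solution \<Omega> \<T> s" and ?K = "zCR s"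
  have UH: "U \<in> H01_space \<Omega>" using U W(2) by (auto simp: rep_def)
  have zP: "?z \<in> P1" using P1_rep[OF rs(2)] by (simp add: rep_def)
  have L: "D U \<in> L2" "?q \<in> L2" "?\<sigma> \<in> L2" "D ?z \<in> L2" "D ?K \<in> L2"
    using broken_H1_L2(2)[OF H01_weak_grad(2)[OF UH]] CR_solution_L2[OF rs(1)] CR_solution_L2[OF rs(2)]
      marini_L2[OF rs(2)] P1_solution_L2[OF rs(2)] by auto
  have a: "ip (D U) ?\<sigma> = ip s U" using marini_H01[OF rs(2) UH] by (simp add: L2_inner_commute)
  have b: "ip ?q ?\<sigma> = ip s (zCR r)"
  proof -
    have "ip ?\<sigma> ?q = ip (D ?K) ?q"
      using marini_orthogonal[OF rs(2) crouzeix_raviart_pw_affine[OF CR_solution_in[OF rs(1)]]] L by (simp add: L2_inner_diff_left)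
    then show ?thesis using CR_solution_eq[OF rs(2) CR_solution_in[OF rs(1)]] by (simp add: L2_inner_commute[of \<Omega> ?q])
  qed
  have c: "ip (D U) (D ?z) = ip r ?z" using U W(3) zP by (auto simp: rep_def)
  have d: "ip ?q (D ?z) = ip r ?z"
    using marini_orthogonal[OF rs(1), of ?z] zP conforming_P1_pw_affine marini_H01[OF rs(1) P1_solution_H01[OF rs(2)]]
      L marini_L2[OF rs(1)] by (auto simp: L2_inner_diff_left)
  have "ip s U - ip s (zCR r) = ip (\<lambda>x. D U x - ?q x) (\<lambda>x. ?\<sigma> x - D ?z x)"
    using L a b c d by (simp add: L2_inner_diff_left L2_inner_diff_right)
  also have "\<dots> \<le> nrm (\<lambda>x. D U x - ?q x) * nrm (\<lambda>x. ?\<sigma> x - D ?z x)"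
    using L by (intro L2_inner_le) simp_all
  also have "\<dots> \<le> (\<kappa> * nrm r) * (\<kappa> * nrm s)"
    by (intro mult_mono representer_gap[OF W rs(1) U] kappa_bound(2)[OF rs(2)] mult_nonneg_nonneg kappa_bound(1)) simp_all
  finally show ?thesis by (simp add: power2_eq_square mult_ac)
qed

text \<open>The oscillation acts on \<open>U - zCR r\<close>; the Poincare inequality passes to its
  broken gradient, which is small by \<open>representer_gap\<close>.\<close>

lemma block_mixed:
  assumes W: "fun_subspace W" "W \<subseteq> H01_space \<Omega>" "P1 \<subseteq> W"
    and r: "r \<in> pw_constant \<T>" and U: "rep W r U"
    and s: "s \<in> L2" "\<And>w. w \<in> pw_constant \<T> \<Longrightarrow> ip s w = 0"
  shows "ip s U - ip s (zCR r) \<le> \<alpha> * \<kappa> * nrm r * nrm s"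
proof -
  let ?C = "zCR r"
  have UH: "U \<in> H01_space \<Omega>" using U W(2) by (auto simp: rep_def)
  have CA: "?C \<in> pw_affine \<T>" by (rule crouzeix_raviart_pw_affine[OF CR_solution_in[OF r]])
  have L: "U \<in> L2" "?C \<in> L2"
    using broken_H1_L2(1)[OF H01_weak_grad(2)[OF UH]] broken_H1_L2(1)[OF pw_affine_broken_H1[OF CA]] by auto
  have "ip s U - ip s ?C = ip s (\<lambda>x. U x + (-1) * ?C x)"
    using L s(1) by (simp add: L2_inner_diff_right)
  also have "\<dots> \<le> \<alpha> * nrm s * nrm (\<lambda>x. D U x + (-1) *\<^sub>R D ?C x)"
    using poincare_H01[OF s UH CA, of "-1"] by linarith
  also have "\<dots> \<le> \<alpha> * nrm s * (\<kappa> * nrm r)"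
    using representer_gap[OF W r U] by (intro mult_left_mono mult_nonneg_nonneg \<alpha>_nonneg) simp_all
  finally show ?thesis by (simp add: mult_ac)
qed

section \<open>Combination of the blocks\<close>

lemma D_diff_norm:
  assumes "v \<in> broken_H1" "w \<in> broken_H1"
  shows "nrm (D (\<lambda>x. v x - w x)) = nrm (\<lambda>x. D v x - D w x)"
proof (rule L2_norm_cong_AE)
  show "AE x in lebesgue_on \<Omega>. D (\<lambda>x. v x - w x) x = D v x - D w x"
    using broken_H1_lincomb(2)[OF assms, of "-1"] by simp
  have "(\<lambda>x. v x - w x) \<in> broken_H1" using broken_H1_lincomb(1)[OF assms, of "-1"] by simp
  then show "D (\<lambda>x. v x - w x) \<in> L2" by (rule broken_H1_L2(2))
qed (use assms broken_H1_L2(2) in auto)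

lemma error_estimates:
  assumes f: "f \<in> L2" and u: "is_weak_solution \<Omega> f u" and uc: "is_CR_solution \<Omega> \<T> f uc"
  shows "nrm (D (\<lambda>x. u x - uc x)) \<le> 2 * E_hat \<Omega> \<T> f"
    and "E_hat \<Omega> \<T> f \<le> M_hat \<Omega> \<T> * nrm f"
    and "nrm (\<lambda>x. u x - uc x) \<le> M_hat \<Omega> \<T> * E_hat \<Omega> \<T> f"
proof -
  let ?CR = "CR"
  \<comment> \<open>In this span \<open>u\<close> is the representer of \<open>f\<close>, and by
    \<open>riesz_extend\<close> every load has a representer, so the solutions for the parts of
    \<open>f\<close> are taken in \<open>W\<close> rather than in the whole of
    \<open>H01_space\<close>.\<close>
  define W where "W = {(\<lambda>x. v x + c * u x) | v c. v \<in> P1}"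
  have uH: "u \<in> H01_space \<Omega>" using u by (simp add: is_weak_solution_def)
  have uB: "u \<in> broken_H1" by (rule H01_weak_grad(2)[OF uH])
  have W1: "fun_subspace W" unfolding W_def by (rule fun_subspace_extend[OF conforming_P1_subspace uB])
  have rW: "riesz W" unfolding W_def
    by (rule riesz_extend[OF conforming_P1_subspace pw_affine_riesz[OF conforming_P1_subspace conforming_P1_pw_affine] uB])
  have W2: "W \<subseteq> H01_space \<Omega>"
  proof
    fix w assume "w \<in> W"
    then obtain v c where "w = (\<lambda>x. v x + c * u x)" "v \<in> P1" unfolding W_def by blast
    then show "w \<in> H01_space \<Omega>" using H01_lincomb[OF _ uH, of v c] conforming_P1_H01 by auto
  qed
  have W3: "P1 \<subseteq> W"
  proof
    fix v assume "v \<in> P1"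
    then show "v \<in> W" unfolding W_def by (intro CollectI exI[of _ v] exI[of _ 0]) simp
  qed
  have uW: "u \<in> W"
    unfolding W_def using zero_fun_subspace[OF conforming_P1_subspace] by (intro CollectI exI[of _ "\<lambda>x. 0"] exI[of _ 1]) simp
  have rep_u: "rep W f u"
    using u uW W2 H01_inner_weak_grad[OF uH] by (auto simp: rep_def is_weak_solution_def subset_iff)
  have rep_uc: "rep ?CR f uc" using uc by (simp add: rep_def is_CR_solution_def)
  have rep_ex: "\<exists>z. rep W r z" if "r \<in> L2" for r
    using riesz_solution[OF rW W1 that] H01_friedrichs W2 unfolding rep_def by blast
  have CR_rep': "rep ?CR r (zCR r)" if "r \<in> L2" for r
    using CR_solution_works[OF that] by (simp add: rep_def is_CR_solution_def)
  have CA: "?CR \<subseteq> pw_affine \<T>" using crouzeix_raviart_pw_affine by blast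
  have split: "proj0 \<Omega> \<T> r \<in> pw_constant \<T>" "(\<lambda>x. r x - proj0 \<Omega> \<T> r x) \<in> L2"
      "\<And>w. w \<in> pw_constant \<T> \<Longrightarrow> ip (\<lambda>x. r x - proj0 \<Omega> \<T> r x) w = 0"
      "(nrm r)\<^sup>2 = (nrm (\<lambda>x. r x - proj0 \<Omega> \<T> r x))\<^sup>2 + (nrm (proj0 \<Omega> \<T> r))\<^sup>2"
    if r: "r \<in> L2" for r
  proof -
    let ?r0 = "proj0 \<Omega> \<T> r" and ?r1 = "\<lambda>x. r x - proj0 \<Omega> \<T> r x"
    show 0: "?r0 \<in> pw_constant \<T>" "\<And>w. w \<in> pw_constant \<T> \<Longrightarrow> ip ?r1 w = 0" using proj0_works[OF r] by auto
    show 1: "?r1 \<in> L2" using r pw_constant_L2[OF 0(1)] by simp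
    have "(nrm (\<lambda>x. ?r1 x + 1 *\<^sub>R ?r0 x))\<^sup>2 = (nrm ?r1)\<^sup>2 + (nrm ?r0)\<^sup>2"
      using L2_norm_lincomb_sq[OF 1 pw_constant_L2[OF 0(1)], of 1] 0 by simp
    then show "(nrm r)\<^sup>2 = (nrm ?r1)\<^sup>2 + (nrm ?r0)\<^sup>2" by simp
  qed
  have E_le: "E_hat \<Omega> \<T> r \<le> M_hat \<Omega> \<T> * nrm r" if r: "r \<in> L2" for r
  proof (rule power2_le_imp_le)
    let ?F = "nrm (\<lambda>x. r x - proj0 \<Omega> \<T> r x)" and ?G = "nrm (proj0 \<Omega> \<T> r)"
    \<comment> \<open>Cauchy-Schwarz for the vectors \<open>(\<alpha>, \<kappa>)\<close> and
      \<open>(?F, ?G)\<close>; the second factor is the squared norm of \<open>r\<close> by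
      Pythagoras.\<close>
    have "(\<alpha> * ?F + \<kappa> * ?G)\<^sup>2 \<le> (\<alpha>\<^sup>2 + \<kappa>\<^sup>2) * (?F\<^sup>2 + ?G\<^sup>2)"
    proof -
      have "(\<alpha>\<^sup>2 + \<kappa>\<^sup>2) * (?F\<^sup>2 + ?G\<^sup>2) - (\<alpha> * ?F + \<kappa> * ?G)\<^sup>2 = (\<alpha> * ?G - \<kappa> * ?F)\<^sup>2"
        by (simp add: power2_eq_square algebra_simps)
      then show ?thesis using zero_le_power2[of "\<alpha> * ?G - \<kappa> * ?F"] by linarith
    qed
    also have "\<dots> = (M_hat \<Omega> \<T> * nrm r)\<^sup>2"
      unfolding power_mult_distrib split(4)[OF r] M_hat_def by (simp add: real_sqrt_pow2)
    finally show "(E_hat \<Omega> \<T> r)\<^sup>2 \<le> (M_hat \<Omega> \<T> * nrm r)\<^sup>2" by (simp add: E_hat_def)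
    show "0 \<le> M_hat \<Omega> \<T> * nrm r" by (simp add: M_hat_def)
  qed
  show "E_hat \<Omega> \<T> f \<le> M_hat \<Omega> \<T> * nrm f" by (rule E_le[OF f])
  define f0 where "f0 = proj0 \<Omega> \<T> f"
  define f1 where "f1 = (\<lambda>x. f x - f0 x)"
  note sf = split[OF f, folded f0_def, folded f1_def]
  have f0L: "f0 \<in> L2" by (rule pw_constant_L2[OF sf(1)])
  obtain U0 where U0: "rep W f0 U0" using rep_ex[OF f0L] by blast
  define C0 where "C0 = zCR f0"
  have C0: "rep ?CR f0 C0" unfolding C0_def by (rule CR_rep[OF sf(1)])
  \<comment> \<open>Taken as a difference so that the representers of the two parts add up exactly
    to \<open>u\<close>; likewise for \<open>C1\<close>.\<close>
  define U1 where "U1 = (\<lambda>x. u x - U0 x)"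
  define C1 where "C1 = (\<lambda>x. uc x - C0 x)"
  have U1: "rep W f1 U1" using rep_lincomb[OF W1 rep_u U0 f f0L, of "-1"] by (simp add: f1_def U1_def)
  have C1: "rep ?CR f1 C1" using rep_lincomb[OF crouzeix_raviart_subspace rep_uc C0 f f0L, of "-1"] by (simp add: f1_def C1_def)
  have inW: "u \<in> W" "U0 \<in> W" "U1 \<in> W" "uc \<in> ?CR" "C0 \<in> ?CR" "C1 \<in> ?CR"
    using uW U0 U1 rep_uc C0 C1 by (auto simp: rep_def)
  have B: "v \<in> broken_H1" if "v \<in> W \<or> v \<in> ?CR" for v
    using that W1 crouzeix_raviart_broken_H1 by (auto simp: fun_subspace_def)
  have bB: "U0 \<in> broken_H1" "U1 \<in> broken_H1" "uc \<in> broken_H1" "C0 \<in> broken_H1" "C1 \<in> broken_H1"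
    using B inW by auto
  note DL = broken_H1_L2(2)[OF uB] broken_H1_L2(2)[OF bB(1)] broken_H1_L2(2)[OF bB(2)] broken_H1_L2(2)[OF bB(3)]
    broken_H1_L2(2)[OF bB(4)] broken_H1_L2(2)[OF bB(5)]
  note VL = broken_H1_L2(1)[OF uB] broken_H1_L2(1)[OF bB(1)] broken_H1_L2(1)[OF bB(2)] broken_H1_L2(1)[OF bB(3)]
    broken_H1_L2(1)[OF bB(4)] broken_H1_L2(1)[OF bB(5)]
  let ?F = "nrm f1" and ?G = "nrm f0"
  have E: "E_hat \<Omega> \<T> f = \<alpha> * ?F + \<kappa> * ?G" by (simp add: E_hat_def f1_def f0_def)
  show "nrm (D (\<lambda>x. u x - uc x)) \<le> 2 * E_hat \<Omega> \<T> f"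
  proof -
    have "nrm (D (\<lambda>x. u x - uc x)) = nrm (\<lambda>x. D u x - D uc x)" by (rule D_diff_norm[OF uB bB(3)])
    also have "\<dots> = nrm (\<lambda>x. (D u x - D U0 x) + ((D U0 x - D C0 x) - (D uc x - D C0 x)))" by simp
    also have "\<dots> \<le> nrm (\<lambda>x. D u x - D U0 x) + nrm (\<lambda>x. (D U0 x - D C0 x) - (D uc x - D C0 x))"
      using DL by (intro L2_norm_triangle) simp_all
    also have "\<dots> \<le> nrm (\<lambda>x. D u x - D U0 x) + (nrm (\<lambda>x. D U0 x - D C0 x) + nrm (\<lambda>x. D uc x - D C0 x))"
      using DL by (intro add_left_mono L2_norm_diff_triangle) simp_all
    also have "\<dots> \<le> \<alpha> * ?F + (\<kappa> * ?G + \<alpha> * ?F)"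
    proof (intro add_mono)
      show "nrm (\<lambda>x. D u x - D U0 x) \<le> \<alpha> * ?F"
        using rep_oscillation[OF U1 sf(2,3) disjI1[OF W2]] D_diff_norm[OF uB bB(1)] by (simp add: U1_def)
      show "nrm (\<lambda>x. D uc x - D C0 x) \<le> \<alpha> * ?F"
        using rep_oscillation[OF C1 sf(2,3) disjI2[OF CA]] D_diff_norm[OF bB(3,4)] by (simp add: C1_def)
      show "nrm (\<lambda>x. D U0 x - D C0 x) \<le> \<kappa> * ?G"
        unfolding C0_def by (rule representer_gap[OF W1 W2 W3 sf(1) U0])
    qed
    \<comment> \<open>The oscillation contributes twice, once for each solution, and the constant
      part once; the factor 2 on the latter is slack.\<close>
    also have "\<dots> \<le> 2 * E_hat \<Omega> \<T> f"
    proof -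
      have "x + (y + x) \<le> 2 * (x + y)" if "0 \<le> y" for x y :: real using that by simp
      note le = this
      show ?thesis unfolding E by (rule le[OF mult_nonneg_nonneg[OF kappa_bound(1) L2_norm_nonneg]])
    qed
    finally show ?thesis .
  qed
  \<comment> \<open>The error itself is taken as the load of the dual problem.\<close>
  define g where "g = (\<lambda>x. u x - uc x)"
  have gL: "g \<in> L2" using VL by (simp add: g_def)
  define g0 where "g0 = proj0 \<Omega> \<T> g"
  define g1 where "g1 = (\<lambda>x. g x - g0 x)"
  note sg = split[OF gL, folded g0_def, folded g1_def]
  have g0L: "g0 \<in> L2" by (rule pw_constant_L2[OF sg(1)])
  obtain V0 where V0: "rep W g0 V0" using rep_ex[OF g0L] by blast
  obtain V1 where V1: "rep W g1 V1" using rep_ex[OF sg(2)] by blast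
  let ?K0 = "zCR g0"
  have b00: "ip g0 U0 - ip g0 C0 \<le> \<kappa>\<^sup>2 * ?G * nrm g0"
    unfolding C0_def by (rule block_constant[OF W1 W2 W3 sf(1) sg(1) U0])
  have b01: "ip g1 U0 - ip g1 C0 \<le> \<alpha> * \<kappa> * ?G * nrm g1"
    unfolding C0_def by (rule block_mixed[OF W1 W2 W3 sf(1) U0 sg(2,3)])
  \<comment> \<open>By symmetry of the solution operators this is the mixed block with the two loads
    exchanged.\<close>
  have b10: "ip g0 U1 - ip g0 C1 \<le> \<alpha> * \<kappa> * nrm g0 * ?F"
    using block_mixed[OF W1 W2 W3 sg(1) V0 sf(2,3)] rep_sym[OF V0 U1] rep_sym[OF CR_rep[OF sg(1)] C1] by simp
  have b11: "ip g1 U1 - ip g1 C1 \<le> \<alpha>\<^sup>2 * ?F * nrm g1"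
    by (rule block_oscillation[OF W1 W2 sf(2) sg(2) sf(3) sg(3) U1 C1 V1 CR_rep'[OF sg(2)]])
  have E0: "0 \<le> E_hat \<Omega> \<T> f"
    unfolding E by (intro add_nonneg_nonneg mult_nonneg_nonneg \<alpha>_nonneg kappa_bound(1) L2_norm_nonneg)
  have "(nrm g)\<^sup>2 = ip (\<lambda>x. g0 x + g1 x) (\<lambda>x. (U0 x + U1 x) - (C0 x + C1 x))"
    unfolding L2_norm_sq by (rule arg_cong2[of _ _ _ _ "ip"]) (simp_all add: g1_def U1_def C1_def g_def fun_eq_iff)
  also have "\<dots> = (ip g0 U0 - ip g0 C0) + (ip g1 U0 - ip g1 C0)
      + (ip g0 U1 - ip g0 C1) + (ip g1 U1 - ip g1 C1)"
    using VL g0L sg(2) by (simp add: L2_inner_simps)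
  also have "\<dots> \<le> \<kappa>\<^sup>2 * ?G * nrm g0 + \<alpha> * \<kappa> * ?G * nrm g1
      + \<alpha> * \<kappa> * nrm g0 * ?F + \<alpha>\<^sup>2 * ?F * nrm g1"
    using b00 b01 b10 b11 by linarith
  \<comment> \<open>The four bounds are the expanded product of the two sums
    \<open>\<alpha> * ?F + \<kappa> * ?G\<close> and
    \<open>\<alpha> * nrm g1 + \<kappa> * nrm g0\<close>.\<close>
  also have "\<dots> = E_hat \<Omega> \<T> f * (\<alpha> * nrm g1 + \<kappa> * nrm g0)"
    unfolding E by (simp only: power2_eq_square distrib_left distrib_right mult_ac add_ac)
  also have "\<alpha> * nrm g1 + \<kappa> * nrm g0 = E_hat \<Omega> \<T> g" by (simp add: E_hat_def g1_def g0_def)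
  also have "E_hat \<Omega> \<T> f * E_hat \<Omega> \<T> g \<le> E_hat \<Omega> \<T> f * (M_hat \<Omega> \<T> * nrm g)"
    by (rule mult_left_mono[OF E_le[OF gL] E0])
  finally have "(nrm g)\<^sup>2 \<le> M_hat \<Omega> \<T> * E_hat \<Omega> \<T> f * nrm g" by (simp only: mult_ac)
  then have "nrm g \<le> M_hat \<Omega> \<T> * E_hat \<Omega> \<T> f"
  proof (rule le_of_sq_le_mult)
    have "0 \<le> M_hat \<Omega> \<T>" unfolding M_hat_def by (intro real_sqrt_ge_zero add_nonneg_nonneg zero_le_power2)
    then show "0 \<le> M_hat \<Omega> \<T> * E_hat \<Omega> \<T> f" using E0 by (rule mult_nonneg_nonneg)
  qed simp
  then show "nrm (\<lambda>x. u x - uc x) \<le> M_hat \<Omega> \<T> * E_hat \<Omega> \<T> f" by (simp add: g_def)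
qed

end

theorem corollary4p10:
  fixes \<Omega> :: "(real ^ 'n) set" and \<T> :: "(real ^ 'n) set set"
    and f u u_CR :: "real ^ 'n \<Rightarrow> real"
  assumes "CARD('n) \<in> {2, 3}"
    and "polyhedral_lipschitz_domain \<Omega>"
    and "conforming_triangulation \<Omega> \<T>"
    and "f \<in> L2_space \<Omega>"
    and "is_weak_solution \<Omega> f u"
    and "is_CR_solution \<Omega> \<T> f u_CR"
  shows "broken_H1_seminorm \<Omega> \<T> (\<lambda>x. u x - u_CR x) \<le> 2 * E_hat \<Omega> \<T> f \<and>
         2 * E_hat \<Omega> \<T> f \<le> 2 * M_hat \<Omega> \<T> * L2_norm \<Omega> f \<and>
         L2_norm \<Omega> (\<lambda>x. u x - u_CR x) \<le>
           min ((M_hat \<Omega> \<T>)\<^sup>2 * L2_norm \<Omega> f) (2 * M_hat \<Omega> \<T> * E_hat \<Omega> \<T> f)"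
proof -
  interpret mesh \<Omega> \<T>
    using assms(1-3) by unfold_locales simp_all
  let ?e = "L2_norm \<Omega> (\<lambda>x. u x - u_CR x)"
  note est = error_estimates[OF assms(4-6)]
  have M: "0 \<le> M_hat \<Omega> \<T>"
    unfolding M_hat_def by (intro real_sqrt_ge_zero add_nonneg_nonneg zero_le_power2)
  have 0: "0 \<le> M_hat \<Omega> \<T> * E_hat \<Omega> \<T> f"
    by (rule order_trans[OF L2_norm_nonneg est(3)])
  \<comment> \<open>Both entries of the minimum weaken the single bound \<open>M_hat\<close> times
    \<open>E_hat\<close>: the first by estimating \<open>E_hat\<close> through \<open>M_hat\<close>
    and the norm of \<open>f\<close>, the second by the factor 2.\<close>
  have "M_hat \<Omega> \<T> * E_hat \<Omega> \<T> f \<le> M_hat \<Omega> \<T> * (M_hat \<Omega> \<T> * L2_norm \<Omega> f)"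
    by (rule mult_left_mono[OF est(2) M])
  also have "\<dots> = (M_hat \<Omega> \<T>)\<^sup>2 * L2_norm \<Omega> f"
    by (simp only: power2_eq_square mult.assoc)
  finally have 1: "?e \<le> (M_hat \<Omega> \<T>)\<^sup>2 * L2_norm \<Omega> f"
    using est(3) by (rule order_trans[rotated])
  have 2: "?e \<le> 2 * M_hat \<Omega> \<T> * E_hat \<Omega> \<T> f"
    using est(3) 0 by linarith
  show ?thesis
    unfolding broken_H1_seminorm_def
    by (intro conjI min.boundedI est(1) 1 2) (use est(2) in linarith)
qed

end
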